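(* Let $\xi$ be a real-valued Lévy process with $\lim_{t\to\infty}\xi_t=-\infty$ almost surely. If for some integer $n\ge1$ $$\int_{(1,\infty)}\Big(\frac{x}{|A(x)|}\Big)^{n+1}\Pi(\mathrm{d}x)<\infty,$$ then for every measurable $F:(0,\infty)\to\mathbb{R}$ such that for some $a\in(0,1)$ the map $x\mapsto x^aF(x)$ is bounded, we have $\mathbb{E}[|F(I_\xi(t))|]=o(t^{-n})$ as $t\to\infty$ and $\int_0^\infty t^n\,\mathbb{E}[|F(I_\xi(t))|]\,\mathrm{d}t<\infty$. Furthermore, assuming only that $\lim_{t\to\infty}\xi_t=-\infty$ a.s. and that $x\mapsto x^aF(x)$ is bounded for some $a\in(0,1)$, it holds that $\int_0^\infty\mathbb{E}[|F(I_\xi(t))|]\,\mathrm{d}t<\infty$.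
   Context: $I_\xi(t):=\int_0^t e^{-\xi_s}\,\mathrm{d}s$. The Lévy–Khintchine exponent of $\xi$ is $\log\mathbb{E}[e^{z\xi_1}]=\gamma z+\frac{\sigma^2}{2}z^2+\int_{\mathbb{R}}(e^{zy}-1-zy\mathbf{1}_{\{|y|\le1\}})\Pi(\mathrm{d}y)$, $z\in i\mathbb{R}$, with Lévy measure $\Pi$. For $x>0$, $A(x):=\gamma+\Pi(1,\infty)-\Pi(-\infty,-1)+\int_1^x\big(\Pi(y,\infty)-\Pi(-\infty,-y)\big)\mathrm{d}y$. When $\xi_t\to-\infty$, $\lim_{x\to\infty}|A(x)|>0$ (possibly $+\infty$), so $A$ is non-zero on some $[x_0,\infty)$; by convention $A$ is redefined to be a non-zero constant on $(1,x_0]$ if needed (the criterion only concerns integrability at infinity). *)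

theory Defs
  imports "HOL-Probability.Probability"
begin

definition levy_process :: "'a measure \<Rightarrow> (real \<Rightarrow> 'a \<Rightarrow> real) \<Rightarrow> bool" where
  "levy_process M X \<longleftrightarrow>
     prob_space M \<and>
     (\<forall>t\<ge>0. X t \<in> borel_measurable M) \<and>
     (\<forall>\<omega>\<in>space M. X 0 \<omega> = 0) \<and>
     (\<forall>\<omega>\<in>space M. \<forall>t\<ge>0. continuous (at_right t) (\<lambda>s. X s \<omega>) \<and>
         (t > 0 \<longrightarrow> (\<exists>l. ((\<lambda>s. X s \<omega>) \<longlongrightarrow> l) (at_left t)))) \<and>
     (\<forall>s t. 0 \<le> s \<longrightarrow> 0 \<le> t \<longrightarrow>
         distr M borel (\<lambda>\<omega>. X (s + t) \<omega> - X s \<omega>) = distr M borel (X t)) \<and>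
     (\<forall>(n::nat) (ts::nat \<Rightarrow> real). 0 \<le> ts 0 \<and> (\<forall>i<n. ts i \<le> ts (Suc i)) \<longrightarrow>
         prob_space.indep_vars M (\<lambda>_. borel) (\<lambda>i \<omega>. X (ts (Suc i)) \<omega> - X (ts i) \<omega>) {..<n})"

definition levy_measure :: "real measure \<Rightarrow> bool" where
  "levy_measure Lm \<longleftrightarrow> sets Lm = sets borel \<and> emeasure Lm {0} = 0 \<and>
     (\<integral>\<^sup>+ y. ennreal (min 1 (y\<^sup>2)) \<partial>Lm) < \<infinity>"

text \<open>Levy-Khintchine exponent psi(z) for z purely imaginary.\<close>
definition lk_exponent :: "real \<Rightarrow> real \<Rightarrow> real measure \<Rightarrow> complex \<Rightarrow> complex" where
  "lk_exponent \<gamma> \<sigma>2 Lm z =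
     of_real \<gamma> * z + of_real (\<sigma>2 / 2) * z\<^sup>2 +
     integral\<^sup>L Lm (\<lambda>y. exp (z * of_real y) - 1 - z * of_real y * of_real (indicator {-1..1} y))"

definition has_levy_triplet ::
  "'a measure \<Rightarrow> (real \<Rightarrow> 'a \<Rightarrow> real) \<Rightarrow> real \<Rightarrow> real \<Rightarrow> real measure \<Rightarrow> bool" where
  "has_levy_triplet M X \<gamma> \<sigma>2 Lm \<longleftrightarrow> levy_measure Lm \<and> 0 \<le> \<sigma>2 \<and>
     (\<forall>u::real. integral\<^sup>L M (\<lambda>\<omega>. exp (\<i> * of_real u * of_real (X 1 \<omega>)))
                 = exp (lk_exponent \<gamma> \<sigma>2 Lm (\<i> * of_real u)))"

definition levy_A :: "real \<Rightarrow> real measure \<Rightarrow> real \<Rightarrow> real" where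
  "levy_A \<gamma> Lm x = \<gamma> + measure Lm {1<..} - measure Lm {..<-1} +
     set_lebesgue_integral lborel {1..x} (\<lambda>y. measure Lm {y<..} - measure Lm {..<-y})"

definition exp_functional :: "(real \<Rightarrow> 'a \<Rightarrow> real) \<Rightarrow> real \<Rightarrow> 'a \<Rightarrow> real" where
  "exp_functional X t \<omega> = set_lebesgue_integral lborel {0..t} (\<lambda>s. exp (- X s \<omega>))"

end

theory Submission
  imports Defs "HOL-Real_Asymp.Real_Asymp"
begin

text \<open>
Write \<open>J t\<close> for the integral of \<open>exp X\<close> over \<open>[0, t]\<close>. By time reversal \<open>exp (- X t) * J t\<close> has the law of
the exponential functional \<open>I t\<close>, so the substitution \<open>v = J t\<close> and independence of increments show that
\<open>g t = E (I t powr - a)\<close> and \<open>gh s = E (J s powr (a - 1))\<close> have the constant convolution \<open>B (1 - a, a)\<close>.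
Let \<open>c\<close> be the limit of \<open>gh\<close>. If \<open>c > 0\<close>, subtracting the identity at a finite horizon from the one at
infinity bounds \<open>c\<close> times the tail mass of \<open>g\<close> by the convolution of \<open>g\<close> with \<open>gh - c\<close>, so moments of
\<open>gh - c\<close> of order \<open>n - 1\<close> give moments of \<open>g\<close> of order \<open>n\<close>.

Comparing \<open>J\<close> at consecutive integers, the decrement of \<open>gh\<close> is controlled by the survival probabilities
of a walk that is killed when the reversed path reaches a new minimum. Sums of these probabilities
weighted by \<open>i ^ n\<close> are iterated Green functions \<open>W (n + 1)\<close>. Always \<open>W 1 < \<infinity>\<close>, because the path drifts to
\<open>- \<infinity>\<close>, and this yields \<open>c > 0\<close>. In general \<open>W k x\<close> is of order \<open>(x / m x) ^ k\<close>, where \<open>m x\<close> is the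
mean of the negative part of \<open>X 1\<close> truncated at \<open>x\<close>; Ottaviani's inequality reduces its expectation at the
height of a block to a moment of \<open>X 1\<close>, and a compound Poisson approximation reduces that moment
to the integral condition on the Levy measure.
\<close>

text \<open>The exponents \<open>- a\<close> and \<open>a - 1\<close> add to \<open>- 1\<close>.
  This makes \<open>exp (X t)\<close>, the derivative of \<open>J\<close>, appear as the density of
  the pathwise integral and leaves a Beta integral that does not see the path. The orders match
  because \<open>gh - c\<close> is a tail sum of survival probabilities: summing the tail costs one
  power, and passing from \<open>gh - c\<close> to \<open>g\<close> gains it back. The obstacle is
  the size of \<open>W k x\<close>. Large positive jumps may leave \<open>X 1\<close> without
  exponential moments, so an exponential supersolution need not exist for the walk itself. Marks
  above a level \<open>z0\<close> are removed, and the truncated walk has such a supersolution, with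
  a rate of order \<open>1 / x\<close> when started at \<open>x\<close>. The removed marks return as
  a perturbation: subadditivity of iterated Green functions splits off each of them, and the
  self-referential term has the weight \<open>big 1\<close>, which a large \<open>z0\<close> makes
  at most \<open>1 / 2\<close>. This is possible because the case \<open>k = 1\<close> is settled
  beforehand by a counting argument that uses only the drift. Growth ratios of \<open>J\<close>
  enter only through \<open>min 1\<close>, since they need not be integrable.\<close>

section \<open>Killed random walks and their iterated Green functions\<close>

text \<open>Transition operator of a walk with increment \<open>D\<close> that is killed as soon as its position plus the
  current mark \<open>M\<close> is not positive.\<close>
definition kstep :: "'b measure \<Rightarrow> ('b \<Rightarrow> real) \<Rightarrow> ('b \<Rightarrow> real) \<Rightarrow> (real \<Rightarrow> ennreal) \<Rightarrow> real \<Rightarrow> ennreal" where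
  "kstep N D M f y = (\<integral>\<^sup>+ z. (if 0 < y + M z then f (y + D z) else 0) \<partial>N)"

definition green :: "'b measure \<Rightarrow> ('b \<Rightarrow> real) \<Rightarrow> ('b \<Rightarrow> real) \<Rightarrow> (real \<Rightarrow> ennreal) \<Rightarrow> real \<Rightarrow> ennreal" where
  "green N D M h y = (\<Sum>m. (kstep N D M ^^ m) h y)"

definition iter_green :: "'b measure \<Rightarrow> ('b \<Rightarrow> real) \<Rightarrow> ('b \<Rightarrow> real) \<Rightarrow> nat \<Rightarrow> real \<Rightarrow> ennreal" where
  "iter_green N D M k = (green N D M ^^ k) (\<lambda>_. 1)"

lemma iter_green_0 [simp]: "iter_green N D M 0 y = 1"
  by (simp add: iter_green_def)

lemma iter_green_Suc: "iter_green N D M (Suc k) = green N D M (iter_green N D M k)"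
  by (simp add: iter_green_def)

lemma kstep_le: "(\<And>y. f y \<le> g y) \<Longrightarrow> kstep N D M f y \<le> kstep N D M g y"
  unfolding kstep_def by (intro nn_integral_mono) auto

lemma kstep_pow_le: "(\<And>y. f y \<le> g y) \<Longrightarrow> (kstep N D M ^^ m) f y \<le> (kstep N D M ^^ m) g y"
  by (induction m arbitrary: y) (auto intro: kstep_le)

lemma kstep_mono: "mono f \<Longrightarrow> mono (kstep N D M f)"
  unfolding kstep_def by (intro monoI nn_integral_mono) (auto intro: monoD)

lemma kstep_pow_mono: "mono f \<Longrightarrow> mono ((kstep N D M ^^ m) f)"
  by (induction m) (auto intro: kstep_mono)

lemma green_mono: "mono f \<Longrightarrow> mono (green N D M f)"
  unfolding green_def by (intro monoI suminf_le) (auto intro: monoD[OF kstep_pow_mono])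

lemma green_le_green: "(\<And>y. f y \<le> g y) \<Longrightarrow> green N D M f y \<le> green N D M g y"
  unfolding green_def by (intro suminf_le) (auto intro: kstep_pow_le)

lemma iter_green_mono: "mono (iter_green N D M k)"
  by (induction k) (auto simp: iter_green_Suc mono_def[of "iter_green N D M 0"] intro: green_mono)

lemma iter_green_monoD: "x \<le> y \<Longrightarrow> iter_green N D M k x \<le> iter_green N D M k y"
  using iter_green_mono[of N D M k] by (rule monoD)

locale marked_step = prob_space N for N :: "'b measure" +
  fixes D M :: "'b \<Rightarrow> real"
  assumes D_measurable [measurable]: "D \<in> borel_measurable N"
    and M_measurable [measurable]: "M \<in> borel_measurable N"
    and D_le_M: "z \<in> space N \<Longrightarrow> D z \<le> M z"
begin

abbreviation "P \<equiv> kstep N D M"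
abbreviation "G \<equiv> green N D M"
abbreviation "W \<equiv> iter_green N D M"

lemma kstep_measurable [measurable]:
  assumes [measurable]: "f \<in> borel_measurable borel"
  shows "P f \<in> borel_measurable borel"
  unfolding kstep_def by measurable

lemma kstep_pow_measurable [measurable]:
  assumes [measurable]: "f \<in> borel_measurable borel"
  shows "(P ^^ m) f \<in> borel_measurable borel"
  by (induction m) auto

lemma green_measurable [measurable]:
  assumes [measurable]: "f \<in> borel_measurable borel"
  shows "G f \<in> borel_measurable borel"
  unfolding green_def by measurable

lemma iter_green_measurable [measurable]: "W k \<in> borel_measurable borel"
proof (induction k)
  case 0
  have "W 0 = (\<lambda>_. 1)" by auto
  then show ?case by simp
next
  case (Suc k)
  then show ?case unfolding iter_green_Suc by measurable
qed

lemma kstep_add: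
  assumes [measurable]: "f \<in> borel_measurable borel" "g \<in> borel_measurable borel"
  shows "P (\<lambda>y. f y + g y) y = P f y + P g y"
  unfolding kstep_def by (subst nn_integral_add[symmetric]) (auto intro!: nn_integral_cong)

lemma kstep_cmult:
  assumes [measurable]: "f \<in> borel_measurable borel"
  shows "P (\<lambda>y. c * f y) y = c * P f y"
  unfolding kstep_def by (subst nn_integral_cmult[symmetric]) (auto intro!: nn_integral_cong)

lemma kstep_sum:
  assumes [measurable]: "\<And>i. i \<in> I \<Longrightarrow> f i \<in> borel_measurable borel"
  shows "P (\<lambda>y. \<Sum>i\<in>I. f i y) y = (\<Sum>i\<in>I. P (f i) y)"
proof -
  have "P (\<lambda>y. \<Sum>i\<in>I. f i y) y = (\<integral>\<^sup>+ z. (\<Sum>i\<in>I. if 0 < y + M z then f i (y + D z) else 0) \<partial>N)"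
    unfolding kstep_def by (intro nn_integral_cong) auto
  also have "\<dots> = (\<Sum>i\<in>I. P (f i) y)"
    unfolding kstep_def by (subst nn_integral_sum) auto
  finally show ?thesis .
qed

lemma kstep_suminf:
  assumes [measurable]: "\<And>i::nat. f i \<in> borel_measurable borel"
  shows "P (\<lambda>y. \<Sum>i. f i y) y = (\<Sum>i. P (f i) y)"
proof -
  have "P (\<lambda>y. \<Sum>i. f i y) y = (\<integral>\<^sup>+ z. (\<Sum>i. if 0 < y + M z then f i (y + D z) else 0) \<partial>N)"
    unfolding kstep_def by (intro nn_integral_cong) auto
  also have "\<dots> = (\<Sum>i. P (f i) y)"
    unfolding kstep_def by (subst nn_integral_suminf) auto
  finally show ?thesis .
qed

lemma green_unfold:
  assumes [measurable]: "h \<in> borel_measurable borel"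
  shows "G h y = h y + P (G h) y"
proof -
  have "G h y = (P ^^ 0) h y + (\<Sum>m. (P ^^ Suc m) h y)"
    unfolding green_def by (subst suminf_offset[of _ 1]) auto
  also have "(\<Sum>m. (P ^^ Suc m) h y) = (\<Sum>m. P ((P ^^ m) h) y)" by simp
  also have "\<dots> = P (\<lambda>y. \<Sum>m. (P ^^ m) h y) y" by (subst kstep_suminf) auto
  also have "(\<lambda>y. \<Sum>m. (P ^^ m) h y) = G h" by (auto simp: green_def)
  finally show ?thesis by simp
qed

text \<open>Minimality of the Green function: iterating \<open>h + P f \<le> f\<close> bounds every
  partial sum by \<open>f\<close>, because the remainder \<open>(P ^^ n) f\<close> is nonnegative.
  The analytic upper bounds on Green functions below all exhibit a supersolution and quote
  this.\<close>

lemma green_le: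
  assumes [measurable]: "h \<in> borel_measurable borel" "f \<in> borel_measurable borel"
    and super: "\<And>y. h y + P f y \<le> f y"
  shows "G h y \<le> f y"
proof -
  have "(\<Sum>m<n. (P ^^ m) h y) + (P ^^ n) f y \<le> f y" for n y
  proof (induction n arbitrary: y)
    case (Suc n)
    have "(\<Sum>m<Suc n. (P ^^ m) h y) + (P ^^ Suc n) f y
        = h y + (P (\<lambda>y. \<Sum>m<n. (P ^^ m) h y) y + P ((P ^^ n) f) y)"
      by (subst kstep_sum) (auto simp: sum.lessThan_Suc_shift add.assoc simp del: sum.lessThan_Suc)
    also have "\<dots> = h y + P (\<lambda>y. (\<Sum>m<n. (P ^^ m) h y) + (P ^^ n) f y) y"
      by (subst kstep_add) auto
    also have "\<dots> \<le> h y + P f y" by (intro add_left_mono kstep_le Suc)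
    also have "\<dots> \<le> f y" by (rule super)
    finally show ?case .
  qed simp
  then have "(\<Sum>m<n. (P ^^ m) h y) \<le> f y" for n
    using add_increasing2[OF zero_le order_refl] order_trans by blast
  then show ?thesis unfolding green_def by (intro suminf_le_const) auto
qed

lemma iter_green_rec: "W (Suc k) y = W k y + P (W (Suc k)) y"
  unfolding iter_green_Suc by (rule green_unfold) auto

text \<open>Probabilistically \<open>W k x\<close> is the expectation of the binomial coefficient
  \<open>T x + k - 1\<close> over \<open>k\<close>, where \<open>T x\<close> is the killing time of the chain started at \<open>x\<close>, and
  \<open>T (x + y)\<close> is dominated by \<open>T x\<close> plus an independent copy of \<open>T y\<close>.\<close>
lemma iter_green_add_le: "W k (x + y) \<le> (\<Sum>j\<le>k. W (k - j) x * W j y)"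
proof -
  have "\<forall>z. W k z \<le> (\<Sum>j\<le>k. W (k - j) (z - y) * W j y)"
  proof (induction k)
    case 0
    show ?case by simp
  next
    case (Suc k)
    define F where "F z = (\<Sum>j\<le>Suc k. W (Suc k - j) (z - y) * W j y)" for z
    \<comment> \<open>The minimum lets each case of a step use the better bound: \<open>F\<close> if
      the walk started at \<open>x = z - y\<close> survives, and \<open>W (Suc k)\<close> if it
      dies. In the second case \<open>x + M t \<le> 0\<close> and \<open>D t \<le> M t\<close> put
      the new position at or below \<open>y\<close>, which produces the single extra term
      \<open>W (Suc k) y\<close>.\<close>
    define f where "f z = min (W (Suc k) z) (F z)" for z
    have [measurable]: "F \<in> borel_measurable borel" "f \<in> borel_measurable borel"
      unfolding F_def f_def by measurable
    have "W k z + P f z \<le> f z" for z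
    proof -
      have "W k z + P f z \<le> W k z + P (W (Suc k)) z"
        by (intro add_left_mono kstep_le) (auto simp: f_def)
      also have "\<dots> = W (Suc k) z" by (simp add: iter_green_rec)
      finally have 1: "W k z + P f z \<le> W (Suc k) z" .
      define x where "x = z - y"
      have "P f z \<le> (\<integral>\<^sup>+ t. (\<Sum>j\<le>k. (if 0 < x + M t then W (Suc k - j) (x + D t) else 0) * W j y) + W (Suc k) y \<partial>N)"
        unfolding kstep_def
      proof (intro nn_integral_mono)
        fix t assume t: "t \<in> space N"
        show "(if 0 < z + M t then f (z + D t) else 0)
          \<le> (\<Sum>j\<le>k. (if 0 < x + M t then W (Suc k - j) (x + D t) else 0) * W j y) + W (Suc k) y"
        proof (cases "0 < x + M t")
          case True
          have "f (z + D t) \<le> F (z + D t)" by (simp add: f_def)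
          also have "\<dots> = (\<Sum>j\<le>k. W (Suc k - j) (x + D t) * W j y) + W (Suc k) y"
            unfolding F_def x_def by (simp add: algebra_simps)
          finally show ?thesis using True by simp
        next
          case False
          have "f (z + D t) \<le> W (Suc k) (z + D t)" by (simp add: f_def)
          also have "\<dots> \<le> W (Suc k) y"
            using False D_le_M[OF t] by (intro iter_green_monoD) (auto simp: x_def)
          finally show ?thesis using False by simp
        qed
      qed
      also have "\<dots> = (\<Sum>j\<le>k. P (W (Suc k - j)) x * W j y) + W (Suc k) y"
        unfolding kstep_def
        by (subst nn_integral_add; (subst nn_integral_sum)?; (subst nn_integral_multc)?)
           (auto simp: emeasure_space_1)
      finally have "W k z + P f z \<le> W k z + ((\<Sum>j\<le>k. P (W (Suc k - j)) x * W j y) + W (Suc k) y)"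
        by (rule add_left_mono)
      also have "\<dots> \<le> (\<Sum>j\<le>k. W (k - j) x * W j y) + ((\<Sum>j\<le>k. P (W (Suc k - j)) x * W j y) + W (Suc k) y)"
        using Suc by (intro add_right_mono) (auto simp: x_def)
      also have "\<dots> = (\<Sum>j\<le>k. (W (k - j) x + P (W (Suc (k - j))) x) * W j y) + W (Suc k) y"
        by (simp add: sum.distrib distrib_right add.assoc Suc_diff_le)
      also have "\<dots> = (\<Sum>j\<le>k. W (Suc (k - j)) x * W j y) + W (Suc k) y"
        by (simp add: iter_green_rec[symmetric])
      also have "\<dots> = F z" unfolding F_def x_def by (simp add: Suc_diff_le)
      finally show ?thesis using 1 by (simp add: f_def)
    qed
    then have "W (Suc k) z \<le> f z" for z
      unfolding iter_green_Suc by (intro green_le) auto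
    then show ?case unfolding f_def F_def by simp
  qed
  from this[rule_format, of "x + y"] show ?thesis by simp
qed

text \<open>In closed form \<open>W (Suc k)\<close> sums \<open>(P ^^ m) (\<lambda>_. 1)\<close>
  with weights \<open>(m + k) choose k\<close>, and \<open>(m + 1) ^ k\<close> is at most
  \<open>fact k\<close> times this weight. The double induction avoids binomial coefficients: it
  replays the recursion of \<open>W\<close> through the inequality \<open>pow\<close>.\<close>

lemma sum_pow_kstep_pow_le:
  "(\<Sum>m<n. of_nat ((m + 1) ^ k) * (P ^^ m) (\<lambda>_. 1) y) \<le> of_nat (fact k) * W (Suc k) y"
proof (induction k arbitrary: n y)
  case 0
  have "(\<Sum>m<n. (P ^^ m) (\<lambda>_. 1) y) \<le> G (\<lambda>_. 1) y"
    unfolding green_def by (intro sum_le_suminf) auto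
  moreover have "W 0 = (\<lambda>_. 1)" by auto
  ultimately show ?case by (simp add: iter_green_Suc)
next
  case (Suc k)
  note IHk = Suc
  show ?case
  proof (induction n arbitrary: y)
    case (Suc n)
    let ?q = "\<lambda>m. (P ^^ m) (\<lambda>_. 1)"
    have pow: "(m + 1) ^ Suc k \<le> Suc k * (m + 1) ^ k + m ^ Suc k" for m :: nat
    proof (induction k)
      case (Suc j)
      have "(m + 1) ^ Suc (Suc j) \<le> (m + 1) * (Suc j * (m + 1) ^ j + m ^ Suc j)"
        using mult_left_mono[OF Suc, of "m + 1"] by simp
      also have "\<dots> = Suc j * (m + 1) ^ Suc j + m ^ Suc j + m ^ Suc (Suc j)"
        by (simp add: algebra_simps)
      also have "\<dots> \<le> Suc (Suc j) * (m + 1) ^ Suc j + m ^ Suc (Suc j)"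
        using power_mono[of m "m + 1" "Suc j"] by (simp del: power_Suc)
      finally show ?case .
    qed simp
    have "(\<Sum>m<Suc n. of_nat ((m + 1) ^ Suc k) * ?q m y)
      \<le> (\<Sum>m<Suc n. of_nat (Suc k * (m + 1) ^ k + m ^ Suc k) * ?q m y)"
      by (intro sum_mono mult_right_mono of_nat_mono pow) auto
    also have "\<dots> = of_nat (Suc k) * (\<Sum>m<Suc n. of_nat ((m + 1) ^ k) * ?q m y)
        + (\<Sum>m<Suc n. of_nat (m ^ Suc k) * ?q m y)"
      by (simp only: of_nat_add of_nat_mult distrib_right sum.distrib sum_distrib_left mult.assoc)
    \<comment> \<open>The term \<open>m = 0\<close> vanishes, so shifting the index exposes one
      application of \<open>P\<close>, to which the induction hypothesis for \<open>n\<close>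
      applies.\<close>
    also have "(\<Sum>m<Suc n. of_nat (m ^ Suc k) * ?q m y) = (\<Sum>m<n. of_nat ((m + 1) ^ Suc k) * P (?q m) y)"
      unfolding sum.lessThan_Suc_shift by simp
    also have "\<dots> = P (\<lambda>y. \<Sum>m<n. of_nat ((m + 1) ^ Suc k) * ?q m y) y"
      by (subst kstep_sum) (auto intro!: sum.cong simp: kstep_cmult)
    also have "\<dots> \<le> P (\<lambda>y. of_nat (fact (Suc k)) * W (Suc (Suc k)) y) y"
      by (intro kstep_le Suc)
    also have "\<dots> = of_nat (fact (Suc k)) * P (W (Suc (Suc k))) y"
      by (intro kstep_cmult) auto
    also have "of_nat (Suc k) * (\<Sum>m<Suc n. of_nat ((m + 1) ^ k) * ?q m y)
      \<le> of_nat (Suc k) * (of_nat (fact k) * W (Suc k) y)"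
      by (intro mult_left_mono IHk) auto
    also have "of_nat (Suc k) * (of_nat (fact k) * W (Suc k) y) + of_nat (fact (Suc k)) * P (W (Suc (Suc k))) y
      = of_nat (fact (Suc k)) * (W (Suc k) y + P (W (Suc (Suc k))) y)"
      by (simp only: fact_Suc of_nat_mult of_nat_id mult.assoc distrib_left)
    also have "\<dots> = of_nat (fact (Suc k)) * W (Suc (Suc k)) y"
      by (simp add: iter_green_rec[symmetric])
    finally show ?case by (simp add: add_right_mono)
  qed simp
qed

lemma suminf_pow_kstep_pow_le:
  "(\<Sum>m. of_nat ((m + 1) ^ k) * (P ^^ m) (\<lambda>_. 1) y) \<le> of_nat (fact k) * W (Suc k) y"
  by (intro suminf_le_const sum_pow_kstep_pow_le) auto

end

section \<open>Divergence and exponential bounds for iterated Green functions\<close>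

context marked_step
begin

lemma green_linear:
  assumes [measurable]: "\<And>i. i \<in> I \<Longrightarrow> f i \<in> borel_measurable borel" and fin: "finite I"
  shows "G (\<lambda>y. c * (\<Sum>i\<in>I. f i y)) y = c * (\<Sum>i\<in>I. G (f i) y)"
proof -
  have pow: "(P ^^ m) (\<lambda>y. c * (\<Sum>i\<in>I. f i y)) = (\<lambda>y. c * (\<Sum>i\<in>I. (P ^^ m) (f i) y))" for m
  proof (induction m)
    case (Suc m)
    have "P (\<lambda>y. c * (\<Sum>i\<in>I. (P ^^ m) (f i) y)) y = c * (\<Sum>i\<in>I. P ((P ^^ m) (f i)) y)" for y
      by (subst kstep_cmult) (auto simp: kstep_sum)
    then show ?case by (simp add: Suc)
  qed simp
  have "(\<Sum>m. c * (\<Sum>i\<in>I. (P ^^ m) (f i) y)) = c * (\<Sum>i\<in>I. \<Sum>m. (P ^^ m) (f i) y)"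
    by (simp add: ennreal_suminf_cmult suminf_sum)
  then show ?thesis unfolding green_def by (simp add: pow)
qed

text \<open>Used contrapositively: finiteness of \<open>W 1\<close> forces a negative mean. With a
  nonnegative mean the expected positive position carried by the survivors never falls below the
  start, while after \<open>m\<close> steps a position exceeds the positive part of the start by at
  most \<open>m * b\<close>. The survival probabilities are thus bounded below by a harmonic
  sequence, which is not summable.\<close>

lemma iter_green_1_infinite:
  assumes int: "integrable N D" "0 \<le> (\<integral>z. D z \<partial>N)" and bd: "\<And>z. z \<in> space N \<Longrightarrow> D z \<le> b" and b: "0 \<le> b"
  shows "W 1 1 = \<infinity>"
proof -
  let ?h = "\<lambda>m. (P ^^ m) (\<lambda>y. ennreal y)" and ?q = "\<lambda>m. (P ^^ m) (\<lambda>_. 1)"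
  have low: "ennreal y \<le> ?h m y" for m y
  proof (induction m arbitrary: y)
    case (Suc m)
    have "ennreal y \<le> ennreal (\<integral>z. max 0 (y + D z) \<partial>N)"
    proof (rule ennreal_leI)
      have "y \<le> (\<integral>z. y + D z \<partial>N)" using int by (simp add: prob_space)
      also have "\<dots> \<le> (\<integral>z. max 0 (y + D z) \<partial>N)" using int by (intro integral_mono) auto
      finally show "y \<le> (\<integral>z. max 0 (y + D z) \<partial>N)" .
    qed
    also have "\<dots> = (\<integral>\<^sup>+z. ennreal (max 0 (y + D z)) \<partial>N)"
      using int by (intro nn_integral_eq_integral[symmetric]) auto
    \<comment> \<open>A positive new position \<open>y + D z\<close> implies
      \<open>0 < y + M z\<close>, so killing removes only positions that \<open>ennreal\<close>
      sends to 0 anyway.\<close>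
    also have "\<dots> \<le> P (\<lambda>y. ennreal y) y" unfolding kstep_def
    proof (intro nn_integral_mono)
      fix z assume "z \<in> space N"
      from D_le_M[OF this] show "ennreal (max 0 (y + D z)) \<le> (if 0 < y + M z then ennreal (y + D z) else 0)"
        by (auto simp: max_def ennreal_neg)
    qed
    also have "\<dots> \<le> P (?h m) y" by (intro kstep_le Suc)
    finally show ?case by simp
  qed simp
  have up: "?h m y \<le> ennreal (max 0 y + m * b) * ?q m y" for m y
  proof (induction m arbitrary: y)
    case (Suc m)
    have "?h (Suc m) y \<le> P (\<lambda>y. ennreal (max 0 y + m * b) * ?q m y) y"
      by (simp, intro kstep_le Suc)
    also have "\<dots> = (\<integral>\<^sup>+ z. (if 0 < y + M z then ennreal (max 0 (y + D z) + m * b) * ?q m (y + D z) else 0) \<partial>N)"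
      by (rule kstep_def)
    also have "\<dots> \<le> (\<integral>\<^sup>+ z. ennreal (max 0 y + Suc m * b) * (if 0 < y + M z then ?q m (y + D z) else 0) \<partial>N)"
    proof (intro nn_integral_mono)
      fix z assume "z \<in> space N"
      then have "max 0 (y + D z) + m * b \<le> max 0 y + Suc m * b"
        using bd[of z] b by (auto simp: algebra_simps max_def)
      then show "(if 0 < y + M z then ennreal (max 0 (y + D z) + m * b) * ?q m (y + D z) else 0)
        \<le> ennreal (max 0 y + Suc m * b) * (if 0 < y + M z then ?q m (y + D z) else 0)"
        by (auto intro!: mult_right_mono ennreal_leI)
    qed
    also have "\<dots> = ennreal (max 0 y + Suc m * b) * P (?q m) y"
      by (subst nn_integral_cmult) (auto simp: kstep_def[of N D M "?q m"])
    finally show ?case by simp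
  qed (auto simp: max_def ennreal_neg)
  have le: "1 \<le> ennreal (1 + m * b) * ?q m 1" for m
    using order_trans[OF low[of 1 m] up[of m 1]] by simp
  show ?thesis
  proof (rule ccontr)
    assume "W 1 1 \<noteq> \<infinity>"
    have W0: "W 0 = (\<lambda>_. 1)" by auto
    with \<open>W 1 1 \<noteq> \<infinity>\<close> have fin: "(\<Sum>m. ?q m 1) \<noteq> \<infinity>"
      unfolding One_nat_def iter_green_Suc by (simp add: green_def)
    then have fin': "?q m 1 \<noteq> \<infinity>" for m
      by (metis ennreal_suminf_lessD infinity_ennreal_def top.not_eq_extremum)
    define r where "r m = enn2real (?q m 1)" for m
    have r: "?q m 1 = ennreal (r m)" "0 \<le> r m" for m
      using fin'[of m] by (auto simp: r_def ennreal_enn2real_if)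
    have sr: "summable r"
      using fin r by (intro summable_suminf_not_top) auto
    have "inverse (real (Suc m)) \<le> (1 + b) * r m" for m
    proof -
      have "ennreal 1 \<le> ennreal ((1 + m * b) * r m)" using le[of m] r[of m] b by (simp add: ennreal_mult)
      then have "1 \<le> (1 + m * b) * r m" using r b by (subst (asm) ennreal_le_iff) auto
      also have "\<dots> \<le> (Suc m * (1 + b)) * r m" using r b by (intro mult_right_mono) (auto simp: algebra_simps)
      finally show ?thesis by (simp add: field_simps)
    qed
    then have "summable (\<lambda>m. inverse (real (Suc m)))"
      by (intro summable_comparison_test'[OF summable_mult[OF sr, of "1 + b"]]) auto
    then show False using not_summable_harmonic[where ?'a = real] summable_Suc_iff by blast
  qed
qed

text \<open>A multiple of \<open>exp (\<theta> * (y + b))\<close> plus 1 is a supersolution for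
  every \<open>k\<close>: surviving a step needs \<open>0 < y + b\<close>, so the exponential
  dominates \<open>P (\<lambda>_. 1)\<close>, and \<open>P\<close> contracts it by the factor
  \<open>\<beta>\<close>.\<close>

lemma iter_green_exp_bound:
  assumes M_le: "\<And>z. z \<in> space N \<Longrightarrow> M z \<le> b"
    and \<theta>: "0 \<le> \<theta>" and \<beta>: "0 \<le> \<beta>" "\<beta> < 1" "(\<integral>\<^sup>+z. ennreal (exp (\<theta> * D z)) \<partial>N) \<le> ennreal \<beta>"
  shows "W k y \<le> 1 + ennreal (k * (1 / (1 - \<beta>)) ^ k * exp (\<theta> * (y + b)))"
proof -
  define s where "s = 1 / (1 - \<beta>)"
  have s: "1 \<le> s" "s * (1 - \<beta>) = 1" using \<beta> by (auto simp: s_def)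
  \<comment> \<open>Solves \<open>c (Suc k) = c k + 1 + \<beta> * c (Suc k)\<close>, the equality
    that the supersolution property asks for; \<open>s\<close> is the sum of the geometric series in
    \<open>\<beta>\<close>.\<close>
  define c where "c = rec_nat 0 (\<lambda>_ c. s * (c + 1))"
  have c_simps [simp]: "c 0 = 0" "c (Suc k) = s * (c k + 1)" for k by (auto simp: c_def)
  have c_nonneg: "0 \<le> c k" for k using s by (induction k) auto
  define \<phi> where "\<phi> y = ennreal (exp (\<theta> * (y + b)))" for y
  have [measurable]: "\<phi> \<in> borel_measurable borel" unfolding \<phi>_def by measurable
  have P1: "P (\<lambda>_. 1) y \<le> \<phi> y" for y
  proof -
    have "P (\<lambda>_. 1) y \<le> (\<integral>\<^sup>+z. \<phi> y \<partial>N)" unfolding kstep_def \<phi>_def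
    proof (intro nn_integral_mono)
      fix z assume "z \<in> space N"
      with M_le \<theta> have "0 < y + M z \<Longrightarrow> 1 \<le> exp (\<theta> * (y + b))" by force
      then show "(if 0 < y + M z then 1 else 0) \<le> ennreal (exp (\<theta> * (y + b)))"
        by (auto simp: ennreal_leI[of 1, simplified])
    qed
    then show ?thesis by (simp add: emeasure_space_1)
  qed
  have P2: "P \<phi> y \<le> ennreal \<beta> * \<phi> y" for y
  proof -
    have "P \<phi> y \<le> (\<integral>\<^sup>+z. \<phi> y * ennreal (exp (\<theta> * D z)) \<partial>N)" unfolding kstep_def \<phi>_def
      by (intro nn_integral_mono) (auto simp: ennreal_mult[symmetric] exp_add[symmetric] algebra_simps)
    also have "\<dots> \<le> \<phi> y * ennreal \<beta>"
      by (subst nn_integral_cmult) (auto intro!: mult_left_mono \<beta>)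
    finally show ?thesis by (simp add: mult.commute)
  qed
  have W: "W k y \<le> 1 + ennreal (c k) * \<phi> y" for k y
  proof (induction k arbitrary: y)
    case (Suc k)
    show ?case unfolding iter_green_Suc
    proof (rule green_le)
      fix y
      have "W k y + P (\<lambda>y. 1 + ennreal (c (Suc k)) * \<phi> y) y
          \<le> (1 + ennreal (c k) * \<phi> y) + (\<phi> y + ennreal (c (Suc k)) * (ennreal \<beta> * \<phi> y))"
      proof (intro add_mono Suc)
        have "P (\<lambda>y. 1 + ennreal (c (Suc k)) * \<phi> y) y = P (\<lambda>_. 1) y + ennreal (c (Suc k)) * P \<phi> y"
          by (subst kstep_add) (auto simp: kstep_cmult)
        also have "\<dots> \<le> \<phi> y + ennreal (c (Suc k)) * (ennreal \<beta> * \<phi> y)"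
          by (intro add_mono P1 mult_left_mono P2) auto
        finally show "P (\<lambda>y. 1 + ennreal (c (Suc k)) * \<phi> y) y \<le> \<phi> y + ennreal (c (Suc k)) * (ennreal \<beta> * \<phi> y)" .
      qed
      also have "\<dots> = 1 + ennreal (c k + 1 + c (Suc k) * \<beta>) * \<phi> y"
        using c_nonneg[of k] c_nonneg[of "Suc k"] \<beta>
        by (simp add: ennreal_plus[symmetric] ennreal_mult distrib_right add.assoc mult.assoc del: c_simps ennreal_plus)
           (simp add: ennreal_plus distrib_right distrib_left ennreal_mult ac_simps del: c_simps)
      also have "c k + 1 + c (Suc k) * \<beta> = c (Suc k)"
      proof -
        have "c (Suc k) * (1 - \<beta>) = (c k + 1) * (s * (1 - \<beta>))" by (simp add: mult_ac)
        then have "c (Suc k) * (1 - \<beta>) = c k + 1" by (simp only: s mult_1_right)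
        then show ?thesis by (simp add: algebra_simps del: c_simps)
      qed
      finally show "W k y + P (\<lambda>y. 1 + ennreal (c (Suc k)) * \<phi> y) y \<le> 1 + ennreal (c (Suc k)) * \<phi> y" .
    qed auto
  qed simp
  have c_le: "c k \<le> k * s ^ k" for k
  proof (induction k)
    case (Suc k)
    have "c (Suc k) \<le> s * (k * s ^ k + 1)" using Suc s by simp
    also have "\<dots> \<le> Suc k * s ^ Suc k" using s one_le_power[of s k] by (simp add: algebra_simps)
    finally show ?case .
  qed simp
  have "ennreal (c k) * \<phi> y \<le> ennreal (k * s ^ k * exp (\<theta> * (y + b)))"
    unfolding \<phi>_def using c_le[of k] c_nonneg[of k]
    by (subst ennreal_mult[symmetric]) (auto intro!: ennreal_leI mult_right_mono)
  with W[of k y] show ?thesis unfolding s_def by (meson add_left_mono order_trans)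
qed

end

section \<open>Removal of large marks as a perturbation of the killed walk\<close>

text \<open>Marks above \<open>z0\<close> are subtracted from the step; they come back as a perturbation of the Green
  function of the truncated walk.\<close>
locale truncated_step = marked_step +
  fixes z0 :: real
  assumes z0_pos: "0 < z0" and M_nonneg: "z \<in> space N \<Longrightarrow> 0 \<le> M z"
begin

definition "D' z = (if z0 < M z then D z - M z else D z)"
definition "M' z = (if z0 < M z then 0 else M z)"

lemma M'_le: "M' z \<le> z0" using z0_pos by (auto simp: M'_def)

lemma D'_le_D: "z \<in> space N \<Longrightarrow> D' z \<le> D z" using M_nonneg by (auto simp: D'_def)

lemma D'_le_M': "z \<in> space N \<Longrightarrow> D' z \<le> M' z" using D_le_M[of z] by (auto simp: D'_def M'_def)

sublocale trunc: marked_step N D' M'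
proof
  show "D' \<in> borel_measurable N" "M' \<in> borel_measurable N"
    unfolding D'_def M'_def by measurable
qed (rule D'_le_M')

abbreviation "u \<equiv> iter_green N D' M'"

text \<open>For nondecreasing \<open>f\<close> both changes lower the value: the step becomes
  smaller, and it is killed at least as often because a removed mark is replaced by 0.\<close>

lemma trunc_kstep_le: "mono f \<Longrightarrow> kstep N D' M' f y \<le> P f y"
  unfolding kstep_def
  by (intro nn_integral_mono) (use M_nonneg D'_le_D z0_pos in \<open>force simp: M'_def intro: monoD split: if_splits\<close>)

lemma trunc_pow_le:
  assumes "mono f"
  shows "(kstep N D' M' ^^ m) f y \<le> (P ^^ m) f y"
proof (induction m arbitrary: y)
  case (Suc m)
  have "(kstep N D' M' ^^ Suc m) f y \<le> kstep N D' M' ((P ^^ m) f) y" by (simp, intro kstep_le Suc)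
  also have "\<dots> \<le> (P ^^ Suc m) f y" by (simp add: trunc_kstep_le kstep_pow_mono assms)
  finally show ?case .
qed simp

lemma u_le_W: "u k y \<le> W k y"
proof (induction k arbitrary: y)
  case (Suc k)
  have "u (Suc k) y \<le> green N D' M' (W k) y" unfolding iter_green_Suc by (intro green_le_green Suc)
  also have "\<dots> \<le> W (Suc k) y" unfolding iter_green_Suc green_def
    by (intro suminf_le) (auto simp: trunc_pow_le iter_green_mono)
  finally show ?case .
qed simp

definition "big k = (\<integral>\<^sup>+z. (if z0 < M z then u k (M z) else 0) \<partial>N)"

text \<open>A step with a removed mark leads to \<open>(y + D' z) + M z\<close>; subadditivity of
  \<open>u\<close> splits off \<open>M z\<close>, and integration yields the weights
  \<open>big\<close>. The sum on the right measures how far \<open>u (Suc k)\<close> is from being a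
  supersolution for the full walk.\<close>

lemma u_drift: "P (u (Suc k)) y + u k y \<le> u (Suc k) y + (\<Sum>j\<le>k. big (Suc j) * u (k - j) y)"
proof -
  have "P (u (Suc k)) y \<le> (\<integral>\<^sup>+z. (if 0 < y + M' z then u (Suc k) (y + D' z) else 0)
      + (\<Sum>j\<le>k. (if z0 < M z then u (Suc j) (M z) else 0) * u (k - j) y) \<partial>N)"
    unfolding kstep_def
  proof (intro nn_integral_mono)
    fix z assume z: "z \<in> space N"
    show "(if 0 < y + M z then u (Suc k) (y + D z) else 0) \<le> (if 0 < y + M' z then u (Suc k) (y + D' z) else 0)
      + (\<Sum>j\<le>k. (if z0 < M z then u (Suc j) (M z) else 0) * u (k - j) y)"
    proof (cases "z0 < M z")
      case False
      then show ?thesis by (simp add: D'_def M'_def)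
    next
      case big: True
      show ?thesis
      proof (cases "0 < y")
        case True
        have "u (Suc k) (y + D z) = u (Suc k) ((y + D' z) + M z)" using big by (simp add: D'_def)
        also have "\<dots> \<le> (\<Sum>j\<le>Suc k. u (Suc k - j) (y + D' z) * u j (M z))"
          by (rule trunc.iter_green_add_le)
        also have "\<dots> = u (Suc k) (y + D' z) + (\<Sum>j\<le>k. u (Suc j) (M z) * u (k - j) (y + D' z))"
          by (subst sum.atMost_Suc_shift) (simp add: mult.commute)
        \<comment> \<open>On a removed mark \<open>D' z = D z - M z \<le> 0\<close>, so
          \<open>u (k - j)\<close> may be evaluated at \<open>y\<close> instead; the factor then no
          longer depends on \<open>z\<close>.\<close>
        also have "\<dots> \<le> u (Suc k) (y + D' z) + (\<Sum>j\<le>k. u (Suc j) (M z) * u (k - j) y)"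
          using big D_le_M[OF z]
          by (intro add_left_mono sum_mono mult_left_mono iter_green_monoD) (auto simp: D'_def)
        finally show ?thesis using big True z0_pos by (simp add: M'_def)
      next
        \<comment> \<open>From a nonpositive start the new position is at most \<open>M z\<close>,
          and the term \<open>j = k\<close>, in which \<open>u 0 = 1\<close>, suffices.\<close>
        case False
        have "u (Suc k) (y + D z) \<le> u (Suc k) (M z)"
          using False D_le_M[OF z] by (intro iter_green_monoD) auto
        also have "\<dots> = u (Suc k) (M z) * u (k - k) y" by simp
        also have "\<dots> \<le> (\<Sum>j\<le>k. u (Suc j) (M z) * u (k - j) y)"
          by (rule member_le_sum) auto
        finally show ?thesis using big False by (auto simp: M'_def)
      qed
    qed
  qed
  also have "\<dots> = kstep N D' M' (u (Suc k)) y + (\<Sum>j\<le>k. big (Suc j) * u (k - j) y)"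
    unfolding kstep_def big_def
    by (subst nn_integral_add; (subst nn_integral_sum)?; (subst nn_integral_multc)?) auto
  finally have "P (u (Suc k)) y + u k y \<le> (kstep N D' M' (u (Suc k)) y + (\<Sum>j\<le>k. big (Suc j) * u (k - j) y)) + u k y"
    by (rule add_right_mono)
  also have "\<dots> = (u k y + kstep N D' M' (u (Suc k)) y) + (\<Sum>j\<le>k. big (Suc j) * u (k - j) y)"
    by (simp add: ac_simps)
  also have "u k y + kstep N D' M' (u (Suc k)) y = u (Suc k) y"
    by (rule trunc.iter_green_rec[symmetric])
  finally show ?thesis .
qed

text \<open>The drift inequality has \<open>big 1 * u k\<close> on the right. With
  \<open>big 1 \<le> 1 / 2\<close> half of \<open>u k\<close> remains on the left, and doubling
  makes \<open>u (Suc k)\<close> a supersolution once the lower orders are corrected by their own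
  Green functions. Finiteness of \<open>u k\<close> allows its cancellation in
  \<open>ennreal\<close>.\<close>

lemma green_u_le:
  assumes b1: "big 1 \<le> 1 / 2" and u_fin: "\<And>y. u k y < \<infinity>"
  shows "G (u k) y \<le> 2 * (u (Suc k) y + (\<Sum>j<k. big (Suc (Suc j)) * G (u (k - Suc j)) y))"
proof -
  define h where "h j = u (k - Suc j)" for j
  define F where "F y = 2 * (u (Suc k) y + (\<Sum>j<k. big (Suc (Suc j)) * G (h j) y))" for y
  have [measurable]: "h j \<in> borel_measurable borel" for j unfolding h_def by measurable
  have [measurable]: "F \<in> borel_measurable borel" unfolding F_def by measurable
  have "G (u k) y \<le> F y"
  proof (rule green_le)
    fix y
    let ?S = "\<Sum>j<k. big (Suc (Suc j)) * h j y" and ?T = "\<Sum>j<k. big (Suc (Suc j)) * P (G (h j)) y"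
    have PF: "P F y = 2 * (P (u (Suc k)) y + ?T)"
      unfolding F_def by (simp add: kstep_cmult kstep_add kstep_sum)
    have "P (u (Suc k)) y + u k y \<le> u (Suc k) y + (big 1 * u k y + ?S)"
      using u_drift[of k y] unfolding h_def
      by (simp add: sum.atMost_shift del: iter_green_0)
    also have "\<dots> \<le> u (Suc k) y + (1 / 2 * u k y + ?S)"
      by (intro add_mono mult_right_mono b1) auto
    finally have "2 * (P (u (Suc k)) y + u k y) \<le> 2 * (u (Suc k) y + (1 / 2 * u k y + ?S))"
      by (intro mult_left_mono) auto
    then have "(2 * P (u (Suc k)) y + u k y) + u k y \<le> (2 * u (Suc k) y + 2 * ?S) + u k y"
      by (simp add: distrib_left mult.assoc[symmetric] ennreal_times_divide mult_2[of "u k y"] ac_simps ennreal_mult_divide_eq)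
    then have *: "2 * P (u (Suc k)) y + u k y \<le> 2 * u (Suc k) y + 2 * ?S"
      using u_fin[of y] by (auto simp: ennreal_add_left_cancel_le add.commute[of _ "u k y"])
    have "u k y + P F y = (2 * P (u (Suc k)) y + u k y) + 2 * ?T"
      unfolding PF by (simp add: distrib_left ac_simps)
    also have "\<dots> \<le> (2 * u (Suc k) y + 2 * ?S) + 2 * ?T" by (intro add_right_mono *)
    also have "\<dots> = 2 * (u (Suc k) y + (\<Sum>j<k. big (Suc (Suc j)) * (h j y + P (G (h j)) y)))"
      by (simp add: distrib_left sum.distrib ac_simps)
    also have "\<dots> = F y" unfolding F_def by (simp add: green_unfold[symmetric])
    finally show "u k y + P F y \<le> F y" .
  qed auto
  then show ?thesis unfolding F_def h_def .
qed

text \<open>Strong induction resolves the lower-order Green functions in \<open>green_u_le\<close>,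
  so that \<open>G (u k)\<close> is bounded by a finite multiple of the sum of the
  \<open>u i\<close> with \<open>i \<le> Suc k\<close>. Applying \<open>G\<close> repeatedly to the
  constant 1 then reaches \<open>W k\<close>.\<close>

lemma W_le_sum_u:
  assumes b1: "big 1 \<le> 1 / 2" and b_fin: "\<And>j. j \<le> K \<Longrightarrow> big j < \<infinity>"
    and u_fin: "\<And>j y. j \<le> K \<Longrightarrow> u j y < \<infinity>" and k: "k \<le> K"
  shows "\<exists>C<\<infinity>. \<forall>y. W k y \<le> C * (\<Sum>i\<le>k. u i y)"
proof -
  have gu: "\<exists>C<\<infinity>. \<forall>y. G (u k) y \<le> C * (\<Sum>i\<le>Suc k. u i y)" if "Suc k \<le> K" for k
    using that
  proof (induction k rule: less_induct)
    case (less k)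
    have "\<forall>j<k. \<exists>C<\<infinity>. \<forall>y. G (u (k - Suc j)) y \<le> C * (\<Sum>i\<le>Suc (k - Suc j). u i y)"
      using less by auto
    then obtain C where C: "\<And>j. j < k \<Longrightarrow> C j < \<infinity>"
      "\<And>j y. j < k \<Longrightarrow> G (u (k - Suc j)) y \<le> C j * (\<Sum>i\<le>Suc (k - Suc j). u i y)"
      by metis
    have "G (u k) y \<le> 2 * (1 + (\<Sum>j<k. big (Suc (Suc j)) * C j)) * (\<Sum>i\<le>Suc k. u i y)" for y
    proof -
      let ?U = "\<Sum>i\<le>Suc k. u i y"
      have "G (u k) y \<le> 2 * (u (Suc k) y + (\<Sum>j<k. big (Suc (Suc j)) * G (u (k - Suc j)) y))"
        using less.prems by (intro green_u_le b1 u_fin) auto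
      also have "\<dots> \<le> 2 * (?U + (\<Sum>j<k. big (Suc (Suc j)) * (C j * ?U)))"
      proof (intro mult_left_mono add_mono sum_mono)
        fix j assume "j \<in> {..<k}"
        then have "G (u (k - Suc j)) y \<le> C j * (\<Sum>i\<le>Suc (k - Suc j). u i y)" using C by auto
        also have "\<dots> \<le> C j * ?U" by (intro mult_left_mono sum_mono2) auto
        finally show "G (u (k - Suc j)) y \<le> C j * ?U" .
      qed auto
      also have "\<dots> = 2 * (1 + (\<Sum>j<k. big (Suc (Suc j)) * C j)) * ?U"
        by (simp add: distrib_right sum_distrib_right mult.assoc del: sum.atMost_Suc)
      finally show ?thesis .
    qed
    moreover have "2 * (1 + (\<Sum>j<k. big (Suc (Suc j)) * C j)) < \<infinity>"
      using C(1) b_fin less.prems by (auto simp: ennreal_mult_less_top)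
    ultimately show ?case by blast
  qed
  show ?thesis using k
  proof (induction k)
    case 0
    show ?case by (intro exI[of _ 1]) auto
  next
    case (Suc k)
    then obtain C where C: "C < \<infinity>" "\<And>y. W k y \<le> C * (\<Sum>i\<le>k. u i y)" by auto
    have "\<forall>i\<le>k. \<exists>C<\<infinity>. \<forall>y. G (u i) y \<le> C * (\<Sum>i\<le>Suc i. u i y)"
      using gu Suc.prems by auto
    then obtain E where E: "\<And>i. i \<le> k \<Longrightarrow> E i < \<infinity>"
      "\<And>i y. i \<le> k \<Longrightarrow> G (u i) y \<le> E i * (\<Sum>j\<le>Suc i. u j y)" by metis
    have "W (Suc k) y \<le> (C * (\<Sum>i\<le>k. E i)) * (\<Sum>i\<le>Suc k. u i y)" for y
    proof -
      have "W (Suc k) y \<le> G (\<lambda>y. C * (\<Sum>i\<le>k. u i y)) y"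
        unfolding iter_green_Suc by (intro green_le_green C)
      also have "\<dots> = C * (\<Sum>i\<le>k. G (u i) y)" by (rule green_linear) auto
      also have "\<dots> \<le> C * (\<Sum>i\<le>k. E i * (\<Sum>i\<le>Suc k. u i y))"
      proof (intro mult_left_mono sum_mono)
        fix i assume i: "i \<in> {..k}"
        then have "G (u i) y \<le> E i * (\<Sum>j\<le>Suc i. u j y)" using E by auto
        also have "\<dots> \<le> E i * (\<Sum>i\<le>Suc k. u i y)" using i by (intro mult_left_mono sum_mono2) auto
        finally show "G (u i) y \<le> E i * (\<Sum>i\<le>Suc k. u i y)" .
      qed auto
      finally show ?thesis by (simp add: sum_distrib_right mult.assoc del: sum.atMost_Suc)
    qed
    moreover have "C * (\<Sum>i\<le>k. E i) < \<infinity>" using C E by (auto simp: ennreal_mult_less_top)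
    ultimately show ?case by blast
  qed
qed

end

text \<open>For negative \<open>v\<close> the bound follows from
  \<open>exp (- v) \<ge> 1 - v\<close> and
  \<open>(1 - v) * (1 + v + v ^ 2) = 1 - v ^ 3\<close>.\<close>

lemma exp_le_quadratic:
  fixes v :: real
  assumes "\<bar>v\<bar> \<le> 1"
  shows "exp v \<le> 1 + v + v\<^sup>2"
proof (cases "0 \<le> v")
  case True
  then show ?thesis using exp_bound assms by auto
next
  case False
  have "1 - v \<le> exp (- v)" using exp_ge_add_one_self[of "- v"] by simp
  then have "exp v \<le> 1 / (1 - v)" using False by (simp add: exp_minus field_simps)
  also have "\<dots> \<le> 1 + v + v\<^sup>2"
  proof -
    have "v * v\<^sup>2 \<le> 0" using False by (intro mult_nonpos_nonneg) auto
    then have "1 \<le> (1 - v) * (1 + v + v\<^sup>2)" by (simp add: algebra_simps power2_eq_square power3_eq_cube)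
    then show ?thesis using False by (simp add: field_simps)
  qed
  finally show ?thesis .
qed

definition trunc_neg :: "'b measure \<Rightarrow> ('b \<Rightarrow> real) \<Rightarrow> real \<Rightarrow> real" where
  "trunc_neg N D x = (\<integral>z. min (max 0 (- D z)) x \<partial>N)"

lemma (in prob_space) trunc_neg_integrable [simp]:
  fixes x :: real
  assumes [measurable]: "D \<in> borel_measurable M" and "0 \<le> x"
  shows "integrable M (\<lambda>z. min (max 0 (- D z)) x)"
  using assms by (intro integrable_const_bound[of _ x]) auto

lemma (in prob_space) trunc_neg_nonneg: "0 \<le> x \<Longrightarrow> 0 \<le> trunc_neg M D x"
  unfolding trunc_neg_def by (intro integral_nonneg_AE) auto

lemma (in prob_space) trunc_neg_mono:
  assumes [measurable]: "D \<in> borel_measurable M" and "0 \<le> x" "x \<le> y"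
  shows "trunc_neg M D x \<le> trunc_neg M D y"
  unfolding trunc_neg_def using assms by (intro integral_mono) auto

lemma (in prob_space) trunc_neg_le:
  assumes [measurable]: "D \<in> borel_measurable M" and "0 \<le> x"
  shows "trunc_neg M D x \<le> x"
proof -
  have "trunc_neg M D x \<le> (\<integral>z. x \<partial>M)"
    unfolding trunc_neg_def using assms by (intro integral_mono) auto
  then show ?thesis by (simp add: prob_space)
qed

section \<open>Exponential supersolution for the truncated walk\<close>

context truncated_step
begin

abbreviation "a' \<equiv> trunc_neg N D'"

lemma D'_le: "z \<in> space N \<Longrightarrow> D' z \<le> z0"
  using D'_le_M' M'_le order_trans by blast

lemma pos_D'_integrable [simp]: "integrable N (\<lambda>z. max 0 (D' z))"
  using z0_pos D'_le by (intro integrable_const_bound[of _ z0]) auto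

text \<open>Otherwise all truncated negative means stay below the mean of the positive part, so by
  monotone convergence \<open>D'\<close> is integrable with nonnegative mean, against
  \<open>iter_green_1_infinite\<close>. Truncation is kept in the conclusion because the negative
  part may have infinite mean; the margin \<open>c\<close> persists for larger \<open>x\<close>
  since \<open>a'\<close> is monotone.\<close>

lemma negative_drift:
  assumes fin: "u 1 1 < \<infinity>"
  obtains x1 c where "z0 \<le> x1" "0 < c" "c \<le> 1"
    "\<And>x. x1 \<le> x \<Longrightarrow> 0 < a' x"
    "\<And>x. x1 \<le> x \<Longrightarrow> (\<integral>z. max 0 (D' z) \<partial>N) \<le> (1 - c) * a' x"
proof -
  let ?e = "\<integral>z. max 0 (D' z) \<partial>N"
  have e0: "0 \<le> ?e" by (intro integral_nonneg_AE) auto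
  have "\<exists>n::nat. ?e < a' n"
  proof (rule ccontr)
    assume "\<not> ?thesis"
    then have le: "a' (real n) \<le> ?e" for n by (simp add: not_less)
    have "(\<lambda>n. \<integral>\<^sup>+z. ennreal (min (max 0 (- D' z)) (real n)) \<partial>N) \<longlonglongrightarrow> (\<integral>\<^sup>+z. ennreal (max 0 (- D' z)) \<partial>N)"
    proof (rule nn_integral_LIMSEQ)
      show "incseq (\<lambda>n z. ennreal (min (max 0 (- D' z)) (real n)))"
        by (auto simp: incseq_def le_fun_def intro!: ennreal_leI)
      fix z
      have "\<forall>\<^sub>F n in sequentially. min (max 0 (- D' z)) (real n) = max 0 (- D' z)"
        using eventually_ge_at_top[of "nat \<lceil>max 0 (- D' z)\<rceil>"] by eventually_elim (auto simp: min_def; linarith)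
      then show "(\<lambda>n. ennreal (min (max 0 (- D' z)) (real n))) \<longlonglongrightarrow> ennreal (max 0 (- D' z))"
        by (intro tendsto_ennrealI tendsto_eventually)
    qed auto
    moreover have "(\<integral>\<^sup>+z. ennreal (min (max 0 (- D' z)) (real n)) \<partial>N) \<le> ennreal ?e" for n
      using le[of n] by (subst nn_integral_eq_integral) (auto simp: trunc_neg_def intro!: ennreal_leI)
    ultimately have nn: "(\<integral>\<^sup>+z. ennreal (max 0 (- D' z)) \<partial>N) \<le> ennreal ?e"
      by (intro LIMSEQ_le_const2) auto
    then have int: "integrable N (\<lambda>z. max 0 (- D' z))"
      by (intro integrableI_bounded) (auto simp: top.not_eq_extremum elim!: order_le_less_trans)
    with nn have "(\<integral>z. max 0 (- D' z) \<partial>N) \<le> ?e"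
      using e0 by (subst (asm) nn_integral_eq_integral) auto
    moreover have D'_eq: "D' z = max 0 (D' z) - max 0 (- D' z)" for z by (auto simp: max_def)
    have "integrable N (\<lambda>z. max 0 (D' z) - max 0 (- D' z))" using int by auto
    then have "integrable N D'" unfolding D'_eq[symmetric] .
    moreover have "(\<integral>z. D' z \<partial>N) = ?e - (\<integral>z. max 0 (- D' z) \<partial>N)"
      by (subst D'_eq, subst Bochner_Integration.integral_diff) (auto intro: int)
    ultimately have "u 1 1 = \<infinity>"
      using z0_pos D'_le by (intro trunc.iter_green_1_infinite[of z0]) auto
    with fin show False by simp
  qed
  then obtain n :: nat where n: "?e < a' n" by auto
  define x1 where "x1 = max z0 n"
  define c where "c = 1 - ?e / a' n"
  have pos: "0 < a' n" by (rule le_less_trans[OF e0 n])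
  have mono: "a' n \<le> a' x" if "x1 \<le> x" for x
    using that by (intro trunc_neg_mono) (auto simp: x1_def)
  show ?thesis
  proof (rule that[of x1 c])
    show "z0 \<le> x1" by (simp add: x1_def)
    show "0 < c" using n pos by (simp add: c_def)
    show "c \<le> 1" using e0 pos by (simp add: c_def)
    show "0 < a' x" if "x1 \<le> x" for x using mono[OF that] pos by simp
    show "?e \<le> (1 - c) * a' x" if "x1 \<le> x" for x
    proof -
      have "?e = (1 - c) * a' n" using pos by (simp add: c_def)
      also have "\<dots> \<le> (1 - c) * a' x" using mono[OF that] e0 pos by (intro mult_left_mono) (auto simp: c_def)
      finally show ?thesis .
    qed
  qed
qed

text \<open>Second-order expansion after cutting the negative part at \<open>x\<close>. The linear
  term contributes at most \<open>- \<theta> * c * a' x\<close>, the quadratic one at most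
  \<open>2 * \<theta> ^ 2 * x * a' x\<close>; the choice \<open>\<theta> = c / (4 * x)\<close> makes
  the gain twice the loss and keeps the argument of \<open>exp\<close> within
  \<open>[-1, 1]\<close>.\<close>

lemma exp_moment_D':
  assumes c: "0 < c" "c \<le> 1" and x: "z0 \<le> x"
    and e: "(\<integral>z. max 0 (D' z) \<partial>N) \<le> (1 - c) * a' x"
  shows "(\<integral>\<^sup>+z. ennreal (exp (c / (4 * x) * D' z)) \<partial>N) \<le> ennreal (1 - c\<^sup>2 / 8 * a' x / x)"
proof -
  let ?e = "\<integral>z. max 0 (D' z) \<partial>N"
  have x0: "0 < x" using x z0_pos by simp
  define \<theta> where "\<theta> = c / (4 * x)"
  have \<theta>: "0 < \<theta>" "\<theta> * x = c / 4" using c x0 by (auto simp: \<theta>_def)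
  define p w where "p z = max 0 (D' z)" and "w z = min (max 0 (- D' z)) x" for z
  have [simp]: "integrable N p" "integrable N w" unfolding p_def w_def using x0 by auto
  have a'x: "0 \<le> a' x" using x0 by (simp add: trunc_neg_nonneg)
  have iw: "(\<integral>z. w z \<partial>N) = a' x" unfolding w_def trunc_neg_def ..
  have bnd: "exp (\<theta> * D' z) \<le> 1 + \<theta> * (p z - w z) + \<theta>\<^sup>2 * (z0 * p z + x * w z)" if "z \<in> space N" for z
  proof -
    have pw: "0 \<le> p z" "p z \<le> z0" "0 \<le> w z" "w z \<le> x" "p z * w z = 0" "D' z \<le> p z - w z"
      using D'_le[OF that] x0 z0_pos by (auto simp: p_def w_def max_def min_def)
    have "\<theta> * (p z - w z) \<le> \<theta> * x" "\<theta> * (w z - p z) \<le> \<theta> * x"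
      using pw \<theta> x by (auto intro!: mult_left_mono)
    then have "\<bar>\<theta> * (p z - w z)\<bar> \<le> 1" using \<theta> c by (auto simp: abs_le_iff algebra_simps)
    then have "exp (\<theta> * (p z - w z)) \<le> 1 + \<theta> * (p z - w z) + (\<theta> * (p z - w z))\<^sup>2"
      by (rule exp_le_quadratic)
    moreover have "exp (\<theta> * D' z) \<le> exp (\<theta> * (p z - w z))" using pw \<theta> by auto
    moreover have "(p z - w z)\<^sup>2 \<le> z0 * p z + x * w z"
    proof -
      have "(p z - w z)\<^sup>2 = p z * p z + w z * w z" using pw(5) by (simp add: power2_eq_square algebra_simps)
      also have "\<dots> \<le> z0 * p z + x * w z" using pw by (intro add_mono mult_right_mono) auto
      finally show ?thesis .
    qed
    then have "(\<theta> * (p z - w z))\<^sup>2 \<le> \<theta>\<^sup>2 * (z0 * p z + x * w z)"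
      by (simp add: power_mult_distrib mult_left_mono)
    ultimately show ?thesis by linarith
  qed
  have int: "integrable N (\<lambda>z. 1 + \<theta> * (p z - w z) + \<theta>\<^sup>2 * (z0 * p z + x * w z))" by simp
  have "(\<integral>\<^sup>+z. ennreal (exp (\<theta> * D' z)) \<partial>N) \<le> (\<integral>\<^sup>+z. ennreal (1 + \<theta> * (p z - w z) + \<theta>\<^sup>2 * (z0 * p z + x * w z)) \<partial>N)"
    by (intro nn_integral_mono ennreal_leI bnd)
  also have "\<dots> = ennreal (\<integral>z. 1 + \<theta> * (p z - w z) + \<theta>\<^sup>2 * (z0 * p z + x * w z) \<partial>N)"
    by (intro nn_integral_eq_integral int) (auto intro!: AE_I2 order_trans[OF _ bnd])
  also have "(\<integral>z. 1 + \<theta> * (p z - w z) + \<theta>\<^sup>2 * (z0 * p z + x * w z) \<partial>N)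
      = 1 + \<theta> * (?e - a' x) + \<theta>\<^sup>2 * (z0 * ?e + x * a' x)"
    unfolding iw[symmetric] by (simp add: prob_space p_def[symmetric])
  also have "\<dots> \<le> 1 + \<theta> * (- c * a' x) + \<theta>\<^sup>2 * (2 * x * a' x)"
  proof -
    have "?e \<le> 1 * a' x" using e c a'x by (intro order_trans[OF e] mult_right_mono) auto
    then have "z0 * ?e \<le> x * a' x" using x z0_pos a'x by (intro mult_mono) (auto intro!: integral_nonneg_AE)
    then show ?thesis using \<theta> e by (intro add_mono mult_left_mono) (auto simp: algebra_simps)
  qed
  also have "\<dots> = 1 - c\<^sup>2 / 8 * a' x / x"
    using x0 by (simp add: \<theta>_def field_simps power2_eq_square)
  finally show ?thesis unfolding \<theta>_def by (auto intro: ennreal_leI)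
qed

text \<open>The tilt is matched to the starting height: with \<open>\<theta>\<close> of order
  \<open>1 / x\<close> the factor \<open>exp (\<theta> * (x + z0))\<close> is at most 3, and
  \<open>1 / (1 - \<beta>)\<close> is a constant times \<open>x / a' x\<close>. Since
  \<open>D' \<le> D\<close>, replacing \<open>a'\<close> by \<open>trunc_neg N D\<close> only
  enlarges the bound.\<close>

lemma u_bound:
  assumes "u 1 1 < \<infinity>" and a1: "0 < trunc_neg N D 1"
  obtains x1 C where "1 \<le> x1" "0 \<le> C"
    "\<And>k x. x1 \<le> x \<Longrightarrow> u k x \<le> ennreal ((1 + 3 * real k) * (C * (x / trunc_neg N D x)) ^ k)"
proof -
  from negative_drift[OF assms(1)] obtain x1 c where xc: "z0 \<le> x1" "0 < c" "c \<le> 1"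
    "\<And>x. x1 \<le> x \<Longrightarrow> 0 < a' x"
    "\<And>x. x1 \<le> x \<Longrightarrow> (\<integral>z. max 0 (D' z) \<partial>N) \<le> (1 - c) * a' x" by blast
  show ?thesis
  proof (rule that[of "max 1 x1" "8 / c\<^sup>2"])
    fix k :: nat and x assume x: "max 1 x1 \<le> x"
    then have x0: "1 \<le> x" "x1 \<le> x" "z0 \<le> x" using xc by auto
    note ax = xc(4)[OF x0(2)]
    have ax_le: "a' x \<le> x" using x0 by (intro trunc_neg_le) auto
    have a_le: "trunc_neg N D x \<le> a' x"
      unfolding trunc_neg_def using x0 D'_le_D by (intro integral_mono min.mono max.mono) auto
    have a_pos: "0 < trunc_neg N D x"
      using a1 x0 trunc_neg_mono[of D 1 x] by simp
    define \<beta> where "\<beta> = 1 - c\<^sup>2 / 8 * a' x / x"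
    define \<theta> where "\<theta> = c / (4 * x)"
    have c2: "c\<^sup>2 \<le> 1" using xc by (simp add: power_le_one)
    have frac: "0 < a' x / x" "a' x / x \<le> 1" using ax ax_le x0 by auto
    have "c\<^sup>2 / 8 * (a' x / x) \<le> 1 * 1" using c2 frac by (intro mult_mono) auto
    moreover have "0 < c\<^sup>2 / 8 * (a' x / x)" using frac xc by (intro mult_pos_pos) auto
    ultimately have \<beta>: "0 \<le> \<beta>" "\<beta> < 1" by (simp_all add: \<beta>_def)
    have "u k x \<le> 1 + ennreal (k * (1 / (1 - \<beta>)) ^ k * exp (\<theta> * (x + z0)))"
    proof (rule trunc.iter_green_exp_bound[OF _ _ \<beta>])
      show "(\<integral>\<^sup>+ z. ennreal (exp (\<theta> * D' z)) \<partial>N) \<le> ennreal \<beta>"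
        unfolding \<beta>_def \<theta>_def using xc x0 by (intro exp_moment_D') auto
      show "0 \<le> \<theta>" using xc x0 by (simp add: \<theta>_def)
    qed (rule M'_le)
    also have "1 / (1 - \<beta>) = 8 / c\<^sup>2 * (x / a' x)" using xc ax x0 by (simp add: \<beta>_def field_simps)
    also have "1 + ennreal (k * (8 / c\<^sup>2 * (x / a' x)) ^ k * exp (\<theta> * (x + z0)))
      \<le> ennreal ((1 + 3 * real k) * (8 / c\<^sup>2 * (x / trunc_neg N D x)) ^ k)"
    proof -
      have "\<theta> * (x + z0) \<le> \<theta> * (2 * x)" using xc x0 by (intro mult_left_mono) (auto simp: \<theta>_def)
      also have "\<dots> \<le> 1" using xc x0 by (simp add: \<theta>_def)
      finally have "exp (\<theta> * (x + z0)) \<le> exp 1" by simp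
      then have ex: "exp (\<theta> * (x + z0)) \<le> 3" using exp_le by linarith
      have "x / a' x \<le> x / trunc_neg N D x" using a_le a_pos x0 by (intro divide_left_mono) auto
      moreover have "0 \<le> x / a' x" by (intro divide_nonneg_pos ax) (use x0 in auto)
      ultimately have pw: "(8 / c\<^sup>2 * (x / a' x)) ^ k \<le> (8 / c\<^sup>2 * (x / trunc_neg N D x)) ^ k"
        by (intro power_mono mult_left_mono mult_nonneg_nonneg) auto
      \<comment> \<open>The power is at least 1 and can therefore absorb the summand 1 of the
        exponential bound.\<close>
      have "1 * 1 \<le> 8 / c\<^sup>2 * (x / a' x)" using c2 xc ax ax_le by (intro mult_mono) (auto simp: field_simps)
      then have one0: "1 \<le> (8 / c\<^sup>2 * (x / a' x)) ^ k" by (intro one_le_power) simp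
      with pw have one: "1 \<le> (8 / c\<^sup>2 * (x / trunc_neg N D x)) ^ k" by linarith
      have "k * (8 / c\<^sup>2 * (x / a' x)) ^ k * exp (\<theta> * (x + z0)) \<le> k * (8 / c\<^sup>2 * (x / trunc_neg N D x)) ^ k * 3"
      proof (rule mult_mono)
        show "0 \<le> k * (8 / c\<^sup>2 * (x / trunc_neg N D x)) ^ k"
          using one by (intro mult_nonneg_nonneg) linarith+
        show "k * (8 / c\<^sup>2 * (x / a' x)) ^ k \<le> k * (8 / c\<^sup>2 * (x / trunc_neg N D x)) ^ k"
          by (rule mult_left_mono[OF pw]) simp
      qed (use ex in auto)
      then have "1 + k * (8 / c\<^sup>2 * (x / a' x)) ^ k * exp (\<theta> * (x + z0)) \<le> (1 + 3 * real k) * (8 / c\<^sup>2 * (x / trunc_neg N D x)) ^ k"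
        using one by (simp add: algebra_simps)
      then have "ennreal (1 + k * (8 / c\<^sup>2 * (x / a' x)) ^ k * exp (\<theta> * (x + z0))) \<le> ennreal ((1 + 3 * real k) * (8 / c\<^sup>2 * (x / trunc_neg N D x)) ^ k)"
        by (rule ennreal_leI)
      then show ?thesis using ax x0 by (subst (asm) ennreal_plus) auto
    qed
    finally show "u k x \<le> ennreal ((1 + 3 * real k) * (8 / c\<^sup>2 * (x / trunc_neg N D x)) ^ k)" .
  qed auto
qed

end

text \<open>No circularity arises: \<open>big 1\<close> is bounded by the tail of
  \<open>W 1 (M z)\<close>, whose expectation is finite by hypothesis, so \<open>z0\<close> is fixed
  before anything is known about higher orders. Then \<open>u_bound\<close> and the moment
  hypothesis bound each \<open>u k (M z)\<close> in expectation, and \<open>W_le_sum_u\<close>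
  transfers this to \<open>W k\<close>.\<close>

theorem (in marked_step) iter_green_moments:
  assumes M_nonneg: "\<And>z. z \<in> space N \<Longrightarrow> 0 \<le> M z"
    and W1: "W 1 1 < \<infinity>" and EW1: "(\<integral>\<^sup>+z. W 1 (M z) \<partial>N) < \<infinity>"
    and a1: "0 < trunc_neg N D 1"
    and mom: "(\<integral>\<^sup>+z. (if 1 \<le> M z then ennreal ((M z / trunc_neg N D (M z)) ^ K) else 0) \<partial>N) < \<infinity>"
    and k: "k \<le> K"
  shows "(\<integral>\<^sup>+z. W k (M z) \<partial>N) < \<infinity>" "W k y < \<infinity>"
proof -
  have "(\<lambda>n. \<integral>\<^sup>+z. (if real (Suc n) < M z then W 1 (M z) else 0) \<partial>N) \<longlonglongrightarrow> (\<integral>\<^sup>+z. 0 \<partial>N)"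
  proof (rule nn_integral_dominated_convergence[where w = "\<lambda>z. W 1 (M z)"])
    show "AE z in N. (\<lambda>n. if real (Suc n) < M z then W 1 (M z) else 0) \<longlonglongrightarrow> 0"
    proof (intro AE_I2 tendsto_eventually)
      fix z
      show "\<forall>\<^sub>F n in sequentially. (if real (Suc n) < M z then W 1 (M z) else 0) = 0"
        using eventually_ge_at_top[of "nat \<lceil>M z\<rceil>"] by eventually_elim (auto; linarith)
    qed
  qed (use EW1 in auto)
  then have "\<forall>\<^sub>F n in sequentially. (\<integral>\<^sup>+z. (if real (Suc n) < M z then W 1 (M z) else 0) \<partial>N) < 1 / 2"
    by (intro order_tendstoD) (auto simp: ennreal_zero_less_divide)
  then obtain n where n: "(\<integral>\<^sup>+z. (if real (Suc n) < M z then W 1 (M z) else 0) \<partial>N) < 1 / 2"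
    by (auto simp: eventually_sequentially simp del: of_nat_Suc)
  define z0 where "z0 = real (Suc n)"
  note n = n[folded z0_def]
  interpret T: truncated_step N D M z0
    by unfold_locales (use M_nonneg in \<open>auto simp: z0_def\<close>)
  have b1: "T.big 1 \<le> 1 / 2"
    unfolding T.big_def
    by (rule order_trans[OF nn_integral_mono order.strict_implies_order[OF n]]) (auto intro: T.u_le_W)
  have u1: "T.u 1 1 < \<infinity>" using T.u_le_W[of 1 1] W1 by (rule order_le_less_trans)
  from T.u_bound[OF u1 a1] obtain x1 C where x1: "1 \<le> x1" "0 \<le> C"
    "\<And>k x. x1 \<le> x \<Longrightarrow> T.u k x \<le> ennreal ((1 + 3 * real k) * (C * (x / trunc_neg N D x)) ^ k)" by metis
  have u_fin: "T.u k y < \<infinity>" for k y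
  proof -
    have "T.u k y \<le> T.u k (max x1 y)" by (intro iter_green_monoD) auto
    also have "\<dots> \<le> ennreal ((1 + 3 * real k) * (C * (max x1 y / trunc_neg N D (max x1 y))) ^ k)" by (intro x1) auto
    also have "\<dots> < \<infinity>" by simp
    finally show ?thesis .
  qed
  have Eu: "(\<integral>\<^sup>+z. T.u k (M z) \<partial>N) < \<infinity>" if k: "k \<le> K" for k
  proof -
    have "(\<integral>\<^sup>+z. T.u k (M z) \<partial>N) \<le> (\<integral>\<^sup>+z. T.u k x1 + ennreal ((1 + 3 * real k) * C ^ k) *
        (if 1 \<le> M z then ennreal ((M z / trunc_neg N D (M z)) ^ K) else 0) \<partial>N)"
    proof (intro nn_integral_mono)
      fix z assume "z \<in> space N"
      show "T.u k (M z) \<le> T.u k x1 + ennreal ((1 + 3 * real k) * C ^ k) *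
        (if 1 \<le> M z then ennreal ((M z / trunc_neg N D (M z)) ^ K) else 0)"
      proof (cases "x1 \<le> M z")
        case False
        then have "T.u k (M z) \<le> T.u k x1" by (intro iter_green_monoD) auto
        then show ?thesis by (rule add_increasing2[rotated]) simp
      next
        case True
        then have M1: "1 \<le> M z" using x1 by simp
        let ?r = "M z / trunc_neg N D (M z)"
        have "0 < trunc_neg N D (M z)" "trunc_neg N D (M z) \<le> M z"
          using a1 trunc_neg_mono[of D 1 "M z"] M1 trunc_neg_le[of D "M z"] by auto
        then have r1: "1 \<le> ?r" by simp
        have "T.u k (M z) \<le> ennreal ((1 + 3 * real k) * (C * ?r) ^ k)" by (rule x1(3)[OF True])
        also have "\<dots> \<le> ennreal ((1 + 3 * real k) * (C ^ k * ?r ^ K))"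
          unfolding power_mult_distrib using x1 r1 k
          by (intro ennreal_leI mult_left_mono power_increasing) auto
        also have "\<dots> = ennreal ((1 + 3 * real k) * C ^ k) * ennreal (?r ^ K)"
          using x1 r1 by (subst ennreal_mult[symmetric]) (auto simp: mult_ac)
        finally show ?thesis using M1 by (simp add: add_increasing)
      qed
    qed
    also have "\<dots> = T.u k x1 + ennreal ((1 + 3 * real k) * C ^ k) *
        (\<integral>\<^sup>+z. (if 1 \<le> M z then ennreal ((M z / trunc_neg N D (M z)) ^ K) else 0) \<partial>N)"
    proof -
      have [measurable]: "trunc_neg N D \<in> borel_measurable borel" unfolding trunc_neg_def by measurable
      show ?thesis by (subst nn_integral_add; (subst nn_integral_cmult)?) (auto simp: emeasure_space_1)
    qed
    also have "\<dots> < \<infinity>" using u_fin mom by (auto simp: ennreal_mult_less_top)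
    finally show ?thesis .
  qed
  have b_fin: "T.big j < \<infinity>" if "j \<le> K" for j
    unfolding T.big_def by (rule order_le_less_trans[OF nn_integral_mono Eu[OF that]]) auto
  from T.W_le_sum_u[OF b1 b_fin u_fin k] obtain E where E: "E < \<infinity>" "\<And>y. W k y \<le> E * (\<Sum>i\<le>k. T.u i y)"
    by auto
  show "W k y < \<infinity>"
    using E(1) u_fin by (intro order_le_less_trans[OF E(2)]) (auto simp: ennreal_mult_less_top)
  have "(\<integral>\<^sup>+z. W k (M z) \<partial>N) \<le> (\<integral>\<^sup>+z. E * (\<Sum>i\<le>k. T.u i (M z)) \<partial>N)" by (intro nn_integral_mono E)
  also have "\<dots> = E * (\<Sum>i\<le>k. \<integral>\<^sup>+z. T.u i (M z) \<partial>N)"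
    by (subst nn_integral_cmult; (subst nn_integral_sum)?) auto
  also have "\<dots> < \<infinity>" using E Eu k by (auto simp: ennreal_mult_less_top)
  finally show "(\<integral>\<^sup>+z. W k (M z) \<partial>N) < \<infinity>" .
qed

text \<open>Subadditivity makes \<open>W k\<close> grow at most like \<open>l ^ k\<close> along the
  integers, which the exponential weights absorb. The shifts \<open>real (Suc l)\<close> are the
  logarithmic levels at which the growth of \<open>J\<close> is measured later.\<close>

lemma (in marked_step) iter_green_exp_sum:
  assumes EW: "\<And>k. k \<le> K \<Longrightarrow> (\<integral>\<^sup>+z. W k (M z) \<partial>N) < \<infinity>" and W: "\<And>k. k \<le> K \<Longrightarrow> W k 1 < \<infinity>"
  shows "(\<Sum>l. ennreal (exp (- real l)) * (\<integral>\<^sup>+z. W K (M z + real (Suc l)) \<partial>N)) < \<infinity>"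
proof -
  define C where "C = 1 + (\<Sum>k\<le>K. enn2real (W k 1))"
  have C1: "1 \<le> C" unfolding C_def by (simp add: sum_nonneg)
  have WC: "W j 1 \<le> ennreal (C ^ j)" if "j \<le> K" for j
  proof (cases j)
    case (Suc i)
    have "W j 1 = ennreal (enn2real (W j 1))" using W[OF that] by simp
    also have "\<dots> \<le> ennreal (C ^ 1)"
      using that member_le_sum[of j "{..K}" "\<lambda>k. enn2real (W k 1)"] by (intro ennreal_leI) (auto simp: C_def)
    also have "\<dots> \<le> ennreal (C ^ j)" using C1 Suc by (intro ennreal_leI power_increasing) auto
    finally show ?thesis .
  qed simp
  have Wl: "W k (real (Suc l)) \<le> ennreal (C ^ k * real (Suc l) ^ k)" if "k \<le> K" for k l
    using that
  proof (induction l arbitrary: k)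
    case 0
    then show ?case using WC by simp
  next
    case (Suc l)
    have "W k (real (Suc l) + 1) \<le> (\<Sum>j\<le>k. W (k - j) (real (Suc l)) * W j 1)" by (rule iter_green_add_le)
    also have "\<dots> \<le> (\<Sum>j\<le>k. ennreal (C ^ (k - j) * real (Suc l) ^ (k - j)) * ennreal (C ^ j))"
      using Suc.prems by (intro sum_mono mult_mono Suc WC) auto
    also have "\<dots> = (\<Sum>j\<le>k. ennreal (C ^ k * real (Suc l) ^ (k - j)))"
    proof (intro sum.cong refl)
      fix j assume "j \<in> {..k}"
      then have "C ^ k = C ^ (k - j) * C ^ j" by (simp add: power_add[symmetric])
      then show "ennreal (C ^ (k - j) * real (Suc l) ^ (k - j)) * ennreal (C ^ j) = ennreal (C ^ k * real (Suc l) ^ (k - j))"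
        using C1 by (subst ennreal_mult[symmetric]) (auto simp: mult_ac)
    qed
    also have "\<dots> = ennreal (\<Sum>j\<le>k. C ^ k * real (Suc l) ^ (k - j))"
      using C1 by (subst sum_ennreal) auto
    also have "\<dots> \<le> ennreal (C ^ k * real (Suc (Suc l)) ^ k)"
    proof (rule ennreal_leI)
      \<comment> \<open>Binomial coefficients in the relevant range are at least 1, so the sum is
        dominated by the binomial expansion of \<open>(1 + real (Suc l)) ^ k\<close>.\<close>
      have "(\<Sum>j\<le>k. real (Suc l) ^ (k - j)) \<le> (\<Sum>j\<le>k. real (k choose j) * 1 ^ j * real (Suc l) ^ (k - j))"
        by (intro sum_mono) (auto simp: mult_le_cancel_right1 Suc_le_eq)
      also have "\<dots> = (1 + real (Suc l)) ^ k" by (subst binomial_ring) auto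
      finally show "(\<Sum>j\<le>k. C ^ k * real (Suc l) ^ (k - j)) \<le> C ^ k * real (Suc (Suc l)) ^ k"
        using C1 by (simp add: sum_distrib_left[symmetric] add.commute mult_left_mono)
    qed
    finally show ?case by (simp add: add.commute)
  qed
  define B where "B = (\<Sum>j\<le>K. \<integral>\<^sup>+z. W (K - j) (M z) \<partial>N)"
  have B: "B < \<infinity>" unfolding B_def using EW by auto
  have "(\<integral>\<^sup>+z. W K (M z + real (Suc l)) \<partial>N) \<le> B * ennreal (C ^ K * real (Suc l) ^ K)" for l
  proof -
    have "(\<integral>\<^sup>+z. W K (M z + real (Suc l)) \<partial>N) \<le> (\<integral>\<^sup>+z. (\<Sum>j\<le>K. W (K - j) (M z) * ennreal (C ^ K * real (Suc l) ^ K)) \<partial>N)"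
    proof (intro nn_integral_mono)
      fix z
      have "W K (M z + real (Suc l)) \<le> (\<Sum>j\<le>K. W (K - j) (M z) * W j (real (Suc l)))" by (rule iter_green_add_le)
      also have "\<dots> \<le> (\<Sum>j\<le>K. W (K - j) (M z) * ennreal (C ^ K * real (Suc l) ^ K))"
        using C1 by (intro sum_mono mult_left_mono order_trans[OF Wl] ennreal_leI mult_mono power_increasing) auto
      finally show "W K (M z + real (Suc l)) \<le> \<dots>" .
    qed
    also have "\<dots> = B * ennreal (C ^ K * real (Suc l) ^ K)"
      unfolding B_def sum_distrib_right by (subst nn_integral_sum; (subst nn_integral_multc)?) auto
    finally show ?thesis .
  qed
  then have "(\<Sum>l. ennreal (exp (- real l)) * (\<integral>\<^sup>+z. W K (M z + real (Suc l)) \<partial>N))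
    \<le> (\<Sum>l. (B * ennreal (C ^ K)) * ennreal (exp (- real l) * real (Suc l) ^ K))"
  proof (intro suminf_le)
    fix l
    have "ennreal (exp (- real l)) * (\<integral>\<^sup>+z. W K (M z + real (Suc l)) \<partial>N)
      \<le> ennreal (exp (- real l)) * (B * ennreal (C ^ K * real (Suc l) ^ K))"
      by (rule mult_left_mono) (use \<open>\<And>l. (\<integral>\<^sup>+z. W K (M z + real (Suc l)) \<partial>N) \<le> _\<close> in auto)
    also have "\<dots> = (B * ennreal (C ^ K)) * ennreal (exp (- real l) * real (Suc l) ^ K)"
      using C1 by (simp add: ennreal_mult ac_simps del: of_nat_Suc)
    finally show "ennreal (exp (- real l)) * (\<integral>\<^sup>+z. W K (M z + real (Suc l)) \<partial>N)
      \<le> (B * ennreal (C ^ K)) * ennreal (exp (- real l) * real (Suc l) ^ K)" .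
  qed auto
  also have "\<dots> = (B * ennreal (C ^ K)) * (\<Sum>l. ennreal (exp (- real l) * real (Suc l) ^ K))"
    by (rule ennreal_suminf_cmult)
  also have "(\<Sum>l. ennreal (exp (- real l) * real (Suc l) ^ K)) < \<infinity>"
  proof -
    have "summable (\<lambda>l. exp (- real l) * real (Suc l) ^ K)"
    proof (rule summable_comparison_test_ev)
      have "((\<lambda>l::nat. real (Suc l) ^ K * exp (- (real l / 2))) \<longlongrightarrow> 0) sequentially" by real_asymp
      then have "\<forall>\<^sub>F l in sequentially. real (Suc l) ^ K * exp (- (real l / 2)) < 1"
        by (rule order_tendstoD) simp
      then show "\<forall>\<^sub>F l in sequentially. norm (exp (- real l) * real (Suc l) ^ K) \<le> exp (- 1 / 2) ^ l"
      proof eventually_elim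
        case (elim l)
        have "exp (- real l) * real (Suc l) ^ K = (real (Suc l) ^ K * exp (- (real l / 2))) * exp (- (real l / 2))"
          by (simp add: mult.assoc exp_add[symmetric])
        also have "\<dots> \<le> 1 * exp (- (real l / 2))" using elim by (intro mult_right_mono) auto
        also have "\<dots> = exp (- 1 / 2) ^ l" by (simp add: exp_of_nat_mult[symmetric])
        finally show ?case by (simp add: power_abs abs_mult)
      qed
      show "summable (\<lambda>l. exp (- 1 / 2 :: real) ^ l)" by (simp add: summable_geometric)
    qed
    then show ?thesis by (subst suminf_ennreal2) auto
  qed
  then have "(B * ennreal (C ^ K)) * (\<Sum>l. ennreal (exp (- real l) * real (Suc l) ^ K)) < \<infinity>"
    using B by (auto simp: ennreal_mult_less_top)
  finally show ?thesis .
qed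

section \<open>Compound Poisson laws\<close>

lemma prob_space_convolution:
  assumes "prob_space A" "prob_space B" and [measurable_cong, simp]: "sets A = sets borel" "sets B = sets borel"
  shows "prob_space (A \<star> B)"
proof -
  interpret A: prob_space A by fact
  interpret B: prob_space B by fact
  interpret pair_prob_space A B ..
  show ?thesis unfolding convolution_def by (rule prob_space_distr) simp
qed

lemma char_convolution:
  assumes "prob_space A" "prob_space B" and [measurable_cong, simp]: "sets A = sets borel" "sets B = sets borel"
  shows "char (A \<star> B) t = char A t * char B t"
proof -
  interpret A: prob_space A by fact
  interpret B: prob_space B by fact
  interpret pair_prob_space A B ..
  have int: "integrable (A \<Otimes>\<^sub>M B) (\<lambda>z. iexp (t * fst z) * iexp (t * snd z))"
    by (intro P.integrable_const_bound[of _ 1]) (auto simp: norm_mult)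
  have "char (A \<star> B) t = (CLINT z|A \<Otimes>\<^sub>M B. iexp (t * fst z) * iexp (t * snd z))"
    unfolding char_def convolution_def
    by (subst integral_distr) (auto simp: case_prod_beta' distrib_left exp_add)
  also have "\<dots> = (CLINT x|A. CLINT y|B. iexp (t * x) * iexp (t * y))"
    by (subst integral_fst'[symmetric, OF int]) simp
  also have "\<dots> = char A t * char B t" by (simp add: char_def)
  finally show ?thesis .
qed

text \<open>Compound Poisson law on a concrete sample space, a Poisson number of summands and an
  independent iid sequence. This makes moments of the partial sums directly accessible, besides the
  characteristic function.\<close>

definition cpois :: "real \<Rightarrow> real measure \<Rightarrow> real measure" where
  "cpois r Q = distr (measure_pmf (poisson_pmf r) \<Otimes>\<^sub>M PiM UNIV (\<lambda>_::nat. Q)) borel (\<lambda>(k, w). \<Sum>i<k. w i)"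

lemma sets_cpois [simp, measurable_cong]: "sets (cpois r Q) = sets borel" and space_cpois [simp]: "space (cpois r Q) = UNIV"
  by (auto simp: cpois_def)

locale compound_poisson = prob_space Q for Q :: "real measure" +
  fixes r :: real
  assumes sets_Q [measurable_cong, simp]: "sets Q = sets borel" and r_pos: "0 < r"
begin

abbreviation "\<Omega> \<equiv> PiM UNIV (\<lambda>_::nat. Q)"

sublocale iid: product_prob_space "\<lambda>_::nat. Q" UNIV ..

lemma sum_measurable [measurable]:
  "(\<lambda>(k, w). \<Sum>i<k. w i) \<in> borel_measurable (measure_pmf (poisson_pmf r) \<Otimes>\<^sub>M \<Omega>)"
proof -
  have "(\<lambda>z. \<Sum>i<fst z. snd z i) \<in> borel_measurable (count_space UNIV \<Otimes>\<^sub>M \<Omega>)"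
    by (rule measurable_pair_measure_countable1) auto
  then show ?thesis by (simp add: case_prod_beta' cong: measurable_cong_sets)
qed

lemma iid_indep: "iid.indep_vars (\<lambda>_. borel) (\<lambda>i w. w i) UNIV"
proof (subst iid.indep_vars_iff_distr_eq_PiM)
  have d: "distr \<Omega> borel (\<lambda>w. w i) = Q" for i
  proof -
    have "distr \<Omega> borel (\<lambda>w. w i) = distr \<Omega> Q (\<lambda>w. w i)" by (rule distr_cong) auto
    then show ?thesis by (simp add: iid.PiM_component)
  qed
  have "distr \<Omega> (\<Pi>\<^sub>M i\<in>UNIV. borel) (\<lambda>x. \<lambda>i\<in>UNIV. x i) = distr \<Omega> \<Omega> (\<lambda>x. x)"
    by (rule distr_cong) (auto intro!: sets_PiM_cong)
  then show "distr \<Omega> (\<Pi>\<^sub>M i\<in>UNIV. borel) (\<lambda>x. \<lambda>i\<in>UNIV. x i) = (\<Pi>\<^sub>M i\<in>UNIV. distr \<Omega> borel (\<lambda>w. w i))"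
    by (simp add: d distr_id2)
qed auto

lemma distr_component: "distr \<Omega> borel (\<lambda>w. w i) = Q"
proof -
  have "distr \<Omega> borel (\<lambda>w. w i) = distr \<Omega> Q (\<lambda>w. w i)" by (rule distr_cong) auto
  then show ?thesis by (simp add: iid.PiM_component)
qed

lemma nn_integral_component:
  assumes [measurable]: "f \<in> borel_measurable borel"
  shows "(\<integral>\<^sup>+w. f (w i) \<partial>\<Omega>) = (\<integral>\<^sup>+x. f x \<partial>Q)"
  by (subst distr_component[of i, symmetric], subst nn_integral_distr) auto

lemma prob_space_cpois: "prob_space (cpois r Q)"
proof -
  interpret pair_prob_space "measure_pmf (poisson_pmf r)" \<Omega> ..
  show ?thesis unfolding cpois_def by (rule prob_space_distr) simp
qed

lemma nn_integral_cpois: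
  assumes [measurable]: "f \<in> borel_measurable borel"
  shows "(\<integral>\<^sup>+x. f x \<partial>cpois r Q) = (\<Sum>k. ennreal (pmf (poisson_pmf r) k) * (\<integral>\<^sup>+w. f (\<Sum>i<k. w i) \<partial>\<Omega>))"
proof -
  interpret pair_prob_space "measure_pmf (poisson_pmf r)" \<Omega> ..
  have "(\<integral>\<^sup>+x. f x \<partial>cpois r Q) = (\<integral>\<^sup>+z. (\<lambda>(k, w). f (\<Sum>i<k. w i)) z \<partial>(measure_pmf (poisson_pmf r) \<Otimes>\<^sub>M \<Omega>))"
    unfolding cpois_def by (subst nn_integral_distr) (auto simp: case_prod_beta')
  also have "\<dots> = (\<integral>\<^sup>+k. \<integral>\<^sup>+w. f (\<Sum>i<k. w i) \<partial>\<Omega> \<partial>measure_pmf (poisson_pmf r))"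
  proof (subst iid.nn_integral_fst[symmetric])
    have "(\<lambda>z. f ((\<lambda>(k, w). \<Sum>i<k. w i) z)) \<in> borel_measurable (measure_pmf (poisson_pmf r) \<Otimes>\<^sub>M \<Omega>)" by measurable
    then show "(\<lambda>(k, w). f (\<Sum>i<k. w i)) \<in> borel_measurable (measure_pmf (poisson_pmf r) \<Otimes>\<^sub>M \<Omega>)"
      by (simp add: case_prod_beta')
  qed simp
  also have "\<dots> = (\<Sum>k. ennreal (pmf (poisson_pmf r) k) * (\<integral>\<^sup>+w. f (\<Sum>i<k. w i) \<partial>\<Omega>))"
    by (simp add: nn_integral_measure_pmf nn_integral_count_space_nat)
  finally show ?thesis .
qed

lemma poisson_sum: "0 \<le> c \<Longrightarrow> (\<Sum>k. ennreal (pmf (poisson_pmf r) k) * ennreal c ^ k) = ennreal (exp (r * (c - 1)))"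
proof -
  assume c: "0 \<le> c"
  have "(\<lambda>k. (r * c) ^ k /\<^sub>R fact k) sums exp (r * c)" by (rule exp_converges)
  from sums_mult[OF this, of "exp (- r)"]
  have "(\<lambda>k. pmf (poisson_pmf r) k * c ^ k) sums (exp (- r) * exp (r * c))"
    using r_pos by (simp add: power_mult_distrib divide_inverse mult_ac)
  then have "(\<lambda>k. pmf (poisson_pmf r) k * c ^ k) sums exp (r * (c - 1))"
    by (simp add: exp_add[symmetric] algebra_simps)
  then have "(\<Sum>k. ennreal (pmf (poisson_pmf r) k * c ^ k)) = ennreal (exp (r * (c - 1)))"
    using c by (intro suminf_ennreal_eq) auto
  then show ?thesis using c by (simp add: ennreal_mult ennreal_power del: pmf_poisson)
qed

lemma exp_cpois:
  assumes "(\<integral>\<^sup>+x. ennreal (exp (\<theta> * x)) \<partial>Q) = ennreal c" and "0 \<le> c"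
  shows "(\<integral>\<^sup>+x. ennreal (exp (\<theta> * x)) \<partial>cpois r Q) = ennreal (exp (r * (c - 1)))"
proof -
  have "(\<integral>\<^sup>+w. ennreal (exp (\<theta> * (\<Sum>i<k. w i))) \<partial>\<Omega>) = ennreal c ^ k" for k :: nat
  proof -
    have "(\<integral>\<^sup>+w. ennreal (exp (\<theta> * (\<Sum>i<k. w i))) \<partial>\<Omega>) = (\<integral>\<^sup>+w. (\<Prod>i<k. ennreal (exp (\<theta> * w i))) \<partial>\<Omega>)"
      by (simp add: sum_distrib_left exp_sum prod_ennreal)
    also have "\<dots> = (\<Prod>i<k. \<integral>\<^sup>+w. ennreal (exp (\<theta> * w i)) \<partial>\<Omega>)"
    proof (rule iid.indep_vars_nn_integral)
      show "iid.indep_vars (\<lambda>_. borel) (\<lambda>i w. ennreal (exp (\<theta> * w i))) {..<k}"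
        by (rule iid.indep_vars_compose2[where M' = "\<lambda>_. borel"], rule iid.indep_vars_subset[OF iid_indep]) auto
    qed auto
    also have "\<dots> = ennreal c ^ k"
      using assms nn_integral_component[of "\<lambda>x. ennreal (exp (\<theta> * x))"] by simp
    finally show ?thesis .
  qed
  then show ?thesis using poisson_sum[OF assms(2)] by (subst nn_integral_cpois) auto
qed

text \<open>Conditioning on the number of jumps gives the Poisson generating function at
  \<open>char Q t\<close>.\<close>

lemma char_cpois: "char (cpois r Q) t = exp (of_real r * (char Q t - 1))"
proof -
  interpret pair_prob_space "measure_pmf (poisson_pmf r)" \<Omega> ..
  let ?p = "poisson_pmf r"
  have int: "integrable (measure_pmf ?p \<Otimes>\<^sub>M \<Omega>) (\<lambda>(k, w). iexp (t * (\<Sum>i<k. w i)))"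
  proof (rule P.integrable_const_bound[of _ 1])
    have "(\<lambda>z. iexp (t * (\<lambda>(k, w). \<Sum>i<k. w i) z)) \<in> borel_measurable (measure_pmf ?p \<Otimes>\<^sub>M \<Omega>)" by measurable
    then show "(\<lambda>(k, w). iexp (t * (\<Sum>i<k. w i))) \<in> borel_measurable (measure_pmf ?p \<Otimes>\<^sub>M \<Omega>)"
      by (simp add: case_prod_beta')
  qed (auto simp: norm_mult)
  have ch: "(CLINT w|\<Omega>. iexp (t * (\<Sum>i<k. w i))) = char Q t ^ k" for k :: nat
  proof -
    have "(CLINT w|\<Omega>. iexp (t * (\<Sum>i<k. w i))) = char (distr \<Omega> borel (\<lambda>w. \<Sum>i<k. w i)) t"
      unfolding char_def by (subst integral_distr) auto
    also have "\<dots> = (\<Prod>i<k. char (distr \<Omega> borel (\<lambda>w. w i)) t)"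
      by (rule iid.char_distr_sum, rule iid.indep_vars_subset[OF iid_indep]) auto
    finally show ?thesis by (simp add: distr_component)
  qed
  have norm: "norm (char Q t) \<le> 1"
  proof -
    have "real_distribution Q" by unfold_locales (auto simp: sets_eq_imp_space_eq[OF sets_Q])
    then show ?thesis by (rule real_distribution.cmod_char_le_1)
  qed
  have "char (cpois r Q) t = (CLINT z|measure_pmf ?p \<Otimes>\<^sub>M \<Omega>. (\<lambda>(k, w). iexp (t * (\<Sum>i<k. w i))) z)"
    unfolding char_def cpois_def by (subst integral_distr) (auto simp: case_prod_beta')
  also have "\<dots> = (CLINT k|measure_pmf ?p. CLINT w|\<Omega>. iexp (t * (\<Sum>i<k. w i)))"
    by (subst integral_fst'[symmetric, OF int]) simp
  also have "\<dots> = (CLINT k|measure_pmf ?p. char Q t ^ k)" by (simp only: ch)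
  also have "\<dots> = (CLINT k|count_space UNIV. pmf ?p k *\<^sub>R char Q t ^ k)"
    unfolding measure_pmf_eq_density by (subst integral_density) auto
  also have "\<dots> = (\<Sum>k. pmf ?p k *\<^sub>R char Q t ^ k)"
  proof (rule integral_count_space_nat)
    have "integrable (measure_pmf ?p) (\<lambda>k. char Q t ^ k)"
      by (rule measure_pmf.integrable_const_bound[of _ 1]) (auto simp: norm_power power_le_one norm)
    then show "integrable (count_space UNIV) (\<lambda>k. pmf ?p k *\<^sub>R char Q t ^ k)"
      unfolding measure_pmf_eq_density by (subst (asm) integrable_density) auto
  qed
  also have "\<dots> = exp (of_real r * (char Q t - 1))"
  proof -
    have "(\<lambda>k. (of_real r * char Q t) ^ k /\<^sub>R fact k) sums exp (of_real r * char Q t)" by (rule exp_converges)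
    from sums_mult[OF this, of "of_real (exp (- r))"]
    have "(\<lambda>k. pmf ?p k *\<^sub>R char Q t ^ k) sums (of_real (exp (- r)) * exp (of_real r * char Q t))"
      using r_pos by (simp add: power_mult_distrib divide_inverse scaleR_conv_of_real mult_ac)
    also have "of_real (exp (- r)) * exp (of_real r * char Q t) = exp (of_real r * (char Q t - 1))"
      by (simp add: exp_of_real[symmetric] exp_add[symmetric] algebra_simps)
    finally show ?thesis by (rule sums_unique[symmetric])
  qed
  finally show ?thesis .
qed

text \<open>Crude but sufficient: every summand costs a factor \<open>2 * c\<close>, and Poisson weights
  have all exponential moments.\<close>
lemma nn_integral_cpois_quasi_subadditive:
  assumes [measurable]: "H \<in> borel_measurable borel"
    and H0: "H 0 = 0" and H: "\<And>x y. H (x + y) \<le> ennreal c * (H x + H y)" and c: "1 \<le> c"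
    and m: "(\<integral>\<^sup>+x. H x \<partial>Q) < \<infinity>"
  shows "(\<integral>\<^sup>+x. H x \<partial>cpois r Q) < \<infinity>"
proof -
  let ?m = "\<integral>\<^sup>+x. H x \<partial>Q"
  have e: "(\<integral>\<^sup>+w. H (\<Sum>i<k. w i) \<partial>\<Omega>) \<le> ennreal (2 * c) ^ k * ?m" for k :: nat
  proof (induction k)
    case (Suc k)
    have "(\<integral>\<^sup>+w. H (\<Sum>i<Suc k. w i) \<partial>\<Omega>) \<le> (\<integral>\<^sup>+w. ennreal c * (H (\<Sum>i<k. w i) + H (w k)) \<partial>\<Omega>)"
      by (intro nn_integral_mono) (simp add: H)
    also have "\<dots> = ennreal c * ((\<integral>\<^sup>+w. H (\<Sum>i<k. w i) \<partial>\<Omega>) + ?m)"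
      by (subst nn_integral_cmult, measurable, subst nn_integral_add) (auto simp: nn_integral_component)
    also have "\<dots> \<le> ennreal c * (ennreal (2 * c) ^ k * ?m + ennreal (2 * c) ^ k * ?m)"
    proof (intro mult_left_mono add_mono Suc)
      have "1 \<le> ennreal (2 * c) ^ k" using c by (intro one_le_power) (simp add: ennreal_leI[of 1, simplified])
      then show "?m \<le> ennreal (2 * c) ^ k * ?m" using mult_right_mono[of 1 _ ?m] by fastforce
    qed auto
    also have "\<dots> = ennreal (2 * c) ^ Suc k * ?m"
      using c by (simp add: mult_2[symmetric] ennreal_mult mult_ac)
    finally show ?case .
  qed (simp add: H0)
  have "(\<integral>\<^sup>+x. H x \<partial>cpois r Q) \<le> (\<Sum>k. ennreal (pmf (poisson_pmf r) k) * (ennreal (2 * c) ^ k * ?m))"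
    by (subst nn_integral_cpois) (auto intro!: suminf_le mult_left_mono e)
  also have "\<dots> = (\<Sum>k. ?m * (ennreal (pmf (poisson_pmf r) k) * ennreal (2 * c) ^ k))" by (simp only: mult_ac)
  also have "\<dots> = ?m * ennreal (exp (r * (2 * c - 1)))"
    using c by (simp only: ennreal_suminf_cmult poisson_sum)
  also have "\<dots> < \<infinity>" using m by (simp add: ennreal_mult_less_top)
  finally show ?thesis .
qed

text \<open>Only the outcome of exactly one jump is kept; its probability is
  \<open>r * exp (- r)\<close>.\<close>

lemma nn_integral_cpois_ge:
  assumes [measurable]: "f \<in> borel_measurable borel"
  shows "ennreal (r * exp (- r)) * (\<integral>\<^sup>+x. f x \<partial>Q) \<le> (\<integral>\<^sup>+x. f x \<partial>cpois r Q)"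
proof -
  let ?g = "\<lambda>k. ennreal (pmf (poisson_pmf r) k) * (\<integral>\<^sup>+w. f (\<Sum>i<k. w i) \<partial>\<Omega>)"
  have "ennreal (r * exp (- r)) * (\<integral>\<^sup>+x. f x \<partial>Q) = ?g 1"
    using r_pos by (simp add: nn_integral_component)
  also have "\<dots> \<le> (\<Sum>k. ?g k)"
    using sum_le_suminf[of ?g "{1}"] by simp
  finally show ?thesis by (subst nn_integral_cpois) auto
qed

end

text \<open>The null measure needs a dummy rate, hence the restriction to \<open>f 0 = 0\<close>.\<close>
lemma finite_measure_normalise:
  fixes L :: "real measure"
  assumes "finite_measure L" and [measurable_cong, simp]: "sets L = sets borel"
  obtains r Q where "compound_poisson Q r"
    "\<And>f :: real \<Rightarrow> ennreal. f \<in> borel_measurable borel \<Longrightarrow> f 0 = 0 \<Longrightarrow> (\<integral>\<^sup>+x. f x \<partial>L) = ennreal r * (\<integral>\<^sup>+x. f x \<partial>Q)"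
    "\<And>f :: real \<Rightarrow> complex. f \<in> borel_measurable borel \<Longrightarrow> f 0 = 0 \<Longrightarrow> (\<integral>x. f x \<partial>L) = of_real r * (\<integral>x. f x \<partial>Q)"
    "\<And>f :: real \<Rightarrow> real. integrable L f \<Longrightarrow> f 0 = 0 \<Longrightarrow> integrable Q f \<and> (\<integral>x. f x \<partial>L) = r * (\<integral>x. f x \<partial>Q)"
proof -
  interpret L: finite_measure L by fact
  have [simp]: "space L = UNIV" using sets_eq_imp_space_eq[of L borel] by simp
  show ?thesis
  proof (cases "measure L UNIV = 0")
    case True
    then have "emeasure L UNIV = 0" by (simp add: L.emeasure_eq_measure)
    then have ae: "AE x in L. f x = 0" for f :: "real \<Rightarrow> 'c::zero" by (intro AE_I[of _ _ UNIV]) auto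
    show ?thesis
    proof (rule that[of "return borel 0" 1])
      show "compound_poisson (return borel 0) 1"
        by (auto simp: compound_poisson_def compound_poisson_axioms_def prob_space_return)
      show "(\<integral>\<^sup>+x. f x \<partial>L) = ennreal 1 * (\<integral>\<^sup>+x. f x \<partial>return borel 0)"
        if "f \<in> borel_measurable borel" "f 0 = 0" for f :: "real \<Rightarrow> ennreal"
        using that ae[of f] by (subst nn_integral_cong_AE[of _ "\<lambda>_. 0"]) (auto simp: nn_integral_return)
      show "(\<integral>x. f x \<partial>L) = of_real 1 * (\<integral>x. f x \<partial>return borel 0)"
        if "f \<in> borel_measurable borel" "f 0 = 0" for f :: "real \<Rightarrow> complex"
        using that ae[of f] by (subst integral_cong_AE[of _ _ "\<lambda>_. 0"]) (auto simp: integral_return)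
      show "integrable (return borel 0) f \<and> (\<integral>x. f x \<partial>L) = 1 * (\<integral>x. f x \<partial>return borel 0)"
        if "integrable L f" "f 0 = 0" for f :: "real \<Rightarrow> real"
      proof -
        have m: "f \<in> borel_measurable borel" using borel_measurable_integrable[OF that(1)] by simp
        then have "integrable (return borel 0) f" by (intro integrableI_bounded) (auto simp: nn_integral_return)
        then show ?thesis
          using that m ae[of f] by (subst integral_cong_AE[of _ _ "\<lambda>_. 0"]) (auto simp: integral_return)
      qed
    qed
  next
    case False
    define r where "r = measure L UNIV"
    have r: "0 < r" using False by (simp add: r_def zero_less_measure_iff)
    define Q where "Q = density L (\<lambda>_. ennreal (1 / r))"
    show ?thesis
    proof (rule that[of Q r])
      have "emeasure Q UNIV = 1"
        using r by (simp add: Q_def emeasure_density L.emeasure_eq_measure r_def[symmetric] ennreal_mult[symmetric])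
      then have "prob_space Q" by (intro prob_spaceI) (simp add: Q_def)
      then show "compound_poisson Q r"
        using r by (auto simp: compound_poisson_def compound_poisson_axioms_def Q_def)
      show "(\<integral>\<^sup>+x. f x \<partial>L) = ennreal r * (\<integral>\<^sup>+x. f x \<partial>Q)"
        if [measurable]: "f \<in> borel_measurable borel" for f :: "real \<Rightarrow> ennreal"
        using r unfolding Q_def
        by (simp add: nn_integral_density nn_integral_cmult mult.assoc[symmetric] ennreal_mult[symmetric])
      show "(\<integral>x. f x \<partial>L) = of_real r * (\<integral>x. f x \<partial>Q)"
        if [measurable]: "f \<in> borel_measurable borel" for f :: "real \<Rightarrow> complex"
        using r unfolding Q_def by (simp add: integral_density scaleR_conv_of_real)
      show "integrable Q f \<and> (\<integral>x. f x \<partial>L) = r * (\<integral>x. f x \<partial>Q)"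
        if "integrable L f" for f :: "real \<Rightarrow> real"
        using r that borel_measurable_integrable[OF that] unfolding Q_def
        by (simp add: integral_density integrable_density)
    qed
  qed
qed

text \<open>Completing the square turns the tilted density into the normal density with mean
  \<open>\<theta>\<close>.\<close>

lemma exp_normal:
  "(\<integral>\<^sup>+x. ennreal (exp (\<theta> * x)) \<partial>std_normal_distribution) = ennreal (exp (\<theta>\<^sup>2 / 2))"
proof -
  have "(\<integral>\<^sup>+x. ennreal (exp (\<theta> * x)) \<partial>std_normal_distribution)
    = (\<integral>\<^sup>+x. ennreal (exp (\<theta>\<^sup>2 / 2)) * ennreal (normal_density \<theta> 1 x) \<partial>lborel)"
    by (subst nn_integral_density)
       (auto intro!: nn_integral_cong simp: ennreal_mult[symmetric] normal_density_def exp_add[symmetric]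
          power2_eq_square algebra_simps add_divide_distrib diff_divide_distrib)
  also have "\<dots> = ennreal (exp (\<theta>\<^sup>2 / 2)) * emeasure (density lborel (normal_density \<theta> 1)) UNIV"
    by (subst nn_integral_cmult) (auto simp: emeasure_density)
  also have "emeasure (density lborel (normal_density \<theta> 1)) UNIV = 1"
    using prob_space.emeasure_space_1[OF prob_space_normal_density[of 1 \<theta>]] by simp
  finally show ?thesis by simp
qed

section \<open>Gaussian plus compound Poisson approximation of the law of \<open>X\<close>\<close>

locale levy_khintchine_law = prob_space M for M :: "'a measure" +
  fixes X :: "'a \<Rightarrow> real" and \<gamma> \<sigma>2 :: real and Lm :: "real measure"
  assumes X_measurable [measurable]: "X \<in> borel_measurable M"
    and levy_measure: "levy_measure Lm" and \<sigma>2: "0 \<le> \<sigma>2"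
    and char_X: "\<And>u::real. (\<integral>\<omega>. exp (\<i> * of_real u * of_real (X \<omega>)) \<partial>M) = exp (lk_exponent \<gamma> \<sigma>2 Lm (\<i> * of_real u))"
begin

lemma sets_Lm [measurable_cong, simp]: "sets Lm = sets borel"
  using levy_measure by (simp add: levy_measure_def)

lemma space_Lm [simp]: "space Lm = UNIV"
  using sets_eq_imp_space_eq[OF sets_Lm] by simp

lemma Lm_moment: "integrable Lm (\<lambda>z. min 1 (z\<^sup>2))"
  using levy_measure by (intro integrableI_bounded) (auto simp: levy_measure_def)

text \<open>A density instead of a restricted space keeps the underlying space equal to the whole
  line, so the normalisation to a compound Poisson law applies directly.\<close>

definition part :: "real set \<Rightarrow> real measure" where "part B = density Lm (indicator B)"

lemma sets_part [measurable_cong, simp]: "sets (part A) = sets borel"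
  and space_part [simp]: "space (part A) = UNIV"
  by (auto simp: part_def)

text \<open>Away from 0 the indicator is dominated by a multiple of \<open>min 1 (z ^ 2)\<close>,
  which is integrable.\<close>

lemma finite_part:
  assumes [measurable]: "A \<in> sets borel" and \<delta>: "0 < \<delta>" "\<And>z. z \<in> A \<Longrightarrow> \<delta> < \<bar>z\<bar>"
  shows "finite_measure (part A)"
proof
  let ?K = "max 1 (1 / \<delta>\<^sup>2)"
  have "emeasure (part A) UNIV = (\<integral>\<^sup>+z. indicator A z \<partial>Lm)"
    by (simp add: part_def emeasure_density)
  also have "\<dots> \<le> (\<integral>\<^sup>+z. ennreal (?K * min 1 (z\<^sup>2)) \<partial>Lm)"
  proof (intro nn_integral_mono)
    fix z
    show "indicator A z \<le> ennreal (?K * min 1 (z\<^sup>2))"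
    proof (cases "z \<in> A")
      case True
      then have "\<delta>\<^sup>2 \<le> \<bar>z\<bar>\<^sup>2" using \<delta> by (intro power_mono) (auto intro: less_imp_le)
      then have "1 \<le> 1 / \<delta>\<^sup>2 * z\<^sup>2" using \<delta> by (simp add: field_simps)
      have "1 \<le> ?K * min 1 (z\<^sup>2)"
      proof (cases "1 \<le> z\<^sup>2")
        case False
        have "1 / \<delta>\<^sup>2 * z\<^sup>2 \<le> ?K * z\<^sup>2" by (intro mult_right_mono) auto
        with \<open>1 \<le> 1 / \<delta>\<^sup>2 * z\<^sup>2\<close> False show ?thesis by (simp add: min_def)
      qed auto
      from ennreal_leI[OF this] show ?thesis by (simp only: indicator_simps(1)[OF True] ennreal_1)
    qed simp
  qed
  also have "\<dots> < \<infinity>"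
    using integrable_mult_right[OF Lm_moment, of ?K] by (subst nn_integral_eq_integral) (auto intro!: AE_I2)
  finally show "emeasure (part A) (space (part A)) \<noteq> \<infinity>" by simp
qed

lemma AE_partI:
  assumes [measurable]: "B \<in> sets borel" and "\<And>z. z \<in> B \<Longrightarrow> R z"
  shows "AE z in part B. R z"
proof -
  have "AE z in Lm. 0 < (indicator B z :: ennreal) \<longrightarrow> R z"
    using assms(2) by (intro AE_I2) (auto simp: indicator_def split: if_splits)
  then show ?thesis unfolding part_def by (subst AE_density) auto
qed

abbreviation "small n \<equiv> part {z. inverse (real (Suc n)) < \<bar>z\<bar> \<and> \<bar>z\<bar> \<le> 1}"
abbreviation "large \<equiv> part {z. 1 < \<bar>z\<bar>}"

lemma finite_small: "finite_measure (small n)"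
  by (rule finite_part[of _ "inverse (real (Suc n))"]) auto

lemma finite_large: "finite_measure large"
  by (rule finite_part[of _ 1]) auto

lemma small_integrable:
  fixes f :: "real \<Rightarrow> 'c::{banach, second_countable_topology}"
  assumes [measurable]: "f \<in> borel_measurable borel" and bd: "\<And>z. \<bar>z\<bar> \<le> 1 \<Longrightarrow> norm (f z) \<le> B"
  shows "integrable (small n) f"
proof -
  interpret finite_measure "small n" by (rule finite_small)
  show ?thesis by (rule integrable_const_bound[of _ B]) (auto intro!: AE_partI simp: bd)
qed

lemma small_square: "(\<integral>z. z\<^sup>2 \<partial>small n) \<le> (\<integral>z. min 1 (z\<^sup>2) \<partial>Lm)"
proof -
  let ?A = "{z. inverse (real (Suc n)) < \<bar>z\<bar> \<and> \<bar>z\<bar> \<le> 1}"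
  have eq: "(\<integral>z. z\<^sup>2 \<partial>small n) = (\<integral>z. indicator ?A z * z\<^sup>2 \<partial>Lm)"
    unfolding part_def ennreal_indicator[symmetric] by (subst integral_density) auto
  show ?thesis unfolding eq
  proof (rule integral_mono')
    show "indicator ?A z * z\<^sup>2 \<le> min 1 (z\<^sup>2)" for z
      by (auto simp: indicator_def abs_square_le_1)
  qed (auto simp: Lm_moment)
qed

text \<open>Carries the compensator of the jumps of modulus at most 1. It may diverge as
  \<open>n\<close> grows, so it is never estimated apart from those jumps.\<close>

definition "drift n = \<gamma> - (\<integral>z. z \<partial>small n)"

text \<open>The law of \<open>X\<close> is the weak limit of Gaussian plus compound Poisson laws in which only
  the compensated small jumps vary.\<close>
lemma approximants:
  obtains r Q S C where "compound_poisson Q r"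
    "\<And>f :: real \<Rightarrow> ennreal. f \<in> borel_measurable borel \<Longrightarrow> f 0 = 0 \<Longrightarrow> (\<integral>\<^sup>+x. f x \<partial>large) = ennreal r * (\<integral>\<^sup>+x. f x \<partial>Q)"
    "\<And>n. prob_space (S n)" "\<And>n. sets (S n) = sets borel"
    "\<And>n::nat. (\<integral>\<^sup>+x. ennreal (exp x) \<partial>S n) \<le> ennreal C" "\<And>n. (\<integral>\<^sup>+x. ennreal (exp (- x)) \<partial>S n) \<le> ennreal C"
    "weak_conv_m (\<lambda>n. S n \<star> cpois r Q) (distr M borel X)" "0 \<le> C"
proof -
  obtain r Q where rQ: "compound_poisson Q r"
    "\<And>f :: real \<Rightarrow> ennreal. f \<in> borel_measurable borel \<Longrightarrow> f 0 = 0 \<Longrightarrow> (\<integral>\<^sup>+x. f x \<partial>large) = ennreal r * (\<integral>\<^sup>+x. f x \<partial>Q)"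
    "\<And>f :: real \<Rightarrow> complex. f \<in> borel_measurable borel \<Longrightarrow> f 0 = 0 \<Longrightarrow> (\<integral>x. f x \<partial>large) = of_real r * (\<integral>x. f x \<partial>Q)"
    by (rule finite_measure_normalise[OF finite_large sets_part]) blast
  have "\<forall>n. \<exists>r Q. compound_poisson Q r \<and>
    (\<forall>f :: real \<Rightarrow> complex. f \<in> borel_measurable borel \<longrightarrow> f 0 = 0 \<longrightarrow> (\<integral>x. f x \<partial>small n) = of_real r * (\<integral>x. f x \<partial>Q)) \<and>
    (\<forall>f :: real \<Rightarrow> real. integrable (small n) f \<longrightarrow> f 0 = 0 \<longrightarrow> integrable Q f \<and> (\<integral>x. f x \<partial>small n) = r * (\<integral>x. f x \<partial>Q))"
  proof
    fix n
    show "\<exists>r Q. compound_poisson Q r \<and>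
    (\<forall>f :: real \<Rightarrow> complex. f \<in> borel_measurable borel \<longrightarrow> f 0 = 0 \<longrightarrow> (\<integral>x. f x \<partial>small n) = of_real r * (\<integral>x. f x \<partial>Q)) \<and>
    (\<forall>f :: real \<Rightarrow> real. integrable (small n) f \<longrightarrow> f 0 = 0 \<longrightarrow> integrable Q f \<and> (\<integral>x. f x \<partial>small n) = r * (\<integral>x. f x \<partial>Q))"
    proof (rule finite_measure_normalise[OF finite_small[of n] sets_part])
      fix r Q
      assume "compound_poisson Q r"
        "\<And>f :: real \<Rightarrow> complex. f \<in> borel_measurable borel \<Longrightarrow> f 0 = 0 \<Longrightarrow> (\<integral>x. f x \<partial>small n) = of_real r * (\<integral>x. f x \<partial>Q)"
        "\<And>f :: real \<Rightarrow> real. integrable (small n) f \<Longrightarrow> f 0 = 0 \<Longrightarrow> integrable Q f \<and> (\<integral>x. f x \<partial>small n) = r * (\<integral>x. f x \<partial>Q)"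
      then show ?thesis by (intro exI[of _ r] exI[of _ Q]) auto
    qed
  qed
  from choice[OF this] obtain rs where "\<forall>n. \<exists>Q. compound_poisson Q (rs n) \<and>
    (\<forall>f :: real \<Rightarrow> complex. f \<in> borel_measurable borel \<longrightarrow> f 0 = 0 \<longrightarrow> (\<integral>x. f x \<partial>small n) = of_real (rs n) * (\<integral>x. f x \<partial>Q)) \<and>
    (\<forall>f :: real \<Rightarrow> real. integrable (small n) f \<longrightarrow> f 0 = 0 \<longrightarrow> integrable Q f \<and> (\<integral>x. f x \<partial>small n) = rs n * (\<integral>x. f x \<partial>Q))" ..
  from choice[OF this] obtain Qs where s0: "\<forall>n. compound_poisson (Qs n) (rs n) \<and>
    (\<forall>f :: real \<Rightarrow> complex. f \<in> borel_measurable borel \<longrightarrow> f 0 = 0 \<longrightarrow> (\<integral>x. f x \<partial>small n) = of_real (rs n) * (\<integral>x. f x \<partial>Qs n)) \<and>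
    (\<forall>f :: real \<Rightarrow> real. integrable (small n) f \<longrightarrow> f 0 = 0 \<longrightarrow> integrable (Qs n) f \<and> (\<integral>x. f x \<partial>small n) = rs n * (\<integral>x. f x \<partial>Qs n))" ..
  have s: "compound_poisson (Qs n) (rs n)"
    "f \<in> borel_measurable borel \<Longrightarrow> f 0 = 0 \<Longrightarrow> (\<integral>x. f x \<partial>small n) = of_real (rs n) * (\<integral>x. f x \<partial>Qs n)"
    "integrable (small n) g \<Longrightarrow> g 0 = 0 \<Longrightarrow> integrable (Qs n) g \<and> (\<integral>x. g x \<partial>small n) = rs n * (\<integral>x. g x \<partial>Qs n)"
    for n and f :: "real \<Rightarrow> complex" and g :: "real \<Rightarrow> real" using s0 by simp_all
  interpret L: compound_poisson Q r by fact
  interpret S: compound_poisson "Qs n" "rs n" for n by (rule s)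
  interpret N: real_distribution std_normal_distribution by (rule real_dist_normal_dist)
  interpret Lf: finite_measure large by (rule finite_large)
  interpret Sf: finite_measure "small n" for n by (rule finite_small)
  \<comment> \<open>Gaussian factor with mean \<open>drift n\<close> and variance
    \<open>\<sigma>2\<close>; convolved with the small jumps it forms \<open>S n\<close>.\<close>
  define G where "G n = distr std_normal_distribution borel (\<lambda>x. drift n + sqrt \<sigma>2 * x)" for n
  have G: "prob_space (G n)" "sets (G n) = sets borel" for n
    unfolding G_def by (auto intro: N.prob_space_distr)
  define S where "S n = (G n \<star> cpois (rs n) (Qs n))" for n
  have S: "prob_space (S n)" "sets (S n) = sets borel" for n
    unfolding S_def using G S.prob_space_cpois by (auto intro!: prob_space_convolution)
  \<comment> \<open>Uniform in \<open>n\<close> because the compensated integrand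
    \<open>exp (\<theta> * z) - 1 - \<theta> * z\<close> is at most \<open>z ^ 2\<close> on the
    small jumps when \<open>\<theta>\<close> is 1 or -1.\<close>
  define C where "C = exp (\<bar>\<gamma>\<bar> + \<sigma>2 / 2 + (\<integral>z. min 1 (z\<^sup>2) \<partial>Lm))"
  have mgf: "(\<integral>\<^sup>+x. ennreal (exp (\<theta> * x)) \<partial>S n) \<le> ennreal C" if \<theta>: "\<theta> = 1 \<or> \<theta> = -1" for \<theta> n
  proof -
    have i1: "integrable (small n) (\<lambda>z. exp (\<theta> * z) - 1)"
    proof (rule small_integrable[of _ "exp 1 + 1"])
      fix z :: real
      assume "\<bar>z\<bar> \<le> 1"
      then have "exp (\<theta> * z) \<le> exp 1" using \<theta> by auto
      with exp_gt_zero[of "\<theta> * z"] show "norm (exp (\<theta> * z) - 1) \<le> exp 1 + 1"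
        unfolding real_norm_def abs_le_iff by linarith
    qed simp
    have i2: "integrable (small n) (\<lambda>z. z)" "integrable (small n) (\<lambda>z. z\<^sup>2)"
      by (rule small_integrable[of _ 1]; simp add: abs_square_le_1)+
    from s(3)[OF i1] have q: "integrable (Qs n) (\<lambda>z. exp (\<theta> * z) - 1)"
      "(\<integral>z. exp (\<theta> * z) - 1 \<partial>small n) = rs n * (\<integral>z. exp (\<theta> * z) - 1 \<partial>Qs n)" by auto
    have "integrable (Qs n) (\<lambda>z. (exp (\<theta> * z) - 1) + 1)" using q(1) by (rule Bochner_Integration.integrable_add) simp
    then have q2: "integrable (Qs n) (\<lambda>z. exp (\<theta> * z))" by simp
    define c where "c = (\<integral>z. exp (\<theta> * z) \<partial>Qs n)"
    have "c - 1 = (\<integral>z. exp (\<theta> * z) - 1 \<partial>Qs n)" using q2 by (simp add: c_def S.prob_space)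
    with q have c: "rs n * (c - 1) = (\<integral>z. exp (\<theta> * z) - 1 \<partial>small n)" by simp
    have c0: "0 \<le> c" unfolding c_def by (intro integral_nonneg_AE) auto
    have "(\<integral>\<^sup>+x. ennreal (exp (\<theta> * x)) \<partial>S n)
      = (\<integral>\<^sup>+x. \<integral>\<^sup>+y. ennreal (exp (\<theta> * x)) * ennreal (exp (\<theta> * y)) \<partial>cpois (rs n) (Qs n) \<partial>G n)"
      unfolding S_def using G S.prob_space_cpois
      by (subst nn_integral_convolution)
         (auto simp: prob_space_def distrib_left exp_add ennreal_mult[symmetric])
    also have "\<dots> = (\<integral>\<^sup>+x. ennreal (exp (\<theta> * x)) \<partial>G n) * (\<integral>\<^sup>+y. ennreal (exp (\<theta> * y)) \<partial>cpois (rs n) (Qs n))"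
      using G by (subst nn_integral_cmult; (subst nn_integral_multc)?) (auto cong: measurable_cong_sets)
    also have "(\<integral>\<^sup>+y. ennreal (exp (\<theta> * y)) \<partial>cpois (rs n) (Qs n)) = ennreal (exp (rs n * (c - 1)))"
      by (rule S.exp_cpois) (auto simp: c_def nn_integral_eq_integral[OF q2] c0[unfolded c_def])
    also have "(\<integral>\<^sup>+x. ennreal (exp (\<theta> * x)) \<partial>G n)
      = (\<integral>\<^sup>+x. ennreal (exp (\<theta> * drift n)) * ennreal (exp ((\<theta> * sqrt \<sigma>2) * x)) \<partial>std_normal_distribution)"
      unfolding G_def
      by (subst nn_integral_distr) (auto simp: distrib_left exp_add ennreal_mult[symmetric] mult_ac)
    also have "\<dots> = ennreal (exp (\<theta> * drift n)) * ennreal (exp ((\<theta> * sqrt \<sigma>2)\<^sup>2 / 2))"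
      by (subst nn_integral_cmult) (auto simp: exp_normal)
    also have "\<dots> * ennreal (exp (rs n * (c - 1))) = ennreal (exp (\<theta> * drift n + (\<theta> * sqrt \<sigma>2)\<^sup>2 / 2 + rs n * (c - 1)))"
      by (simp add: ennreal_mult[symmetric] exp_add[symmetric])
    also have "\<dots> \<le> ennreal C"
    proof -
      have "\<theta> * drift n + rs n * (c - 1) = \<theta> * \<gamma> + (\<integral>z. (exp (\<theta> * z) - 1) - \<theta> * z \<partial>small n)"
        unfolding c drift_def using i1 i2
        by (subst Bochner_Integration.integral_diff) (simp_all add: right_diff_distrib)
      also have "\<dots> \<le> \<bar>\<gamma>\<bar> + (\<integral>z. z\<^sup>2 \<partial>small n)"
      proof (intro add_mono integral_mono_AE)
        show "AE z in small n. exp (\<theta> * z) - 1 - \<theta> * z \<le> z\<^sup>2"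
        proof -
          have "exp (\<theta> * z) - 1 - \<theta> * z \<le> z\<^sup>2" if "\<bar>z\<bar> \<le> 1" for z
            using exp_le_quadratic[of "\<theta> * z"] \<theta> that by auto
          then show ?thesis by (intro AE_partI) auto
        qed
      qed (use \<theta> i1 i2 in auto)
      also have "\<dots> \<le> \<bar>\<gamma>\<bar> + (\<integral>z. min 1 (z\<^sup>2) \<partial>Lm)" using small_square by simp
      finally show ?thesis unfolding C_def
        using \<theta> \<sigma>2 by (intro ennreal_leI) (auto simp: power_mult_distrib)
    qed
    finally show ?thesis .
  qed
  have "weak_conv_m (\<lambda>n. S n \<star> cpois r Q) (distr M borel X)"
  proof (rule levy_continuity)
    show "real_distribution (S n \<star> cpois r Q)" for n
    proof -
      have "prob_space (S n \<star> cpois r Q)" using S L.prob_space_cpois by (intro prob_space_convolution) auto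
      then show ?thesis by (simp add: real_distribution_def real_distribution_axioms_def)
    qed
    show "real_distribution (distr M borel X)"
      by (simp add: real_distribution_def real_distribution_axioms_def prob_space_distr)
    fix t :: real
    \<comment> \<open>Integrand of the Levy-Khintchine formula. It vanishes to second order at 0,
      hence the domination by a multiple of \<open>min 1 (z ^ 2)\<close>.\<close>
    define h where "h z = iexp (t * z) - 1 - \<i> * of_real t * of_real z * of_real (indicator {-1..1} z)" for z
    have [measurable]: "h \<in> borel_measurable borel" unfolding h_def by measurable
    have h_bd: "norm (h z) \<le> max 2 (t\<^sup>2 / 2) * min 1 (z\<^sup>2)" for z
    proof (cases "\<bar>z\<bar> \<le> 1")
      case True
      have "norm (h z) \<le> \<bar>t * z\<bar>\<^sup>2 / 2"
        using iexp_approx1[of "t * z" 1] True by (simp add: h_def numeral_2_eq_2 indicator_def abs_le_iff algebra_simps)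
      also have "\<dots> = t\<^sup>2 / 2 * z\<^sup>2" by (simp add: power_mult_distrib)
      also have "\<dots> \<le> max 2 (t\<^sup>2 / 2) * z\<^sup>2" by (intro mult_right_mono) auto
      also have "z\<^sup>2 = min 1 (z\<^sup>2)" using True abs_square_le_1[of z] by (simp add: min_absorb2)
      finally show ?thesis .
    next
      case False
      then have "h z = iexp (t * z) - 1" by (auto simp: h_def indicator_def)
      then have "norm (h z) \<le> norm (iexp (t * z)) + norm (1::complex)"
        by (simp only: norm_triangle_ineq4)
      also have "\<dots> \<le> max 2 (t\<^sup>2 / 2) * 1" by simp
      also have "1 = min 1 (z\<^sup>2)" using False abs_square_le_1[of z] by (simp add: min_def)
      finally show ?thesis .
    qed
    have h_int: "integrable Lm h"
      by (rule Bochner_Integration.integrable_bound[OF integrable_mult_right[OF Lm_moment, of "max 2 (t\<^sup>2 / 2)"]])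
         (auto intro!: order_trans[OF h_bd])
    have char_U: "char (S n \<star> cpois r Q) t =
        exp (\<i> * of_real t * of_real \<gamma> - of_real (\<sigma>2 * t\<^sup>2 / 2) + (\<integral>z. indicator {z. inverse (real (Suc n)) < \<bar>z\<bar>} z *\<^sub>R h z \<partial>Lm))" for n
    proof -
      have cG: "char (G n) t = exp (\<i> * of_real (t * drift n) - of_real (\<sigma>2 * t\<^sup>2 / 2))"
      proof -
        have "char (G n) t = (CLINT x|std_normal_distribution. iexp (t * drift n) * iexp ((t * sqrt \<sigma>2) * x))"
          unfolding G_def char_def by (subst integral_distr) (auto simp: distrib_left exp_add mult_ac)
        also have "\<dots> = iexp (t * drift n) * char std_normal_distribution (t * sqrt \<sigma>2)"
          by (simp add: char_def)
        also have "char std_normal_distribution (t * sqrt \<sigma>2) = exp (- of_real (\<sigma>2 * t\<^sup>2 / 2))"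
        proof -
          have sq: "(t * sqrt \<sigma>2)\<^sup>2 = \<sigma>2 * t\<^sup>2" using \<sigma>2 by (simp add: power_mult_distrib mult.commute)
          have "char std_normal_distribution (t * sqrt \<sigma>2) = of_real (exp (- (\<sigma>2 * t\<^sup>2) / 2))"
            by (simp only: char_std_normal_distribution sq)
          then show ?thesis by (simp add: exp_of_real[symmetric])
        qed
        also have "iexp (t * drift n) * exp (- of_real (\<sigma>2 * t\<^sup>2 / 2)) = exp (\<i> * of_real (t * drift n) - of_real (\<sigma>2 * t\<^sup>2 / 2))"
          by (simp only: exp_add[symmetric] diff_conv_add_uminus)
        finally show ?thesis .
      qed
      have ch: "of_real r' * (char Q' t - 1) = (\<integral>z. iexp (t * z) - 1 \<partial>L)"
        if "compound_poisson Q' r'" "(\<integral>z. iexp (t * z) - 1 \<partial>L) = of_real r' * (\<integral>z. iexp (t * z) - 1 \<partial>Q')" for r' Q' L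
      proof -
        interpret Q': compound_poisson Q' r' by fact
        have "integrable Q' (\<lambda>z. iexp (t * z))" by (rule Q'.integrable_iexp) auto
        then show ?thesis using that(2) by (simp add: char_def Q'.prob_space)
      qed
      have c1: "of_real (rs n) * (char (Qs n) t - 1) = (\<integral>z. iexp (t * z) - 1 \<partial>small n)"
        by (rule ch[OF s(1)]) (rule s(2), auto)
      have c2: "of_real r * (char Q t - 1) = (\<integral>z. iexp (t * z) - 1 \<partial>large)"
        by (rule ch[OF rQ(1)]) (rule rQ(3), auto)
      let ?A = "{z. inverse (real (Suc n)) < \<bar>z\<bar> \<and> \<bar>z\<bar> \<le> 1}" and ?B = "{z::real. 1 < \<bar>z\<bar>}"
      have i1: "integrable (small n) (\<lambda>z. iexp (t * z) - 1)"
        by (rule small_integrable[of _ 2]) (auto intro!: order_trans[OF norm_triangle_ineq4])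
      have i2: "integrable (small n) (\<lambda>z. z)"
        by (rule small_integrable[of _ 1]) auto
      have "(\<integral>z. iexp (t * z) - 1 \<partial>small n) - \<i> * of_real t * of_real (\<integral>z. z \<partial>small n)
          = (\<integral>z. (iexp (t * z) - 1) - \<i> * of_real t * of_real z \<partial>small n)"
        using i1 i2 by simp
      also have "\<dots> = (\<integral>z. h z \<partial>small n)"
        by (intro integral_cong_AE) (auto intro!: AE_partI simp: h_def indicator_def abs_le_iff)
      also have "\<dots> = (\<integral>z. indicator ?A z *\<^sub>R h z \<partial>Lm)"
        unfolding part_def ennreal_indicator[symmetric] by (subst integral_density) auto
      finally have e1: "(\<integral>z. iexp (t * z) - 1 \<partial>small n) - \<i> * of_real t * of_real (\<integral>z. z \<partial>small n)
          = (\<integral>z. indicator ?A z *\<^sub>R h z \<partial>Lm)" .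
      have "(\<integral>z. iexp (t * z) - 1 \<partial>large) = (\<integral>z. h z \<partial>large)"
        by (intro integral_cong_AE) (auto intro!: AE_partI simp: h_def indicator_def abs_le_iff)
      also have "\<dots> = (\<integral>z. indicator ?B z *\<^sub>R h z \<partial>Lm)"
        unfolding part_def ennreal_indicator[symmetric] by (subst integral_density) auto
      finally have e2: "(\<integral>z. iexp (t * z) - 1 \<partial>large) = (\<integral>z. indicator ?B z *\<^sub>R h z \<partial>Lm)" .
      have "(\<integral>z. indicator ?A z *\<^sub>R h z \<partial>Lm) + (\<integral>z. indicator ?B z *\<^sub>R h z \<partial>Lm)
        = (\<integral>z. indicator ?A z *\<^sub>R h z + indicator ?B z *\<^sub>R h z \<partial>Lm)"
        using h_int by (intro Bochner_Integration.integral_add[symmetric] integrable_mult_indicator) auto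
      also have "\<dots> = (\<integral>z. indicator {z. inverse (real (Suc n)) < \<bar>z\<bar>} z *\<^sub>R h z \<partial>Lm)"
      proof (intro Bochner_Integration.integral_cong refl)
        fix z :: real
        have "inverse (real (Suc n)) \<le> 1" by (simp add: field_simps)
        then show "indicator ?A z *\<^sub>R h z + indicator ?B z *\<^sub>R h z = indicator {z. inverse (real (Suc n)) < \<bar>z\<bar>} z *\<^sub>R h z"
          by (auto simp: indicator_def)
      qed
      finally have e3: "(\<integral>z. indicator ?A z *\<^sub>R h z \<partial>Lm) + (\<integral>z. indicator ?B z *\<^sub>R h z \<partial>Lm)
        = (\<integral>z. indicator {z. inverse (real (Suc n)) < \<bar>z\<bar>} z *\<^sub>R h z \<partial>Lm)" .
      have "char (S n \<star> cpois r Q) t = char (G n) t * exp (\<integral>z. iexp (t * z) - 1 \<partial>small n) * exp (\<integral>z. iexp (t * z) - 1 \<partial>large)"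
        unfolding S_def using G S.prob_space_cpois L.prob_space_cpois
        by (subst char_convolution; (subst char_convolution)?)
           (auto intro!: prob_space_convolution simp: S.char_cpois L.char_cpois c1 c2)
      also have "\<dots> = exp (\<i> * of_real t * of_real \<gamma> - of_real (\<sigma>2 * t\<^sup>2 / 2) +
         (((\<integral>z. iexp (t * z) - 1 \<partial>small n) - \<i> * of_real t * of_real (\<integral>z. z \<partial>small n)) + (\<integral>z. iexp (t * z) - 1 \<partial>large)))"
        unfolding cG drift_def by (simp add: exp_add[symmetric] algebra_simps)
      finally show ?thesis unfolding e1 e2 e3 .
    qed
    have lim: "(\<lambda>n. \<integral>z. indicator {z. inverse (real (Suc n)) < \<bar>z\<bar>} z *\<^sub>R h z \<partial>Lm) \<longlonglongrightarrow> (\<integral>z. h z \<partial>Lm)"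
    proof (rule integral_dominated_convergence[where w = "\<lambda>z. norm (h z)"])
      show "AE z in Lm. (\<lambda>n. indicator {z. inverse (real (Suc n)) < \<bar>z\<bar>} z *\<^sub>R h z) \<longlonglongrightarrow> h z"
      proof (intro AE_I2 tendsto_eventually)
        fix z
        show "\<forall>\<^sub>F n in sequentially. indicator {z. inverse (real (Suc n)) < \<bar>z\<bar>} z *\<^sub>R h z = h z"
        proof (cases "z = 0")
          case True
          then show ?thesis by (simp add: h_def)
        next
          case False
          have "((\<lambda>n. inverse (real (Suc n))) \<longlongrightarrow> 0) sequentially" by (rule LIMSEQ_inverse_real_of_nat)
          then have "\<forall>\<^sub>F n in sequentially. inverse (real (Suc n)) < \<bar>z\<bar>"
            by (rule order_tendstoD) (use False in auto)
          then show ?thesis by eventually_elim auto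
        qed
      qed
    qed (use h_int in \<open>auto simp: indicator_def\<close>)
    have "(\<lambda>n. char (S n \<star> cpois r Q) t) \<longlonglongrightarrow>
       exp (\<i> * of_real t * of_real \<gamma> - of_real (\<sigma>2 * t\<^sup>2 / 2) + (\<integral>z. h z \<partial>Lm))"
      unfolding char_U by (intro tendsto_intros lim)
    also have "exp (\<i> * of_real t * of_real \<gamma> - of_real (\<sigma>2 * t\<^sup>2 / 2) + (\<integral>z. h z \<partial>Lm))
      = exp (lk_exponent \<gamma> \<sigma>2 Lm (\<i> * of_real t))"
      unfolding lk_exponent_def h_def by (simp add: power_mult_distrib mult_ac)
    also have "\<dots> = char (distr M borel X) t"
      unfolding char_X[symmetric] char_def by (subst integral_distr) (auto simp: mult_ac)
    finally show "(\<lambda>n. char (S n \<star> cpois r Q) t) \<longlonglongrightarrow> char (distr M borel X) t" .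
  qed
  moreover have "0 \<le> C" by (simp add: C_def)
  moreover have "(\<integral>\<^sup>+x. ennreal (exp x) \<partial>S n) \<le> ennreal C" "(\<integral>\<^sup>+x. ennreal (exp (- x)) \<partial>S n) \<le> ennreal C" for n
    using mgf[of 1 n] mgf[of "-1" n] by simp_all
  ultimately show ?thesis by (intro that[OF rQ(1,2) S]) auto
qed

end

section \<open>Transfer of the moment condition from the Levy measure to the law\<close>

context levy_khintchine_law
begin

text \<open>A Fatou property: weak convergence handles the bounded continuous functions
  \<open>min (f x) (real m)\<close>, and monotone convergence in \<open>m\<close> removes the
  cap.\<close>

lemma nn_integral_le_of_approx:
  fixes f :: "real \<Rightarrow> real"
  assumes conv: "weak_conv_m U (distr M borel X)" and U: "\<And>n. prob_space (U n)" "\<And>n. sets (U n) = sets borel"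
    and f: "\<And>x. isCont f x" "\<And>x. 0 \<le> f x" and le: "\<And>n. (\<integral>\<^sup>+x. ennreal (f x) \<partial>U n) \<le> K"
  shows "(\<integral>\<^sup>+\<omega>. ennreal (f (X \<omega>)) \<partial>M) \<le> K"
proof (cases "K = \<infinity>")
  case False
  have rd: "real_distribution (U n)" for n
    using U by (simp add: real_distribution_def real_distribution_axioms_def)
  have rX: "real_distribution (distr M borel X)"
    by (simp add: real_distribution_def real_distribution_axioms_def prob_space_distr)
  have [measurable]: "f \<in> borel_measurable borel"
    using f(1) by (intro borel_measurable_continuous_onI continuous_at_imp_continuous_on) auto
  have b: "(\<integral>\<^sup>+\<omega>. ennreal (min (f (X \<omega>)) (real m)) \<partial>M) \<le> K" for m :: nat
  proof -
    let ?g = "\<lambda>x. min (f x) (real m)"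
    have "(\<lambda>n. \<integral>x. ?g x \<partial>U n) \<longlonglongrightarrow> (\<integral>x. ?g x \<partial>distr M borel X)"
      by (rule weak_conv_imp_integral_bdd_continuous_conv[OF rd rX conv, of _ "real m"])
         (use f in \<open>auto intro!: continuous_intros\<close>)
    also have "(\<integral>x. ?g x \<partial>distr M borel X) = (\<integral>\<omega>. ?g (X \<omega>) \<partial>M)" by (subst integral_distr) auto
    finally have lim: "(\<lambda>n. \<integral>x. ?g x \<partial>U n) \<longlonglongrightarrow> (\<integral>\<omega>. ?g (X \<omega>) \<partial>M)" .
    have "(\<integral>x. ?g x \<partial>U n) \<le> enn2real K" for n
    proof -
      interpret U: prob_space "U n" by (rule U)
      have [measurable]: "f \<in> borel_measurable (U n)" using U(2) by (simp cong: measurable_cong_sets)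
      have int: "integrable (U n) ?g" using f(2) by (intro U.integrable_const_bound[of _ "real m"]) auto
      have "ennreal (\<integral>x. ?g x \<partial>U n) = (\<integral>\<^sup>+x. ennreal (?g x) \<partial>U n)"
        using f(2) by (intro nn_integral_eq_integral[symmetric] int) auto
      also have "\<dots> \<le> (\<integral>\<^sup>+x. ennreal (f x) \<partial>U n)" by (intro nn_integral_mono ennreal_leI) auto
      also have "\<dots> \<le> K" by (rule le)
      finally have "ennreal (\<integral>x. ?g x \<partial>U n) \<le> K" .
      then show ?thesis using False by (cases K) (auto simp: ennreal_le_iff)
    qed
    then have "(\<integral>\<omega>. ?g (X \<omega>) \<partial>M) \<le> enn2real K" by (intro LIMSEQ_le_const2[OF lim]) auto
    moreover have "(\<integral>\<^sup>+\<omega>. ennreal (?g (X \<omega>)) \<partial>M) = ennreal (\<integral>\<omega>. ?g (X \<omega>) \<partial>M)"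
      using f(2) by (intro nn_integral_eq_integral integrable_const_bound[of _ "real m"]) auto
    ultimately show ?thesis using False by (cases K) (auto intro: ennreal_leI)
  qed
  have "(\<lambda>m. \<integral>\<^sup>+\<omega>. ennreal (min (f (X \<omega>)) (real m)) \<partial>M) \<longlonglongrightarrow> (\<integral>\<^sup>+\<omega>. ennreal (f (X \<omega>)) \<partial>M)"
  proof (rule nn_integral_LIMSEQ)
    show "incseq (\<lambda>n z. ennreal (min (f (X z)) (real n)))"
      by (auto simp: incseq_def le_fun_def intro!: ennreal_leI)
    fix z
    have "\<forall>\<^sub>F n in sequentially. min (f (X z)) (real n) = f (X z)"
      using eventually_ge_at_top[of "nat \<lceil>f (X z)\<rceil>"] by eventually_elim (auto simp: min_def; linarith)
    then show "(\<lambda>n. ennreal (min (f (X z)) (real n))) \<longlonglongrightarrow> ennreal (f (X z))"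
      by (intro tendsto_ennrealI tendsto_eventually)
  qed auto
  then show ?thesis using b by (intro LIMSEQ_le_const2) auto
qed simp

text \<open>The approximating laws are \<open>S n\<close> convolved with a fixed compound Poisson
  law. The first factor has uniform exponential moments and \<open>h\<close> grows at most linearly;
  the second inherits the moment from the large jumps, since \<open>h ^ K\<close> is subadditive up
  to the factor \<open>2 ^ K\<close>. The shift \<open>c\<close> makes room for the constant in
  Ottaviani's inequality.\<close>

lemma moment_transfer:
  fixes h :: "real \<Rightarrow> real"
  assumes h: "\<And>x. isCont h x" "\<And>x. 0 \<le> h x" "\<And>x y. h (x + y) \<le> h x + h y" "\<And>x. h x \<le> max 0 x"
    and K: "1 \<le> K" and fin: "(\<integral>\<^sup>+z. ennreal (h z ^ K) \<partial>large) < \<infinity>"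
  shows "(\<integral>\<^sup>+\<omega>. ennreal (h (X \<omega> + c) ^ K) \<partial>M) < \<infinity>"
proof -
  have [measurable]: "h \<in> borel_measurable borel"
    using h(1) by (intro borel_measurable_continuous_onI continuous_at_imp_continuous_on) auto
  obtain r Q S C where a: "compound_poisson Q r"
    "\<And>f :: real \<Rightarrow> ennreal. f \<in> borel_measurable borel \<Longrightarrow> f 0 = 0 \<Longrightarrow> (\<integral>\<^sup>+x. f x \<partial>large) = ennreal r * (\<integral>\<^sup>+x. f x \<partial>Q)"
    "\<And>n. prob_space (S n)" "\<And>n. sets (S n) = sets borel"
    "\<And>n::nat. (\<integral>\<^sup>+x. ennreal (exp x) \<partial>S n) \<le> ennreal C" "\<And>n. (\<integral>\<^sup>+x. ennreal (exp (- x)) \<partial>S n) \<le> ennreal C"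
    "weak_conv_m (\<lambda>n. S n \<star> cpois r Q) (distr M borel X)" "0 \<le> C"
    by (rule approximants) blast
  interpret L: compound_poisson Q r by fact
  define H where "H x = ennreal (h x ^ K)" for x
  have [measurable]: "H \<in> borel_measurable borel" unfolding H_def by measurable
  have h0: "h 0 = 0" using h(2,4)[of 0] by simp
  have H0: "H 0 = 0" using h0 K by (simp add: H_def power_0_left)
  have H_add: "H (x + y) \<le> ennreal (2 ^ K) * (H x + H y)" for x y
  proof -
    have "h (x + y) ^ K \<le> (2 * max (h x) (h y)) ^ K"
      using h(2)[of "x + y"] h(3)[of x y] by (intro power_mono) (auto simp: max_def)
    also have "\<dots> \<le> 2 ^ K * (h x ^ K + h y ^ K)"
      using h(2) by (auto simp: power_mult_distrib max_def intro!: mult_left_mono)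
    finally have "ennreal (h (x + y) ^ K) \<le> ennreal (2 ^ K * (h x ^ K + h y ^ K))" by (rule ennreal_leI)
    then show ?thesis using h(2) unfolding H_def by (simp add: ennreal_mult ennreal_plus)
  qed
  have Q: "(\<integral>\<^sup>+x. H x \<partial>Q) < \<infinity>"
    using a(2)[of H] H0 fin L.r_pos unfolding H_def[symmetric]
    by (auto simp: ennreal_mult_less_top)
  have B: "(\<integral>\<^sup>+x. H x \<partial>cpois r Q) < \<infinity>"
    by (rule L.nn_integral_cpois_quasi_subadditive[of _ "2 ^ K"]) (use H0 H_add Q in auto)
  define E where "E = ennreal (2 ^ K) * (ennreal (fact K * exp c) * ennreal C + (\<integral>\<^sup>+x. H x \<partial>cpois r Q))"
  have "(\<integral>\<^sup>+\<omega>. ennreal (h (X \<omega> + c) ^ K) \<partial>M) \<le> E"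
  proof (rule nn_integral_le_of_approx[where f = "\<lambda>x. h (x + c) ^ K"])
    show "weak_conv_m (\<lambda>n. S n \<star> cpois r Q) (distr M borel X)" by (rule a)
    show "prob_space (S n \<star> cpois r Q)" for n
      using a L.prob_space_cpois by (intro prob_space_convolution) auto
    show "isCont (\<lambda>x. h (x + c) ^ K) x" for x
      by (intro continuous_intros isCont_o2[OF _ h(1)])
    show "0 \<le> h (x + c) ^ K" for x using h(2) by simp
    fix n
    have [measurable_cong]: "sets (S n) = sets borel" by (rule a)
    interpret Sn: prob_space "S n" by (rule a)
    interpret B: prob_space "cpois r Q" by (rule L.prob_space_cpois)
    have "(\<integral>\<^sup>+x. ennreal (h (x + c) ^ K) \<partial>(S n \<star> cpois r Q)) = (\<integral>\<^sup>+s. \<integral>\<^sup>+b. H (s + b + c) \<partial>cpois r Q \<partial>S n)"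
      unfolding H_def
      by (rule nn_integral_convolution) (auto simp: a Sn.finite_measure_axioms B.finite_measure_axioms)
    also have "\<dots> \<le> (\<integral>\<^sup>+s. \<integral>\<^sup>+b. ennreal (2 ^ K) * (H (s + c) + H b) \<partial>cpois r Q \<partial>S n)"
    proof (intro nn_integral_mono)
      fix s b
      show "H (s + b + c) \<le> ennreal (2 ^ K) * (H (s + c) + H b)"
        using H_add[of "s + c" b] by (simp add: ac_simps)
    qed
    also have "\<dots> = (\<integral>\<^sup>+s. ennreal (2 ^ K) * (H (s + c) + (\<integral>\<^sup>+b. H b \<partial>cpois r Q)) \<partial>S n)"
      using B.emeasure_space_1 by (intro nn_integral_cong) (simp add: nn_integral_cmult nn_integral_add)
    also have "\<dots> = ennreal (2 ^ K) * ((\<integral>\<^sup>+s. H (s + c) \<partial>S n) + (\<integral>\<^sup>+b. H b \<partial>cpois r Q))"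
      using Sn.emeasure_space_1 by (simp add: nn_integral_cmult nn_integral_add)
    also have "(\<integral>\<^sup>+s. H (s + c) \<partial>S n) \<le> (\<integral>\<^sup>+s. ennreal (fact K * exp c) * ennreal (exp s) \<partial>S n)"
    proof (intro nn_integral_mono)
      fix s
      have "h (s + c) ^ K \<le> max 0 (s + c) ^ K" using h by (intro power_mono) auto
      also have "\<dots> \<le> fact K * exp (s + c)"
      proof (cases "0 \<le> s + c")
        case True
        have "(s + c) ^ K / fact K \<le> (\<Sum>k. (s + c) ^ k /\<^sub>R fact k)"
          using sum_le_suminf[OF summable_exp_generic, of "{K}" "s + c"] True
          by (simp add: divide_inverse mult.commute)
        then show ?thesis using True by (simp add: exp_def field_simps)
      next
        case False
        then show ?thesis using K by (simp add: power_0_left)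
      qed
      finally have "ennreal (h (s + c) ^ K) \<le> ennreal (fact K * exp (s + c))" by (rule ennreal_leI)
      then show "H (s + c) \<le> ennreal (fact K * exp c) * ennreal (exp s)"
        unfolding H_def by (simp add: ennreal_mult[symmetric] exp_add mult_ac)
    qed
    also have "\<dots> = ennreal (fact K * exp c) * (\<integral>\<^sup>+s. ennreal (exp s) \<partial>S n)"
      by (simp add: nn_integral_cmult)
    also have "\<dots> \<le> ennreal (fact K * exp c) * ennreal C" by (intro mult_left_mono a) auto
    finally show "(\<integral>\<^sup>+x. ennreal (h (x + c) ^ K) \<partial>(S n \<star> cpois r Q)) \<le> E"
      unfolding E_def by (simp add: add_right_mono mult_left_mono)
  qed auto
  also have "E < \<infinity>" using B unfolding E_def by (auto simp: ennreal_mult_less_top)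
  finally show ?thesis .
qed

definition "Am x = (\<integral>z. min (max 0 (- z)) x \<partial>large)"
definition "Ap x = (\<integral>z. min (max 0 z) x \<partial>large)"

lemma large_integrable [simp]:
  fixes x :: real
  assumes "0 \<le> x"
  shows "integrable large (\<lambda>z. min (max 0 (- z)) x)" "integrable large (\<lambda>z. min (max 0 z) x)"
proof -
  interpret finite_measure large by (rule finite_large)
  show "integrable large (\<lambda>z. min (max 0 (- z)) x)" "integrable large (\<lambda>z. min (max 0 z) x)"
    using assms by (auto intro!: integrable_const_bound[of _ x])
qed

lemma Am_nonneg: "0 \<le> x \<Longrightarrow> 0 \<le> Am x" and Ap_nonneg: "0 \<le> x \<Longrightarrow> 0 \<le> Ap x"
  unfolding Am_def Ap_def by (auto intro!: integral_nonneg_AE)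

lemma Am_mono: "0 \<le> x \<Longrightarrow> x \<le> y \<Longrightarrow> Am x \<le> Am y"
  unfolding Am_def by (intro integral_mono) auto

lemma min_scale: "min w y * x \<le> min w x * y" if "0 \<le> w" "0 < x" "x \<le> y" for w x y :: real
proof (cases "w \<le> x")
  case True
  then show ?thesis using that by (auto simp: min_def intro: mult_left_mono)
next
  case False
  then have "min w y * x \<le> y * x" using that by (intro mult_right_mono) auto
  then show ?thesis using False by (simp add: min_def mult.commute)
qed

lemma Am_scale: "0 < x \<Longrightarrow> x \<le> y \<Longrightarrow> Am y * x \<le> Am x * y"
  and Ap_scale: "0 < x \<Longrightarrow> x \<le> y \<Longrightarrow> Ap y * x \<le> Ap x * y"
  unfolding Am_def Ap_def integral_mult_left_zero[symmetric]
  by (intro integral_mono; simp add: min_scale)+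

lemma Am_Lipschitz:
  assumes "0 \<le> x" "0 \<le> y"
  shows "\<bar>Am x - Am y\<bar> \<le> measure large UNIV * \<bar>x - y\<bar>"
proof -
  interpret finite_measure large by (rule finite_large)
  have e: "Am x - Am y = (\<integral>z. min (max 0 (- z)) x - min (max 0 (- z)) y \<partial>large)"
    unfolding Am_def using assms by simp
  have "\<bar>Am x - Am y\<bar> \<le> (\<integral>z. \<bar>min (max 0 (- z)) x - min (max 0 (- z)) y\<bar> \<partial>large)"
    unfolding e by (rule integral_abs_bound)
  also have "\<dots> \<le> (\<integral>z. \<bar>x - y\<bar> \<partial>large)"
    using assms by (intro integral_mono integrable_abs Bochner_Integration.integrable_diff) auto
  finally show ?thesis by simp
qed

text \<open>Only the event of exactly one large jump and a moderate remainder is used here.\<close>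
lemma trunc_neg_lower:
  obtains p c where "0 < p" "0 \<le> c" "\<And>x. 0 \<le> x \<Longrightarrow> p * Am x \<le> trunc_neg M X x + c"
proof -
  obtain r Q S C where a: "compound_poisson Q r"
    "\<And>f :: real \<Rightarrow> ennreal. f \<in> borel_measurable borel \<Longrightarrow> f 0 = 0 \<Longrightarrow> (\<integral>\<^sup>+x. f x \<partial>large) = ennreal r * (\<integral>\<^sup>+x. f x \<partial>Q)"
    "\<And>n. prob_space (S n)" "\<And>n. sets (S n) = sets borel"
    "\<And>n::nat. (\<integral>\<^sup>+x. ennreal (exp x) \<partial>S n) \<le> ennreal C" "\<And>n. (\<integral>\<^sup>+x. ennreal (exp (- x)) \<partial>S n) \<le> ennreal C"
    "weak_conv_m (\<lambda>n. S n \<star> cpois r Q) (distr M borel X)" "0 \<le> C"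
    by (rule approximants) blast
  interpret L: compound_poisson Q r by fact
  \<comment> \<open>By the exponential Chebyshev bound \<open>S n\<close> leaves
    \<open>[- c, c]\<close> with probability at most \<open>2 * C * exp (- c)\<close>, and this
    choice makes it at most \<open>1 / 2\<close>.\<close>
  define c where "c = ln (4 * C + 1)"
  have c: "0 \<le> c" "exp c = 4 * C + 1" using a(8) by (auto simp: c_def)
  have half: "ennreal (1 / 2) \<le> emeasure (S n) {s. \<bar>s\<bar> \<le> c}" for n
  proof -
    interpret Sn: prob_space "S n" by (rule a)
    have [measurable_cong]: "sets (S n) = sets borel" by (rule a)
    have sp: "space (S n) = UNIV" using sets_eq_imp_space_eq[OF a(4)] by simp
    have "emeasure (S n) {s. c < \<bar>s\<bar>} = (\<integral>\<^sup>+s. indicator {s. c < \<bar>s\<bar>} s \<partial>S n)" by simp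
    also have "\<dots> \<le> (\<integral>\<^sup>+s. ennreal (exp (- c)) * (ennreal (exp s) + ennreal (exp (- s))) \<partial>S n)"
    proof (intro nn_integral_mono)
      fix s
      show "indicator {s. c < \<bar>s\<bar>} s \<le> ennreal (exp (- c)) * (ennreal (exp s) + ennreal (exp (- s)))"
      proof (cases "c < \<bar>s\<bar>")
        case True
        then have "exp c \<le> exp s \<or> exp c \<le> exp (- s)" by auto
        then have "exp c \<le> exp s + exp (- s)" using exp_gt_zero[of s] exp_gt_zero[of "-s"] by linarith
        then have "1 \<le> exp (- c) * (exp s + exp (- s))" by (simp add: exp_minus field_simps)
        then have "ennreal 1 \<le> ennreal (exp (- c) * (exp s + exp (- s)))" by (rule ennreal_leI)
        then show ?thesis using True by (simp add: ennreal_mult ennreal_plus)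
      qed simp
    qed
    also have "\<dots> = ennreal (exp (- c)) * ((\<integral>\<^sup>+s. ennreal (exp s) \<partial>S n) + (\<integral>\<^sup>+s. ennreal (exp (- s)) \<partial>S n))"
      by (simp add: nn_integral_cmult nn_integral_add)
    also have "\<dots> \<le> ennreal (exp (- c)) * (ennreal C + ennreal C)"
      by (intro mult_left_mono add_mono a) auto
    also have "ennreal C + ennreal C = ennreal (C + C)" using a(8) by (simp only: ennreal_plus)
    also have "ennreal (exp (- c)) * ennreal (C + C) = ennreal (exp (- c) * (C + C))"
      by (rule ennreal_mult[symmetric]) (use a(8) in auto)
    also have "\<dots> \<le> ennreal (1 / 2)"
      using c a(8) by (intro ennreal_leI) (simp add: exp_minus field_simps)
    finally have "Sn.prob {s. c < \<bar>s\<bar>} \<le> 1 / 2"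
      by (subst (asm) Sn.emeasure_eq_measure, subst (asm) ennreal_le_iff) auto
    moreover have "Sn.prob {s. c < \<bar>s\<bar>} = 1 - Sn.prob {s. \<bar>s\<bar> \<le> c}"
      by (subst Sn.prob_compl[symmetric]) (auto simp: sp intro!: arg_cong[where f = Sn.prob])
    ultimately have "1 / 2 \<le> Sn.prob {s. \<bar>s\<bar> \<le> c}" by simp
    then show ?thesis unfolding Sn.emeasure_eq_measure by (rule ennreal_leI)
  qed
  \<comment> \<open>One large jump has probability \<open>r * exp (- r)\<close>; the factor
    \<open>r\<close> is absorbed in passing from \<open>Q\<close> to \<open>large\<close>, and
    \<open>1 / 2\<close> bounds from below the probability that the remainder is moderate.\<close>
  define p where "p = exp (- r) / 2"
  show ?thesis
  proof (rule that[of p c])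
    show "0 < p" by (simp add: p_def)
    fix x :: real assume x: "0 \<le> x"
    define f where "f v = min (max 0 (- v)) x" for v :: real
    have f: "0 \<le> f v" "f v \<le> x" "isCont f v" for v
      using x unfolding f_def by (auto intro!: continuous_intros)
    have [measurable]: "f \<in> borel_measurable borel" unfolding f_def by measurable
    have rd: "real_distribution (S n \<star> cpois r Q)" for n
    proof -
      have "prob_space (S n \<star> cpois r Q)" using a L.prob_space_cpois by (intro prob_space_convolution) auto
      then show ?thesis by (simp add: real_distribution_def real_distribution_axioms_def)
    qed
    have rX: "real_distribution (distr M borel X)"
      by (simp add: real_distribution_def real_distribution_axioms_def prob_space_distr)
    have "(\<lambda>n. \<integral>v. f v \<partial>(S n \<star> cpois r Q)) \<longlonglongrightarrow> (\<integral>v. f v \<partial>distr M borel X)"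
      by (rule weak_conv_imp_integral_bdd_continuous_conv[OF rd rX a(7), of _ x]) (use f in auto)
    also have "(\<integral>v. f v \<partial>distr M borel X) = trunc_neg M X x"
      by (subst integral_distr) (auto simp: trunc_neg_def f_def)
    finally have lim: "(\<lambda>n. \<integral>v. f v \<partial>(S n \<star> cpois r Q)) \<longlonglongrightarrow> trunc_neg M X x" .
    have "p * Am x - c \<le> (\<integral>v. f v \<partial>(S n \<star> cpois r Q))" for n
    proof -
      have [measurable_cong]: "sets (S n) = sets borel" by (rule a)
      interpret Sn: prob_space "S n" by (rule a)
      interpret B: prob_space "cpois r Q" by (rule L.prob_space_cpois)
      interpret U: real_distribution "S n \<star> cpois r Q" by (rule rd)
      have f_large: "(\<integral>\<^sup>+z. ennreal (f z) \<partial>large) = ennreal (Am x)"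
        unfolding f_def Am_def using x by (intro nn_integral_eq_integral) auto
      have "ennreal (exp (- r)) * ennreal (Am x) = ennreal (r * exp (- r)) * (\<integral>\<^sup>+z. ennreal (f z) \<partial>Q)"
        unfolding f_large[symmetric] using L.r_pos x
        by (subst a(2)) (auto simp: f_def ennreal_mult mult_ac)
      also have "\<dots> \<le> (\<integral>\<^sup>+z. ennreal (f z) \<partial>cpois r Q)" by (rule L.nn_integral_cpois_ge) auto
      finally have s1: "ennreal (exp (- r)) * ennreal (Am x) \<le> (\<integral>\<^sup>+z. ennreal (f z) \<partial>cpois r Q)" .
      have "ennreal (p * Am x) = ennreal (1 / 2) * (ennreal (exp (- r)) * ennreal (Am x))"
      proof -
        have "ennreal (p * Am x) = ennreal (1 / 2 * (exp (- r) * Am x))" by (simp add: p_def)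
        also have "\<dots> = ennreal (1 / 2) * ennreal (exp (- r) * Am x)"
          by (rule ennreal_mult) (use x Am_nonneg in auto)
        also have "ennreal (exp (- r) * Am x) = ennreal (exp (- r)) * ennreal (Am x)"
          by (rule ennreal_mult) (use x Am_nonneg in auto)
        finally show ?thesis .
      qed
      also have "\<dots> \<le> ennreal (1 / 2) * (\<integral>\<^sup>+z. ennreal (f z) \<partial>cpois r Q)"
        by (rule mult_left_mono[OF s1]) simp
      also have "\<dots> \<le> emeasure (S n) {s. \<bar>s\<bar> \<le> c} * (\<integral>\<^sup>+z. ennreal (f z) \<partial>cpois r Q)"
        by (intro mult_right_mono half) auto
      also have "\<dots> = (\<integral>\<^sup>+s. indicator {s. \<bar>s\<bar> \<le> c} s * (\<integral>\<^sup>+z. ennreal (f z) \<partial>cpois r Q) \<partial>S n)"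
        by (subst nn_integral_multc) auto
      also have "\<dots> \<le> (\<integral>\<^sup>+s. (\<integral>\<^sup>+z. ennreal (f (s + z)) \<partial>cpois r Q) + ennreal c \<partial>S n)"
      proof (intro nn_integral_mono)
        fix s
        have "(\<integral>\<^sup>+z. ennreal (f z) \<partial>cpois r Q) \<le> (\<integral>\<^sup>+z. ennreal (f (s + z)) + ennreal c \<partial>cpois r Q)" if "\<bar>s\<bar> \<le> c"
        proof (intro nn_integral_mono)
          fix z
          have "f z \<le> f (s + z) + c" using that x c by (auto simp: f_def min_def max_def)
          then show "ennreal (f z) \<le> ennreal (f (s + z)) + ennreal c"
            using f c by (simp add: ennreal_plus[symmetric] ennreal_leI del: ennreal_plus)
        qed
        also have "(\<integral>\<^sup>+z. ennreal (f (s + z)) + ennreal c \<partial>cpois r Q) = (\<integral>\<^sup>+z. ennreal (f (s + z)) \<partial>cpois r Q) + ennreal c"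
          using B.emeasure_space_1 by (simp add: nn_integral_add)
        finally show "indicator {s. \<bar>s\<bar> \<le> c} s * (\<integral>\<^sup>+z. ennreal (f z) \<partial>cpois r Q) \<le> (\<integral>\<^sup>+z. ennreal (f (s + z)) \<partial>cpois r Q) + ennreal c"
          by (auto simp: indicator_def)
      qed
      also have "\<dots> = (\<integral>\<^sup>+s. \<integral>\<^sup>+z. ennreal (f (s + z)) \<partial>cpois r Q \<partial>S n) + ennreal c"
        using Sn.emeasure_space_1 by (simp add: nn_integral_add)
      also have "(\<integral>\<^sup>+s. \<integral>\<^sup>+z. ennreal (f (s + z)) \<partial>cpois r Q \<partial>S n) = (\<integral>\<^sup>+v. ennreal (f v) \<partial>(S n \<star> cpois r Q))"
        by (rule nn_integral_convolution[symmetric]) (auto simp: a Sn.finite_measure_axioms B.finite_measure_axioms)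
      also have "\<dots> = ennreal (\<integral>v. f v \<partial>(S n \<star> cpois r Q))"
        using f by (intro nn_integral_eq_integral U.integrable_const_bound[of _ x]) auto
      finally have "ennreal (p * Am x) \<le> ennreal ((\<integral>v. f v \<partial>(S n \<star> cpois r Q)) + c)"
        using f c by (simp add: ennreal_plus integral_nonneg_AE)
      then show ?thesis using f c by (subst (asm) ennreal_le_iff) (auto intro!: add_nonneg_nonneg integral_nonneg_AE)
    qed
    then have "p * Am x - c \<le> trunc_neg M X x" by (intro LIMSEQ_le_const[OF lim]) auto
    then show "p * Am x \<le> trunc_neg M X x + c" by simp
  qed (rule c)
qed

end

section \<open>Comparison of \<open>levy_A\<close> with truncated means of the large jumps\<close>

context levy_khintchine_law
begin

lemma nn_integral_large:
  assumes [measurable]: "f \<in> borel_measurable borel"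
  shows "(\<integral>\<^sup>+z. f z \<partial>large) = (\<integral>\<^sup>+z. indicator {z. 1 < \<bar>z\<bar>} z * f z \<partial>Lm)"
  unfolding part_def by (subst nn_integral_density) auto

lemma emeasure_large:
  assumes [measurable]: "B \<in> sets borel" and "B \<subseteq> {z. 1 < \<bar>z\<bar>}"
  shows "emeasure Lm B = emeasure large B"
proof -
  have "emeasure large B = (\<integral>\<^sup>+z. indicator {z. 1 < \<bar>z\<bar>} z * indicator B z \<partial>Lm)"
    unfolding part_def by (subst emeasure_density) auto
  also have "\<dots> = (\<integral>\<^sup>+z. indicator B z \<partial>Lm)"
    using assms(2) by (intro nn_integral_cong) (auto simp: indicator_def)
  finally show ?thesis by simp
qed

text \<open>Layer-cake by Fubini: for fixed \<open>z\<close> the levels \<open>y\<close> in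
  \<open>[1, x]\<close> below \<open>g z\<close> have total length at most
  \<open>min (max 0 (g z)) x\<close>.\<close>

lemma tail_integral_le:
  fixes g :: "real \<Rightarrow> real"
  assumes [measurable]: "g \<in> borel_measurable borel" and x: "0 \<le> x"
  shows "(\<integral>\<^sup>+y. indicator {1..x} y * (\<integral>\<^sup>+z. (if y < g z then 1 else 0) \<partial>large) \<partial>lborel)
    \<le> (\<integral>\<^sup>+z. ennreal (min (max 0 (g z)) x) \<partial>large)"
proof -
  interpret L: finite_measure large by (rule finite_large)
  interpret pair_sigma_finite lborel large ..
  have "(\<integral>\<^sup>+y. indicator {1..x} y * (\<integral>\<^sup>+z. (if y < g z then 1 else 0) \<partial>large) \<partial>lborel)
    = (\<integral>\<^sup>+y. \<integral>\<^sup>+z. indicator {1..x} y * (if y < g z then 1 else 0) \<partial>large \<partial>lborel)"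
    by (intro nn_integral_cong) (simp add: nn_integral_cmult)
  also have "\<dots> = (\<integral>\<^sup>+z. \<integral>\<^sup>+y. indicator {1..x} y * (if y < g z then 1 else 0) \<partial>lborel \<partial>large)"
    by (rule Fubini'[symmetric]) measurable
  also have "\<dots> \<le> (\<integral>\<^sup>+z. \<integral>\<^sup>+y. indicator {0..min (max 0 (g z)) x} y \<partial>lborel \<partial>large)"
    by (intro nn_integral_mono) (auto simp: indicator_def)
  also have "\<dots> = (\<integral>\<^sup>+z. ennreal (min (max 0 (g z)) x) \<partial>large)"
    using x by (intro nn_integral_cong) auto
  finally show ?thesis .
qed

text \<open>\<open>levy_A\<close> stands in the denominator of the criterion, so an upper bound is
  the direction that is needed, and cancellation between its two tails does no harm. Each tail
  integral is bounded by a truncated mean.\<close>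

lemma levy_A_bound:
  obtains C where "0 < C" "\<And>x. 1 \<le> x \<Longrightarrow> \<bar>levy_A \<gamma> Lm x\<bar> \<le> C * (1 + Ap x + Am x)"
proof -
  interpret L: finite_measure large by (rule finite_large)
  define C where "C = 1 + \<bar>\<gamma>\<bar> + measure Lm {1<..} + measure Lm {..<-1}"
  have C: "1 \<le> C" unfolding C_def by simp
  show ?thesis
  proof (rule that[of C])
    fix x :: real assume x: "1 \<le> x"
    define F where "F y = indicator {1..x} y *\<^sub>R (measure Lm {y<..} - measure Lm {..<-y})" for y :: real
    have F_le: "ennreal (norm (F y)) \<le> indicator {1..x} y * (\<integral>\<^sup>+z. (if y < z then 1 else 0) \<partial>large)
        + indicator {1..x} y * (\<integral>\<^sup>+z. (if y < - z then 1 else 0) \<partial>large)" for y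
    proof (cases "y \<in> {1..x}")
      case True
      have e1: "emeasure Lm {y<..} = emeasure large {y<..}" "emeasure Lm {..<-y} = emeasure large {..<-y}"
        using True by (auto intro!: emeasure_large)
      then have m: "measure Lm {y<..} = measure large {y<..}" "measure Lm {..<-y} = measure large {..<-y}"
        by (auto simp: measure_def)
      have "emeasure large {y<..} = (\<integral>\<^sup>+z. indicator {y<..} z \<partial>large)" by simp
      also have "\<dots> = (\<integral>\<^sup>+z. (if y < z then 1 else 0) \<partial>large)"
        by (intro nn_integral_cong) (auto simp: indicator_def)
      finally have i1: "ennreal (measure large {y<..}) = (\<integral>\<^sup>+z. (if y < z then 1 else 0) \<partial>large)"
        by (simp add: L.emeasure_eq_measure)
      have "emeasure large {..<-y} = (\<integral>\<^sup>+z. indicator {..<-y} z \<partial>large)" by simp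
      also have "\<dots> = (\<integral>\<^sup>+z. (if y < - z then 1 else 0) \<partial>large)"
        by (intro nn_integral_cong) (auto simp: indicator_def)
      finally have i2: "ennreal (measure large {..<-y}) = (\<integral>\<^sup>+z. (if y < - z then 1 else 0) \<partial>large)"
        by (simp add: L.emeasure_eq_measure)
      have "norm (F y) \<le> measure large {y<..} + measure large {..<-y}"
        using True by (simp add: F_def m abs_le_iff)
      then have "ennreal (norm (F y)) \<le> ennreal (measure large {y<..} + measure large {..<-y})" by (rule ennreal_leI)
      then show ?thesis using True by (simp add: i1 i2)
    qed (simp add: F_def)
    have nnF: "(\<integral>\<^sup>+y. ennreal (norm (F y)) \<partial>lborel) \<le> ennreal (Ap x + Am x)"
    proof -
      have "(\<integral>\<^sup>+y. ennreal (norm (F y)) \<partial>lborel)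
        \<le> (\<integral>\<^sup>+y. indicator {1..x} y * (\<integral>\<^sup>+z. (if y < z then 1 else 0) \<partial>large) \<partial>lborel)
          + (\<integral>\<^sup>+y. indicator {1..x} y * (\<integral>\<^sup>+z. (if y < - z then 1 else 0) \<partial>large) \<partial>lborel)"
      proof -
        have "(\<integral>\<^sup>+y. ennreal (norm (F y)) \<partial>lborel) \<le> (\<integral>\<^sup>+y. indicator {1..x} y * (\<integral>\<^sup>+z. (if y < z then 1 else 0) \<partial>large)
            + indicator {1..x} y * (\<integral>\<^sup>+z. (if y < - z then 1 else 0) \<partial>large) \<partial>lborel)"
          by (intro nn_integral_mono F_le)
        then show ?thesis by (subst (asm) nn_integral_add) measurable
      qed
      also have "\<dots> \<le> (\<integral>\<^sup>+z. ennreal (min (max 0 z) x) \<partial>large) + (\<integral>\<^sup>+z. ennreal (min (max 0 (- z)) x) \<partial>large)"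
        using x by (intro add_mono tail_integral_le) auto
      also have "\<dots> = ennreal (Ap x) + ennreal (Am x)"
        unfolding Ap_def Am_def using x by (intro arg_cong2[where f = "(+)"] nn_integral_eq_integral) auto
      finally show ?thesis using x by (simp add: Ap_nonneg Am_nonneg)
    qed
    have "\<bar>\<integral>y. F y \<partial>lborel\<bar> \<le> Ap x + Am x"
    \<comment> \<open>The integral is 0 by convention when \<open>F\<close> is not integrable, so
      that case is immediate.\<close>
    proof (cases "integrable lborel F")
      case True
      have "ennreal (norm (\<integral>y. F y \<partial>lborel)) \<le> (\<integral>\<^sup>+y. ennreal (norm (F y)) \<partial>lborel)"
        by (rule integral_norm_bound_ennreal[OF True])
      also note nnF
      finally show ?thesis
        by (subst (asm) ennreal_le_iff) (use x in \<open>auto simp: Ap_nonneg Am_nonneg\<close>)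
    qed (use x in \<open>simp add: not_integrable_integral_eq Ap_nonneg Am_nonneg\<close>)
    moreover have "levy_A \<gamma> Lm x = \<gamma> + measure Lm {1<..} - measure Lm {..<-1} + (\<integral>y. F y \<partial>lborel)"
      unfolding levy_A_def set_lebesgue_integral_def F_def by simp
    ultimately have "\<bar>levy_A \<gamma> Lm x\<bar> \<le> C + (Ap x + Am x)"
      unfolding C_def using measure_nonneg[of Lm "{1<..}"] measure_nonneg[of Lm "{..<-1}"] by linarith
    also have "\<dots> \<le> C + C * (Ap x + Am x)"
      using mult_right_mono[OF C, of "Ap x + Am x"] x by (simp add: Ap_nonneg Am_nonneg)
    finally show "\<bar>levy_A \<gamma> Lm x\<bar> \<le> C * (1 + Ap x + Am x)" by (simp add: algebra_simps)
  qed (use C in simp)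
qed

text \<open>Integrability of the positive jumps against \<open>x / (1 + Ap x + Am x)\<close> forces the truncated mean
  of the positive jumps to be dominated by that of the negative ones.\<close>
lemma Ap_dominated:
  assumes K: "1 \<le> K" and x0: "1 \<le> x0"
    and fin: "(\<integral>\<^sup>+z. (if x0 < z then ennreal ((z / (1 + Ap z + Am z)) ^ K) else 0) \<partial>large) < \<infinity>"
  obtains C where "0 < C" "\<And>x. 1 \<le> x \<Longrightarrow> 1 + Ap x + Am x \<le> C * (1 + Am x)"
proof -
  interpret L: finite_measure large by (rule finite_large)
  have [measurable]: "Ap \<in> borel_measurable borel" "Am \<in> borel_measurable borel"
    unfolding Ap_def Am_def by measurable
  define D where "D x = 1 + Ap x + Am x" for x
  have [measurable]: "D \<in> borel_measurable borel" unfolding D_def by measurable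
  have D1: "1 \<le> D x" if "0 \<le> x" for x using that by (simp add: D_def Ap_nonneg Am_nonneg)
  define l where "l = measure large UNIV"
  have l0: "0 \<le> l" by (simp add: l_def)
  have A_le: "Ap x \<le> l * x" "Am x \<le> l * x" if "0 \<le> x" for x
  proof -
    have "Ap x \<le> (\<integral>z. x \<partial>large)" "Am x \<le> (\<integral>z. x \<partial>large)"
      unfolding Ap_def Am_def using that by (intro integral_mono; simp)+
    then show "Ap x \<le> l * x" "Am x \<le> l * x" by (simp_all add: l_def)
  qed
  have D_le: "D x \<le> (1 + 2 * l) * x" if "1 \<le> x" for x
    using A_le[of x] that by (simp add: D_def algebra_simps)
  have D_mono: "D x \<le> D y" if "0 \<le> x" "x \<le> y" for x y
    unfolding D_def Ap_def Am_def using that by (intro add_mono integral_mono) auto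
  have D_scale: "D y * x \<le> D x * y" if "0 < x" "x \<le> y" for x y
    using Am_scale[OF that] Ap_scale[OF that] that by (simp add: D_def algebra_simps)
  define \<delta> where "\<delta> = 1 / (1 + 2 * l)"
  have \<delta>: "0 < \<delta>" using l0 by (simp add: \<delta>_def)
  \<comment> \<open>\<open>z / D z\<close> is bounded below by \<open>\<delta>\<close>, so its
    \<open>K\<close>-th power controls the first power, the only one that the argument for
    \<open>Ap\<close> uses.\<close>
  have zD: "\<delta> ^ (K - 1) * (z / D z) \<le> (z / D z) ^ K" if "1 \<le> z" for z
  proof -
    have "\<delta> \<le> z / D z" using D_le[OF that] D1[of z] that l0 by (simp add: \<delta>_def field_simps)
    then have "\<delta> ^ (K - 1) * (z / D z) \<le> (z / D z) ^ (K - 1) * (z / D z)"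
      using \<delta> D1[of z] that by (intro mult_right_mono power_mono) auto
    also have "\<dots> = (z / D z) ^ K" using K by (cases K) auto
    finally show ?thesis .
  qed
  have fin1: "(\<integral>\<^sup>+z. (if x0 < z then ennreal (z / D z) else 0) \<partial>large) < \<infinity>"
  proof -
    have "ennreal (\<delta> ^ (K - 1)) * (\<integral>\<^sup>+z. (if x0 < z then ennreal (z / D z) else 0) \<partial>large)
      = (\<integral>\<^sup>+z. ennreal (\<delta> ^ (K - 1)) * (if x0 < z then ennreal (z / D z) else 0) \<partial>large)"
      by (subst nn_integral_cmult) auto
    also have "\<dots> \<le> (\<integral>\<^sup>+z. (if x0 < z then ennreal ((z / (1 + Ap z + Am z)) ^ K) else 0) \<partial>large)"
      unfolding D_def[symmetric]
    proof (intro nn_integral_mono)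
      fix z
      show "ennreal (\<delta> ^ (K - 1)) * (if x0 < z then ennreal (z / D z) else 0) \<le> (if x0 < z then ennreal ((z / D z) ^ K) else 0)"
      proof (cases "x0 < z")
        case True
        then have z: "1 \<le> z" "1 \<le> D z" using x0 D1[of z] by auto
        have "ennreal (\<delta> ^ (K - 1)) * ennreal (z / D z) = ennreal (\<delta> ^ (K - 1) * (z / D z))"
          by (rule ennreal_mult[symmetric]) (use \<delta> z in auto)
        also have "\<dots> \<le> ennreal ((z / D z) ^ K)" by (rule ennreal_leI[OF zD[OF z(1)]])
        finally show ?thesis using True by simp
      qed simp
    qed
    also note fin
    finally show ?thesis using \<delta> by (auto simp: ennreal_mult_less_top)
  qed
  have "(\<lambda>n. \<integral>\<^sup>+z. (if x0 + real n < z then ennreal (z / D z) else 0) \<partial>large) \<longlonglongrightarrow> (\<integral>\<^sup>+z. 0 \<partial>large)"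
  proof (rule nn_integral_dominated_convergence[where w = "\<lambda>z. if x0 < z then ennreal (z / D z) else 0"])
    show "AE z in large. (\<lambda>n. if x0 + real n < z then ennreal (z / D z) else 0) \<longlonglongrightarrow> 0"
    proof (intro AE_I2 tendsto_eventually)
      fix z
      show "\<forall>\<^sub>F n in sequentially. (if x0 + real n < z then ennreal (z / D z) else 0) = 0"
        using eventually_ge_at_top[of "nat \<lceil>z - x0\<rceil>"] by eventually_elim (auto; linarith)
    qed
  qed (use fin1 in auto)
  then have "\<forall>\<^sub>F n in sequentially. (\<integral>\<^sup>+z. (if x0 + real n < z then ennreal (z / D z) else 0) \<partial>large) < ennreal (1 / 4)"
    by (intro order_tendstoD) auto
  then obtain n where "(\<integral>\<^sup>+z. (if x0 + real n < z then ennreal (z / D z) else 0) \<partial>large) < ennreal (1 / 4)"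
    by (auto simp: eventually_sequentially)
  moreover define z1 where "z1 = x0 + real n"
  ultimately have n: "(\<integral>\<^sup>+z. (if z1 < z then ennreal (z / D z) else 0) \<partial>large) < ennreal (1 / 4)"
    by simp
  have z1: "1 \<le> z1" using x0 by (simp add: z1_def)
  define f where "f z = (if z1 < z then z / D z else 0)" for z
  have [measurable]: "f \<in> borel_measurable borel" unfolding f_def by measurable
  have f0: "0 \<le> f z" for z using z1 D1[of z] by (auto simp: f_def)
  have nf: "(\<integral>\<^sup>+z. ennreal (f z) \<partial>large) < ennreal (1 / 4)"
    using n by (simp add: f_def if_distrib[of ennreal] cong: if_cong)
  have f_int: "integrable large f"
    using f0 nf by (intro integrableI_nonneg) (auto intro: order.strict_trans)
  have f_le: "(\<integral>z. f z \<partial>large) \<le> 1 / 4"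
    using nf f0 by (subst (asm) nn_integral_eq_integral[OF f_int]) (auto simp: ennreal_less_iff integral_nonneg_AE)
  \<comment> \<open>For \<open>z > z1\<close> one has \<open>min z x \<le> D x * (z / D z)\<close>,
    because \<open>D x\<close> is nondecreasing and \<open>D x / x\<close> is nonincreasing. Beyond
    \<open>z1\<close> the function \<open>z / D z\<close> has integral at most \<open>1 / 4\<close>,
    so a quarter of \<open>D x\<close> can be absorbed into the left-hand side afterwards; this is
    the origin of \<open>4 / 3\<close>.\<close>
  have Ap_le: "Ap x \<le> z1 * l + D x / 4" if x: "1 \<le> x" for x
  proof -
    have pt: "min (max 0 z) x \<le> z1 + D x * f z" for z
    proof (cases "z1 < z")
      case False
      then show ?thesis using z1 f0[of z] D1[of x] x by (auto intro!: order_trans[OF min.cobounded1] add_increasing2)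
    next
      case True
      then have z: "0 < z" "1 \<le> D z" using z1 D1[of z] by auto
      have "min z x * D z \<le> D x * z"
      proof (cases "z \<le> x")
        case True
        then have "z * D z \<le> z * D x" using D_mono[of z x] z by (intro mult_left_mono) auto
        then show ?thesis using True by (simp add: mult.commute)
      next
        case False
        then show ?thesis using D_scale[of x z] x by (simp add: mult.commute)
      qed
      then have "min z x \<le> D x * f z" using True z by (simp add: f_def field_simps)
      then show ?thesis using z z1 by simp
    qed
    have "Ap x \<le> (\<integral>z. z1 + D x * f z \<partial>large)"
      unfolding Ap_def using x f_int pt by (intro integral_mono) auto
    also have "\<dots> = z1 * l + D x * (\<integral>z. f z \<partial>large)" using f_int by (simp add: l_def)
    also have "\<dots> \<le> z1 * l + D x * (1 / 4)" using f_le D1[of x] x by (intro add_left_mono mult_left_mono) auto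
    finally show ?thesis by simp
  qed
  show ?thesis
  proof (rule that[of "4 / 3 * (1 + z1 * l)"])
    show "0 < 4 / 3 * (1 + z1 * l)" using z1 l0 by (simp add: add_pos_nonneg)
    fix x :: real assume x: "1 \<le> x"
    have "D x \<le> 4 / 3 * (1 + z1 * l + Am x)" 
    proof -
      have "D x \<le> 1 + (z1 * l + D x / 4) + Am x" using Ap_le[OF x] D_def[of x] by linarith
      then show ?thesis by (simp add: field_simps)
    qed
    also have "\<dots> \<le> 4 / 3 * ((1 + z1 * l) * (1 + Am x))"
      using z1 l0 x by (simp add: algebra_simps Am_nonneg)
    finally show "1 + Ap x + Am x \<le> 4 / 3 * (1 + z1 * l) * (1 + Am x)" by (simp only: D_def mult.assoc)
  qed
qed

text \<open>The quantity carried from the jumps to \<open>X\<close> must be continuous and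
  subadditive, and its denominator must be dominated by \<open>trunc_neg M X\<close>. Hence
  \<open>levy_A\<close> is first replaced by \<open>1 + Ap + Am\<close> and then by
  \<open>1 + Am\<close> alone, since \<open>trunc_neg_lower\<close> controls only the negative
  jumps.\<close>

theorem moment_criterion:
  assumes K: "1 \<le> K" and x0: "1 < x0" and A: "\<And>x. x0 \<le> x \<Longrightarrow> levy_A \<gamma> Lm x \<noteq> 0"
    and fin: "(\<integral>\<^sup>+ x\<in>{x0<..}. ennreal ((x / \<bar>levy_A \<gamma> Lm x\<bar>) ^ K) \<partial>Lm) < \<infinity>"
    and a1: "0 < trunc_neg M X 1"
  shows "(\<integral>\<^sup>+\<omega>. (if 1 \<le> X \<omega> + c then ennreal (((X \<omega> + c) / trunc_neg M X (X \<omega> + c)) ^ K) else 0) \<partial>M) < \<infinity>"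
proof -
  interpret L: finite_measure large by (rule finite_large)
  have [measurable]: "Ap \<in> borel_measurable borel" "Am \<in> borel_measurable borel"
    unfolding Ap_def Am_def by measurable
  obtain C where C: "0 < C" "\<And>x. 1 \<le> x \<Longrightarrow> \<bar>levy_A \<gamma> Lm x\<bar> \<le> C * (1 + Ap x + Am x)"
    by (rule levy_A_bound) blast
  let ?D = "\<lambda>z. 1 + Ap z + Am z"
  have D1: "1 \<le> ?D x" if "0 \<le> x" for x using that by (simp add: Ap_nonneg Am_nonneg)
  have fin1: "(\<integral>\<^sup>+z. (if x0 < z then ennreal ((z / ?D z) ^ K) else 0) \<partial>large) < \<infinity>"
  proof -
    have "ennreal ((1 / C) ^ K) * (\<integral>\<^sup>+z. (if x0 < z then ennreal ((z / ?D z) ^ K) else 0) \<partial>large)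
      = (\<integral>\<^sup>+z. ennreal ((1 / C) ^ K) * (if x0 < z then ennreal ((z / ?D z) ^ K) else 0) \<partial>large)"
      by (subst nn_integral_cmult) auto
    also have "\<dots> = (\<integral>\<^sup>+z. indicator {z. 1 < \<bar>z\<bar>} z * (ennreal ((1 / C) ^ K) * (if x0 < z then ennreal ((z / ?D z) ^ K) else 0)) \<partial>Lm)"
      by (rule nn_integral_large) measurable
    also have "\<dots> \<le> (\<integral>\<^sup>+ x\<in>{x0<..}. ennreal ((x / \<bar>levy_A \<gamma> Lm x\<bar>) ^ K) \<partial>Lm)"
    proof (intro nn_integral_mono)
      fix z
      show "indicator {z. 1 < \<bar>z\<bar>} z * (ennreal ((1 / C) ^ K) * (if x0 < z then ennreal ((z / ?D z) ^ K) else 0))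
        \<le> ennreal ((z / \<bar>levy_A \<gamma> Lm z\<bar>) ^ K) * indicator {x0<..} z"
      proof (cases "x0 < z")
        case True
        then have z: "1 < z" "1 \<le> ?D z" "0 < \<bar>levy_A \<gamma> Lm z\<bar>" using x0 D1[of z] A[of z] by auto
        have "1 / C * (z / ?D z) = z / (C * ?D z)" by simp
        also have "\<dots> \<le> z / \<bar>levy_A \<gamma> Lm z\<bar>"
          using C(2)[of z] z C(1) by (intro divide_left_mono mult_pos_pos) auto
        finally have "(1 / C * (z / ?D z)) ^ K \<le> (z / \<bar>levy_A \<gamma> Lm z\<bar>) ^ K"
          using z C by (intro power_mono) auto
        then have "ennreal ((1 / C) ^ K * (z / ?D z) ^ K) \<le> ennreal ((z / \<bar>levy_A \<gamma> Lm z\<bar>) ^ K)"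
          by (intro ennreal_leI) (simp only: power_mult_distrib)
        moreover have "ennreal ((1 / C) ^ K * (z / ?D z) ^ K) = ennreal ((1 / C) ^ K) * ennreal ((z / ?D z) ^ K)"
          using C z by (intro ennreal_mult) auto
        ultimately show ?thesis using True z by simp
      qed simp
    qed
    also note fin
    finally show ?thesis using C by (auto simp: ennreal_mult_less_top)
  qed
  have x01: "1 \<le> x0" using x0 by simp
  obtain C2 where C2: "0 < C2" "\<And>x. 1 \<le> x \<Longrightarrow> ?D x \<le> C2 * (1 + Am x)"
    by (rule Ap_dominated[OF K x01 fin1]) blast
  \<comment> \<open>Nondecreasing because \<open>Am x / x\<close> is nonincreasing, and subadditive
    because \<open>Am\<close> is nondecreasing.\<close>
  define h where "h x = max x 0 / (1 + Am (max x 0))" for x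
  have pos: "0 < 1 + Am (max x 0)" for x using Am_nonneg[of "max x 0"] by simp
  have h_mono': "p / (1 + Am p) \<le> q / (1 + Am q)" if "0 \<le> p" "p \<le> q" for p q
  proof (cases "p = 0")
    case True
    then show ?thesis using that Am_nonneg[of q] by simp
  next
    case False
    then have "(1 + Am q) * p \<le> (1 + Am p) * q" using Am_scale[of p q] that by (simp add: algebra_simps)
    then show ?thesis using that Am_nonneg[of p] Am_nonneg[of q] by (simp add: field_simps)
  qed
  have h0: "0 \<le> h x" for x using pos[of x] by (simp add: h_def)
  have h_le: "h x \<le> max 0 x" for x
  proof -
    have "max x 0 / (1 + Am (max x 0)) \<le> max x 0 / 1"
      using Am_nonneg[of "max x 0"] by (intro divide_left_mono) auto
    then show ?thesis by (simp add: h_def max.commute)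
  qed
  have h_add: "h (x + y) \<le> h x + h y" for x y
  proof -
    define p q where "p = max x 0" and "q = max y 0"
    have pq: "0 \<le> p" "0 \<le> q" "max (x + y) 0 \<le> p + q" by (auto simp: p_def q_def)
    have "h (x + y) \<le> (p + q) / (1 + Am (p + q))" unfolding h_def by (rule h_mono') (use pq in auto)
    also have "\<dots> = p / (1 + Am (p + q)) + q / (1 + Am (p + q))" by (rule add_divide_distrib)
    also have "\<dots> \<le> p / (1 + Am p) + q / (1 + Am q)"
      using pq Am_mono[of p "p + q"] Am_mono[of q "p + q"] Am_nonneg[of p] Am_nonneg[of q]
      by (intro add_mono divide_left_mono mult_pos_pos) auto
    finally show ?thesis by (simp add: h_def p_def q_def)
  qed
  have h_cont: "isCont h x" for x
  proof -
    have "isCont (\<lambda>x. Am (max x 0)) x"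
      unfolding isCont_def
    proof (rule LIM_I)
      fix e :: real assume e: "0 < e"
      define l where "l = measure large UNIV"
      have l: "0 \<le> l" by (simp add: l_def)
      show "\<exists>s>0. \<forall>y. y \<noteq> x \<and> norm (y - x) < s \<longrightarrow> norm (Am (max y 0) - Am (max x 0)) < e"
      proof (intro exI[of _ "e / (l + 1)"] conjI allI impI)
        show "0 < e / (l + 1)" using e l by simp
        fix y assume y: "y \<noteq> x \<and> norm (y - x) < e / (l + 1)"
        have "norm (Am (max y 0) - Am (max x 0)) \<le> l * \<bar>max y 0 - max x 0\<bar>"
          using Am_Lipschitz[of "max y 0" "max x 0"] by (simp add: l_def)
        also have "\<dots> \<le> l * \<bar>y - x\<bar>" using l by (intro mult_left_mono) auto
        also have "\<dots> \<le> (l + 1) * \<bar>y - x\<bar>" by (intro mult_right_mono) auto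
        also have "\<dots> < e" using y l by (simp add: field_simps)
        finally show "norm (Am (max y 0) - Am (max x 0)) < e" .
      qed
    qed
    then show ?thesis unfolding h_def using pos[of x] by (intro continuous_intros) auto
  qed
  have [measurable]: "h \<in> borel_measurable borel" unfolding h_def by measurable
  have fin_h: "(\<integral>\<^sup>+z. ennreal (h z ^ K) \<partial>large) < \<infinity>"
  proof -
    have "(\<integral>\<^sup>+z. ennreal (h z ^ K) \<partial>large) \<le>
      (\<integral>\<^sup>+z. ennreal (x0 ^ K) + ennreal (C2 ^ K) * (if x0 < z then ennreal ((z / ?D z) ^ K) else 0) \<partial>large)"
    proof (intro nn_integral_mono)
      fix z
      show "ennreal (h z ^ K) \<le> ennreal (x0 ^ K) + ennreal (C2 ^ K) * (if x0 < z then ennreal ((z / ?D z) ^ K) else 0)"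
      proof (cases "x0 < z")
        case True
        then have z: "1 \<le> z" "1 \<le> ?D z" "0 < 1 + Am z" using x0 D1[of z] Am_nonneg[of z] by auto
        have "h z = C2 * (z / (C2 * (1 + Am z)))" using z C2 by (simp add: h_def max_def)
        also have "\<dots> \<le> C2 * (z / ?D z)"
          using C2 z by (intro mult_left_mono divide_left_mono mult_pos_pos) auto
        finally have "h z ^ K \<le> (C2 * (z / ?D z)) ^ K" by (intro power_mono h0)
        then have "ennreal (h z ^ K) \<le> ennreal (C2 ^ K * (z / ?D z) ^ K)"
          by (intro ennreal_leI) (simp only: power_mult_distrib)
        also have "\<dots> = ennreal (C2 ^ K) * ennreal ((z / ?D z) ^ K)"
          using C2 z by (intro ennreal_mult) auto
        finally show ?thesis using True by (simp add: add_increasing)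
      next
        case False
        then have "h z ^ K \<le> x0 ^ K" using h_le[of z] h0[of z] x0 by (intro power_mono) auto
        then show ?thesis using False by (simp add: ennreal_leI)
      qed
    qed
    also have "\<dots> = ennreal (x0 ^ K) * emeasure large UNIV
       + ennreal (C2 ^ K) * (\<integral>\<^sup>+z. (if x0 < z then ennreal ((z / ?D z) ^ K) else 0) \<partial>large)"
      by (subst nn_integral_add; (subst nn_integral_cmult)?) auto
    also have "\<dots> < \<infinity>" using fin1 by (auto simp: ennreal_mult_less_top L.emeasure_eq_measure)
    finally show ?thesis .
  qed
  have fin_X: "(\<integral>\<^sup>+\<omega>. ennreal (h (X \<omega> + c) ^ K) \<partial>M) < \<infinity>"
    by (rule moment_transfer[OF h_cont h0 h_add h_le K fin_h])
  obtain p b where pb: "0 < p" "0 \<le> b" "\<And>x. 0 \<le> x \<Longrightarrow> p * Am x \<le> trunc_neg M X x + b"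
    by (rule trunc_neg_lower) blast
  \<comment> \<open>Chosen so that \<open>1 + Am m \<le> C3 * trunc_neg M X m\<close> for
    \<open>m \<ge> 1\<close>: the additive error \<open>b + p\<close> is absorbed through
    \<open>trunc_neg M X 1 \<le> trunc_neg M X m\<close>.\<close>
  define C3 where "C3 = (1 + (b + p) / trunc_neg M X 1) / p"
  have C3: "0 < C3" using pb a1 by (auto simp: C3_def intro!: divide_pos_pos add_pos_nonneg)
  have bound: "m / trunc_neg M X m \<le> C3 * h m" if m: "1 \<le> m" for m
  proof -
    have am: "trunc_neg M X 1 \<le> trunc_neg M X m" using m by (intro trunc_neg_mono) auto
    have "p * (1 + Am m) \<le> trunc_neg M X m + (b + p)" using pb(3)[of m] m by (simp add: algebra_simps)
    also have "b + p \<le> (b + p) / trunc_neg M X 1 * trunc_neg M X m"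
    proof -
      have "(b + p) * 1 \<le> (b + p) * (trunc_neg M X m / trunc_neg M X 1)"
        using am a1 pb by (intro mult_left_mono) auto
      then show ?thesis by simp
    qed
    finally have "1 + Am m \<le> C3 * trunc_neg M X m"
      using pb(1) a1 by (simp add: C3_def field_simps)
    then have "m * (1 + Am m) \<le> m * (C3 * trunc_neg M X m)" using m by (intro mult_left_mono) auto
    then show ?thesis using m am a1 Am_nonneg[of m] by (simp add: h_def max_def field_simps)
  qed
  have "(\<integral>\<^sup>+\<omega>. (if 1 \<le> X \<omega> + c then ennreal (((X \<omega> + c) / trunc_neg M X (X \<omega> + c)) ^ K) else 0) \<partial>M)
    \<le> (\<integral>\<^sup>+\<omega>. ennreal (C3 ^ K) * ennreal (h (X \<omega> + c) ^ K) \<partial>M)"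
  proof (intro nn_integral_mono)
    fix \<omega>
    let ?m = "X \<omega> + c"
    show "(if 1 \<le> ?m then ennreal ((?m / trunc_neg M X ?m) ^ K) else 0) \<le> ennreal (C3 ^ K) * ennreal (h ?m ^ K)"
    proof (cases "1 \<le> ?m")
      case True
      have "(?m / trunc_neg M X ?m) ^ K \<le> (C3 * h ?m) ^ K"
        using True trunc_neg_nonneg[of ?m X] by (intro power_mono bound) auto
      then have "ennreal ((?m / trunc_neg M X ?m) ^ K) \<le> ennreal (C3 ^ K * h ?m ^ K)"
        by (intro ennreal_leI) (simp only: power_mult_distrib)
      also have "\<dots> = ennreal (C3 ^ K) * ennreal (h ?m ^ K)" using C3 h0 by (intro ennreal_mult) auto
      finally show ?thesis using True by simp
    qed simp
  qed
  also have "\<dots> = ennreal (C3 ^ K) * (\<integral>\<^sup>+\<omega>. ennreal (h (X \<omega> + c) ^ K) \<partial>M)" by (intro nn_integral_cmult) measurable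
  also have "\<dots> < \<infinity>" using fin_X by (auto simp: ennreal_mult_less_top)
  finally show ?thesis .
qed

end

section \<open>Limits of laws and of independent families\<close>

text \<open>Continuous functions decreasing to the indicator of a closed set. The empty set is
  separate because \<open>infdist\<close> to it is 0, which would give the value 1.\<close>

definition closed_approx :: "nat \<Rightarrow> 'a::metric_space set \<Rightarrow> 'a \<Rightarrow> real" where
  "closed_approx k F x = (if F = {} then 0 else max 0 (1 - real k * infdist x F))"

lemma closed_approx_range: "0 \<le> closed_approx k F x" "closed_approx k F x \<le> 1"
  by (auto simp: closed_approx_def infdist_nonneg)

lemma closed_approx_isCont: "isCont (closed_approx k F) x"
  unfolding closed_approx_def by (cases "F = {}") (auto intro!: continuous_intros)

lemma closed_approx_measurable [measurable]: "closed_approx k F \<in> borel_measurable borel"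
  by (intro borel_measurable_continuous_onI continuous_at_imp_continuous_on ballI closed_approx_isCont)

lemma closed_approx_tendsto:
  assumes "closed F"
  shows "(\<lambda>k. closed_approx k F x) \<longlonglongrightarrow> indicator F x"
proof (cases "x \<in> F")
  case True
  then have "closed_approx k F x = 1" for k
    using infdist_zero[OF True] by (auto simp: closed_approx_def)
  then show ?thesis using True by simp
next
  case False
  have "\<forall>\<^sub>F k in sequentially. closed_approx k F x = 0"
  proof (cases "F = {}")
    case nonempty: False
    define d where "d = infdist x F"
    have d: "0 < d" unfolding d_def using infdist_pos_not_in_closed[OF assms nonempty False] .
    have "\<forall>\<^sub>F k in sequentially. 1 \<le> real k * d"
      using eventually_ge_at_top[of "nat \<lceil>1 / d\<rceil>"]
    proof eventually_elim
      case (elim k)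
      then have "1 / d \<le> real k" by linarith
      then show ?case using d by (simp add: field_simps)
    qed
    then show ?thesis by eventually_elim (simp add: closed_approx_def d_def)
  qed (simp add: closed_approx_def)
  then show ?thesis using False by (simp add: tendsto_eventually)
qed

lemma Int_stable_closed: "Int_stable (Collect closed)"
  by (auto simp: Int_stable_def)

context prob_space
begin

lemma nn_integral_indep_pair:
  assumes "indep_var S Y T Z" and f [measurable]: "f \<in> borel_measurable (S \<Otimes>\<^sub>M T)"
  shows "(\<integral>\<^sup>+\<omega>. f (Y \<omega>, Z \<omega>) \<partial>M) = (\<integral>\<^sup>+\<omega>. \<integral>\<^sup>+\<omega>'. f (Y \<omega>, Z \<omega>') \<partial>M \<partial>M)"
proof -
  have [measurable]: "Y \<in> measurable M S" "Z \<in> measurable M T"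
    and eq: "distr M S Y \<Otimes>\<^sub>M distr M T Z = distr M (S \<Otimes>\<^sub>M T) (\<lambda>x. (Y x, Z x))"
    using assms(1) by (auto simp: indep_var_distribution_eq)
  interpret Y: prob_space "distr M S Y" by (rule prob_space_distr) measurable
  interpret Z: prob_space "distr M T Z" by (rule prob_space_distr) measurable
  interpret pair_prob_space "distr M S Y" "distr M T Z" ..
  have "(\<integral>\<^sup>+\<omega>. f (Y \<omega>, Z \<omega>) \<partial>M) = (\<integral>\<^sup>+z. f z \<partial>distr M (S \<Otimes>\<^sub>M T) (\<lambda>x. (Y x, Z x)))"
    by (subst nn_integral_distr) auto
  also have "\<dots> = (\<integral>\<^sup>+y. \<integral>\<^sup>+z. f (y, z) \<partial>distr M T Z \<partial>distr M S Y)"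
    unfolding eq[symmetric] by (subst Z.nn_integral_fst[symmetric]) auto
  also have "\<dots> = (\<integral>\<^sup>+\<omega>. \<integral>\<^sup>+z. f (Y \<omega>, z) \<partial>distr M T Z \<partial>M)"
    by (subst nn_integral_distr) auto
  also have "\<dots> = (\<integral>\<^sup>+\<omega>. \<integral>\<^sup>+\<omega>'. f (Y \<omega>, Z \<omega>') \<partial>M \<partial>M)"
  proof (intro nn_integral_cong)
    fix \<omega> assume "\<omega> \<in> space M"
    then have [measurable]: "Y \<omega> \<in> space S" by (rule measurable_space[OF \<open>Y \<in> measurable M S\<close>])
    show "(\<integral>\<^sup>+z. f (Y \<omega>, z) \<partial>distr M T Z) = (\<integral>\<^sup>+\<omega>'. f (Y \<omega>, Z \<omega>') \<partial>M)"
      by (subst nn_integral_distr) auto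
  qed
  finally show ?thesis .
qed

text \<open>Bounded continuous tests pass to the limit, \<open>closed_approx\<close> recovers the
  closed sets, and these form an intersection-stable generator of the Borel sets.\<close>

lemma distr_eq_limit:
  fixes U U' :: "nat \<Rightarrow> 'a \<Rightarrow> 'b::metric_space" and V V' :: "'a \<Rightarrow> 'b"
  assumes [measurable]: "\<And>r. U r \<in> borel_measurable M" "\<And>r. U' r \<in> borel_measurable M"
    "V \<in> borel_measurable M" "V' \<in> borel_measurable M"
    and lim: "\<And>\<omega>. \<omega> \<in> space M \<Longrightarrow> (\<lambda>r. U r \<omega>) \<longlonglongrightarrow> V \<omega>" "\<And>\<omega>. \<omega> \<in> space M \<Longrightarrow> (\<lambda>r. U' r \<omega>) \<longlonglongrightarrow> V' \<omega>"
    and eq: "\<And>r. distr M borel (U r) = distr M borel (U' r)"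
  shows "distr M borel V = distr M borel V'"
proof (rule measure_eqI_generator_eq[where E = "Collect closed" and \<Omega> = UNIV and A = "\<lambda>_. UNIV"])
  show "Int_stable (Collect closed :: 'b set set)" by (rule Int_stable_closed)
  show "sets (distr M borel V) = sigma_sets UNIV (Collect closed)" "sets (distr M borel V') = sigma_sets UNIV (Collect closed)"
    by (simp_all add: borel_eq_closed[where 'a = 'b])
  show "emeasure (distr M borel V) UNIV \<noteq> \<infinity>" for i :: nat
    by (simp add: emeasure_distr emeasure_eq_measure)
  fix F :: "'b set" assume "F \<in> Collect closed"
  then have F: "closed F" by simp
  then have [measurable]: "F \<in> sets borel" by simp
  have E: "(\<integral>\<omega>. closed_approx k F (V \<omega>) \<partial>M) = (\<integral>\<omega>. closed_approx k F (V' \<omega>) \<partial>M)" for k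
  proof -
    have "(\<lambda>r. \<integral>\<omega>. closed_approx k F (U r \<omega>) \<partial>M) \<longlonglongrightarrow> (\<integral>\<omega>. closed_approx k F (V \<omega>) \<partial>M)"
      by (rule integral_dominated_convergence[where w = "\<lambda>_. 1"])
         (auto intro!: AE_I2 isCont_tendsto_compose[OF closed_approx_isCont] lim simp: closed_approx_range)
    moreover have "(\<lambda>r. \<integral>\<omega>. closed_approx k F (U' r \<omega>) \<partial>M) \<longlonglongrightarrow> (\<integral>\<omega>. closed_approx k F (V' \<omega>) \<partial>M)"
      by (rule integral_dominated_convergence[where w = "\<lambda>_. 1"])
         (auto intro!: AE_I2 isCont_tendsto_compose[OF closed_approx_isCont] lim simp: closed_approx_range)
    moreover have "(\<integral>\<omega>. closed_approx k F (U r \<omega>) \<partial>M) = (\<integral>\<omega>. closed_approx k F (U' r \<omega>) \<partial>M)" for r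
      using arg_cong[OF eq[of r], of "\<lambda>N. \<integral>x. closed_approx k F x \<partial>N"] by (simp add: integral_distr)
    ultimately show ?thesis by (auto dest: LIMSEQ_unique)
  qed
  have P: "(\<lambda>k. \<integral>\<omega>. closed_approx k F (Y \<omega>) \<partial>M) \<longlonglongrightarrow> (\<integral>\<omega>. indicator F (Y \<omega>) \<partial>M)"
    if [measurable]: "Y \<in> borel_measurable M" for Y
    by (rule integral_dominated_convergence[where w = "\<lambda>_. 1"])
       (auto intro!: AE_I2 closed_approx_tendsto F simp: closed_approx_range)
  have "(\<integral>\<omega>. indicator F (V \<omega>) \<partial>M) = (\<integral>\<omega>. indicat_real F (V' \<omega>) \<partial>M)"
    using P[of V] P[of V'] unfolding E by (intro LIMSEQ_unique) auto
  moreover have "(\<integral>\<omega>. indicat_real F (Y \<omega>) \<partial>M) = measure (distr M borel Y) F"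
    if [measurable]: "Y \<in> borel_measurable M" for Y
  proof -
    have "(\<integral>\<omega>. indicat_real F (Y \<omega>) \<partial>M) = (\<integral>x. indicat_real F x \<partial>distr M borel Y)"
      by (subst integral_distr) auto
    then show ?thesis by simp
  qed
  ultimately have "measure (distr M borel V) F = measure (distr M borel V') F" by simp
  moreover interpret V: prob_space "distr M borel V" by (rule prob_space_distr) simp
  interpret V': prob_space "distr M borel V'" by (rule prob_space_distr) simp
  show "emeasure (distr M borel V) F = emeasure (distr M borel V') F"
    using calculation by (simp add: V.emeasure_eq_measure V'.emeasure_eq_measure)
qed auto

text \<open>Same scheme as for laws, with products: independence factorises expectations of products
  of continuous tests, and both sides survive the limit first in \<open>r\<close>, then in
  \<open>k\<close>.\<close>

lemma indep_vars_limit: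
  fixes U :: "nat \<Rightarrow> 'i \<Rightarrow> 'a \<Rightarrow> 'b::metric_space" and V :: "'i \<Rightarrow> 'a \<Rightarrow> 'b"
  assumes I: "finite I" "I \<noteq> {}"
    and V [measurable]: "\<And>i. i \<in> I \<Longrightarrow> V i \<in> borel_measurable M"
    and lim: "\<And>i \<omega>. i \<in> I \<Longrightarrow> \<omega> \<in> space M \<Longrightarrow> (\<lambda>r. U r i \<omega>) \<longlonglongrightarrow> V i \<omega>"
    and ind: "\<And>r. indep_vars (\<lambda>_. borel) (U r) I"
  shows "indep_vars (\<lambda>_. borel) V I"
proof (subst indep_vars_finite[where E = "\<lambda>_. Collect (closed :: 'b set \<Rightarrow> bool)"])
  have U [measurable]: "U r i \<in> borel_measurable M" if "i \<in> I" for r i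
    using ind[of r] that by (auto simp: indep_vars_def)
  show "\<forall>A\<in>I \<rightarrow> Collect (closed :: 'b set \<Rightarrow> bool). prob (\<Inter>j\<in>I. V j -` A j \<inter> space M) = (\<Prod>j\<in>I. prob (V j -` A j \<inter> space M))"
  proof
    fix A :: "'i \<Rightarrow> 'b set" assume "A \<in> I \<rightarrow> Collect closed"
    then have A: "closed (A j)" if "j \<in> I" for j using that by auto
    then have [measurable]: "A j \<in> sets borel" if "j \<in> I" for j using that by simp
    have bd: "\<bar>\<Prod>j\<in>I. closed_approx k (A j) (f j)\<bar> \<le> 1" for k f
    proof -
      have "(\<Prod>j\<in>I. closed_approx k (A j) (f j)) \<le> (\<Prod>j\<in>I. 1)"
        by (intro prod_mono) (auto simp: closed_approx_range)
      moreover have "0 \<le> (\<Prod>j\<in>I. closed_approx k (A j) (f j))"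
        by (intro prod_nonneg) (auto simp: closed_approx_range)
      ultimately show ?thesis by simp
    qed
    have E: "(\<integral>\<omega>. (\<Prod>j\<in>I. closed_approx k (A j) (V j \<omega>)) \<partial>M) = (\<Prod>j\<in>I. \<integral>\<omega>. closed_approx k (A j) (V j \<omega>) \<partial>M)" for k
    proof (rule LIMSEQ_unique)
      show "(\<lambda>r. \<integral>\<omega>. (\<Prod>j\<in>I. closed_approx k (A j) (U r j \<omega>)) \<partial>M) \<longlonglongrightarrow> (\<integral>\<omega>. (\<Prod>j\<in>I. closed_approx k (A j) (V j \<omega>)) \<partial>M)"
        by (rule integral_dominated_convergence[where w = "\<lambda>_. 1"])
           (auto intro!: AE_I2 tendsto_prod isCont_tendsto_compose[OF closed_approx_isCont] lim bd)
      have "(\<integral>\<omega>. (\<Prod>j\<in>I. closed_approx k (A j) (U r j \<omega>)) \<partial>M) = (\<Prod>j\<in>I. \<integral>\<omega>. closed_approx k (A j) (U r j \<omega>) \<partial>M)" for r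
      proof (rule indep_vars_lebesgue_integral[OF I(1)])
        show "indep_vars (\<lambda>_. borel) (\<lambda>j \<omega>. closed_approx k (A j) (U r j \<omega>)) I"
          by (rule indep_vars_compose2[OF ind]) simp
        show "integrable M (\<lambda>\<omega>. closed_approx k (A j) (U r j \<omega>))" if "j \<in> I" for j
          using that by (intro integrable_const_bound[of _ 1]) (auto simp: closed_approx_range)
      qed
      moreover have "(\<lambda>r. \<Prod>j\<in>I. \<integral>\<omega>. closed_approx k (A j) (U r j \<omega>) \<partial>M) \<longlonglongrightarrow> (\<Prod>j\<in>I. \<integral>\<omega>. closed_approx k (A j) (V j \<omega>) \<partial>M)"
      proof (intro tendsto_prod)
        fix j assume "j \<in> I"
        then show "(\<lambda>r. \<integral>\<omega>. closed_approx k (A j) (U r j \<omega>) \<partial>M) \<longlonglongrightarrow> (\<integral>\<omega>. closed_approx k (A j) (V j \<omega>) \<partial>M)"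
          by (intro integral_dominated_convergence[where w = "\<lambda>_. 1"])
             (auto intro!: AE_I2 isCont_tendsto_compose[OF closed_approx_isCont] lim simp: closed_approx_range)
      qed
      ultimately show "(\<lambda>r. \<integral>\<omega>. (\<Prod>j\<in>I. closed_approx k (A j) (U r j \<omega>)) \<partial>M) \<longlonglongrightarrow> (\<Prod>j\<in>I. \<integral>\<omega>. closed_approx k (A j) (V j \<omega>) \<partial>M)"
        by simp
    qed
    have l1: "(\<lambda>k. \<integral>\<omega>. (\<Prod>j\<in>I. closed_approx k (A j) (V j \<omega>)) \<partial>M) \<longlonglongrightarrow> (\<integral>\<omega>. (\<Prod>j\<in>I. indicator (A j) (V j \<omega>)) \<partial>M)"
      by (rule integral_dominated_convergence[where w = "\<lambda>_. 1"])
         (auto intro!: AE_I2 tendsto_prod closed_approx_tendsto A bd)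
    have l2: "(\<lambda>k. \<Prod>j\<in>I. \<integral>\<omega>. closed_approx k (A j) (V j \<omega>) \<partial>M) \<longlonglongrightarrow> (\<Prod>j\<in>I. \<integral>\<omega>. indicator (A j) (V j \<omega>) \<partial>M)"
    proof (intro tendsto_prod)
      fix j assume "j \<in> I"
      then show "(\<lambda>k. \<integral>\<omega>. closed_approx k (A j) (V j \<omega>) \<partial>M) \<longlonglongrightarrow> (\<integral>\<omega>. indicator (A j) (V j \<omega>) \<partial>M)"
        by (intro integral_dominated_convergence[where w = "\<lambda>_. 1"])
           (auto intro!: AE_I2 closed_approx_tendsto A simp: closed_approx_range)
    qed
    have eq: "(\<integral>\<omega>. (\<Prod>j\<in>I. indicat_real (A j) (V j \<omega>)) \<partial>M) = (\<Prod>j\<in>I. \<integral>\<omega>. indicat_real (A j) (V j \<omega>) \<partial>M)"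
      by (rule LIMSEQ_unique[OF l1 l2[folded E]])
    have m [measurable]: "V j -` A j \<inter> space M \<in> events" if "j \<in> I" for j
      using that by (intro measurable_sets[OF V]) auto
    have i1: "(\<integral>\<omega>. indicat_real (A j) (V j \<omega>) \<partial>M) = prob (V j -` A j \<inter> space M)" if "j \<in> I" for j
    proof -
      have "(\<integral>\<omega>. indicat_real (A j) (V j \<omega>) \<partial>M) = (\<integral>\<omega>. indicat_real (V j -` A j \<inter> space M) \<omega> \<partial>M)"
        by (intro Bochner_Integration.integral_cong) (auto simp: indicator_def)
      then show ?thesis using m[OF that] by simp
    qed
    have "(\<integral>\<omega>. (\<Prod>j\<in>I. indicat_real (A j) (V j \<omega>)) \<partial>M) = (\<integral>\<omega>. indicat_real (\<Inter>j\<in>I. V j -` A j \<inter> space M) \<omega> \<partial>M)"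
    proof (intro Bochner_Integration.integral_cong refl)
      fix \<omega> assume "\<omega> \<in> space M"
      then show "(\<Prod>j\<in>I. indicat_real (A j) (V j \<omega>)) = indicat_real (\<Inter>j\<in>I. V j -` A j \<inter> space M) \<omega>"
        using I by (auto simp: indicator_def prod_zero_iff)
    qed
    also have "\<dots> = prob (\<Inter>j\<in>I. V j -` A j \<inter> space M)"
    proof -
      have "(\<Inter>j\<in>I. V j -` A j \<inter> space M) \<in> events" using I m by (intro sets.finite_INT) auto
      then show ?thesis by simp
    qed
    finally show "prob (\<Inter>j\<in>I. V j -` A j \<inter> space M) = (\<Prod>j\<in>I. prob (V j -` A j \<inter> space M))"
      unfolding eq using i1 by (simp cong: prod.cong)
  qed
  show "sets (borel :: 'b measure) = sigma_sets (space borel) (Collect closed)"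
    by (simp add: borel_eq_closed[where 'a = 'b])
qed (use I V in \<open>auto simp: Int_stable_closed\<close>)

end

section \<open>Cadlag paths and right Riemann sums\<close>

definition cadlag :: "(real \<Rightarrow> real) \<Rightarrow> bool" where
  "cadlag x \<longleftrightarrow> (\<forall>t\<ge>0. continuous (at_right t) x \<and> (t > 0 \<longrightarrow> (\<exists>l. (x \<longlongrightarrow> l) (at_left t))))"

lemma cadlag_right_tendsto:
  assumes "cadlag x" "0 \<le> u" "\<And>n. u \<le> p n" "(p \<longlongrightarrow> u) F"
  shows "((\<lambda>n. x (p n)) \<longlongrightarrow> x u) F"
proof -
  have "(x \<longlongrightarrow> x u) (at_right u)"
    using assms(1,2) by (auto simp: cadlag_def continuous_within)
  then have "continuous (at u within {u..}) x"
    unfolding continuous_within by (simp add: at_within_Ici_at_right)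
  then show ?thesis
    by (rule continuous_within_tendsto_compose') (use assms in auto)
qed

text \<open>One-sided limits bound the path near each point, and compactness of
  \<open>[0, t]\<close> makes the bound uniform.\<close>

lemma cadlag_bounded:
  assumes "cadlag x"
  obtains B where "\<And>u. 0 \<le> u \<Longrightarrow> u \<le> t \<Longrightarrow> \<bar>x u\<bar> \<le> B"
proof -
  have loc: "\<exists>S B. open S \<and> u \<in> S \<and> (\<forall>v\<in>S. 0 \<le> v \<longrightarrow> \<bar>x v\<bar> \<le> B)" if u: "0 \<le> u" for u
  proof -
    have "(x \<longlongrightarrow> x u) (at_right u)" using assms u by (auto simp: cadlag_def continuous_within)
    then have "\<forall>\<^sub>F v in at_right u. dist (x v) (x u) < 1" by (rule tendstoD) simp
    then have r: "\<forall>\<^sub>F v in at_right u. \<bar>x v\<bar> \<le> \<bar>x u\<bar> + 1"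
      by eventually_elim (auto simp: dist_real_def)
    have "\<exists>B. \<forall>\<^sub>F v in at_left u. 0 \<le> v \<longrightarrow> \<bar>x v\<bar> \<le> B"
    proof (cases "u = 0")
      case True
      have "\<forall>\<^sub>F v in at_left (0::real). v < 0" by (auto simp: eventually_at_filter)
      then show ?thesis unfolding True by (intro exI[of _ 0]) (auto elim: eventually_mono)
    next
      case False
      then obtain l where "(x \<longlongrightarrow> l) (at_left u)" using assms u by (auto simp: cadlag_def)
      then have "\<forall>\<^sub>F v in at_left u. dist (x v) l < 1" by (rule tendstoD) simp
      then have "\<forall>\<^sub>F v in at_left u. 0 \<le> v \<longrightarrow> \<bar>x v\<bar> \<le> \<bar>l\<bar> + 1"
        by eventually_elim (auto simp: dist_real_def)
      then show ?thesis ..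
    qed
    then obtain B where l: "\<forall>\<^sub>F v in at_left u. 0 \<le> v \<longrightarrow> \<bar>x v\<bar> \<le> B" ..
    define B' where "B' = max B (\<bar>x u\<bar> + 1)"
    have "\<forall>\<^sub>F v in at_left u. 0 \<le> v \<longrightarrow> \<bar>x v\<bar> \<le> B'" using l by eventually_elim (auto simp: B'_def)
    moreover have "\<forall>\<^sub>F v in at_right u. 0 \<le> v \<longrightarrow> \<bar>x v\<bar> \<le> B'" using r by eventually_elim (auto simp: B'_def)
    ultimately have "\<forall>\<^sub>F v in at u. 0 \<le> v \<longrightarrow> \<bar>x v\<bar> \<le> B'"
      by (simp add: eventually_at_split)
    then have "\<forall>\<^sub>F v in nhds u. 0 \<le> v \<longrightarrow> \<bar>x v\<bar> \<le> B'"
      by (auto simp: eventually_nhds_conv_at B'_def)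
    then show ?thesis unfolding eventually_nhds by blast
  qed
  define S where "S u = (SOME S. \<exists>B. open S \<and> u \<in> S \<and> (\<forall>v\<in>S. 0 \<le> v \<longrightarrow> \<bar>x v\<bar> \<le> B))" for u
  have S: "\<exists>B. open (S u) \<and> u \<in> S u \<and> (\<forall>v\<in>S u. 0 \<le> v \<longrightarrow> \<bar>x v\<bar> \<le> B)" if "0 \<le> u" for u
    unfolding S_def by (rule someI_ex) (rule loc[OF that])
  have op: "\<And>u. u \<in> {0..t} \<Longrightarrow> open (S u)" and cov: "{0..t} \<subseteq> (\<Union>u\<in>{0..t}. S u)"
    using S by fastforce+
  obtain C where C: "C \<subseteq> {0..t}" "finite C" "{0..t} \<subseteq> (\<Union>u\<in>C. S u)"
    using compactE_image[OF compact_Icc op cov] by metis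
  have "\<forall>u\<in>C. \<exists>B. \<forall>v\<in>S u. 0 \<le> v \<longrightarrow> \<bar>x v\<bar> \<le> B" 
  proof
    fix u assume "u \<in> C"
    then have "0 \<le> u" using C(1) by auto
    from S[OF this] show "\<exists>B. \<forall>v\<in>S u. 0 \<le> v \<longrightarrow> \<bar>x v\<bar> \<le> B" by blast
  qed
  then obtain B where B: "\<And>u v. u \<in> C \<Longrightarrow> v \<in> S u \<Longrightarrow> 0 \<le> v \<Longrightarrow> \<bar>x v\<bar> \<le> B u" by metis
  show ?thesis
  proof (rule that[of "\<Sum>u\<in>C. \<bar>B u\<bar>"])
    fix v assume v: "0 \<le> v" "v \<le> t"
    then obtain u where u: "u \<in> C" "v \<in> S u" using C(3) by auto
    have "\<bar>x v\<bar> \<le> \<bar>B u\<bar>" using B[OF u v(1)] by simp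
    also have "\<dots> \<le> (\<Sum>u\<in>C. \<bar>B u\<bar>)" using u C by (intro member_le_sum) auto
    finally show "\<bar>x v\<bar> \<le> (\<Sum>u\<in>C. \<bar>B u\<bar>)" .
  qed
qed

text \<open>Rounding up, never down: only right continuity of the path is available.\<close>

definition grid_point :: "real \<Rightarrow> real \<Rightarrow> real \<Rightarrow> real" where
  "grid_point s h u = s + of_int \<lceil>(u - s) / h\<rceil> * h"

lemma grid_point_bounds:
  assumes "0 < h"
  shows "u \<le> grid_point s h u" "grid_point s h u \<le> u + h"
proof -
  have "(u - s) / h \<le> of_int \<lceil>(u - s) / h\<rceil>" "of_int \<lceil>(u - s) / h\<rceil> \<le> (u - s) / h + 1" by linarith+
  then have "(u - s) / h * h \<le> of_int \<lceil>(u - s) / h\<rceil> * h" "of_int \<lceil>(u - s) / h\<rceil> * h \<le> ((u - s) / h + 1) * h"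
    using mult_right_mono[OF _ less_imp_le[OF assms]] by blast+
  then show "u \<le> grid_point s h u" "grid_point s h u \<le> u + h"
    using assms by (auto simp: grid_point_def distrib_right)
qed

lemma grid_point_index:
  assumes h: "0 < h" and u: "s < u" "u \<le> s + real n * h"
  obtains k where "k < n" "grid_point s h u = s + real (Suc k) * h" "s + real k * h < u" "u \<le> s + real (Suc k) * h"
    "\<And>j. s + real j * h < u \<Longrightarrow> u \<le> s + real (Suc j) * h \<Longrightarrow> j = k"
proof -
  define v where "v = (u - s) / h"
  have v: "0 < v" "v \<le> real n" using h u by (auto simp: v_def field_simps)
  define k where "k = nat (\<lceil>v\<rceil> - 1)"
  have c: "1 \<le> \<lceil>v\<rceil>" using v by linarith
  then have k: "\<lceil>v\<rceil> = int k + 1" by (simp add: k_def)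
  then have kv: "real k < v" "v \<le> real k + 1" by linarith+
  have u_eq: "u = s + v * h" using h by (simp add: v_def)
  show ?thesis
  proof (rule that[of k])
    show "k < n" using kv v by linarith
    show "grid_point s h u = s + real (Suc k) * h"
      unfolding grid_point_def v_def[symmetric] k by (simp add: add.commute)
    show "s + real k * h < u" "u \<le> s + real (Suc k) * h"
      unfolding u_eq using kv h by (auto simp: add.commute)
    fix j assume "s + real j * h < u" "u \<le> s + real (Suc j) * h"
    then have "real j < v" "v \<le> real j + 1" unfolding u_eq using h by (auto simp: add.commute)
    then show "j = k" using kv by linarith
  qed
qed

text \<open>The Riemann sum is the integral of the step function
  \<open>f (grid_point s (h n) u)\<close>. Its argument tends to \<open>u\<close> from the right, so
  right continuity and boundedness suffice for dominated convergence.\<close>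

lemma riemann_sum_tendsto:
  fixes f :: "real \<Rightarrow> real"
  assumes st: "s < t" and [measurable]: "f \<in> borel_measurable borel"
    and bd: "\<And>u. s \<le> u \<Longrightarrow> u \<le> t \<Longrightarrow> \<bar>f u\<bar> \<le> B"
    and right: "\<And>u p. s \<le> u \<Longrightarrow> u \<le> t \<Longrightarrow> (\<And>n::nat. u \<le> p n) \<Longrightarrow> p \<longlonglongrightarrow> u \<Longrightarrow> (\<lambda>n. f (p n)) \<longlonglongrightarrow> f u"
    and N: "\<And>n. 0 < N n" "filterlim N at_top sequentially"
  shows "(\<lambda>n. \<Sum>k<N n. (t - s) / N n * f (s + real (Suc k) * ((t - s) / N n))) \<longlonglongrightarrow> (\<integral>u. indicator {s..t} u * f u \<partial>lborel)"
proof -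
  define h where "h n = (t - s) / N n" for n
  have h: "0 < h n" "s + real (N n) * h n = t" for n using st N(1)[of n] by (auto simp: h_def)
  have h_lim: "h \<longlonglongrightarrow> 0"
    unfolding h_def by (intro real_tendsto_divide_at_top[OF tendsto_const] filterlim_compose[OF filterlim_real_sequentially N(2)])
  define F where "F n u = (\<Sum>k<N n. f (s + real (Suc k) * h n) * indicator {s + real k * h n<..s + real (Suc k) * h n} u)" for n u
  have F_int: "(\<integral>u. F n u \<partial>lborel) = (\<Sum>k<N n. h n * f (s + real (Suc k) * h n))" for n
  proof -
    have "(\<integral>u. F n u \<partial>lborel) = (\<Sum>k<N n. \<integral>u. f (s + real (Suc k) * h n) * indicator {s + real k * h n<..s + real (Suc k) * h n} u \<partial>lborel)"
      unfolding F_def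
    proof (rule Bochner_Integration.integral_sum)
      fix k
      have "s + real k * h n \<le> s + real (Suc k) * h n" using h(1)[of n] by simp
      then show "integrable lborel (\<lambda>u. f (s + real (Suc k) * h n) * indicator {s + real k * h n<..s + real (Suc k) * h n} u)"
        by (intro integrable_mult_right integrable_real_indicator) (simp_all del: of_nat_Suc)
    qed
    also have "\<dots> = (\<Sum>k<N n. h n * f (s + real (Suc k) * h n))"
    proof (intro sum.cong refl)
      fix k
      have "s + real k * h n \<le> s + real (Suc k) * h n" using h(1)[of n] by simp
      then show "(\<integral>u. f (s + real (Suc k) * h n) * indicator {s + real k * h n<..s + real (Suc k) * h n} u \<partial>lborel) = h n * f (s + real (Suc k) * h n)"
        using h(1)[of n] by (simp add: algebra_simps)
    qed
    finally show ?thesis .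
  qed
  have F_eq: "F n u = f (grid_point s (h n) u)" "grid_point s (h n) u \<le> t" if u: "s < u" "u \<le> t" for n u
  proof -
    obtain k where k: "k < N n" "grid_point s (h n) u = s + real (Suc k) * h n" "s + real k * h n < u" "u \<le> s + real (Suc k) * h n"
      "\<And>j. s + real j * h n < u \<Longrightarrow> u \<le> s + real (Suc j) * h n \<Longrightarrow> j = k"
    proof -
      have un: "u \<le> s + real (N n) * h n" using u h(2)[of n] by simp
      show thesis by (rule grid_point_index[OF h(1) u(1) un]) (rule that; blast)
    qed
    have "F n u = (\<Sum>j\<in>{k}. f (s + real (Suc j) * h n) * indicator {s + real j * h n<..s + real (Suc j) * h n} u)"
      unfolding F_def
    proof (rule sum.mono_neutral_right)
      show "\<forall>i\<in>{..<N n} - {k}. f (s + real (Suc i) * h n) * indicator {s + real i * h n<..s + real (Suc i) * h n} u = 0"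
        using k(5) by (auto simp: indicator_def simp del: of_nat_Suc)
    qed (use k(1) in auto)
    then show "F n u = f (grid_point s (h n) u)" using k(2,3,4) by (simp add: indicator_def del: of_nat_Suc)
    have "real (Suc k) * h n \<le> real (N n) * h n" using k(1) h(1)[of n] by (intro mult_right_mono) auto
    then show "grid_point s (h n) u \<le> t" unfolding k(2) using h(2)[of n] by linarith
  qed
  have F_out: "F n u = 0" if "u \<le> s \<or> t < u" for n u
  proof -
    have "u \<notin> {s + real k * h n<..s + real (Suc k) * h n}" if "k < N n" for k
    proof
      assume "u \<in> {s + real k * h n<..s + real (Suc k) * h n}"
      moreover have "0 \<le> real k * h n" using h(1)[of n] by simp
      moreover have "real (Suc k) * h n \<le> real (N n) * h n" using that h(1)[of n] by (intro mult_right_mono) auto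
      ultimately show False using \<open>u \<le> s \<or> t < u\<close> h(2)[of n] by auto
    qed
    then show ?thesis unfolding F_def by (intro sum.neutral) auto
  qed
  have "(\<lambda>n. \<integral>u. F n u \<partial>lborel) \<longlonglongrightarrow> (\<integral>u. indicator {s..t} u * f u \<partial>lborel)"
  proof (rule integral_dominated_convergence[where w = "\<lambda>u. B * indicator {s..t} u"])
    show "integrable lborel (\<lambda>u. B * indicator {s..t} u)" by (intro integrable_mult_right integrable_real_indicator) (use st in auto)
    show "AE u in lborel. (\<lambda>n. F n u) \<longlonglongrightarrow> indicator {s..t} u * f u"
      using AE_lborel_singleton[of s]
    proof eventually_elim
      case (elim u)
      show ?case
      proof (cases "s < u \<and> u \<le> t")
        case True
        have "(\<lambda>n. grid_point s (h n) u) \<longlonglongrightarrow> u"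
          by (rule tendsto_sandwich[of "\<lambda>_. u" _ _ "\<lambda>n. u + h n"])
             (use grid_point_bounds h tendsto_add[OF tendsto_const h_lim, of u] in auto)
        then have "(\<lambda>n. f (grid_point s (h n) u)) \<longlonglongrightarrow> f u"
          using True grid_point_bounds h by (intro right) auto
        then show ?thesis using True F_eq(1) by simp
      next
        case False
        then have "u \<le> s \<or> t < u" "u \<notin> {s..t}" using elim by auto
        then show ?thesis using F_out by simp
      qed
    qed
    show "AE u in lborel. norm (F n u) \<le> B * indicator {s..t} u" for n
    proof (intro AE_I2)
      fix u
      show "norm (F n u) \<le> B * indicator {s..t} u"
      proof (cases "s < u \<and> u \<le> t")
        case True
        have "\<bar>f (grid_point s (h n) u)\<bar> \<le> B"
          using True F_eq(2)[of u n] grid_point_bounds[OF h(1)[of n], of u s] by (intro bd) auto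
        then show ?thesis using True F_eq(1) by simp
      next
        case False
        then have "F n u = 0" using F_out by auto
        moreover have "0 \<le> B" using bd[of s] st by auto
        ultimately show ?thesis by simp
      qed
    qed
    show "F n \<in> borel_measurable lborel" for n unfolding F_def by measurable
  qed measurable
  then show ?thesis unfolding F_int by (simp add: h_def)
qed

section \<open>Functionals of the path of a Levy process\<close>

locale levy = prob_space M for M :: "'a measure" +
  fixes X :: "real \<Rightarrow> 'a \<Rightarrow> real"
  assumes levy: "levy_process M X"
begin

lemma X_measurable [measurable]: "0 \<le> t \<Longrightarrow> X t \<in> borel_measurable M"
  using levy by (auto simp: levy_process_def)

lemma X_0: "\<omega> \<in> space M \<Longrightarrow> X 0 \<omega> = 0"
  using levy by (auto simp: levy_process_def)

lemma X_cadlag: "\<omega> \<in> space M \<Longrightarrow> cadlag (\<lambda>u. X u \<omega>)"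
  using levy unfolding levy_process_def cadlag_def by blast

lemma X_stationary: "0 \<le> s \<Longrightarrow> 0 \<le> t \<Longrightarrow> distr M borel (\<lambda>\<omega>. X (s + t) \<omega> - X s \<omega>) = distr M borel (X t)"
  using levy by (auto simp: levy_process_def)

lemma X_indep:
  assumes "0 \<le> ts 0" "\<And>i::nat. i < n \<Longrightarrow> ts i \<le> ts (Suc i)"
  shows "indep_vars (\<lambda>_. borel) (\<lambda>i \<omega>. X (ts (Suc i)) \<omega> - X (ts i) \<omega>) {..<n}"
proof -
  have "\<forall>(n::nat) (ts::nat \<Rightarrow> real). 0 \<le> ts 0 \<and> (\<forall>i<n. ts i \<le> ts (Suc i)) \<longrightarrow>
         prob_space.indep_vars M (\<lambda>_. borel) (\<lambda>i \<omega>. X (ts (Suc i)) \<omega> - X (ts i) \<omega>) {..<n}"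
    using levy unfolding levy_process_def by blast
  then show ?thesis using assms by blast
qed

text \<open>Freezing the process at negative times removes side conditions from measurability
  statements over the whole time line.\<close>

definition path :: "real \<Rightarrow> 'a \<Rightarrow> real" where "path u \<omega> = X (max u 0) \<omega>"

text \<open>Moving the time to the right onto a grid of mesh \<open>1 / Suc n\<close> leaves
  countably many values, and right continuity gives the limit.\<close>

lemma path_measurable: "(\<lambda>(u, \<omega>). path u \<omega>) \<in> borel_measurable (borel \<Otimes>\<^sub>M M)"
proof (rule borel_measurable_LIMSEQ_metric)
  show "(\<lambda>(u, \<omega>). X (real (nat \<lfloor>max u 0 * real (Suc n)\<rfloor> + 1) / real (Suc n)) \<omega>) \<in> borel_measurable (borel \<Otimes>\<^sub>M M)" for n
  proof -
    have "(\<lambda>z. X (real (nat \<lfloor>max (fst z) 0 * real (Suc n)\<rfloor> + 1) / real (Suc n)) (snd z)) \<in> borel_measurable (borel \<Otimes>\<^sub>M M)"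
      by (rule measurable_compose_countable[where f = "\<lambda>k z. X (real (k + 1) / real (Suc n)) (snd z)" and g = "\<lambda>z. nat \<lfloor>max (fst z) 0 * real (Suc n)\<rfloor>"])
         measurable
    then show ?thesis by (simp add: case_prod_beta')
  qed
  fix z assume "z \<in> space (borel \<Otimes>\<^sub>M M :: (real \<times> 'a) measure)"
  then obtain u \<omega> where z: "z = (u, \<omega>)" "\<omega> \<in> space M" by (auto simp: space_pair_measure)
  define v where "v = max u 0"
  let ?p = "\<lambda>n. real (nat \<lfloor>v * real (Suc n)\<rfloor> + 1) / real (Suc n)"
  have p: "v \<le> ?p n" "?p n \<le> v + 1 / real (Suc n)" for n
  proof -
    have f: "0 \<le> \<lfloor>v * real (Suc n)\<rfloor>" by (simp add: v_def)
    then have r: "real (nat \<lfloor>v * real (Suc n)\<rfloor> + 1) = of_int \<lfloor>v * real (Suc n)\<rfloor> + 1" by simp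
    have "v * real (Suc n) \<le> of_int \<lfloor>v * real (Suc n)\<rfloor> + 1" "of_int \<lfloor>v * real (Suc n)\<rfloor> + 1 \<le> v * real (Suc n) + 1"
      by linarith+
    then show "v \<le> ?p n" "?p n \<le> v + 1 / real (Suc n)"
      unfolding r by (simp_all add: field_simps del: of_nat_Suc)
  qed
  have "(\<lambda>n. 1 / real (Suc n)) \<longlonglongrightarrow> 0" by (rule LIMSEQ_Suc[OF lim_1_over_n])
  then have "?p \<longlonglongrightarrow> v"
    by (intro tendsto_sandwich[of "\<lambda>_. v" ?p _ "\<lambda>n. v + 1 / real (Suc n)"])
       (use p tendsto_add[OF tendsto_const, of "\<lambda>n. 1 / real (Suc n)" 0 sequentially v] in \<open>auto simp del: of_nat_Suc\<close>)
  then have "(\<lambda>n. X (?p n) \<omega>) \<longlonglongrightarrow> X v \<omega>"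
    using p by (intro cadlag_right_tendsto[OF X_cadlag[OF z(2)]]) (auto simp: v_def)
  then show "(\<lambda>n. (\<lambda>(u, \<omega>). X (real (nat \<lfloor>max u 0 * real (Suc n)\<rfloor> + 1) / real (Suc n)) \<omega>) z) \<longlonglongrightarrow> (\<lambda>(u, \<omega>). path u \<omega>) z"
    by (simp add: z path_def v_def)
qed

lemma path_measurable' [measurable (raw)]:
  assumes [measurable]: "f \<in> borel_measurable N" "g \<in> measurable N M"
  shows "(\<lambda>x. path (f x) (g x)) \<in> borel_measurable N"
proof -
  have "(\<lambda>x. (f x, g x)) \<in> measurable N (borel \<Otimes>\<^sub>M M)" by measurable
  from measurable_compose[OF this path_measurable] show ?thesis by simp
qed

lemma path_section: "\<omega> \<in> space M \<Longrightarrow> (\<lambda>u. path u \<omega>) \<in> borel_measurable borel"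
  using measurable_Pair2[OF path_measurable] by simp

lemma path_eq: "0 \<le> u \<Longrightarrow> path u \<omega> = X u \<omega>"
  by (simp add: path_def)

lemma path_bounded:
  assumes "\<omega> \<in> space M"
  obtains C where "0 \<le> C" "\<And>u. u \<le> t \<Longrightarrow> \<bar>path u \<omega>\<bar> \<le> C"
proof -
  obtain C where C: "\<And>u. 0 \<le> u \<Longrightarrow> u \<le> max t 0 \<Longrightarrow> \<bar>X u \<omega>\<bar> \<le> C"
    by (rule cadlag_bounded[OF X_cadlag[OF assms]]) blast
  show ?thesis
  proof (rule that[of C])
    show "0 \<le> C" using C[of 0] by auto
    show "\<bar>path u \<omega>\<bar> \<le> C" if "u \<le> t" for u unfolding path_def using that by (intro C) auto
  qed
qed

lemma exp_path_integrable:
  assumes "\<omega> \<in> space M"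
  shows "integrable lborel (\<lambda>u. indicator {s..t} u * exp (c * path u \<omega>))"
proof -
  obtain C where C: "0 \<le> C" "\<And>u. u \<le> t \<Longrightarrow> \<bar>path u \<omega>\<bar> \<le> C" by (rule path_bounded[OF assms, of t]) blast
  note [measurable] = path_section[OF assms]
  show ?thesis
  proof (rule Bochner_Integration.integrable_bound)
    show "integrable lborel (\<lambda>u. exp (\<bar>c\<bar> * C) * indicator {s..t} u)"
      by (intro integrable_mult_right integrable_real_indicator) (auto simp: emeasure_lborel_Icc_eq)
    show "AE u in lborel. norm (indicator {s..t} u * exp (c * path u \<omega>)) \<le> norm (exp (\<bar>c\<bar> * C) * indicator {s..t} u)"
    proof (intro AE_I2)
      fix u
      have "c * path u \<omega> \<le> \<bar>c\<bar> * C" if "u \<le> t"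
      proof -
        have "c * path u \<omega> \<le> \<bar>c\<bar> * \<bar>path u \<omega>\<bar>" by (metis abs_ge_self abs_mult)
        also have "\<dots> \<le> \<bar>c\<bar> * C" using C(2)[OF that] by (intro mult_left_mono) auto
        finally show ?thesis .
      qed
      then show "norm (indicator {s..t} u * exp (c * path u \<omega>)) \<le> norm (exp (\<bar>c\<bar> * C) * indicator {s..t} u)"
        by (auto simp: indicator_def)
    qed
  qed measurable
qed

text \<open>The functional of a block \<open>[s, t]\<close> of the path: exponential integral, increment, and
  final value minus infimum, all relative to the start of the block.\<close>
definition J :: "real \<Rightarrow> real \<Rightarrow> real \<Rightarrow> 'a \<Rightarrow> real" where
  "J c s t \<omega> = (\<integral>u. indicator {s..t} u * exp (c * (path u \<omega> - path s \<omega>)) \<partial>lborel)"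

definition D :: "real \<Rightarrow> real \<Rightarrow> 'a \<Rightarrow> real" where
  "D s t \<omega> = path t \<omega> - path s \<omega>"

definition H :: "real \<Rightarrow> real \<Rightarrow> 'a \<Rightarrow> real" where
  "H s t \<omega> = (SUP u\<in>{s..t}. path t \<omega> - path u \<omega>)"

definition V :: "real \<Rightarrow> real \<Rightarrow> 'a \<Rightarrow> real \<times> real \<times> real" where
  "V s t \<omega> = (J 1 s t \<omega>, D s t \<omega>, H s t \<omega>)"

definition incr :: "nat \<Rightarrow> real \<Rightarrow> real \<Rightarrow> nat \<Rightarrow> 'a \<Rightarrow> real" where
  "incr N s t k \<omega> = path (s + real (Suc k) * ((t - s) / N)) \<omega> - path (s + real k * ((t - s) / N)) \<omega>"

text \<open>The grid quantities are functions of the increment vector alone, so the joint law of the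
  increments determines their laws and their independence.\<close>

definition J_grid :: "real \<Rightarrow> nat \<Rightarrow> real \<Rightarrow> (nat \<Rightarrow> real) \<Rightarrow> real" where
  "J_grid c N l \<delta> = (\<Sum>k<N. l / N * exp (c * (\<Sum>j<Suc k. \<delta> j)))"

definition V_grid :: "nat \<Rightarrow> real \<Rightarrow> (nat \<Rightarrow> real) \<Rightarrow> real \<times> real \<times> real" where
  "V_grid N l \<delta> = (J_grid 1 N l \<delta>, \<Sum>j<N. \<delta> j, MAX k\<in>{..N}. (\<Sum>j<N. \<delta> j) - (\<Sum>j<k. \<delta> j))"

lemma J_measurable [measurable]: "J c s t \<in> borel_measurable M"
  unfolding J_def by measurable

lemma sum_incr:
  "(\<Sum>j<k. incr N s t j \<omega>) = path (s + real k * ((t - s) / N)) \<omega> - path s \<omega>"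
  unfolding incr_def using sum_lessThan_telescope[of "\<lambda>k. path (s + real k * ((t - s) / N)) \<omega>" k]
  by simp

lemma path_right_tendsto:
  assumes "\<omega> \<in> space M" "0 \<le> u" "\<And>n. u \<le> p n" "(p \<longlongrightarrow> u) F"
  shows "((\<lambda>n. path (p n) \<omega>) \<longlongrightarrow> path u \<omega>) F"
proof -
  have "((\<lambda>n. X (p n) \<omega>) \<longlongrightarrow> X u \<omega>) F"
    by (rule cadlag_right_tendsto[OF X_cadlag]) (use assms in auto)
  moreover have "path (p n) \<omega> = X (p n) \<omega>" for n using assms(2) assms(3)[of n] by (intro path_eq) simp
  ultimately show ?thesis using assms(2) by (simp add: path_eq)
qed

lemma exp_riemann:
  assumes \<omega>: "\<omega> \<in> space M" and st: "0 \<le> s" "s < t"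
    and N: "\<And>n. 0 < N n" "filterlim N at_top sequentially"
  shows "(\<lambda>n. \<Sum>k<N n. (t - s) / N n * exp (c * (path (s + real (Suc k) * ((t - s) / N n)) \<omega> - a)))
    \<longlonglongrightarrow> (\<integral>u. indicator {s..t} u * exp (c * (path u \<omega> - a)) \<partial>lborel)"
proof -
  note [measurable] = path_section[OF \<omega>]
  obtain C where C: "0 \<le> C" "\<And>u. u \<le> t \<Longrightarrow> \<bar>path u \<omega>\<bar> \<le> C" by (rule path_bounded[OF \<omega>, of t]) blast
  show ?thesis
  proof (rule riemann_sum_tendsto[OF st(2), where B = "exp (\<bar>c\<bar> * (C + \<bar>a\<bar>))"])
    fix u assume u: "s \<le> u" "u \<le> t"
    have "c * (path u \<omega> - a) \<le> \<bar>c\<bar> * \<bar>path u \<omega> - a\<bar>" by (metis abs_ge_self abs_mult)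
    also have "\<dots> \<le> \<bar>c\<bar> * (C + \<bar>a\<bar>)" using C(2)[OF u(2)] by (intro mult_left_mono) auto
    finally show "\<bar>exp (c * (path u \<omega> - a))\<bar> \<le> exp (\<bar>c\<bar> * (C + \<bar>a\<bar>))" by simp
  next
    fix u and p :: "nat \<Rightarrow> real" assume u: "s \<le> u" "u \<le> t" "\<And>n. u \<le> p n" "p \<longlonglongrightarrow> u"
    show "(\<lambda>n. exp (c * (path (p n) \<omega> - a))) \<longlonglongrightarrow> exp (c * (path u \<omega> - a))"
      by (intro tendsto_intros path_right_tendsto[OF \<omega>]) (use u st in auto)
  qed (use N in auto)
qed

lemma J_grid_tendsto:
  assumes \<omega>: "\<omega> \<in> space M" and st: "0 \<le> s" "s < t"
  shows "(\<lambda>r. J_grid c (2 ^ r) (t - s) (\<lambda>k. incr (2 ^ r) s t k \<omega>)) \<longlonglongrightarrow> J c s t \<omega>"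
proof -
  have "filterlim (\<lambda>r::nat. 2 ^ r :: nat) at_top sequentially"
    by (rule filterlim_subseq) (auto intro!: strict_monoI power_strict_increasing)
  from exp_riemann[OF \<omega> st _ this, of c "path s \<omega>"] show ?thesis
    unfolding J_grid_def J_def sum_incr by simp
qed

lemma H_bdd:
  assumes \<omega>: "\<omega> \<in> space M"
  shows "bdd_above ((\<lambda>u. path t \<omega> - path u \<omega>) ` {s..t})"
proof -
  obtain C where C: "0 \<le> C" "\<And>u. u \<le> t \<Longrightarrow> \<bar>path u \<omega>\<bar> \<le> C" by (rule path_bounded[OF \<omega>, of t]) blast
  have "path t \<omega> - path u \<omega> \<le> C + C" if "u \<in> {s..t}" for u
    using C(2)[of t] C(2)[of u] that by (auto simp: abs_le_iff)
  then show ?thesis by (intro bdd_aboveI2[of _ _ "C + C"]) auto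
qed

lemma H_upper: "\<omega> \<in> space M \<Longrightarrow> s \<le> u \<Longrightarrow> u \<le> t \<Longrightarrow> path t \<omega> - path u \<omega> \<le> H s t \<omega>"
  unfolding H_def by (rule cSUP_upper[OF _ H_bdd]) auto

lemma H_nonneg: "\<omega> \<in> space M \<Longrightarrow> s \<le> t \<Longrightarrow> 0 \<le> H s t \<omega>"
  using H_upper[of \<omega> s t t] by simp

lemma D_le_H: "\<omega> \<in> space M \<Longrightarrow> s \<le> t \<Longrightarrow> D s t \<omega> \<le> H s t \<omega>"
  using H_upper[of \<omega> s s t] by (simp add: D_def)

text \<open>Grid maxima never exceed the supremum. Conversely a near-maximiser is approached from
  the right by grid points, along which the path converges to its value.\<close>

lemma H_grid_tendsto:
  assumes \<omega>: "\<omega> \<in> space M" and st: "0 \<le> s" "s < t"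
  shows "(\<lambda>r. MAX k\<in>{..2 ^ r}. path t \<omega> - path (s + real k * ((t - s) / 2 ^ r)) \<omega>) \<longlonglongrightarrow> H s t \<omega>"
proof (rule order_tendstoI)
  define h where "h r = (t - s) / 2 ^ r" for r :: nat
  have h: "0 < h r" "s + 2 ^ r * h r = t" for r using st by (auto simp: h_def)
  have grid: "s + real k * h r \<in> {s..t}" if "k \<le> 2 ^ r" for k r
  proof -
    have "real k * h r \<le> 2 ^ r * h r" using that h(1)[of r] by (intro mult_right_mono) auto
    then show ?thesis using h[of r] by auto
  qed
  have fin: "finite ((\<lambda>k. path t \<omega> - path (s + real k * h r) \<omega>) ` {..2 ^ r})"
    "(\<lambda>k. path t \<omega> - path (s + real k * h r) \<omega>) ` {..2 ^ r} \<noteq> {}" for r by auto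
  fix a
  show "\<forall>\<^sub>F r in sequentially. (MAX k\<in>{..2 ^ r}. path t \<omega> - path (s + real k * ((t - s) / 2 ^ r)) \<omega>) < a" if "H s t \<omega> < a"
  proof (intro always_eventually allI)
    fix r
    have "(MAX k\<in>{..2 ^ r}. path t \<omega> - path (s + real k * h r) \<omega>) \<le> H s t \<omega>"
      using grid by (subst Max_le_iff[OF fin]) (auto intro!: H_upper[OF \<omega>])
    from order.strict_trans1[OF this that]
    show "(MAX k\<in>{..2 ^ r}. path t \<omega> - path (s + real k * ((t - s) / 2 ^ r)) \<omega>) < a"
      by (simp only: h_def)
  qed
  show "\<forall>\<^sub>F r in sequentially. a < (MAX k\<in>{..2 ^ r}. path t \<omega> - path (s + real k * ((t - s) / 2 ^ r)) \<omega>)" if a: "a < H s t \<omega>"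
  proof -
    obtain u where u: "u \<in> {s..t}" "a < path t \<omega> - path u \<omega>"
      using a less_cSUP_iff[OF _ H_bdd[OF \<omega>], of s t a] st by (auto simp: H_def)
    have pu: "\<exists>k\<le>2 ^ r. grid_point s (h r) u = s + real k * h r" for r
    proof (cases "s < u")
      case True
      have "u \<le> s + real (2 ^ r) * h r" using u h(2)[of r] by simp
      from grid_point_index[OF h(1) True this] show ?thesis by (metis Suc_leI)
    next
      case False
      then show ?thesis using u by (intro exI[of _ 0]) (auto simp: grid_point_def)
    qed
    have h_lim: "h \<longlonglongrightarrow> 0" unfolding h_def by real_asymp
    have "(\<lambda>r. grid_point s (h r) u) \<longlonglongrightarrow> u"
      by (rule tendsto_sandwich[of "\<lambda>_. u" _ _ "\<lambda>n. u + h n"])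
         (use grid_point_bounds h tendsto_add[OF tendsto_const h_lim, of u] in auto)
    then have "(\<lambda>r. path (grid_point s (h r) u) \<omega>) \<longlonglongrightarrow> path u \<omega>"
      by (intro path_right_tendsto[OF \<omega>]) (use u st grid_point_bounds h in auto)
    then have "(\<lambda>r. path t \<omega> - path (grid_point s (h r) u) \<omega>) \<longlonglongrightarrow> path t \<omega> - path u \<omega>"
      by (intro tendsto_intros)
    then have "\<forall>\<^sub>F r in sequentially. a < path t \<omega> - path (grid_point s (h r) u) \<omega>"
      using u(2) by (rule order_tendstoD)
    then show ?thesis
    proof eventually_elim
      case (elim r)
      obtain k where k: "k \<le> 2 ^ r" "grid_point s (h r) u = s + real k * h r" using pu by blast
      have "a < path t \<omega> - path (s + real k * h r) \<omega>" using elim k(2) by simp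
      also have "\<dots> \<le> (MAX k\<in>{..2 ^ r}. path t \<omega> - path (s + real k * h r) \<omega>)"
        using k by (intro Max_ge fin) auto
      finally show ?case by (simp only: h_def)
    qed
  qed
qed

lemma V_grid_tendsto:
  assumes \<omega>: "\<omega> \<in> space M" and st: "0 \<le> s" "s < t"
  shows "(\<lambda>r. V_grid (2 ^ r) (t - s) (\<lambda>k. incr (2 ^ r) s t k \<omega>)) \<longlonglongrightarrow> V s t \<omega>"
proof -
  have e: "(\<Sum>j<2 ^ r. incr (2 ^ r) s t j \<omega>) = D s t \<omega>" for r
    unfolding sum_incr D_def by simp
  have "(MAX k\<in>{..2 ^ r}. D s t \<omega> - (\<Sum>j<k. incr (2 ^ r) s t j \<omega>))
    = (MAX k\<in>{..2 ^ r}. path t \<omega> - path (s + real k * ((t - s) / 2 ^ r)) \<omega>)" for r :: nat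
    unfolding sum_incr D_def by simp
  then show ?thesis
    unfolding V_grid_def V_def e
    using J_grid_tendsto[OF assms, of 1] H_grid_tendsto[OF assms] by (intro tendsto_Pair) auto
qed

lemma J_grid_measurable [measurable]: "J_grid c N l \<in> borel_measurable (PiM {..<N} (\<lambda>_. borel))"
  unfolding J_grid_def by measurable

lemma V_grid_measurable [measurable]:
  "V_grid N l \<in> borel_measurable (PiM {..<N} (\<lambda>_. borel))"
proof -
  have "(\<lambda>\<delta>. \<Sum>j<k. \<delta> j) \<in> borel_measurable (PiM {..<N} (\<lambda>_. borel :: real measure))" if "k \<le> N" for k
    using that by (intro borel_measurable_sum measurable_component_singleton) auto
  then have "(\<lambda>\<delta>. MAX k\<in>{..N}. (\<Sum>j<N. \<delta> j) - (\<Sum>j<k. \<delta> j)) \<in> borel_measurable (PiM {..<N} (\<lambda>_. borel :: real measure))"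
    by (intro borel_measurable_Max borel_measurable_diff) auto
  then show ?thesis unfolding V_grid_def by (intro borel_measurable_Pair) measurable
qed

lemma sum_restrict: "k \<le> N \<Longrightarrow> (\<Sum>j<k. restrict \<delta> {..<N} j) = (\<Sum>j<k. \<delta> j)" for \<delta> :: "nat \<Rightarrow> real"
  by (intro sum.cong) auto

lemma J_grid_restrict: "J_grid c N l (restrict \<delta> {..<N}) = J_grid c N l \<delta>"
  unfolding J_grid_def
proof (intro sum.cong refl)
  fix k assume "k \<in> {..<N}"
  then have "Suc k \<le> N" by auto
  from sum_restrict[OF this]
  show "l / N * exp (c * (\<Sum>j<Suc k. restrict \<delta> {..<N} j)) = l / N * exp (c * (\<Sum>j<Suc k. \<delta> j))" by simp
qed

lemma V_grid_restrict: "V_grid N l (restrict \<delta> {..<N}) = V_grid N l \<delta>"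
proof -
  have "(\<lambda>k. (\<Sum>j<N. restrict \<delta> {..<N} j) - (\<Sum>j<k. restrict \<delta> {..<N} j)) ` {..N} = (\<lambda>k. (\<Sum>j<N. \<delta> j) - (\<Sum>j<k. \<delta> j)) ` {..N}"
    by (intro image_cong refl) (simp add: sum_restrict del: restrict_apply)
  then show ?thesis unfolding V_grid_def by (simp add: J_grid_restrict sum_restrict del: restrict_apply)
qed

lemma V_measurable [measurable]:
  assumes st: "0 \<le> s" "s < t"
  shows "V s t \<in> borel_measurable M"
proof (rule borel_measurable_LIMSEQ_metric)
  show "(\<lambda>\<omega>. V_grid (2 ^ r) (t - s) (\<lambda>k. incr (2 ^ r) s t k \<omega>)) \<in> borel_measurable M" for r
  proof -
    have "(\<lambda>\<omega>. \<lambda>k\<in>{..<2 ^ r}. incr (2 ^ r) s t k \<omega>) \<in> measurable M (PiM {..<2 ^ r} (\<lambda>_. borel))"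
      unfolding incr_def by measurable
    from measurable_compose[OF this V_grid_measurable, of "t - s"] show ?thesis
      unfolding V_grid_restrict .
  qed
qed (rule V_grid_tendsto[OF _ st])

lemma H_measurable [measurable]: "0 \<le> s \<Longrightarrow> s < t \<Longrightarrow> H s t \<in> borel_measurable M"
proof -
  assume "0 \<le> s" "s < t"
  then have "(\<lambda>\<omega>. snd (snd (V s t \<omega>))) \<in> borel_measurable M"
    by (intro measurable_compose[OF V_measurable] borel_measurable_continuous_onI continuous_intros)
  then show ?thesis by (simp add: V_def)
qed

lemma D_measurable [measurable]: "D s t \<in> borel_measurable M"
  unfolding D_def by measurable

end

section \<open>Stationarity, independence and reversal of path functionals\<close>

context levy
begin

lemma X_distr_incr:
  assumes "0 \<le> u" "0 \<le> v"
  shows "distr M borel (\<lambda>\<omega>. path (u + v) \<omega> - path u \<omega>) = distr M borel (X v)"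
  using X_stationary[OF assms] assms by (simp add: path_eq)

lemma incr_distr:
  assumes "0 \<le> s" "s < t"
  shows "distr M borel (incr N s t k) = distr M borel (X ((t - s) / N))"
proof -
  have "distr M borel (\<lambda>\<omega>. path ((s + real k * ((t - s) / N)) + (t - s) / N) \<omega> - path (s + real k * ((t - s) / N)) \<omega>)
     = distr M borel (X ((t - s) / N))"
    using assms by (intro X_distr_incr) auto
  moreover have "incr N s t k = (\<lambda>\<omega>. path ((s + real k * ((t - s) / N)) + (t - s) / N) \<omega> - path (s + real k * ((t - s) / N)) \<omega>)"
  proof -
    define h where "h = (t - s) / N"
    have "s + real (Suc k) * h = s + real k * h + h" by (simp add: distrib_right)
    then show ?thesis unfolding h_def[symmetric] incr_def by (simp only:)
  qed
  ultimately show ?thesis by simp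
qed

lemma incr_measurable [measurable]: "incr N s t k \<in> borel_measurable M"
  unfolding incr_def by measurable

text \<open>Flattening block and grid step into one index by \<open>div\<close> and
  \<open>mod\<close> makes the grid points a single nondecreasing sequence, to which independence of
  increments applies once.\<close>

lemma incr_indep_blocks:
  assumes N: "0 < N" and t0: "0 \<le> t 0" and t: "\<And>i::nat. i < n \<Longrightarrow> t i < t (Suc i)"
  shows "indep_vars (\<lambda>_. borel) (\<lambda>m. incr N (t (m div N)) (t (Suc (m div N))) (m mod N)) {..<n * N}"
proof -
  define ts where "ts m = t (m div N) + real (m mod N) * ((t (Suc (m div N)) - t (m div N)) / N)" for m
  have i: "m div N < n" if "m < n * N" for m using that N by (simp add: less_mult_imp_div_less)
  \<comment> \<open>At the last step of a block the index carries over, and both descriptions of the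
    grid point give the start of the next block.\<close>
  have Suc: "ts (Suc m) = t (m div N) + real (Suc (m mod N)) * ((t (Suc (m div N)) - t (m div N)) / N)" for m
  proof (cases "Suc (m mod N) = N")
    case True
    then have "Suc m div N = Suc (m div N)" "Suc m mod N = 0"
      using N by (auto simp: div_Suc mod_Suc)
    then show ?thesis unfolding True ts_def using N by (simp add: field_simps)
  next
    case False
    then have "Suc m div N = m div N" "Suc m mod N = Suc (m mod N)"
      using N by (auto simp: div_Suc mod_Suc)
    then show ?thesis unfolding ts_def by simp
  qed
  have t_nonneg: "0 \<le> t i" if "i \<le> n" for i
    using that
  proof (induction i)
    case (Suc i)
    then show ?case using t[of i] by simp
  qed (rule t0)
  have ts_nonneg: "0 \<le> ts m" if "m < n * N" for m
    unfolding ts_def using t[OF i[OF that]] t_nonneg[of "m div N"] i[OF that] by auto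
  have le: "ts m \<le> ts (Suc m)" if "m < n * N" for m
    unfolding Suc unfolding ts_def using t[OF i[OF that]] N by (intro add_left_mono mult_right_mono) auto
  have "indep_vars (\<lambda>_. borel) (\<lambda>i \<omega>. X (ts (Suc i)) \<omega> - X (ts i) \<omega>) {..<n * N}"
    by (rule X_indep) (use N t0 le in \<open>auto simp: ts_def\<close>)
  moreover have "incr N (t (m div N)) (t (Suc (m div N))) (m mod N) \<omega> = X (ts (Suc m)) \<omega> - X (ts m) \<omega>"
    if "m < n * N" for m \<omega>
  proof -
    have "incr N (t (m div N)) (t (Suc (m div N))) (m mod N) \<omega> = path (ts (Suc m)) \<omega> - path (ts m) \<omega>"
      unfolding Suc unfolding ts_def incr_def ..
    then show ?thesis using ts_nonneg[OF that] le[OF that] by (simp add: path_eq)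
  qed
  ultimately show ?thesis by (subst indep_vars_cong) (auto simp: fun_eq_iff)
qed

lemma incr_indep:
  assumes "0 \<le> s" "s < t" "0 < N"
  shows "indep_vars (\<lambda>_. borel) (incr N s t) {..<N}"
proof -
  have "indep_vars (\<lambda>_. borel) (\<lambda>m. incr N ((\<lambda>i. if i = 0 then s else t) (m div N)) ((\<lambda>i. if i = 0 then s else t) (Suc (m div N))) (m mod N)) {..<1 * N}"
    by (rule incr_indep_blocks) (use assms in auto)
  then show ?thesis by (subst indep_vars_cong[where J = "{..<1 * N}"]) auto
qed

lemma incr_vector_distr:
  assumes "0 \<le> s" "s < t" "0 < N"
  shows "distr M (PiM {..<N} (\<lambda>_. borel)) (\<lambda>\<omega>. \<lambda>k\<in>{..<N}. incr N s t k \<omega>) = PiM {..<N} (\<lambda>_. distr M borel (X ((t - s) / N)))"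
proof -
  have "distr M (PiM {..<N} (\<lambda>_. borel)) (\<lambda>\<omega>. \<lambda>k\<in>{..<N}. incr N s t k \<omega>) = PiM {..<N} (\<lambda>k. distr M borel (incr N s t k))"
    using incr_indep[OF assms] assms(3) by (subst (asm) indep_vars_iff_distr_eq_PiM') auto
  then show ?thesis using assms by (simp add: incr_distr)
qed

lemma distr_grid_functional:
  assumes st: "0 \<le> s" "s < t" "0 < N" and [measurable]: "f \<in> measurable (PiM {..<N} (\<lambda>_. borel)) K"
  shows "distr M K (\<lambda>\<omega>. f (\<lambda>k\<in>{..<N}. incr N s t k \<omega>)) = distr (PiM {..<N} (\<lambda>_. distr M borel (X ((t - s) / N)))) K f"
  unfolding incr_vector_distr[OF st, symmetric]
  by (subst distr_distr) (auto simp: comp_def)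

text \<open>The law of the grid version depends only on the length \<open>l\<close> and the mesh,
  and equality of laws survives the limit.\<close>

lemma V_distr:
  assumes "0 \<le> s" "0 < l"
  shows "distr M borel (V s (s + l)) = distr M borel (V 0 l)"
proof (rule distr_eq_limit)
  let ?U = "\<lambda>s r \<omega>. V_grid (2 ^ r) l (\<lambda>k\<in>{..<2 ^ r}. incr (2 ^ r) s (s + l) k \<omega>)"
  have m: "?U s r \<in> borel_measurable M" if "0 \<le> s" for s r
    by (rule measurable_compose[OF _ V_grid_measurable]) measurable
  show "?U s r \<in> borel_measurable M" "?U 0 r \<in> borel_measurable M" for r
    using m assms by auto
  show "V s (s + l) \<in> borel_measurable M" "V 0 l \<in> borel_measurable M" using assms by auto
  show "(\<lambda>r. ?U s r \<omega>) \<longlonglongrightarrow> V s (s + l) \<omega>" "(\<lambda>r. ?U 0 r \<omega>) \<longlonglongrightarrow> V 0 l \<omega>" if "\<omega> \<in> space M" for \<omega>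
    using V_grid_tendsto[OF that, of s "s + l"] V_grid_tendsto[OF that, of 0 l] assms
    unfolding V_grid_restrict by simp_all
  show "distr M borel (?U s r) = distr M borel (?U 0 r)" for r
    using distr_grid_functional[of s "s + l" "2 ^ r" "V_grid (2 ^ r) l" borel]
      distr_grid_functional[of 0 "0 + l" "2 ^ r" "V_grid (2 ^ r) l" borel] assms V_grid_measurable by simp
qed

text \<open>Blocks of flattened grid increments are disjoint groups of independent variables;
  \<open>indep_vars_limit\<close> carries this through the refinement of the grid.\<close>

lemma V_indep:
  assumes t0: "0 \<le> t 0" and t: "\<And>i::nat. i < n \<Longrightarrow> t i < t (Suc i)" and n: "0 < n"
  shows "indep_vars (\<lambda>_. borel) (\<lambda>i. V (t i) (t (Suc i))) {..<n}"
proof (rule indep_vars_limit)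
  have t_nonneg: "0 \<le> t i" if "i \<le> n" for i
    using that
  proof (induction i)
    case (Suc i)
    then show ?case using t[of i] by simp
  qed (rule t0)
  show "finite {..<n}" "{..<n} \<noteq> {}" using n by auto
  show "V (t i) (t (Suc i)) \<in> borel_measurable M" if "i \<in> {..<n}" for i
    using that t t_nonneg by (intro V_measurable) auto
  let ?U = "\<lambda>r i \<omega>. V_grid (2 ^ r) (t (Suc i) - t i) (\<lambda>k. incr (2 ^ r) (t i) (t (Suc i)) k \<omega>)"
  show "(\<lambda>r. ?U r i \<omega>) \<longlonglongrightarrow> V (t i) (t (Suc i)) \<omega>" if "i \<in> {..<n}" "\<omega> \<in> space M" for i \<omega>
    using that t t_nonneg by (intro V_grid_tendsto) auto
  show "indep_vars (\<lambda>_. borel) (?U r) {..<n}" for r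
  proof -
    define N :: nat where "N = 2 ^ r"
    have N: "0 < N" by (simp add: N_def)
    define Y where "Y m = incr N (t (m div N)) (t (Suc (m div N))) (m mod N)" for m
    define B where "B i = {i * N..<Suc i * N}" for i
    have ind: "indep_vars (\<lambda>_. borel) Y {..<n * N}"
      unfolding Y_def by (rule incr_indep_blocks[OF N t0 t])
    have B: "B i \<subseteq> {..<n * N}" if "i \<in> {..<n}" for i
    proof -
      have "Suc i * N \<le> n * N" using that by (intro mult_right_mono) auto
      then show ?thesis by (auto simp: B_def)
    qed
    have B_div: "m div N = i" if "m \<in> B i" for m i
      using that N by (auto simp: B_def intro!: div_nat_eqI simp: mult.commute)
    have disj: "disjoint_family_on B {..<n}"
      unfolding disjoint_family_on_def using B_div by blast
    have "indep_vars (\<lambda>i. PiM (B i) (\<lambda>_. borel)) (\<lambda>i \<omega>. restrict (\<lambda>m. Y m \<omega>) (B i)) {..<n}"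
      by (rule indep_vars_restrict[OF ind B disj])
    then have "indep_vars (\<lambda>_. borel)
      (\<lambda>i \<omega>. V_grid N (t (Suc i) - t i) (\<lambda>k\<in>{..<N}. restrict (\<lambda>m. Y m \<omega>) (B i) (i * N + k))) {..<n}"
    proof (rule indep_vars_compose2)
      fix i assume "i \<in> {..<n}"
      have "(\<lambda>w. \<lambda>k\<in>{..<N}. w (i * N + k)) \<in> measurable (PiM (B i) (\<lambda>_. borel)) (PiM {..<N} (\<lambda>_. borel :: real measure))"
        by (intro measurable_restrict measurable_component_singleton) (auto simp: B_def)
      from measurable_compose[OF this V_grid_measurable]
      show "(\<lambda>w. V_grid N (t (Suc i) - t i) (\<lambda>k\<in>{..<N}. w (i * N + k))) \<in> borel_measurable (PiM (B i) (\<lambda>_. borel))" .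
    qed
    moreover have "V_grid N (t (Suc i) - t i) (\<lambda>k\<in>{..<N}. restrict (\<lambda>m. Y m \<omega>) (B i) (i * N + k)) = ?U r i \<omega>" for i \<omega>
    proof -
      have "(\<lambda>k\<in>{..<N}. restrict (\<lambda>m. Y m \<omega>) (B i) (i * N + k)) = (\<lambda>k\<in>{..<N}. incr N (t i) (t (Suc i)) k \<omega>)"
      proof (intro restrict_ext)
        fix k assume k: "k \<in> {..<N}"
        then have "i * N + k \<in> B i" by (auto simp: B_def)
        moreover have "(i * N + k) mod N = k" using k by simp
        ultimately show "restrict (\<lambda>m. Y m \<omega>) (B i) (i * N + k) = incr N (t i) (t (Suc i)) k \<omega>"
          using B_div[of "i * N + k" i] by (simp add: Y_def)
      qed
      then show ?thesis unfolding N_def[symmetric] by (simp only: V_grid_restrict)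
    qed
    ultimately show ?thesis by simp
  qed
qed

text \<open>Time reversal on the grid: reversing the iid increments does not change their joint law.\<close>
lemma J_reversal:
  assumes t: "0 < t"
  shows "distr M borel (\<lambda>\<omega>. \<integral>u. indicator {0..t} u * exp (c * path u \<omega>) \<partial>lborel)
       = distr M borel (\<lambda>\<omega>. \<integral>u. indicator {0..t} u * exp (c * (path t \<omega> - path u \<omega>)) \<partial>lborel)"
proof (rule distr_eq_limit)
  let ?d = "\<lambda>r \<omega>. (\<lambda>k\<in>{..<2 ^ r}. incr (2 ^ r) 0 t k \<omega>)"
  define rev where "rev N \<delta> = (\<lambda>k\<in>{..<N}. \<delta> (N - Suc k))" for N and \<delta> :: "nat \<Rightarrow> real"
  let ?f = "\<lambda>N. J_grid c N t"
  have rev_m [measurable]: "rev N \<in> measurable (PiM {..<N} (\<lambda>_. borel)) (PiM {..<N} (\<lambda>_. borel))" for N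
    unfolding rev_def by (intro measurable_restrict measurable_component_singleton) auto
  have d_m [measurable]: "?d r \<in> measurable M (PiM {..<2 ^ r} (\<lambda>_. borel))" for r by measurable
  show "(\<lambda>\<omega>. ?f (2 ^ r) (?d r \<omega>)) \<in> borel_measurable M" for r by measurable
  show "(\<lambda>\<omega>. ?f (2 ^ r) (rev (2 ^ r) (?d r \<omega>))) \<in> borel_measurable M" for r by measurable
  show "(\<lambda>\<omega>. \<integral>u. indicator {0..t} u * exp (c * path u \<omega>) \<partial>lborel) \<in> borel_measurable M" by measurable
  show "(\<lambda>\<omega>. \<integral>u. indicator {0..t} u * exp (c * (path t \<omega> - path u \<omega>)) \<partial>lborel) \<in> borel_measurable M" by measurable
  show "distr M borel (\<lambda>\<omega>. ?f (2 ^ r) (?d r \<omega>)) = distr M borel (\<lambda>\<omega>. ?f (2 ^ r) (rev (2 ^ r) (?d r \<omega>)))" for r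
  proof -
    define N :: nat where "N = 2 ^ r"
    have N: "0 < N" by (simp add: N_def)
    define \<mu> where "\<mu> = distr M borel (X (t / N))"
    have mu: "prob_space \<mu>" unfolding \<mu>_def using t by (intro prob_space_distr) auto
    have sets_mu: "sets \<mu> = sets borel" by (simp add: \<mu>_def)
    have sp: "sets (PiM {..<N} (\<lambda>_. \<mu>)) = sets (PiM {..<N} (\<lambda>_. borel))"
      by (intro sets_PiM_cong) (auto simp: sets_mu)
    have "distr (PiM {..<N} (\<lambda>_. \<mu>)) (PiM {..<N} (\<lambda>_. \<mu>)) (\<lambda>\<delta>. \<lambda>k\<in>{..<N}. \<delta> (N - Suc k)) = PiM {..<N} (\<lambda>_. \<mu>)"
      by (rule distr_PiM_reindex[OF mu]) (auto simp: inj_on_def)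
    then have inv: "distr (PiM {..<N} (\<lambda>_. \<mu>)) (PiM {..<N} (\<lambda>_. borel)) (rev N) = PiM {..<N} (\<lambda>_. \<mu>)"
      unfolding rev_def by (subst (asm) distr_cong[OF refl sp refl]) auto
    have rev_m' [measurable]: "rev N \<in> measurable (PiM {..<N} (\<lambda>_. \<mu>)) (PiM {..<N} (\<lambda>_. borel))"
      using rev_m[of N] by (simp cong: measurable_cong_sets add: sp)
    have "distr M borel (\<lambda>\<omega>. (\<lambda>\<delta>. ?f N (rev N \<delta>)) (\<lambda>k\<in>{..<N}. incr N 0 t k \<omega>)) = distr (PiM {..<N} (\<lambda>_. \<mu>)) borel (\<lambda>\<delta>. ?f N (rev N \<delta>))"
      using distr_grid_functional[of 0 t N "\<lambda>\<delta>. ?f N (rev N \<delta>)" borel] t N unfolding \<mu>_def by simp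
    also have "\<dots> = distr (distr (PiM {..<N} (\<lambda>_. \<mu>)) (PiM {..<N} (\<lambda>_. borel)) (rev N)) borel (?f N)"
      by (subst distr_distr) (auto simp: comp_def)
    also have "\<dots> = distr (PiM {..<N} (\<lambda>_. \<mu>)) borel (?f N)" unfolding inv ..
    also have "\<dots> = distr M borel (\<lambda>\<omega>. ?f N (\<lambda>k\<in>{..<N}. incr N 0 t k \<omega>))"
      using distr_grid_functional[of 0 t N "?f N" borel] t N unfolding \<mu>_def by simp
    finally show ?thesis unfolding N_def by simp
  qed
  fix \<omega> assume \<omega>: "\<omega> \<in> space M"
  have p0: "path 0 \<omega> = 0" using X_0[OF \<omega>] by (simp add: path_def)
  show "(\<lambda>r. ?f (2 ^ r) (?d r \<omega>)) \<longlonglongrightarrow> (\<integral>u. indicator {0..t} u * exp (c * path u \<omega>) \<partial>lborel)"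
    using J_grid_tendsto[OF \<omega> order_refl t, of c] by (simp add: J_grid_restrict J_def p0)
  let ?g = "\<lambda>u. exp (c * (path t \<omega> - path u \<omega>))"
  have l1: "(\<lambda>r. \<Sum>k<2 ^ r. t / 2 ^ r * ?g (real (Suc k) * (t / 2 ^ r))) \<longlonglongrightarrow> (\<integral>u. indicator {0..t} u * ?g u \<partial>lborel)"
  proof -
    have "filterlim (\<lambda>r::nat. 2 ^ r :: nat) at_top sequentially"
      by (rule filterlim_subseq) (auto intro!: strict_monoI power_strict_increasing)
    from exp_riemann[OF \<omega> order_refl t _ this, of "- c" "path t \<omega>"] show ?thesis
      by (simp add: algebra_simps)
  qed
  \<comment> \<open>Reversal moves the evaluation points from right to left endpoints. The two sums
    differ by one boundary term, which vanishes with the mesh.\<close>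
  have l2: "(\<lambda>r. t / 2 ^ r * (?g 0 - ?g t)) \<longlonglongrightarrow> 0"
  proof -
    have "(\<lambda>r. t / 2 ^ r) \<longlonglongrightarrow> 0" by real_asymp
    from tendsto_mult[OF this tendsto_const, of "?g 0 - ?g t"] show ?thesis by simp
  qed
  have "?f (2 ^ r) (rev (2 ^ r) (?d r \<omega>)) = (\<Sum>k<2 ^ r. t / 2 ^ r * ?g (real (Suc k) * (t / 2 ^ r))) + t / 2 ^ r * (?g 0 - ?g t)" for r
  proof -
    define N :: nat where "N = 2 ^ r"
    have N: "0 < N" "real N = 2 ^ r" by (simp_all add: N_def)
    have s: "(\<Sum>j<Suc k. rev N (\<lambda>k\<in>{..<N}. incr N 0 t k \<omega>) j) = path t \<omega> - path (real (N - Suc k) * (t / N)) \<omega>" if "k < N" for k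
    proof -
      have "(\<Sum>j<Suc k. rev N (\<lambda>k\<in>{..<N}. incr N 0 t k \<omega>) j) = (\<Sum>j<Suc k. incr N 0 t (N - Suc j) \<omega>)"
        using that by (intro sum.cong) (auto simp: rev_def)
      also have "\<dots> = (\<Sum>i\<in>{N - Suc k..<N}. incr N 0 t i \<omega>)"
        using that by (intro sum.reindex_bij_witness[of _ "\<lambda>i. N - Suc i" "\<lambda>j. N - Suc j"]) auto
      also have "\<dots> = (\<Sum>i<N. incr N 0 t i \<omega>) - (\<Sum>i<N - Suc k. incr N 0 t i \<omega>)"
        by (subst sum_diff[symmetric]) (auto intro!: sum.cong)
      also have "\<dots> = path t \<omega> - path (real (N - Suc k) * (t / N)) \<omega>"
        unfolding sum_incr using N by simp
      finally show ?thesis .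
    qed
    have "?f N (rev N (\<lambda>k\<in>{..<N}. incr N 0 t k \<omega>)) = (\<Sum>k<N. t / N * ?g (real (N - Suc k) * (t / N)))"
      unfolding J_grid_def using s by (intro sum.cong) auto
    also have "\<dots> = (\<Sum>k<N. t / N * ?g (real k * (t / N)))"
      by (rule sum.nat_diff_reindex)
    also have "\<dots> = (\<Sum>k<N. t / N * ?g (real (Suc k) * (t / N))) + t / N * (?g 0 - ?g t)"
    proof -
      have "(\<Sum>k<N. t / N * ?g (real (Suc k) * (t / N))) - (\<Sum>k<N. t / N * ?g (real k * (t / N)))
         = t / N * ?g (real N * (t / N)) - t / N * ?g (real 0 * (t / N))"
        unfolding sum_subtractf[symmetric] by (rule sum_lessThan_telescope)
      moreover have "real N * (t / N) = t" using N(1) by simp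
      ultimately show ?thesis by (simp add: right_diff_distrib)
    qed
    finally show ?thesis unfolding N_def by simp
  qed
  then show "(\<lambda>r. ?f (2 ^ r) (rev (2 ^ r) (?d r \<omega>))) \<longlonglongrightarrow> (\<integral>u. indicator {0..t} u * ?g u \<partial>lborel)"
    using tendsto_add[OF l1 l2] by simp
qed

end

section \<open>The walk of unit blocks\<close>

definition block_incr :: "real \<times> real \<times> real \<Rightarrow> real" where "block_incr z = fst (snd z)"
definition block_height :: "real \<times> real \<times> real \<Rightarrow> real" where "block_height z = snd (snd z)"

lemma block_measurable [measurable]:
  "block_incr \<in> borel_measurable borel" "block_height \<in> borel_measurable borel"
  "fst \<in> borel_measurable (borel :: (real \<times> real \<times> real) measure)"
  unfolding block_incr_def block_height_def
  by (intro borel_measurable_continuous_onI continuous_intros)+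

text \<open>The killed walk reads the blocks \<open>s, \<dots>, s + m - 1\<close> backwards, starting with the last one.\<close>
fun alive :: "nat \<Rightarrow> nat \<Rightarrow> real \<Rightarrow> (nat \<Rightarrow> real \<times> real \<times> real) \<Rightarrow> bool" where
  "alive s 0 y w \<longleftrightarrow> True"
| "alive s (Suc m) y w \<longleftrightarrow> 0 < y + block_height (w (s + m)) \<and> alive s m (y + block_incr (w (s + m))) w"

lemma alive_iff:
  "alive s m y w \<longleftrightarrow> (\<forall>i<m. 0 < y + (\<Sum>j\<in>{Suc i..<m}. block_incr (w (s + j))) + block_height (w (s + i)))"
proof (induction m arbitrary: y)
  case (Suc m)
  have "(\<Sum>j\<in>{Suc i..<Suc m}. block_incr (w (s + j))) = block_incr (w (s + m)) + (\<Sum>j\<in>{Suc i..<m}. block_incr (w (s + j)))"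
    if "i < m" for i using that by (simp add: sum.atLeastLessThan_Suc)
  then show ?case by (auto simp: Suc less_Suc_eq add.assoc)
qed simp

lemma alive_cong: "(\<And>i. s \<le> i \<Longrightarrow> i < s + m \<Longrightarrow> w i = w' i) \<Longrightarrow> alive s m y w \<longleftrightarrow> alive s m y w'"
  by (induction m arbitrary: y) auto

lemma alive_measurable [measurable (raw)]:
  assumes g: "g \<in> borel_measurable N" and w: "w \<in> measurable N (PiM B (\<lambda>_. borel))" and B: "{s..<s + m} \<subseteq> B"
  shows "Measurable.pred N (\<lambda>x. alive s m (g x) (w x))"
  using g B
proof (induction m arbitrary: g)
  case (Suc m)
  note [measurable] = Suc.prems(1)
  have [measurable]: "(\<lambda>x. w x (s + m)) \<in> borel_measurable N"
    by (rule measurable_compose[OF w measurable_component_singleton]) (use Suc.prems in auto)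
  have [measurable]: "Measurable.pred N (\<lambda>x. alive s m (g x + block_incr (w x (s + m))) (w x))"
    by (rule Suc.IH) (use Suc.prems in auto)
  show ?case by simp
qed simp

locale levy_drift = levy +
  assumes drift: "AE \<omega> in M. filterlim (\<lambda>t. X t \<omega>) at_bot at_top"
begin

definition blk :: "nat \<Rightarrow> 'a \<Rightarrow> real \<times> real \<times> real" where
  "blk i = V (real i) (real (Suc i))"

lemma blk_measurable [measurable]: "blk i \<in> borel_measurable M"
  unfolding blk_def by (rule V_measurable) auto

lemma block_incr_blk: "block_incr (blk i \<omega>) = path (real (Suc i)) \<omega> - path (real i) \<omega>"
  by (simp add: block_incr_def blk_def V_def D_def)

lemma block_height_blk: "block_height (blk i \<omega>) = H (real i) (real (Suc i)) \<omega>"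
  by (simp add: block_height_def blk_def V_def)

lemma block_blk_0 [simp]: "block_incr (blk 0 \<omega>) = D 0 1 \<omega>" "block_height (blk 0 \<omega>) = H 0 1 \<omega>"
  by (simp_all add: block_incr_blk block_height_blk D_def)

text \<open>Independence is tested on finite subfamilies, each contained in an initial segment of
  blocks.\<close>

lemma blk_indep: "indep_vars (\<lambda>_. borel) blk I"
proof -
  have fin: "indep_vars (\<lambda>_. borel) blk {..<n}" for n
  proof (cases n)
    case (Suc k)
    have "indep_vars (\<lambda>_. borel) (\<lambda>i. V (real i) (real (Suc i))) {..<n}"
      by (rule V_indep) (auto simp: Suc)
    then show ?thesis unfolding blk_def .
  qed (simp add: indep_vars_def2 indep_sets_def)
  show ?thesis
    unfolding indep_vars_def2
  proof (intro conjI ballI)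
    show "indep_sets (\<lambda>i. {blk i -` A \<inter> space M |A. A \<in> sets borel}) I"
    proof (subst indep_sets_finite_index_sets, intro allI impI)
      fix K assume "K \<subseteq> I" "K \<noteq> {}" "finite K"
      then have "K \<subseteq> {..<Suc (Max K)}" by (auto simp: less_Suc_eq_le)
      from indep_vars_subset[OF fin this]
      show "indep_sets (\<lambda>i. {blk i -` A \<inter> space M |A. A \<in> sets borel}) K"
        unfolding indep_vars_def2 by blast
    qed
  qed simp
qed

lemma blk_distr: "distr M borel (blk i) = distr M borel (blk 0)"
  using V_distr[of "real i" 1] unfolding blk_def by (simp add: add.commute)

lemma nn_integral_blk:
  assumes [measurable]: "f \<in> borel_measurable borel"
  shows "(\<integral>\<^sup>+\<omega>. f (blk i \<omega>) \<partial>M) = (\<integral>\<^sup>+\<omega>. f (blk 0 \<omega>) \<partial>M)"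
proof -
  have "(\<integral>\<^sup>+\<omega>. f (blk i \<omega>) \<partial>M) = (\<integral>\<^sup>+z. f z \<partial>distr M borel (blk i))" by (subst nn_integral_distr) auto
  also have "\<dots> = (\<integral>\<^sup>+z. f z \<partial>distr M borel (blk 0))" by (subst blk_distr[of i]) (rule refl)
  also have "\<dots> = (\<integral>\<^sup>+\<omega>. f (blk 0 \<omega>) \<partial>M)" by (subst nn_integral_distr) auto
  finally show ?thesis .
qed

abbreviation "bvec A \<omega> \<equiv> (\<lambda>i\<in>A. blk i \<omega>)"

lemma nn_integral_blk_split:
  assumes "A \<inter> B = {}" and "f \<in> borel_measurable (PiM A (\<lambda>_. borel) \<Otimes>\<^sub>M PiM B (\<lambda>_. borel))"
  shows "(\<integral>\<^sup>+\<omega>. f (bvec A \<omega>, bvec B \<omega>) \<partial>M) = (\<integral>\<^sup>+\<omega>. \<integral>\<^sup>+\<omega>'. f (bvec A \<omega>, bvec B \<omega>') \<partial>M \<partial>M)"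
  by (rule nn_integral_indep_pair[OF indep_var_restrict[OF blk_indep[of UNIV] assms(1) subset_UNIV subset_UNIV] assms(2)])

sublocale mk: marked_step M "D 0 1" "H 0 1"
  by unfold_locales (auto simp: D_le_H)

abbreviation "q m \<equiv> (kstep M (D 0 1) (H 0 1) ^^ m) (\<lambda>_. 1)"
abbreviation "W \<equiv> iter_green M (D 0 1) (H 0 1)"

text \<open>The induction peels off block \<open>s + m\<close>, which the walk reads first. It is
  independent of the earlier blocks, so one application of \<open>kstep\<close> results.\<close>

lemma prob_alive: "(\<integral>\<^sup>+\<omega>. (if alive s m y (\<lambda>i. blk i \<omega>) then 1 else 0) \<partial>M) = q m y"
proof (induction m arbitrary: y)
  case 0
  then show ?case by (simp add: emeasure_space_1)
next
  case (Suc m)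
  let ?A = "{s + m}" and ?B = "{s..<s + m}"
  define f where "f = (\<lambda>(a, b). if 0 < y + block_height (a (s + m)) \<and> alive s m (y + block_incr (a (s + m))) b then 1 else 0 :: ennreal)"
  have f [measurable]: "f \<in> borel_measurable (PiM ?A (\<lambda>_. borel) \<Otimes>\<^sub>M PiM ?B (\<lambda>_. borel))"
  proof -
    have [measurable]: "(\<lambda>z. fst z (s + m)) \<in> borel_measurable (PiM ?A (\<lambda>_. borel :: (real \<times> real \<times> real) measure) \<Otimes>\<^sub>M PiM ?B (\<lambda>_. borel :: (real \<times> real \<times> real) measure))"
      by (rule measurable_compose[OF measurable_fst measurable_component_singleton]) simp
    have [measurable]: "Measurable.pred (PiM ?A (\<lambda>_. borel :: (real \<times> real \<times> real) measure) \<Otimes>\<^sub>M PiM ?B (\<lambda>_. borel))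
      (\<lambda>z. alive s m (y + block_incr (fst z (s + m))) (snd z))"
      by (rule alive_measurable[OF _ measurable_snd]) auto
    show ?thesis unfolding f_def case_prod_beta' by measurable
  qed
  have bvec: "alive s m y' (bvec ?B \<omega>) \<longleftrightarrow> alive s m y' (\<lambda>i. blk i \<omega>)" for y' \<omega>
    by (rule alive_cong) auto
  have "(\<integral>\<^sup>+\<omega>. (if alive s (Suc m) y (\<lambda>i. blk i \<omega>) then 1 else 0) \<partial>M) = (\<integral>\<^sup>+\<omega>. f (bvec ?A \<omega>, bvec ?B \<omega>) \<partial>M)"
    unfolding f_def by (intro nn_integral_cong) (simp add: bvec)
  also have "\<dots> = (\<integral>\<^sup>+\<omega>. \<integral>\<^sup>+\<omega>'. f (bvec ?A \<omega>, bvec ?B \<omega>') \<partial>M \<partial>M)"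
    by (rule nn_integral_blk_split[OF _ f]) auto
  also have "\<dots> = (\<integral>\<^sup>+\<omega>. (\<lambda>z. if 0 < y + block_height z then q m (y + block_incr z) else 0) (blk (s + m) \<omega>) \<partial>M)"
    unfolding f_def by (intro nn_integral_cong) (simp add: bvec Suc)
  also have "\<dots> = (\<integral>\<^sup>+\<omega>. (\<lambda>z. if 0 < y + block_height z then q m (y + block_incr z) else 0) (blk 0 \<omega>) \<partial>M)"
    by (rule nn_integral_blk) measurable
  also have "\<dots> = q (Suc m) y"
    by (simp add: kstep_def cong: if_cong)
  finally show ?case .
qed

lemma vec_shift_distr:
  assumes n: "0 < n"
  shows "distr M (PiM {..<n} (\<lambda>_. borel)) (\<lambda>\<omega>. \<lambda>i\<in>{..<n}. blk (t + i) \<omega>) = PiM {..<n} (\<lambda>_. distr M borel (blk 0))"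
proof -
  have "indep_vars (\<lambda>_. borel) (\<lambda>i. V (real t + real i) (real t + real (Suc i))) {..<n}"
    by (rule V_indep) (use n in auto)
  moreover have "V (real t + real i) (real t + real (Suc i)) = blk (t + i)" for i
    by (simp add: blk_def add.commute add.left_commute)
  ultimately have "indep_vars (\<lambda>_. borel) (\<lambda>i. blk (t + i)) {..<n}" by simp
  then have "distr M (PiM {..<n} (\<lambda>_. borel)) (\<lambda>\<omega>. \<lambda>i\<in>{..<n}. blk (t + i) \<omega>) = PiM {..<n} (\<lambda>i. distr M borel (blk (t + i)))"
    using n by (subst (asm) indep_vars_iff_distr_eq_PiM') auto
  moreover have "(\<lambda>i. distr M borel (blk (t + i))) = (\<lambda>_. distr M borel (blk 0))"
    by (intro ext) (rule blk_distr)
  ultimately show ?thesis by (simp only:)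
qed

text \<open>Near-records of the walk that are followed by a definite descent cannot be frequent:
  two of them are less than \<open>L\<close> apart, so the expected number of near-records is finite.\<close>
lemma W1_finite: "W 1 y < \<infinity>"
proof -
  \<comment> \<open>For every \<open>j\<close> between \<open>L\<close> and \<open>n\<close>, a
    backward walk of length \<open>j\<close> started at \<open>y\<close> is dead once it has read
    block 0. Shifted to block \<open>t\<close>, this contradicts survival at each time
    \<open>t + j\<close> with \<open>j\<close> in that range.\<close>
  define e where "e L n w \<longleftrightarrow> (\<forall>j\<in>{L..n}. y + (\<Sum>i\<in>{1..<j}. block_incr (w i)) + block_height (w 0) \<le> 0)" for L n :: nat and w
  have e_sum: "(\<Sum>i\<in>{1..<j}. block_incr (blk (t + i) \<omega>)) = path (real (t + j)) \<omega> - path (real (Suc t)) \<omega>" if "1 \<le> j" for t j \<omega>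
    using that
  proof (induction j rule: dec_induct)
    case (step j)
    then show ?case by (simp add: sum.atLeastLessThan_Suc block_incr_blk)
  qed simp
  have [measurable]: "path u \<in> borel_measurable M" for u by measurable
  \<comment> \<open>Version with infinite horizon. Since the path drifts to
    \<open>- \<infinity>\<close>, it has positive probability for some \<open>L\<close>.\<close>
  define E where "E L = {\<omega>\<in>space M. \<forall>j\<ge>L. y + (path (real j) \<omega> - path 1 \<omega>) + H 0 1 \<omega> \<le> 0}" for L :: nat
  have E_meas [measurable]: "E L \<in> sets M" for L unfolding E_def by measurable
  have "AE \<omega> in M. \<exists>L. \<omega> \<in> E (Suc L)"
    using drift AE_space
  proof eventually_elim
    case (elim \<omega>)
    from elim(1) have "\<forall>\<^sub>F t in at_top. X t \<omega> \<le> path 1 \<omega> - H 0 1 \<omega> - y"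
      by (auto simp: filterlim_at_bot)
    then obtain T where T: "\<And>t. T \<le> t \<Longrightarrow> X t \<omega> \<le> path 1 \<omega> - H 0 1 \<omega> - y"
      by (auto simp: eventually_at_top_linorder)
    have "\<omega> \<in> E (Suc (nat \<lceil>T\<rceil>))"
      unfolding E_def
    proof (intro CollectI conjI allI impI elim(2))
      fix j assume "Suc (nat \<lceil>T\<rceil>) \<le> j"
      then have "T \<le> real j" by linarith
      from T[OF this] show "y + (path (real j) \<omega> - path 1 \<omega>) + H 0 1 \<omega> \<le> 0" by (simp add: path_eq)
    qed
    then show ?case ..
  qed
  have "\<exists>L. emeasure M (E (Suc L)) \<noteq> 0"
  proof (rule ccontr)
    assume "\<not> ?thesis"
    then have "AE \<omega> in M. \<forall>L. \<omega> \<notin> E (Suc L)"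
      by (intro AE_all_countable[THEN iffD2] allI AE_not_in) (auto simp: null_sets_def)
    with \<open>AE \<omega> in M. \<exists>L. \<omega> \<in> E (Suc L)\<close> have "AE \<omega> in M. False" by eventually_elim auto
    then show False using AE_False by auto
  qed
  then obtain L0 where L0: "emeasure M (E (Suc L0)) \<noteq> 0" ..
  define L where "L = Suc L0"
  define p where "p = emeasure M (E L)"
  have p: "p \<noteq> 0" using L0 by (simp add: p_def L_def)
  have L1: "1 \<le> L" by (simp add: L_def)
  have e_meas: "Measurable.pred (PiM A (\<lambda>_. borel)) (\<lambda>w. e L n (\<lambda>i. w (t + i)))" if tA: "{t..t + n} \<subseteq> A" for A t n
  proof -
    have [measurable]: "(\<lambda>w. w (t + i)) \<in> borel_measurable (PiM A (\<lambda>_. borel :: (real \<times> real \<times> real) measure))" if "i \<le> n" for i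
      by (rule measurable_component_singleton) (use that \<open>{t..t + n} \<subseteq> A\<close> in auto)
    have "Measurable.pred (PiM A (\<lambda>_. borel)) (\<lambda>w. y + (\<Sum>i\<in>{1..<j}. block_incr (w (t + i))) + block_height (w (t + 0)) \<le> 0)" if "j \<le> n" for j
    proof -
      have [measurable]: "(\<lambda>w. \<Sum>i\<in>{1..<j}. block_incr (w (t + i))) \<in> borel_measurable (PiM A (\<lambda>_. borel))"
      proof (intro borel_measurable_sum)
        fix i assume "i \<in> {1..<j}"
        then have "i \<le> n" using that by auto
        then show "(\<lambda>w. block_incr (w (t + i))) \<in> borel_measurable (PiM A (\<lambda>_. borel))" by measurable
      qed
      have [measurable]: "(\<lambda>w. block_height (w (t + 0))) \<in> borel_measurable (PiM A (\<lambda>_. borel))"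
        by measurable
      show ?thesis by measurable
    qed
    then show ?thesis unfolding e_def by (intro pred_intros_finite) auto
  qed
  \<comment> \<open>Stationarity of the blocks moves the event from 0 to \<open>t\<close>; the
    horizon is finite because the laws of finite vectors of blocks are compared.\<close>
  have pe: "p \<le> (\<integral>\<^sup>+\<omega>. (if e L n (\<lambda>i. blk (t + i) \<omega>) then 1 else 0) \<partial>M)" for t n
  proof -
    let ?F = "\<lambda>w. if e L n (\<lambda>i. w (0 + i)) then 1 else 0 :: ennreal"
    have Fm [measurable]: "?F \<in> borel_measurable (PiM {..<Suc n} (\<lambda>_. borel))"
      using e_meas[of 0 n "{..<Suc n}"] by measurable auto
    have e_r: "e L n (\<lambda>i. (\<lambda>i\<in>{..<Suc n}. blk (t + i) \<omega>) (0 + i)) \<longleftrightarrow> e L n (\<lambda>i. blk (t + i) \<omega>)" for t \<omega>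
    proof -
      have "(\<Sum>i\<in>{1..<j}. block_incr ((\<lambda>i\<in>{..<Suc n}. blk (t + i) \<omega>) (0 + i))) = (\<Sum>i\<in>{1..<j}. block_incr (blk (t + i) \<omega>))"
        if "j \<le> n" for j using that by (intro sum.cong) auto
      then show ?thesis unfolding e_def by auto
    qed
    have eq: "(\<integral>\<^sup>+\<omega>. (if e L n (\<lambda>i. blk (t + i) \<omega>) then 1 else 0) \<partial>M)
      = (\<integral>\<^sup>+w. ?F w \<partial>PiM {..<Suc n} (\<lambda>_. distr M borel (blk 0)))" for t
    proof -
      have "(\<integral>\<^sup>+w. ?F w \<partial>PiM {..<Suc n} (\<lambda>_. distr M borel (blk 0)))
        = (\<integral>\<^sup>+w. ?F w \<partial>distr M (PiM {..<Suc n} (\<lambda>_. borel)) (\<lambda>\<omega>. \<lambda>i\<in>{..<Suc n}. blk (t + i) \<omega>))"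
        by (subst vec_shift_distr) auto
      also have "\<dots> = (\<integral>\<^sup>+\<omega>. ?F (\<lambda>i\<in>{..<Suc n}. blk (t + i) \<omega>) \<partial>M)"
        by (subst nn_integral_distr) (use Fm in auto)
      finally show ?thesis unfolding e_r ..
    qed
    have "p = (\<integral>\<^sup>+\<omega>. indicator (E L) \<omega> \<partial>M)" by (simp add: p_def)
    also have "\<dots> \<le> (\<integral>\<^sup>+\<omega>. (if e L n (\<lambda>i. blk (0 + i) \<omega>) then 1 else 0) \<partial>M)"
    proof (intro nn_integral_mono)
      fix \<omega>
      have "e L n (\<lambda>i. blk (0 + i) \<omega>)" if "\<omega> \<in> E L"
        unfolding e_def
      proof
        fix j assume j: "j \<in> {L..n}"
        then have "1 \<le> j" using L1 by simp
        from e_sum[OF this, of 0 \<omega>]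
        show "y + (\<Sum>i\<in>{1..<j}. block_incr (blk (0 + i) \<omega>)) + block_height (blk (0 + 0) \<omega>) \<le> 0"
          using that j by (simp add: E_def block_height_blk)
      qed
      then show "indicator (E L) \<omega> \<le> (if e L n (\<lambda>i. blk (0 + i) \<omega>) then 1 else 0 :: ennreal)"
        by (auto simp: indicator_def)
    qed
    also have "\<dots> = (\<integral>\<^sup>+\<omega>. (if e L n (\<lambda>i. blk (t + i) \<omega>) then 1 else 0) \<partial>M)" by (simp only: eq)
    finally show ?thesis .
  qed
  have step: "(\<Sum>t<N. q t y) * p \<le> of_nat L" for N
  proof -
    let ?F = "\<lambda>t \<omega>. if alive 0 t y (\<lambda>i. blk i \<omega>) \<and> e L N (\<lambda>i. blk (t + i) \<omega>) then 1 else 0 :: ennreal"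
    \<comment> \<open>Survival up to \<open>t\<close> uses the blocks before \<open>t\<close>, the
      descent uses those from \<open>t\<close> on, so the two are independent.\<close>
    have qp: "q t y * p \<le> (\<integral>\<^sup>+\<omega>. ?F t \<omega> \<partial>M)" for t
    proof -
      let ?A = "{0..<0 + t}" and ?B = "{t..t + N}"
      define f where "f = (\<lambda>(a, b). if alive 0 t y a \<and> e L N (\<lambda>i. b (t + i)) then 1 else 0 :: ennreal)"
      have f: "f \<in> borel_measurable (PiM ?A (\<lambda>_. borel) \<Otimes>\<^sub>M PiM ?B (\<lambda>_. borel))"
      proof -
        have [measurable]: "Measurable.pred (PiM ?A (\<lambda>_. borel :: (real \<times> real \<times> real) measure) \<Otimes>\<^sub>M PiM ?B (\<lambda>_. borel :: (real \<times> real \<times> real) measure)) (\<lambda>z. alive 0 t y (fst z))"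
          by (rule alive_measurable[OF _ measurable_fst]) auto
        have [measurable]: "Measurable.pred (PiM ?A (\<lambda>_. borel :: (real \<times> real \<times> real) measure) \<Otimes>\<^sub>M PiM ?B (\<lambda>_. borel)) (\<lambda>z. e L N (\<lambda>i. snd z (t + i)))"
          by (rule measurable_compose[OF measurable_snd e_meas]) auto
        show ?thesis unfolding f_def case_prod_beta' by measurable
      qed
      have va: "alive 0 t y (bvec ?A \<omega>) \<longleftrightarrow> alive 0 t y (\<lambda>i. blk i \<omega>)" for \<omega>
        by (rule alive_cong) auto
      have ve: "e L N (\<lambda>i. bvec ?B \<omega> (t + i)) \<longleftrightarrow> e L N (\<lambda>i. blk (t + i) \<omega>)" for \<omega>
      proof -
        have "(\<Sum>i\<in>{1..<j}. block_incr (bvec ?B \<omega> (t + i))) = (\<Sum>i\<in>{1..<j}. block_incr (blk (t + i) \<omega>))"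
          if "j \<le> N" for j using that by (intro sum.cong) auto
        then show ?thesis unfolding e_def by auto
      qed
      have "q t y * p = (\<integral>\<^sup>+\<omega>. (if alive 0 t y (\<lambda>i. blk i \<omega>) then 1 else 0) * p \<partial>M)"
      proof (subst nn_integral_multc)
        have "Measurable.pred M (\<lambda>\<omega>. alive 0 t y (bvec ?A \<omega>))"
          by (rule alive_measurable) auto
        then have [measurable]: "Measurable.pred M (\<lambda>\<omega>. alive 0 t y (\<lambda>i. blk i \<omega>))" by (simp only: va)
        show "(\<lambda>\<omega>. if alive 0 t y (\<lambda>i. blk i \<omega>) then 1 else 0 :: ennreal) \<in> borel_measurable M" by measurable
      qed (simp add: prob_alive)
      also have "\<dots> \<le> (\<integral>\<^sup>+\<omega>. \<integral>\<^sup>+\<omega>'. f (bvec ?A \<omega>, bvec ?B \<omega>') \<partial>M \<partial>M)"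
        unfolding f_def using pe[of N t]
        by (intro nn_integral_mono) (simp only: va ve prod.case; simp)
      also have "\<dots> = (\<integral>\<^sup>+\<omega>. f (bvec ?A \<omega>, bvec ?B \<omega>) \<partial>M)"
        by (rule nn_integral_blk_split[OF _ f, symmetric]) auto
      also have "\<dots> = (\<integral>\<^sup>+\<omega>. ?F t \<omega> \<partial>M)" unfolding f_def by (simp only: va ve prod.case)
      finally show ?thesis .
    qed
    have Fm: "?F t \<in> borel_measurable M" for t
    proof -
      have "Measurable.pred M (\<lambda>\<omega>. alive 0 t y (bvec {0..<0 + t} \<omega>))"
        by (rule alive_measurable) auto
      moreover have "alive 0 t y (bvec {0..<0 + t} \<omega>) \<longleftrightarrow> alive 0 t y (\<lambda>i. blk i \<omega>)" for \<omega>
        by (rule alive_cong) auto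
      ultimately have [measurable]: "Measurable.pred M (\<lambda>\<omega>. alive 0 t y (\<lambda>i. blk i \<omega>))" by (simp only:)
      have [measurable]: "Measurable.pred M (\<lambda>\<omega>. e L N (\<lambda>i. blk (t + i) \<omega>))" unfolding e_def by measurable
      show ?thesis by measurable
    qed
    have "(\<Sum>t<N. q t y) * p = (\<Sum>t<N. q t y * p)" by (rule sum_distrib_right)
    also have "\<dots> \<le> (\<Sum>t<N. \<integral>\<^sup>+\<omega>. ?F t \<omega> \<partial>M)" by (intro sum_mono qp)
    also have "\<dots> = (\<integral>\<^sup>+\<omega>. (\<Sum>t<N. ?F t \<omega>) \<partial>M)" by (rule nn_integral_sum[symmetric]) (rule Fm)
    also have "\<dots> \<le> (\<integral>\<^sup>+\<omega>. of_nat L \<partial>M)"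
    proof (intro nn_integral_mono)
      fix \<omega>
      let ?R = "\<lambda>t. alive 0 t y (\<lambda>i. blk i \<omega>) \<and> e L N (\<lambda>i. blk (t + i) \<omega>)"
      define S where "S = {t. t < N \<and> ?R t}"
      have finS: "finite S" by (simp add: S_def)
      \<comment> \<open>A time \<open>t'\<close> at distance at least \<open>L\<close> after
        \<open>t\<close> would be alive and, by the descent after \<open>t\<close>, dead. Hence at
        most \<open>L\<close> times below \<open>N\<close> qualify.\<close>
      have close: "t' < t + L" if "t \<in> S" "t' \<in> S" "t < t'" for t t'
      proof (rule ccontr)
        assume "\<not> t' < t + L"
        then have j: "t' - t \<in> {L..N}" using that by (auto simp: S_def)
        then have j1: "1 \<le> t' - t" using L1 by simp
        have "y + (\<Sum>i\<in>{1..<t' - t}. block_incr (blk (t + i) \<omega>)) + block_height (blk (t + 0) \<omega>) \<le> 0"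
          using that(1) j unfolding S_def e_def by blast
        moreover have "(\<Sum>i\<in>{1..<t' - t}. block_incr (blk (t + i) \<omega>)) = (\<Sum>j\<in>{Suc t..<t'}. block_incr (blk (0 + j) \<omega>))"
          using that(3) by (intro sum.reindex_bij_witness[of _ "\<lambda>i. i - t" "\<lambda>i. t + i"]) auto
        moreover have "0 < y + (\<Sum>j\<in>{Suc t..<t'}. block_incr (blk (0 + j) \<omega>)) + block_height (blk (0 + t) \<omega>)"
          using that(2,3) unfolding S_def alive_iff by blast
        ultimately show False by simp
      qed
      have "card S \<le> L"
      proof (cases "S = {}")
        case False
        define t0 where "t0 = Min S"
        have "t0 \<in> S" using False finS by (simp add: t0_def)
        have "S \<subseteq> {t0..<t0 + L}"
        proof
          fix t assume t: "t \<in> S"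
          then have "t0 \<le> t" using finS by (simp add: t0_def)
          then show "t \<in> {t0..<t0 + L}"
            using close[OF \<open>t0 \<in> S\<close> t] L1 by (cases "t = t0") auto
        qed
        then have "card S \<le> card {t0..<t0 + L}" by (intro card_mono) auto
        then show ?thesis by simp
      qed simp
      have "(\<Sum>t<N. ?F t \<omega>) = (\<Sum>t\<in>{..<N} \<inter> {t. ?R t}. 1)"
        by (subst sum.inter_restrict) auto
      also have "{..<N} \<inter> {t. ?R t} = S" by (auto simp: S_def)
      also have "(\<Sum>t\<in>S. 1 :: ennreal) = of_nat (card S)" by simp
      also have "\<dots> \<le> of_nat L" using \<open>card S \<le> L\<close> by (simp add: of_nat_mono)
      finally show "(\<Sum>t<N. ?F t \<omega>) \<le> of_nat L" .
    qed
    also have "\<dots> = of_nat L" by (simp add: emeasure_space_1)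
    finally show ?thesis .
  qed
  have p_fin: "p \<noteq> \<infinity>" by (simp add: p_def emeasure_eq_measure)
  have "(\<Sum>t<N. q t y) \<le> of_nat L / p" for N
  proof -
    have "(\<Sum>t<N. q t y) = (\<Sum>t<N. q t y) * p / p"
      using p p_fin by (simp add: ennreal_mult_divide_eq)
    also have "\<dots> \<le> of_nat L / p" by (intro divide_right_mono_ennreal step)
    finally show ?thesis .
  qed
  then have "(\<Sum>t. q t y) \<le> of_nat L / p" by (intro suminf_le_const) auto
  also have "\<dots> < \<infinity>" using p by (auto simp: ennreal_divide_eq_top_iff less_top[symmetric])
  finally have "green M (D 0 1) (H 0 1) (\<lambda>_. 1) y < \<infinity>" by (simp add: green_def)
  moreover have "iter_green M (D 0 1) (H 0 1) 0 = (\<lambda>_. 1)" by auto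
  ultimately show ?thesis unfolding One_nat_def iter_green_Suc by simp
qed

end

lemma min_scale: "0 \<le> w \<Longrightarrow> 0 < x \<Longrightarrow> x \<le> y \<Longrightarrow> min w y * x \<le> min w x * y" for w x y :: real
  by (auto simp: min_def mult.commute mult_left_mono mult_right_mono intro: order_trans mult_mono)

lemma ennreal_suminf_swap: "(\<Sum>i. \<Sum>l. f i l) = (\<Sum>l. \<Sum>i. f i l)" for f :: "nat \<Rightarrow> nat \<Rightarrow> ennreal"
proof -
  have "(\<Sum>i. \<Sum>l. f i l) = (\<Sum>i. \<integral>\<^sup>+l. f i l \<partial>count_space UNIV)" by (simp add: nn_integral_count_space_nat)
  also have "\<dots> = (\<integral>\<^sup>+l. (\<Sum>i. f i l) \<partial>count_space UNIV)" by (rule nn_integral_suminf[symmetric]) simp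
  finally show ?thesis by (simp add: nn_integral_count_space_nat)
qed

lemma nn_integral_layers: "y = (\<integral>\<^sup>+t. indicator {t. 0 \<le> t \<and> ennreal t < y} t \<partial>lborel)" for y :: ennreal
proof (cases y)
  case (real r)
  then have "{t. 0 \<le> t \<and> ennreal t < y} = {0..<r}" by (auto simp: ennreal_less_iff)
  then show ?thesis using real by simp
next
  case top
  then have "{t. 0 \<le> t \<and> ennreal t < y} = {0..}" by (auto simp: ennreal_less_top)
  moreover have "emeasure lborel {0::real..} = \<infinity>"
  proof -
    have n: "of_nat n \<le> emeasure lborel {0::real..}" for n :: nat
    proof -
      have "of_nat n = emeasure lborel {0..real n}" by (simp add: ennreal_of_nat_eq_real_of_nat)
      also have "\<dots> \<le> emeasure lborel {0::real..}" by (intro emeasure_mono) auto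
      finally show ?thesis .
    qed
    have "(SUP n. of_nat n :: ennreal) \<le> emeasure lborel {0::real..}" by (intro SUP_least n)
    then show ?thesis by (simp add: ennreal_SUP_of_nat_eq_top top_unique)
  qed
  ultimately show ?thesis using top by simp
qed

section \<open>Ottaviani's inequality for the reversed path\<close>

context levy
begin

text \<open>\<open>D 0 1 - H 0 1\<close> is the infimum of the path on \<open>[0, 1]\<close>
  relative to its start, so with probability at least \<open>1 / 2\<close> the path stays above or
  at \<open>- K\<close>. Splitting at the last grid index \<open>k\<close> with
  \<open>a k \<in> U\<close> gives disjoint events that depend on the increments after
  \<open>k\<close>. The independent event \<open>B k\<close> costs a factor 2 and puts
  \<open>D 0 1 + K\<close> into \<open>U\<close>.\<close>

lemma ottaviani_grid:
  assumes K: "1 / 2 \<le> prob {\<omega>\<in>space M. - K \<le> D 0 1 \<omega> - H 0 1 \<omega>}"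
    and U [measurable]: "U \<in> sets borel" and up: "\<And>x y. x \<in> U \<Longrightarrow> x \<le> y \<Longrightarrow> y \<in> U"
  shows "emeasure M {\<omega>\<in>space M. (MAX k\<in>{..2 ^ r}. path 1 \<omega> - path (real k / 2 ^ r) \<omega>) \<in> U}
    \<le> 2 * emeasure M {\<omega>\<in>space M. D 0 1 \<omega> + K \<in> U}"
proof -
  define N :: nat where "N = 2 ^ r"
  have N: "0 < N" "real N = 2 ^ r" by (simp_all add: N_def)
  define a where "a k \<omega> = path 1 \<omega> - path (real k / 2 ^ r) \<omega>" for k \<omega>
  have [measurable]: "a k \<in> borel_measurable M" for k unfolding a_def by measurable
  define A where "A k = {\<omega>\<in>space M. a k \<omega> \<in> U \<and> (\<forall>j\<in>{Suc k..N}. a j \<omega> \<notin> U)}" for k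
  define B where "B k = {\<omega>\<in>space M. - K \<le> path (real k / 2 ^ r) \<omega> - path 0 \<omega>}" for k
  have [measurable]: "A k \<in> sets M" "B k \<in> sets M" for k unfolding A_def B_def by measurable
  have pB: "1 / 2 \<le> emeasure M (B k)" if k: "k \<le> N" for k
  proof -
    have "{\<omega>\<in>space M. - K \<le> D 0 1 \<omega> - H 0 1 \<omega>} \<subseteq> B k"
    proof
      fix \<omega> assume *: "\<omega> \<in> {\<omega>\<in>space M. - K \<le> D 0 1 \<omega> - H 0 1 \<omega>}"
      have "real k \<le> 2 ^ r" using k N by (metis of_nat_le_iff)
      then have "path 1 \<omega> - path (real k / 2 ^ r) \<omega> \<le> H 0 1 \<omega>"
        using * by (intro H_upper) auto
      then show "\<omega> \<in> B k" using * by (simp add: B_def D_def)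
    qed
    then have "prob {\<omega>\<in>space M. - K \<le> D 0 1 \<omega> - H 0 1 \<omega>} \<le> prob (B k)" by (intro finite_measure_mono) auto
    with K have "1 / 2 \<le> prob (B k)" by simp
    then have "ennreal (1 / 2) \<le> ennreal (prob (B k))" by (rule ennreal_leI)
    then show ?thesis by (simp add: emeasure_eq_measure divide_ennreal_def)
  qed
  have AB: "emeasure M (A k \<inter> B k) = emeasure M (A k) * emeasure M (B k)" if k: "k \<le> N" for k
  proof -
    let ?I = "{..<k}" and ?J = "{k..<N}"
    have ind: "indep_var (PiM ?I (\<lambda>_. borel)) (\<lambda>\<omega>. restrict (\<lambda>i. incr N 0 1 i \<omega>) ?I) (PiM ?J (\<lambda>_. borel)) (\<lambda>\<omega>. restrict (\<lambda>i. incr N 0 1 i \<omega>) ?J)"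
      by (rule indep_var_restrict[OF incr_indep]) (use k N in auto)
    define FA where "FA w \<longleftrightarrow> (\<Sum>i\<in>{k..<N}. w i) \<in> U \<and> (\<forall>j\<in>{Suc k..N}. (\<Sum>i\<in>{j..<N}. w i) \<notin> U)" for w :: "nat \<Rightarrow> real"
    define FB where "FB w \<longleftrightarrow> - K \<le> (\<Sum>i<k. w i)" for w :: "nat \<Rightarrow> real"
    have sJ [measurable]: "(\<lambda>w. \<Sum>i\<in>{j..<N}. w i) \<in> borel_measurable (PiM ?J (\<lambda>_. borel :: real measure))" if "k \<le> j" for j
      using that by (intro borel_measurable_sum measurable_component_singleton) auto
    have FAm [measurable]: "Measurable.pred (PiM ?J (\<lambda>_. borel)) FA"
    proof -
      have "Measurable.pred (PiM ?J (\<lambda>_. borel)) (\<lambda>w. (\<Sum>i\<in>{j..<N}. w i) \<notin> U)" if "j \<in> {Suc k..N}" for j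
        using sJ[of j] that by (intro pred_intros_logic) (auto intro!: pred_sets2[OF U])
      then show ?thesis unfolding FA_def
        using sJ[of k] by (intro pred_intros_logic pred_intros_finite) (auto intro!: pred_sets2[OF U])
    qed
    have FBm [measurable]: "Measurable.pred (PiM ?I (\<lambda>_. borel)) FB"
      unfolding FB_def by measurable
    have tail: "(\<Sum>i\<in>{j..<N}. incr N 0 1 i \<omega>) = a j \<omega>" if "j \<le> N" for j \<omega>
    proof -
      have "(\<Sum>i\<in>{j..<N}. incr N 0 1 i \<omega>) = (\<Sum>i<N. incr N 0 1 i \<omega>) - (\<Sum>i<j. incr N 0 1 i \<omega>)"
        using that by (subst sum_diff[symmetric]) (auto intro!: sum.cong)
      then show ?thesis unfolding sum_incr a_def using N by simp
    qed
    have A_iff: "\<omega> \<in> A k \<longleftrightarrow> FA (restrict (\<lambda>i. incr N 0 1 i \<omega>) ?J)" if "\<omega> \<in> space M" for \<omega>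
    proof -
      have "(\<Sum>i\<in>{j..<N}. restrict (\<lambda>i. incr N 0 1 i \<omega>) ?J i) = a j \<omega>" if "k \<le> j" "j \<le> N" for j
        using that by (subst tail[symmetric]) (auto intro!: sum.cong)
      then show ?thesis using that k by (simp add: A_def FA_def)
    qed
    have B_iff: "\<omega> \<in> B k \<longleftrightarrow> FB (restrict (\<lambda>i. incr N 0 1 i \<omega>) ?I)" if "\<omega> \<in> space M" for \<omega>
    proof -
      have "(\<Sum>i<k. restrict (\<lambda>i. incr N 0 1 i \<omega>) ?I i) = (\<Sum>i<k. incr N 0 1 i \<omega>)" by (intro sum.cong) auto
      then show ?thesis unfolding B_def FB_def sum_incr using that N by simp
    qed
    define f where "f = (\<lambda>(u, v). if FB u then if FA v then 1 else 0 else 0 :: ennreal)"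
    have f: "f \<in> borel_measurable (PiM ?I (\<lambda>_. borel) \<Otimes>\<^sub>M PiM ?J (\<lambda>_. borel))"
      unfolding f_def by measurable
    have "emeasure M (A k \<inter> B k) = (\<integral>\<^sup>+\<omega>. indicator (A k \<inter> B k) \<omega> \<partial>M)" by simp
    also have "\<dots> = (\<integral>\<^sup>+\<omega>. f (restrict (\<lambda>i. incr N 0 1 i \<omega>) ?I, restrict (\<lambda>i. incr N 0 1 i \<omega>) ?J) \<partial>M)"
      by (intro nn_integral_cong) (simp add: f_def A_iff B_iff indicator_def)
    also have "\<dots> = (\<integral>\<^sup>+\<omega>. \<integral>\<^sup>+\<omega>'. f (restrict (\<lambda>i. incr N 0 1 i \<omega>) ?I, restrict (\<lambda>i. incr N 0 1 i \<omega>') ?J) \<partial>M \<partial>M)"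
      by (rule nn_integral_indep_pair[OF ind f])
    also have "\<dots> = (\<integral>\<^sup>+\<omega>. \<integral>\<^sup>+\<omega>'. indicator (B k) \<omega> * indicator (A k) \<omega>' \<partial>M \<partial>M)"
      by (intro nn_integral_cong) (simp add: f_def A_iff B_iff indicator_def)
    also have "\<dots> = emeasure M (A k) * emeasure M (B k)"
      by (simp add: nn_integral_cmult nn_integral_multc mult.commute)
    finally show ?thesis .
  qed
  have disj: "disjoint_family_on A {..N}"
    unfolding disjoint_family_on_def
  proof (intro ballI impI)
    fix m n assume "m \<in> {..N}" "n \<in> {..N}" "m \<noteq> n"
    then show "A m \<inter> A n = {}"
      by (cases m n rule: linorder_cases) (fastforce simp: A_def)+
  qed
  have "{\<omega>\<in>space M. (MAX k\<in>{..2 ^ r}. path 1 \<omega> - path (real k / 2 ^ r) \<omega>) \<in> U} \<subseteq> (\<Union>k\<le>N. A k)"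
  proof
    fix \<omega> assume *: "\<omega> \<in> {\<omega>\<in>space M. (MAX k\<in>{..2 ^ r}. path 1 \<omega> - path (real k / 2 ^ r) \<omega>) \<in> U}"
    define S where "S = {k. k \<le> N \<and> a k \<omega> \<in> U}"
    have "Max ((\<lambda>k. a k \<omega>) ` {..N}) \<in> (\<lambda>k. a k \<omega>) ` {..N}" by (rule Max_in) auto
    then obtain k where k: "k \<le> N" "Max ((\<lambda>k. a k \<omega>) ` {..N}) = a k \<omega>"
      unfolding image_iff atMost_iff by blast
    moreover have "Max ((\<lambda>k. a k \<omega>) ` {..N}) \<in> U" using * by (simp add: a_def N_def)
    ultimately have "S \<noteq> {}" by (auto simp: S_def)
    moreover have fin: "finite S" by (simp add: S_def)
    ultimately have "Max S \<in> S" by (intro Max_in)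
    moreover have "j \<notin> S" if "Max S < j" for j using that Max_ge[OF fin, of j] by auto
    ultimately obtain m where m: "m \<in> S" "\<And>j. m < j \<Longrightarrow> j \<notin> S" by blast
    then have "m \<le> N" by (simp add: S_def)
    moreover have "\<omega> \<in> A m" using m * by (auto simp: A_def S_def)
    ultimately show "\<omega> \<in> (\<Union>k\<le>N. A k)" by blast
  qed
  then have "emeasure M {\<omega>\<in>space M. (MAX k\<in>{..2 ^ r}. path 1 \<omega> - path (real k / 2 ^ r) \<omega>) \<in> U} \<le> emeasure M (\<Union>k\<le>N. A k)"
    by (intro emeasure_mono) auto
  also have "\<dots> = (\<Sum>k\<le>N. emeasure M (A k))"
    by (rule sum_emeasure[symmetric]) (use disj in auto)
  also have "\<dots> \<le> (\<Sum>k\<le>N. 2 * emeasure M (A k \<inter> B k))"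
  proof (intro sum_mono)
    fix k assume "k \<in> {..N}"
    then have k: "k \<le> N" by simp
    have "emeasure M (A k) = 2 * (emeasure M (A k) * (1 / 2))"
      by (simp only: mult.left_commute[of 2] ennreal_times_divide) (simp add: ennreal_mult_divide_eq)
    also have "\<dots> \<le> 2 * (emeasure M (A k) * emeasure M (B k))"
      by (intro mult_left_mono pB k) auto
    finally show "emeasure M (A k) \<le> 2 * emeasure M (A k \<inter> B k)" by (simp add: AB[OF k])
  qed
  also have "\<dots> = 2 * emeasure M (\<Union>k\<le>N. A k \<inter> B k)"
  proof -
    have "(\<Sum>k\<le>N. emeasure M (A k \<inter> B k)) = emeasure M (\<Union>k\<le>N. A k \<inter> B k)"
      by (rule sum_emeasure) (use disj in \<open>auto simp: disjoint_family_on_def\<close>)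
    then show ?thesis by (simp add: sum_distrib_left[symmetric])
  qed
  also have "\<dots> \<le> 2 * emeasure M {\<omega>\<in>space M. D 0 1 \<omega> + K \<in> U}"
  proof (intro mult_left_mono emeasure_mono)
    show "(\<Union>k\<le>N. A k \<inter> B k) \<subseteq> {\<omega>\<in>space M. D 0 1 \<omega> + K \<in> U}"
    proof
      fix \<omega> assume "\<omega> \<in> (\<Union>k\<le>N. A k \<inter> B k)"
      then obtain k where k: "\<omega> \<in> A k" "\<omega> \<in> B k" by auto
      then have "a k \<omega> \<le> D 0 1 \<omega> + K" by (simp add: B_def a_def D_def)
      then show "\<omega> \<in> {\<omega>\<in>space M. D 0 1 \<omega> + K \<in> U}" using k(1) up by (auto simp: A_def)
    qed
  qed auto
  finally show ?thesis .
qed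

text \<open>Grid maxima converge to \<open>H 0 1\<close> from below, possibly without reaching a
  closed up-set. Enlarging \<open>U\<close> by 1 leaves room, and Fatou's lemma passes to the
  limit.\<close>

lemma ottaviani_up_set:
  assumes K: "1 / 2 \<le> prob {\<omega>\<in>space M. - K \<le> D 0 1 \<omega> - H 0 1 \<omega>}"
    and U [measurable]: "U \<in> sets borel" and up: "\<And>x y. x \<in> U \<Longrightarrow> x \<le> y \<Longrightarrow> y \<in> U"
  shows "emeasure M {\<omega>\<in>space M. H 0 1 \<omega> \<in> U} \<le> 2 * emeasure M {\<omega>\<in>space M. D 0 1 \<omega> + (K + 1) \<in> U}"
proof -
  define U' where "U' = {x. x + 1 \<in> U}"
  have [measurable]: "U' \<in> sets borel" unfolding U'_def by measurable
  let ?m = "\<lambda>r \<omega>. MAX k\<in>{..2 ^ r}. path 1 \<omega> - path (real k / 2 ^ r) \<omega>"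
  have m [measurable]: "?m r \<in> borel_measurable M" for r
    by (intro borel_measurable_Max) auto
  have "emeasure M {\<omega>\<in>space M. H 0 1 \<omega> \<in> U} = (\<integral>\<^sup>+\<omega>. indicator {\<omega>\<in>space M. H 0 1 \<omega> \<in> U} \<omega> \<partial>M)" by simp
  also have "\<dots> \<le> (\<integral>\<^sup>+\<omega>. liminf (\<lambda>r. indicator {\<omega>\<in>space M. ?m r \<omega> \<in> U'} \<omega>) \<partial>M)"
  proof (intro nn_integral_mono)
    fix \<omega> assume \<omega>: "\<omega> \<in> space M"
    show "indicator {\<omega>\<in>space M. H 0 1 \<omega> \<in> U} \<omega> \<le> liminf (\<lambda>r. indicator {\<omega>\<in>space M. ?m r \<omega> \<in> U'} \<omega> :: ennreal)"
    proof (cases "H 0 1 \<omega> \<in> U")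
      case True
      have "\<forall>\<^sub>F r in sequentially. H 0 1 \<omega> - 1 < ?m r \<omega>"
        using order_tendstoD(1)[OF H_grid_tendsto[OF \<omega>, of 0 1], of "H 0 1 \<omega> - 1"] by simp
      then have "\<forall>\<^sub>F r in sequentially. 1 \<le> (indicator {\<omega>\<in>space M. ?m r \<omega> \<in> U'} \<omega> :: ennreal)"
      proof eventually_elim
        case (elim r)
        then have "?m r \<omega> \<in> U'" unfolding U'_def using up[OF True, of "?m r \<omega> + 1"] by simp
        then show ?case using \<omega> by simp
      qed
      then have "1 \<le> liminf (\<lambda>r. indicator {\<omega>\<in>space M. ?m r \<omega> \<in> U'} \<omega> :: ennreal)" by (rule Liminf_bounded)
      then show ?thesis using True \<omega> by simp
    qed simp
  qed
  also have "\<dots> \<le> liminf (\<lambda>r. \<integral>\<^sup>+\<omega>. indicator {\<omega>\<in>space M. ?m r \<omega> \<in> U'} \<omega> \<partial>M)"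
    by (rule nn_integral_liminf) measurable
  also have "\<dots> = liminf (\<lambda>r. emeasure M {\<omega>\<in>space M. ?m r \<omega> \<in> U'})" by simp
  also have "\<dots> \<le> 2 * emeasure M {\<omega>\<in>space M. D 0 1 \<omega> + K \<in> U'}"
  proof (rule Liminf_le)
    show "\<forall>\<^sub>F r in sequentially. emeasure M {\<omega>\<in>space M. ?m r \<omega> \<in> U'} \<le> 2 * emeasure M {\<omega>\<in>space M. D 0 1 \<omega> + K \<in> U'}"
      by (intro always_eventually allI ottaviani_grid K) (auto simp: U'_def intro: up)
  qed simp
  also have "\<dots> = 2 * emeasure M {\<omega>\<in>space M. D 0 1 \<omega> + (K + 1) \<in> U}" by (simp add: U'_def add.assoc)
  finally show ?thesis .
qed

text \<open>A version of Ottaviani's inequality for the path read backwards from time 1.\<close>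
lemma ottaviani:
  obtains K where "\<And>f :: real \<Rightarrow> ennreal. f \<in> borel_measurable borel \<Longrightarrow> mono f \<Longrightarrow>
    (\<integral>\<^sup>+\<omega>. f (H 0 1 \<omega>) \<partial>M) \<le> 2 * (\<integral>\<^sup>+\<omega>. f (D 0 1 \<omega> + K) \<partial>M)"
proof -
  let ?E = "\<lambda>n::nat. {\<omega>\<in>space M. - real n \<le> D 0 1 \<omega> - H 0 1 \<omega>}"
  have "(\<lambda>n. prob (?E n)) \<longlonglongrightarrow> prob (\<Union>n. ?E n)"
    by (rule finite_Lim_measure_incseq) (auto simp: incseq_def)
  moreover have "(\<Union>n. ?E n) = space M"
  proof -
    have "\<exists>n::nat. - real n \<le> D 0 1 \<omega> - H 0 1 \<omega>" for \<omega>
      using real_arch_simple[of "H 0 1 \<omega> - D 0 1 \<omega>"] by (auto simp: algebra_simps)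
    then show ?thesis by auto
  qed
  ultimately have "(\<lambda>n. prob (?E n)) \<longlonglongrightarrow> 1" by (simp add: prob_space)
  then have "\<forall>\<^sub>F n in sequentially. 1 / 2 < prob (?E n)" by (intro order_tendstoD) auto
  then obtain n where n: "1 / 2 \<le> prob (?E n)" by (auto simp: eventually_sequentially intro: less_imp_le)
  show ?thesis
  proof (rule that)
    fix f :: "real \<Rightarrow> ennreal" assume f [measurable]: "f \<in> borel_measurable borel" and mono: "mono f"
    \<comment> \<open>Superlevel sets of a nondecreasing \<open>f\<close> are up-sets, so the
      inequality for up-sets can be integrated over the levels.\<close>
    have lay: "(\<integral>\<^sup>+\<omega>. f (Y \<omega>) \<partial>M) = (\<integral>\<^sup>+t. indicator {0..} t * emeasure M {\<omega>\<in>space M. ennreal t < f (Y \<omega>)} \<partial>lborel)"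
      if [measurable]: "Y \<in> borel_measurable M" for Y
    proof -
      interpret pair_sigma_finite M lborel ..
      have "(\<integral>\<^sup>+\<omega>. f (Y \<omega>) \<partial>M) = (\<integral>\<^sup>+\<omega>. \<integral>\<^sup>+t. (if 0 \<le> t \<and> ennreal t < f (Y \<omega>) then 1 else 0) \<partial>lborel \<partial>M)"
      proof (intro nn_integral_cong)
        fix \<omega>
        show "f (Y \<omega>) = (\<integral>\<^sup>+t. (if 0 \<le> t \<and> ennreal t < f (Y \<omega>) then 1 else 0) \<partial>lborel)"
          using nn_integral_layers[of "f (Y \<omega>)"] unfolding indicator_def of_bool_def by simp
      qed
      also have "\<dots> = (\<integral>\<^sup>+t. \<integral>\<^sup>+\<omega>. (if 0 \<le> t \<and> ennreal t < f (Y \<omega>) then 1 else 0) \<partial>M \<partial>lborel)"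
        by (rule Fubini'[symmetric]) measurable
      also have "\<dots> = (\<integral>\<^sup>+t. \<integral>\<^sup>+\<omega>. indicator {0..} t * indicator {\<omega>\<in>space M. ennreal t < f (Y \<omega>)} \<omega> \<partial>M \<partial>lborel)"
        by (intro nn_integral_cong) (auto simp: indicator_def)
      also have "\<dots> = (\<integral>\<^sup>+t. indicator {0..} t * emeasure M {\<omega>\<in>space M. ennreal t < f (Y \<omega>)} \<partial>lborel)"
        by (intro nn_integral_cong) (simp add: nn_integral_cmult)
      finally show ?thesis .
    qed
    have "(\<integral>\<^sup>+\<omega>. f (H 0 1 \<omega>) \<partial>M) \<le> (\<integral>\<^sup>+t. 2 * (indicator {0..} t * emeasure M {\<omega>\<in>space M. ennreal t < f (D 0 1 \<omega> + (real n + 1))}) \<partial>lborel)"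
    proof (subst lay, simp, intro nn_integral_mono)
      fix t :: real
      have "emeasure M {\<omega>\<in>space M. H 0 1 \<omega> \<in> {x. ennreal t < f x}} \<le> 2 * emeasure M {\<omega>\<in>space M. D 0 1 \<omega> + (real n + 1) \<in> {x. ennreal t < f x}}"
        by (rule ottaviani_up_set[OF n]) (use mono in \<open>auto intro: less_le_trans dest: monoD\<close>)
      then show "indicator {0..} t * emeasure M {\<omega>\<in>space M. ennreal t < f (H 0 1 \<omega>)} \<le> 2 * (indicator {0..} t * emeasure M {\<omega>\<in>space M. ennreal t < f (D 0 1 \<omega> + (real n + 1))})"
        by (auto simp: indicator_def)
    qed
    also have "\<dots> = 2 * (\<integral>\<^sup>+\<omega>. f (D 0 1 \<omega> + (real n + 1)) \<partial>M)"
      by (subst nn_integral_cmult) (auto simp: lay)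
    finally show "(\<integral>\<^sup>+\<omega>. f (H 0 1 \<omega>) \<partial>M) \<le> 2 * (\<integral>\<^sup>+\<omega>. f (D 0 1 \<omega> + (real n + 1)) \<partial>M)" .
  qed
qed

end

section \<open>Summability of weighted survival probabilities\<close>

context levy_drift
begin

lemma D_eq_X: "\<omega> \<in> space M \<Longrightarrow> D 0 1 \<omega> = X 1 \<omega>"
  by (simp add: D_def path_eq X_0)

lemma trunc_neg_D: "trunc_neg M (D 0 1) x = trunc_neg M (X 1) x"
  unfolding trunc_neg_def by (intro Bochner_Integration.integral_cong) (auto simp: D_eq_X)

text \<open>Ottaviani's inequality replaces the height by \<open>D 0 1 + K\<close>. From a positive
  start \<open>y \<ge> K\<close> the first step is never killed, so the expectation is at most
  \<open>kstep\<close> of \<open>W 1\<close> at \<open>y\<close>, and the recursion bounds that by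
  \<open>W 1 y\<close>.\<close>

lemma EW1_finite: "(\<integral>\<^sup>+\<omega>. W 1 (H 0 1 \<omega>) \<partial>M) < \<infinity>"
proof -
  obtain K where K: "\<And>f :: real \<Rightarrow> ennreal. f \<in> borel_measurable borel \<Longrightarrow> mono f \<Longrightarrow>
    (\<integral>\<^sup>+\<omega>. f (H 0 1 \<omega>) \<partial>M) \<le> 2 * (\<integral>\<^sup>+\<omega>. f (D 0 1 \<omega> + K) \<partial>M)" by (rule ottaviani) blast
  define y where "y = max K 1"
  have y: "0 < y" "K \<le> y" by (auto simp: y_def)
  have "(\<integral>\<^sup>+\<omega>. W 1 (H 0 1 \<omega>) \<partial>M) \<le> 2 * (\<integral>\<^sup>+\<omega>. W 1 (D 0 1 \<omega> + K) \<partial>M)"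
    by (rule K) (auto intro: iter_green_mono)
  also have "\<dots> \<le> 2 * kstep M (D 0 1) (H 0 1) (W 1) y"
    unfolding kstep_def
  proof (intro mult_left_mono nn_integral_mono)
    fix \<omega> assume "\<omega> \<in> space M"
    then have "0 \<le> H 0 1 \<omega>" by (rule H_nonneg) simp
    then have "0 < y + H 0 1 \<omega>" using y by simp
    then show "W 1 (D 0 1 \<omega> + K) \<le> (if 0 < y + H 0 1 \<omega> then W 1 (y + D 0 1 \<omega>) else 0)"
      using y by (auto intro!: iter_green_monoD)
  qed simp
  also have "\<dots> \<le> 2 * W 1 y"
    using mk.iter_green_rec[of 0 y] by (intro mult_left_mono) auto
  also have "\<dots> < \<infinity>" using W1_finite[of y] by (simp add: ennreal_mult_less_top)
  finally show ?thesis .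
qed

text \<open>Otherwise all unit increments are nonnegative almost surely, and the path stays
  nonnegative at integer times, against the drift.\<close>

lemma trunc_neg_pos: "0 < trunc_neg M (X 1) 1"
proof (rule ccontr)
  assume "\<not> 0 < trunc_neg M (X 1) 1"
  then have z: "trunc_neg M (X 1) 1 = 0" using trunc_neg_nonneg[of 1 "X 1"] by simp
  have "AE \<omega> in M. min (max 0 (- X 1 \<omega>)) 1 = 0"
    using z unfolding trunc_neg_def
    by (subst (asm) integral_nonneg_eq_0_iff_AE) (auto intro!: integrable_const_bound[of _ 1])
  then have "AE \<omega> in M. 0 \<le> block_incr (blk 0 \<omega>)"
    using AE_space by eventually_elim (auto simp: D_eq_X min_def max_def split: if_splits)
  then have a0: "(\<integral>\<^sup>+\<omega>. (if 0 \<le> block_incr (blk 0 \<omega>) then 0 else 1) \<partial>M) = 0"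
    by (subst nn_integral_0_iff_AE) auto
  have "AE \<omega> in M. 0 \<le> block_incr (blk i \<omega>)" for i
  proof -
    have "(\<integral>\<^sup>+\<omega>. (\<lambda>z. if 0 \<le> block_incr z then 0 else 1) (blk i \<omega>) \<partial>M) = 0"
      by (subst nn_integral_blk) (use a0 in auto)
    then show ?thesis by (subst (asm) nn_integral_0_iff_AE) (auto split: if_splits)
  qed
  then have "AE \<omega> in M. \<forall>i. 0 \<le> block_incr (blk i \<omega>)" by (simp add: AE_all_countable)
  with drift have "AE \<omega> in M. False"
    using AE_space
  proof eventually_elim
    case (elim \<omega>)
    have "0 \<le> path (real n) \<omega>" for n
    proof (induction n)
      case (Suc n)
      then show ?case using elim(2) block_incr_blk[of n \<omega>] by (metis add_increasing2 diff_add_cancel add.commute)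
    qed (use elim(3) in \<open>simp add: path_eq X_0\<close>)
    moreover have "\<forall>\<^sub>F t in at_top. X t \<omega> \<le> - 1"
      using elim(1) by (auto simp: filterlim_at_bot)
    then obtain T where T: "\<And>t. T \<le> t \<Longrightarrow> X t \<omega> \<le> - 1" by (auto simp: eventually_at_top_linorder)
    obtain n :: nat where "T \<le> real n" using real_arch_simple by blast
    from T[OF this] have "path (real n) \<omega> \<le> - 1" by (simp add: path_eq)
    ultimately show ?case by (metis not_le order_trans neg_le_0_iff_le zero_le_one le_minus_one_simps(3))
  qed
  then show False by simp
qed

text \<open>Controls the expected relative growth of \<open>J\<close> over one unit of time, capped
  at 1 and split by its logarithmic level \<open>l\<close>; the walk starts at a block height raised
  by that level.\<close>

definition \<tau> :: "nat \<Rightarrow> ennreal" where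
  "\<tau> i = (\<Sum>l. ennreal (exp (- real l)) * (\<integral>\<^sup>+\<omega>. q i (H 0 1 \<omega> + real (Suc l)) \<partial>M))"

lemma sum_pow_\<tau>_le:
  "(\<Sum>i. of_nat ((i + 1) ^ n) * \<tau> i) \<le> of_nat (fact n) * (\<Sum>l. ennreal (exp (- real l)) * (\<integral>\<^sup>+\<omega>. W (Suc n) (H 0 1 \<omega> + real (Suc l)) \<partial>M))"
proof -
  have "(\<Sum>i. of_nat ((i + 1) ^ n) * \<tau> i)
    = (\<Sum>i. \<Sum>l. ennreal (exp (- real l)) * (of_nat ((i + 1) ^ n) * (\<integral>\<^sup>+\<omega>. q i (H 0 1 \<omega> + real (Suc l)) \<partial>M)))"
    unfolding \<tau>_def by (simp only: ennreal_suminf_cmult[symmetric] mult.left_commute)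
  also have "\<dots> = (\<Sum>l. \<Sum>i. ennreal (exp (- real l)) * (of_nat ((i + 1) ^ n) * (\<integral>\<^sup>+\<omega>. q i (H 0 1 \<omega> + real (Suc l)) \<partial>M)))"
    by (rule ennreal_suminf_swap)
  also have "\<dots> \<le> (\<Sum>l. of_nat (fact n) * (ennreal (exp (- real l)) * (\<integral>\<^sup>+\<omega>. W (Suc n) (H 0 1 \<omega> + real (Suc l)) \<partial>M)))"
  proof (intro suminf_le summableI)
    fix l
    have "(\<Sum>i. of_nat ((i + 1) ^ n) * (\<integral>\<^sup>+\<omega>. q i (H 0 1 \<omega> + real (Suc l)) \<partial>M))
      = (\<Sum>i. \<integral>\<^sup>+\<omega>. of_nat ((i + 1) ^ n) * q i (H 0 1 \<omega> + real (Suc l)) \<partial>M)"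
      by (intro suminf_cong nn_integral_cmult[symmetric]) measurable
    also have "\<dots> = (\<integral>\<^sup>+\<omega>. (\<Sum>i. of_nat ((i + 1) ^ n) * q i (H 0 1 \<omega> + real (Suc l))) \<partial>M)"
      by (rule nn_integral_suminf[symmetric]) measurable
    also have "\<dots> \<le> (\<integral>\<^sup>+\<omega>. of_nat (fact n) * W (Suc n) (H 0 1 \<omega> + real (Suc l)) \<partial>M)"
      by (intro nn_integral_mono mk.suminf_pow_kstep_pow_le)
    also have "\<dots> = of_nat (fact n) * (\<integral>\<^sup>+\<omega>. W (Suc n) (H 0 1 \<omega> + real (Suc l)) \<partial>M)"
      by (rule nn_integral_cmult) measurable
    finally have "ennreal (exp (- real l)) * (\<Sum>i. of_nat ((i + 1) ^ n) * (\<integral>\<^sup>+\<omega>. q i (H 0 1 \<omega> + real (Suc l)) \<partial>M))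
      \<le> ennreal (exp (- real l)) * (of_nat (fact n) * (\<integral>\<^sup>+\<omega>. W (Suc n) (H 0 1 \<omega> + real (Suc l)) \<partial>M))"
      by (rule mult_left_mono) simp
    then show "(\<Sum>i. ennreal (exp (- real l)) * (of_nat ((i + 1) ^ n) * (\<integral>\<^sup>+\<omega>. q i (H 0 1 \<omega> + real (Suc l)) \<partial>M)))
      \<le> of_nat (fact n) * (ennreal (exp (- real l)) * (\<integral>\<^sup>+\<omega>. W (Suc n) (H 0 1 \<omega> + real (Suc l)) \<partial>M))"
      by (simp only: ennreal_suminf_cmult mult.left_commute)
  qed
  finally show ?thesis by (simp only: ennreal_suminf_cmult)
qed

lemma sum_\<tau>_finite: "(\<Sum>i. \<tau> i) < \<infinity>"
proof -
  have "(\<Sum>l. ennreal (exp (- real l)) * (\<integral>\<^sup>+\<omega>. W 1 (H 0 1 \<omega> + real (Suc l)) \<partial>M)) < \<infinity>"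
  proof (rule mk.iter_green_exp_sum)
    fix k :: nat assume "k \<le> 1"
    then consider "k = 0" | "k = 1" by linarith
    note cases = this
    show "(\<integral>\<^sup>+\<omega>. W k (H 0 1 \<omega>) \<partial>M) < \<infinity>"
      using cases by cases (auto simp: emeasure_space_1 EW1_finite[simplified])
    show "W k 1 < \<infinity>" using cases W1_finite[of 1] by cases auto
  qed
  then show ?thesis using sum_pow_\<tau>_le[of 0] by (auto elim: le_less_trans)
qed

text \<open>\<open>(x / a x) ^ (n + 1)\<close> is nondecreasing in \<open>x\<close>, so Ottaviani's
  inequality reduces its mean at the block height to one at \<open>X 1 + K\<close>, which
  \<open>moment_criterion\<close> controls. The exponent \<open>n + 1\<close> is the number of Green
  iterations that weights of degree \<open>n\<close> require.\<close>

lemma sum_pow_\<tau>_finite: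
  assumes triplet: "has_levy_triplet M X \<gamma> \<sigma>2 Lm"
    and x0: "1 < x0" and A: "\<And>x. x0 \<le> x \<Longrightarrow> levy_A \<gamma> Lm x \<noteq> 0"
    and fin: "(\<integral>\<^sup>+ x\<in>{x0<..}. ennreal ((x / \<bar>levy_A \<gamma> Lm x\<bar>) ^ (n + 1)) \<partial>Lm) < \<infinity>"
  shows "(\<Sum>i. of_nat ((i + 1) ^ n) * \<tau> i) < \<infinity>"
proof -
  interpret L: levy_khintchine_law M "X 1" \<gamma> \<sigma>2 Lm
    by unfold_locales (use triplet in \<open>auto simp: has_levy_triplet_def\<close>)
  define a where "a = trunc_neg M (X 1)"
  have a1: "0 < a 1" unfolding a_def by (rule trunc_neg_pos)
  have a_pos: "0 < a x" if "1 \<le> x" for x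
    using a1 trunc_neg_mono[of "X 1" 1 x] that unfolding a_def by simp
  have ratio: "x / a x \<le> y / a y" if xy: "1 \<le> x" "x \<le> y" for x y
  proof -
    have "(\<integral>\<omega>. min (max 0 (- X 1 \<omega>)) y * x \<partial>M) \<le> (\<integral>\<omega>. min (max 0 (- X 1 \<omega>)) x * y \<partial>M)"
    proof (rule integral_mono)
      show "integrable M (\<lambda>\<omega>. min (max 0 (- X 1 \<omega>)) y * x)" "integrable M (\<lambda>\<omega>. min (max 0 (- X 1 \<omega>)) x * y)"
        using xy by (auto intro!: integrable_mult_left trunc_neg_integrable)
    qed (use xy in \<open>auto intro!: min_scale\<close>)
    then have "a y * x \<le> a x * y" by (simp add: a_def trunc_neg_def)
    then show ?thesis using a_pos[of x] a_pos[of y] xy by (simp add: field_simps)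
  qed
  have [measurable]: "a \<in> borel_measurable borel" unfolding a_def trunc_neg_def by measurable
  obtain K where K: "\<And>f :: real \<Rightarrow> ennreal. f \<in> borel_measurable borel \<Longrightarrow> mono f \<Longrightarrow>
    (\<integral>\<^sup>+\<omega>. f (H 0 1 \<omega>) \<partial>M) \<le> 2 * (\<integral>\<^sup>+\<omega>. f (D 0 1 \<omega> + K) \<partial>M)" by (rule ottaviani) blast
  let ?f = "\<lambda>x. if 1 \<le> x then ennreal ((x / a x) ^ (n + 1)) else 0"
  have mono: "mono ?f"
  proof (rule monoI)
    fix x y :: real assume xy: "x \<le> y"
    show "?f x \<le> ?f y"
    proof (cases "1 \<le> x")
      case True
      then have "(x / a x) ^ (n + 1) \<le> (y / a y) ^ (n + 1)"
        using a_pos[of x] ratio[OF True xy] by (intro power_mono) auto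
      then show ?thesis using True xy by (simp add: ennreal_leI)
    qed simp
  qed
  have "(\<integral>\<^sup>+\<omega>. ?f (H 0 1 \<omega>) \<partial>M) \<le> 2 * (\<integral>\<^sup>+\<omega>. ?f (D 0 1 \<omega> + K) \<partial>M)"
    by (rule K[OF _ mono]) measurable
  also have "(\<integral>\<^sup>+\<omega>. ?f (D 0 1 \<omega> + K) \<partial>M) = (\<integral>\<^sup>+\<omega>. ?f (X 1 \<omega> + K) \<partial>M)"
    by (intro nn_integral_cong) (simp add: D_eq_X)
  also have "2 * \<dots> < \<infinity>"
    using L.moment_criterion[of "n + 1" x0 K, OF _ x0 A fin] a1
    unfolding a_def by (simp add: ennreal_mult_less_top)
  finally have mom: "(\<integral>\<^sup>+\<omega>. ?f (H 0 1 \<omega>) \<partial>M) < \<infinity>" .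
  note fin_W = mk.iter_green_moments[of "n + 1", OF H_nonneg _ EW1_finite, unfolded trunc_neg_D, folded a_def, OF _ _ W1_finite a1 mom]
  have "(\<Sum>l. ennreal (exp (- real l)) * (\<integral>\<^sup>+\<omega>. W (n + 1) (H 0 1 \<omega> + real (Suc l)) \<partial>M)) < \<infinity>"
    by (rule mk.iter_green_exp_sum) (rule fin_W; simp)+
  then show ?thesis using sum_pow_\<tau>_le[of n] of_nat_less_top[of "fact n"]
    by (auto elim!: le_less_trans simp: ennreal_mult_less_top)
qed

end

section \<open>The convolution identity\<close>

lemma integrable_indicator_interval [simp]:
  "integrable lborel (indicat_real {s..t})" "integrable lborel (indicat_real {s<..t})" for s t :: real
  by (cases "s \<le> t"; simp)+

text \<open>The substitution \<open>v = \<Phi> t\<close> for an absolutely continuous \<open>\<Phi>\<close> whose density is merely measurable.\<close>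
lemma nn_integral_density_pushforward:
  fixes p :: "real \<Rightarrow> real" and f :: "real \<Rightarrow> ennreal"
  defines "\<Phi> \<equiv> (\<lambda>t. \<integral>u. indicator {0..t} u * p u \<partial>lborel)"
  assumes p [measurable]: "p \<in> borel_measurable borel" and T: "0 < T" and m: "0 < m"
    and bd: "\<And>u. 0 \<le> u \<Longrightarrow> u \<le> T \<Longrightarrow> m \<le> p u" "\<And>u. 0 \<le> u \<Longrightarrow> u \<le> T \<Longrightarrow> p u \<le> C"
    and f [measurable]: "f \<in> borel_measurable borel"
  shows "(\<integral>\<^sup>+t. indicator {0..T} t * (ennreal (p t) * f (\<Phi> t)) \<partial>lborel) = (\<integral>\<^sup>+v. indicator {0..\<Phi> T} v * f v \<partial>lborel)"
    and "0 \<le> s \<Longrightarrow> s < t \<Longrightarrow> t \<le> T \<Longrightarrow> \<Phi> s < \<Phi> t"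
proof -
  have \<Phi>_m [measurable]: "\<Phi> \<in> borel_measurable borel"
    unfolding \<Phi>_def indicator_def of_bool_def atLeastAtMost_iff by measurable
  have int: "integrable lborel (\<lambda>u. indicator {0..t} u * p u)" if "t \<le> T" for t
  proof (rule Bochner_Integration.integrable_bound)
    show "integrable lborel (\<lambda>u. indicator {0..t} u * C)" by simp
    show "AE u in lborel. norm (indicator {0..t} u * p u) \<le> norm (indicator {0..t} u * C)"
      using bd m that by (intro AE_I2) (fastforce simp: indicator_def)
  qed measurable
  have diff: "\<Phi> t - \<Phi> s = (\<integral>u. indicator {s<..t} u * p u \<partial>lborel)"
    and int': "integrable lborel (\<lambda>u. indicator {s<..t} u * p u)" if "0 \<le> s" "s \<le> t" "t \<le> T" for s t
  proof -
    have e: "indicator {s<..t} u * p u = indicator {0..t} u * p u - indicator {0..s} u * p u" for u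
      using that by (auto simp: indicator_def)
    show "\<Phi> t - \<Phi> s = (\<integral>u. indicator {s<..t} u * p u \<partial>lborel)"
      unfolding \<Phi>_def e using int that by (subst Bochner_Integration.integral_diff) auto
    show "integrable lborel (\<lambda>u. indicator {s<..t} u * p u)"
      unfolding e using int that by (intro Bochner_Integration.integrable_diff) auto
  qed
  have nn: "(\<integral>\<^sup>+u. indicator {s<..t} u * ennreal (p u) \<partial>lborel) = ennreal (\<Phi> t - \<Phi> s)" if st: "0 \<le> s" "s \<le> t" "t \<le> T" for s t
  proof -
    have nonneg: "0 \<le> indicator {s<..t} u * p u" for u using bd(1)[of u] m st by (auto simp: indicator_def)
    have "(\<integral>\<^sup>+u. indicator {s<..t} u * ennreal (p u) \<partial>lborel) = (\<integral>\<^sup>+u. ennreal (indicator {s<..t} u * p u) \<partial>lborel)"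
      by (intro nn_integral_cong) (auto simp: indicator_def)
    also have "\<dots> = ennreal (\<Phi> t - \<Phi> s)"
      unfolding diff[OF st] by (rule nn_integral_eq_integral[OF int'[OF st]]) (simp add: nonneg)
    finally show ?thesis .
  qed
  have low: "m * (t - s) \<le> \<Phi> t - \<Phi> s" and up: "\<Phi> t - \<Phi> s \<le> C * (t - s)" if st: "0 \<le> s" "s \<le> t" "t \<le> T" for s t
  proof -
    have "(\<integral>u. indicator {s<..t} u * m \<partial>lborel) \<le> (\<integral>u. indicator {s<..t} u * p u \<partial>lborel)"
    proof (rule integral_mono)
      show "indicator {s<..t} u * m \<le> indicator {s<..t} u * p u" for u
        using bd(1)[of u] st by (auto simp: indicator_def)
    qed (use int'[OF st] in simp_all)
    then show "m * (t - s) \<le> \<Phi> t - \<Phi> s" using st by (simp add: diff mult.commute)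
    have "(\<integral>u. indicator {s<..t} u * p u \<partial>lborel) \<le> (\<integral>u. indicator {s<..t} u * C \<partial>lborel)"
    proof (rule integral_mono)
      show "indicator {s<..t} u * p u \<le> indicator {s<..t} u * C" for u
        using bd(2)[of u] st by (auto simp: indicator_def)
    qed (use int'[OF st] in simp_all)
    then show "\<Phi> t - \<Phi> s \<le> C * (t - s)" using st by (simp add: diff mult.commute)
  qed
  have strict: "\<Phi> s < \<Phi> t" if "0 \<le> s" "s < t" "t \<le> T" for s t
    using low[of s t] mult_pos_pos[OF m, of "t - s"] that by linarith
  then show "0 \<le> s \<Longrightarrow> s < t \<Longrightarrow> t \<le> T \<Longrightarrow> \<Phi> s < \<Phi> t" .
  have mono: "\<Phi> s \<le> \<Phi> t" if "0 \<le> s" "s \<le> t" "t \<le> T" for s t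
    using strict[of s t] that by (cases "s = t") auto
  have \<Phi>0: "\<Phi> 0 = 0"
  proof -
    have "\<Phi> 0 = (\<integral>u. 0 \<partial>(lborel :: real measure))"
      unfolding \<Phi>_def
    proof (rule integral_cong_AE)
      show "AE u in lborel. indicator {0..0} u * p u = 0"
        using AE_lborel_singleton[of 0] by eventually_elim (simp add: indicator_def)
    qed auto
    then show ?thesis by simp
  qed
  have Cm: "m \<le> C" using bd[of 0] T by (simp add: order_trans)
  have cont: "continuous_on {0..T} \<Phi>"
  proof (rule lipschitz_on_continuous_on, rule lipschitz_onI)
    fix s t assume st: "s \<in> {0..T}" "t \<in> {0..T}"
    show "dist (\<Phi> s) (\<Phi> t) \<le> C * dist s t"
    proof (cases "s \<le> t")
      case True
      then show ?thesis using up[of s t] mono[of s t] st by (simp add: dist_real_def)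
    next
      case False
      then show ?thesis using up[of t s] mono[of t s] st by (simp add: dist_real_def)
    qed
  qed (use Cm m in simp)
  define \<mu> where "\<mu> = distr (density lborel (\<lambda>t. indicator {0..T} t * ennreal (p t))) borel \<Phi>"
  define \<nu> where "\<nu> = density lborel (indicator {0..\<Phi> T} :: real \<Rightarrow> ennreal)"
  have e\<mu>: "emeasure \<mu> {x<..} = (\<integral>\<^sup>+t. indicator {0..T} t * ennreal (p t) * indicator {t. x < \<Phi> t} t \<partial>lborel)" for x
  proof -
    have "\<Phi> -` {x<..} = {t. x < \<Phi> t}" by auto
    then show ?thesis unfolding \<mu>_def by (subst emeasure_distr) (auto simp: emeasure_density)
  qed
  have e\<nu>: "emeasure \<nu> {x<..} = emeasure lborel ({0..\<Phi> T} \<inter> {x<..})" for x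
  proof -
    have "emeasure \<nu> {x<..} = (\<integral>\<^sup>+t. indicator ({0..\<Phi> T} \<inter> {x<..}) t \<partial>lborel)"
      unfolding \<nu>_def indicator_inter_arith by (rule emeasure_density) auto
    then show ?thesis by simp
  qed
  \<comment> \<open>\<open>\<Phi>\<close> is continuous and strictly increasing on
    \<open>[0, T]\<close>, so the times with \<open>x < \<Phi> t\<close> form the interval after the
    preimage \<open>s\<close> of \<open>x\<close>. Half-lines then determine the two
    measures.\<close>
  have eq: "emeasure \<mu> {x<..} = emeasure \<nu> {x<..}" for x
  proof -
    consider "x < 0" | "0 \<le> x" "x \<le> \<Phi> T" | "\<Phi> T < x" by linarith
    then show ?thesis
    proof cases
      case 1
      have "emeasure \<mu> {x<..} = (\<integral>\<^sup>+t. indicator {0<..T} t * ennreal (p t) \<partial>lborel)"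
        unfolding e\<mu>
      proof (rule nn_integral_cong_AE, use AE_lborel_singleton[of 0] in eventually_elim)
        case (elim t)
        have "x < \<Phi> t" if "0 \<le> t" "t \<le> T" using mono[of 0 t] that 1 \<Phi>0 by simp
        then show ?case using elim by (auto simp: indicator_def)
      qed
      also have "\<dots> = ennreal (\<Phi> T)" using nn[of 0 T] T \<Phi>0 by simp
      also have "{0..\<Phi> T} \<inter> {x<..} = {0..\<Phi> T}" using 1 by auto
      then have "ennreal (\<Phi> T) = emeasure \<nu> {x<..}" unfolding e\<nu> using mono[of 0 T] T \<Phi>0 by simp
      finally show ?thesis .
    next
      case 2
      obtain s where s: "0 \<le> s" "s \<le> T" "\<Phi> s = x"
        using IVT'[of \<Phi> 0 x T] 2 T \<Phi>0 cont by auto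
      have "emeasure \<mu> {x<..} = (\<integral>\<^sup>+t. indicator {s<..T} t * ennreal (p t) \<partial>lborel)"
        unfolding e\<mu>
      proof (rule nn_integral_cong)
        fix t
        have "x < \<Phi> t \<longleftrightarrow> s < t" if "0 \<le> t" "t \<le> T"
          using strict[of s t] mono[of t s] that s by (cases "s < t") auto
        then show "indicator {0..T} t * ennreal (p t) * indicator {t. x < \<Phi> t} t = indicator {s<..T} t * ennreal (p t)"
          using s by (auto simp: indicator_def)
      qed
      also have "\<dots> = ennreal (\<Phi> T - x)" using nn[of s T] s by simp
      also have "{0..\<Phi> T} \<inter> {x<..} = {x<..\<Phi> T}" using 2 by auto
      then have "ennreal (\<Phi> T - x) = emeasure \<nu> {x<..}" unfolding e\<nu> using 2 by simp
      finally show ?thesis .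
    next
      case 3
      have "emeasure \<mu> {x<..} = (\<integral>\<^sup>+t. 0 \<partial>(lborel :: real measure))"
        unfolding e\<mu>
      proof (rule nn_integral_cong)
        fix t
        have "\<not> x < \<Phi> t" if "0 \<le> t" "t \<le> T" using mono[of t T] that 3 by simp
        then show "indicator {0..T} t * ennreal (p t) * indicator {t. x < \<Phi> t} t = 0" by (auto simp: indicator_def)
      qed
      also have "{0..\<Phi> T} \<inter> {x<..} = {}" using 3 by auto
      then have "(\<integral>\<^sup>+t. 0 \<partial>(lborel :: real measure)) = emeasure \<nu> {x<..}" unfolding e\<nu> by simp
      finally show ?thesis .
    qed
  qed
  have "\<mu> = \<nu>"
  proof (rule measure_eqI_lessThan)
    show "emeasure \<mu> {x<..} < \<infinity>" for x
      unfolding eq e\<nu> by (rule le_less_trans[OF emeasure_mono[of _ "{0..\<Phi> T}"]]) (auto simp: emeasure_lborel_Icc_eq)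
    show "sets \<mu> = sets borel" "sets \<nu> = sets borel" by (simp_all add: \<mu>_def \<nu>_def)
  qed (rule eq)
  then have "(\<integral>\<^sup>+v. f v \<partial>\<mu>) = (\<integral>\<^sup>+v. f v \<partial>\<nu>)" by simp
  then show "(\<integral>\<^sup>+t. indicator {0..T} t * (ennreal (p t) * f (\<Phi> t)) \<partial>lborel) = (\<integral>\<^sup>+v. indicator {0..\<Phi> T} v * f v \<partial>lborel)"
    unfolding \<mu>_def \<nu>_def by (simp add: nn_integral_distr nn_integral_density mult.assoc)
qed

text \<open>Equals \<open>Beta (1 - a) a\<close> for \<open>a\<close> in \<open>(0, 1)\<close>; kept
  as a nonnegative integral because finiteness and scale invariance are all that is asked of
  it.\<close>

definition beta_const :: "real \<Rightarrow> ennreal" where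
  "beta_const a = (\<integral>\<^sup>+v. indicator {0<..<1} v * ennreal (v powr (- a) * (1 - v) powr (a - 1)) \<partial>lborel)"

lemma beta_const_finite:
  assumes "0 < a" "a < 1"
  shows "beta_const a < \<infinity>"
proof -
  have "((\<lambda>t. t powr (- a) * (1 - t) powr (a - 1)) has_integral Beta (1 - a) a) {0..1}"
    using has_integral_Beta_real[of "1 - a" a] assms by simp
  from nn_integral_has_integral_lebesgue'[OF _ this]
  have "(\<integral>\<^sup>+v. ennreal (v powr (- a) * (1 - v) powr (a - 1)) * indicator {0..1} v \<partial>lborel) = ennreal (Beta (1 - a) a)"
    by simp
  moreover have "beta_const a \<le> (\<integral>\<^sup>+v. ennreal (v powr (- a) * (1 - v) powr (a - 1)) * indicator {0..1} v \<partial>lborel)"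
    unfolding beta_const_def by (intro nn_integral_mono) (auto simp: indicator_def)
  ultimately show ?thesis by (auto elim: le_less_trans)
qed

text \<open>The exponents add to \<open>- 1\<close>, which cancels the Jacobian of the scaling by
  \<open>L\<close>.\<close>

lemma beta_scale:
  assumes L: "0 < L"
  shows "(\<integral>\<^sup>+v. indicator {0<..<L} v * ennreal (v powr (- a) * (L - v) powr (a - 1)) \<partial>lborel) = beta_const a"
proof -
  have "(\<integral>\<^sup>+v. indicator {0<..<L} v * ennreal (v powr (- a) * (L - v) powr (a - 1)) \<partial>lborel)
    = ennreal \<bar>L\<bar> * (\<integral>\<^sup>+v. indicator {0<..<L} (0 + L * v) * ennreal ((0 + L * v) powr (- a) * (L - (0 + L * v)) powr (a - 1)) \<partial>lborel)"
    by (rule nn_integral_real_affine) (use L in auto)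
  also have "\<dots> = (\<integral>\<^sup>+v. ennreal L * (indicator {0<..<L} (0 + L * v) * ennreal ((0 + L * v) powr (- a) * (L - (0 + L * v)) powr (a - 1))) \<partial>lborel)"
    using L by (subst nn_integral_cmult) auto
  also have "\<dots> = beta_const a"
    unfolding beta_const_def
  proof (intro nn_integral_cong)
    fix v :: real
    show "ennreal L * (indicator {0<..<L} (0 + L * v) * ennreal ((0 + L * v) powr (- a) * (L - (0 + L * v)) powr (a - 1)))
      = indicator {0<..<1} v * ennreal (v powr (- a) * (1 - v) powr (a - 1))"
    proof (cases "v \<in> {0<..<1}")
      case True
      then have v: "0 < v" "0 < 1 - v" by auto
      have "(L * v) powr (- a) * (L - L * v) powr (a - 1) = (L powr (- a) * L powr (a - 1)) * (v powr (- a) * (1 - v) powr (a - 1))"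
      proof -
        have "L - L * v = L * (1 - v)" by (simp add: algebra_simps)
        then show ?thesis using L v by (simp add: powr_mult)
      qed
      also have "L powr (- a) * L powr (a - 1) = inverse L"
        using L by (simp only: powr_add[symmetric]) (simp add: powr_neg_one divide_inverse)
      finally have "L * ((L * v) powr (- a) * (L - L * v) powr (a - 1)) = v powr (- a) * (1 - v) powr (a - 1)"
        using L by simp
      moreover have "L * v \<in> {0<..<L}" using True L by simp
      ultimately show ?thesis using True L by (simp add: ennreal_mult[symmetric])
    next
      case False
      then have "L * v \<notin> {0<..<L}" using L by (auto simp: zero_less_mult_iff)
      then show ?thesis using False by simp
    qed
  qed
  finally show ?thesis .
qed

section \<open>Splitting, positivity and reversal of the exponential integrals\<close>

context levy
begin

lemma path_0: "\<omega> \<in> space M \<Longrightarrow> path 0 \<omega> = 0"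
  by (simp add: path_def X_0)

lemma J_measurable2 [measurable (raw)]:
  assumes [measurable]: "f \<in> borel_measurable N" "h \<in> borel_measurable N" "g \<in> measurable N M"
  shows "(\<lambda>x. J c (f x) (h x) (g x)) \<in> borel_measurable N"
  unfolding J_def indicator_def of_bool_def atLeastAtMost_iff by measurable

lemma J_split:
  assumes \<omega>: "\<omega> \<in> space M" and st: "0 \<le> s" "s \<le> t"
  shows "J 1 0 t \<omega> = J 1 0 s \<omega> + exp (path s \<omega>) * J 1 s t \<omega>"
proof -
  have i: "integrable lborel (\<lambda>u. indicator {x..y} u * exp (path u \<omega>))" for x y
    using exp_path_integrable[OF \<omega>, of x y 1] by simp
  have "J 1 0 t \<omega> = (\<integral>u. indicator {0..t} u * exp (path u \<omega>) \<partial>lborel)"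
    by (simp add: J_def path_0[OF \<omega>])
  also have "\<dots> = (\<integral>u. indicator {0..s} u * exp (path u \<omega>) + indicator {s..t} u * exp (path u \<omega>) \<partial>lborel)"
    by (rule integral_cong_AE)
       (use AE_lborel_singleton[of s] st path_section[OF \<omega>] in \<open>auto elim!: eventually_mono simp: indicator_def\<close>)
  also have "\<dots> = J 1 0 s \<omega> + (\<integral>u. indicator {s..t} u * exp (path u \<omega>) \<partial>lborel)"
    by (subst Bochner_Integration.integral_add[OF i i]) (simp add: J_def path_0[OF \<omega>])
  also have "(\<integral>u. indicator {s..t} u * exp (path u \<omega>) \<partial>lborel) = exp (path s \<omega>) * J 1 s t \<omega>"
    unfolding J_def by (subst integral_mult_right_zero[symmetric]) (simp add: exp_diff algebra_simps)
  finally show ?thesis .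
qed

lemma exp_path_integral_pos:
  assumes \<omega>: "\<omega> \<in> space M" and t: "s < t"
  shows "0 < (\<integral>u. indicator {s..t} u * exp (c * path u \<omega>) \<partial>lborel)"
proof -
  obtain C where C: "0 \<le> C" "\<And>u. u \<le> t \<Longrightarrow> \<bar>path u \<omega>\<bar> \<le> C" by (rule path_bounded[OF \<omega>, of t]) blast
  have "0 < (\<integral>u. indicator {s..t} u * exp (- (\<bar>c\<bar> * C)) \<partial>lborel)" using t by simp
  also have "\<dots> \<le> (\<integral>u. indicator {s..t} u * exp (c * path u \<omega>) \<partial>lborel)"
  proof (intro integral_mono exp_path_integrable[OF \<omega>])
    fix u
    have "- (\<bar>c\<bar> * C) \<le> c * path u \<omega>" if "u \<le> t"
    proof -
      have "\<bar>c * path u \<omega>\<bar> \<le> \<bar>c\<bar> * C" unfolding abs_mult using C(2)[OF that] by (intro mult_left_mono) auto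
      then show ?thesis by linarith
    qed
    then show "indicator {s..t} u * exp (- (\<bar>c\<bar> * C)) \<le> indicator {s..t} u * exp (c * path u \<omega>)"
      by (auto simp: indicator_def)
  qed auto
  finally show ?thesis .
qed

lemma J_pos:
  assumes \<omega>: "\<omega> \<in> space M" and t: "s < t"
  shows "0 < J 1 s t \<omega>"
proof -
  have "J 1 s t \<omega> = exp (- path s \<omega>) * (\<integral>u. indicator {s..t} u * exp (1 * path u \<omega>) \<partial>lborel)"
    unfolding J_def by (subst integral_mult_right_zero[symmetric]) (simp add: exp_diff exp_minus field_simps)
  then show ?thesis using exp_path_integral_pos[OF \<omega> t, of 1] by simp
qed

lemma J_mono:
  assumes "\<omega> \<in> space M" "0 \<le> s" "s \<le> t"
  shows "J 1 0 s \<omega> \<le> J 1 0 t \<omega>"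
proof (cases "s = t")
  case False
  then have "0 < exp (path s \<omega>) * J 1 s t \<omega>" using J_pos[of \<omega> s t] assms by simp
  then show ?thesis using J_split[OF assms] by linarith
qed simp

definition I :: "real \<Rightarrow> 'a \<Rightarrow> real" where
  "I t \<omega> = (\<integral>u. indicator {0..t} u * exp (- path u \<omega>) \<partial>lborel)"

lemma I_measurable2 [measurable (raw)]:
  assumes [measurable]: "f \<in> borel_measurable N" "g \<in> measurable N M"
  shows "(\<lambda>x. I (f x) (g x)) \<in> borel_measurable N"
  unfolding I_def indicator_def of_bool_def atLeastAtMost_iff by measurable

lemma I_pos: "\<omega> \<in> space M \<Longrightarrow> 0 < t \<Longrightarrow> 0 < I t \<omega>"
  using exp_path_integral_pos[of \<omega> 0 t "- 1"] by (simp add: I_def)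

lemma I_mono:
  assumes \<omega>: "\<omega> \<in> space M" and "s \<le> t"
  shows "I s \<omega> \<le> I t \<omega>"
  unfolding I_def using exp_path_integrable[OF \<omega>, of _ _ "- 1"] assms(2)
  by (intro integral_mono) (auto simp: indicator_def)

lemma I_distr:
  assumes t: "0 < t"
  shows "distr M borel (I t) = distr M borel (\<lambda>\<omega>. exp (- D 0 t \<omega>) * J 1 0 t \<omega>)"
proof -
  have "distr M borel (I t) = distr M borel (\<lambda>\<omega>. \<integral>u. indicator {0..t} u * exp (- 1 * (path t \<omega> - path u \<omega>)) \<partial>lborel)"
    using J_reversal[OF t, of "- 1"] unfolding I_def by simp
  also have "\<dots> = distr M borel (\<lambda>\<omega>. exp (- D 0 t \<omega>) * J 1 0 t \<omega>)"
  proof (intro distr_cong refl)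
    fix \<omega>
    show "(\<integral>u. indicator {0..t} u * exp (- 1 * (path t \<omega> - path u \<omega>)) \<partial>lborel) = exp (- D 0 t \<omega>) * J 1 0 t \<omega>"
      unfolding J_def D_def
      by (subst integral_mult_right_zero[symmetric]) (intro Bochner_Integration.integral_cong refl, simp add: exp_add[symmetric] mult.left_commute)
  qed
  finally show ?thesis .
qed

end

locale levy_exponent = levy_drift +
  fixes a :: real
  assumes a_pos: "0 < a" and a_less: "a < 1"
begin

definition g :: "real \<Rightarrow> ennreal" where "g t = (\<integral>\<^sup>+\<omega>. ennreal (I t \<omega> powr (- a)) \<partial>M)"
definition gh :: "real \<Rightarrow> ennreal" where "gh t = (\<integral>\<^sup>+\<omega>. ennreal (J 1 0 t \<omega> powr (a - 1)) \<partial>M)"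

lemma g_measurable [measurable]: "g \<in> borel_measurable borel"
  unfolding g_def by measurable

lemma gh_measurable [measurable]: "gh \<in> borel_measurable borel"
  unfolding gh_def by measurable

lemma g_antimono: "0 < s \<Longrightarrow> s \<le> t \<Longrightarrow> g t \<le> g s"
  unfolding g_def using a_pos
  by (intro nn_integral_mono ennreal_leI powr_mono2') (auto intro: I_pos I_mono)

lemma gh_antimono: "0 < s \<Longrightarrow> s \<le> t \<Longrightarrow> gh t \<le> gh s"
  unfolding gh_def using a_less
  by (intro nn_integral_mono ennreal_leI powr_mono2') (auto intro: J_pos J_mono)

text \<open>Reversal replaces \<open>I t\<close> by \<open>exp (- X t) * J 1 0 t\<close>, and
  \<open>J 1 0 T - J 1 0 t\<close> is \<open>exp (X t)\<close> times the functional of an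
  independent block. The powers of \<open>exp (X t)\<close> combine as
  \<open>a = 1 + (a - 1)\<close>, so exactly one factor \<open>exp (X t)\<close> is left for the
  substitution.\<close>

lemma g_gh_product:
  assumes t: "0 < t" "t < T"
  shows "g t * gh (T - t) = (\<integral>\<^sup>+\<omega>. ennreal (exp (path t \<omega>) * (J 1 0 t \<omega> powr (- a) * (J 1 0 T \<omega> - J 1 0 t \<omega>) powr (a - 1))) \<partial>M)"
proof -
  define R where "R z = (exp (- fst (snd z)) * fst z) powr (- a)" for z :: "real \<times> real \<times> real"
  have [measurable]: "(fst :: real \<times> real \<times> real \<Rightarrow> real) \<in> borel_measurable borel" "(\<lambda>z :: real \<times> real \<times> real. fst (snd z)) \<in> borel_measurable borel"
    using block_measurable unfolding block_incr_def by auto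
  have [measurable]: "R \<in> borel_measurable borel" unfolding R_def by measurable
  have [measurable]: "V 0 t \<in> borel_measurable M" "V t T \<in> borel_measurable M" using t by auto
  have ind: "indep_var borel (V 0 t) borel (V t T)"
  proof -
    let ?t = "\<lambda>i::nat. if i = 0 then 0 else if i = 1 then t else T"
    have "indep_vars (\<lambda>_. borel) (\<lambda>i. V (?t i) (?t (Suc i))) {..<2}"
      by (rule V_indep) (use t in \<open>auto simp: less_Suc_eq numeral_2_eq_2\<close>)
    from indep_var_restrict[OF this, of "{0}" "{1}"]
    have "indep_var (PiM {0} (\<lambda>_. borel)) (\<lambda>\<omega>. \<lambda>i\<in>{0}. V (?t i) (?t (Suc i)) \<omega>) (PiM {1} (\<lambda>_. borel)) (\<lambda>\<omega>. \<lambda>i\<in>{1}. V (?t i) (?t (Suc i)) \<omega>)"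
      by simp
    from indep_var_compose[OF this, of "\<lambda>w. w 0" borel "\<lambda>w. w 1" borel] show ?thesis
      by (simp add: comp_def)
  qed
  have g: "g t = (\<integral>\<^sup>+\<omega>. ennreal (R (V 0 t \<omega>)) \<partial>M)"
  proof -
    have "g t = (\<integral>\<^sup>+x. ennreal (x powr (- a)) \<partial>distr M borel (I t))"
      unfolding g_def by (subst nn_integral_distr) auto
    also have "\<dots> = (\<integral>\<^sup>+\<omega>. ennreal (R (V 0 t \<omega>)) \<partial>M)"
      unfolding I_distr[OF t(1)] by (subst nn_integral_distr) (auto simp: R_def V_def)
    finally show ?thesis .
  qed
  have gh: "gh (T - t) = (\<integral>\<^sup>+\<omega>. ennreal (fst (V t T \<omega>) powr (a - 1)) \<partial>M)"
  proof -
    have "gh (T - t) = (\<integral>\<^sup>+z. ennreal (fst z powr (a - 1)) \<partial>distr M borel (V 0 (T - t)))"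
      using t unfolding gh_def by (subst nn_integral_distr) (auto simp: V_def)
    also have "distr M borel (V 0 (T - t)) = distr M borel (V t T)"
      using V_distr[of t "T - t"] t by simp
    also have "(\<integral>\<^sup>+z. ennreal (fst z powr (a - 1)) \<partial>distr M borel (V t T)) = (\<integral>\<^sup>+\<omega>. ennreal (fst (V t T \<omega>) powr (a - 1)) \<partial>M)"
      by (subst nn_integral_distr) auto
    finally show ?thesis .
  qed
  have "g t * gh (T - t) = (\<integral>\<^sup>+\<omega>. ennreal (R (V 0 t \<omega>)) * gh (T - t) \<partial>M)"
    unfolding g by (subst nn_integral_multc) auto
  also have "\<dots> = (\<integral>\<^sup>+\<omega>. \<integral>\<^sup>+\<omega>'. ennreal (R (V 0 t \<omega>)) * ennreal (fst (V t T \<omega>') powr (a - 1)) \<partial>M \<partial>M)"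
    unfolding gh by (intro nn_integral_cong nn_integral_cmult[symmetric]) auto
  also have "\<dots> = (\<integral>\<^sup>+\<omega>. ennreal (R (V 0 t \<omega>)) * ennreal (fst (V t T \<omega>) powr (a - 1)) \<partial>M)"
    using nn_integral_indep_pair[OF ind, of "\<lambda>(x, y). ennreal (R x) * ennreal (fst y powr (a - 1))"] by simp
  also have "\<dots> = (\<integral>\<^sup>+\<omega>. ennreal (exp (path t \<omega>) * (J 1 0 t \<omega> powr (- a) * (J 1 0 T \<omega> - J 1 0 t \<omega>) powr (a - 1))) \<partial>M)"
  proof (intro nn_integral_cong)
    fix \<omega> assume \<omega>: "\<omega> \<in> space M"
    let ?e = "exp (path t \<omega>)"
    have "J 1 0 T \<omega> - J 1 0 t \<omega> = ?e * J 1 t T \<omega>" using J_split[OF \<omega>, of t T] t by simp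
    then have "?e * (J 1 0 t \<omega> powr (- a) * (J 1 0 T \<omega> - J 1 0 t \<omega>) powr (a - 1)) = (?e powr 1 * ?e powr (a - 1)) * J 1 0 t \<omega> powr (- a) * J 1 t T \<omega> powr (a - 1)"
      using J_pos[OF \<omega> t(2)] by (simp add: powr_mult)
    also have "?e powr 1 * ?e powr (a - 1) = ?e powr a" by (simp only: powr_add[symmetric]) simp
    also have "\<dots> = exp (- path t \<omega>) powr (- a)" by (simp add: exp_powr_real)
    also have "exp (- path t \<omega>) powr (- a) * J 1 0 t \<omega> powr (- a) = R (V 0 t \<omega>)"
      using J_pos[OF \<omega> t(1)] by (simp add: R_def V_def D_def path_0[OF \<omega>] powr_mult)
    finally show "ennreal (R (V 0 t \<omega>)) * ennreal (fst (V t T \<omega>) powr (a - 1)) = ennreal (?e * (J 1 0 t \<omega> powr (- a) * (J 1 0 T \<omega> - J 1 0 t \<omega>) powr (a - 1)))"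
      by (simp add: V_def ennreal_mult[symmetric] R_def)
  qed
  finally show ?thesis .
qed

text \<open>Along each path, \<open>exp (path t \<omega>)\<close> is the density of
  \<open>J 1 0 t \<omega>\<close>, so substitution turns the time integral into a Beta integral over
  \<open>[0, J 1 0 T \<omega>]\<close>; scale invariance makes it the same for every path.\<close>

theorem convolution_identity:
  assumes T: "0 < T"
  shows "(\<integral>\<^sup>+t. indicator {0<..<T} t * (g t * gh (T - t)) \<partial>lborel) = beta_const a"
proof -
  interpret pair_sigma_finite M lborel ..
  let ?e = "\<lambda>t \<omega>. exp (path t \<omega>) * (J 1 0 t \<omega> powr (- a) * (J 1 0 T \<omega> - J 1 0 t \<omega>) powr (a - 1))"
  have "(\<integral>\<^sup>+t. indicator {0<..<T} t * (g t * gh (T - t)) \<partial>lborel) = (\<integral>\<^sup>+t. \<integral>\<^sup>+\<omega>. indicator {0<..<T} t * ennreal (?e t \<omega>) \<partial>M \<partial>lborel)"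
  proof (intro nn_integral_cong)
    fix t
    have "indicator {0<..<T} t * (g t * gh (T - t)) = indicator {0<..<T} t * (\<integral>\<^sup>+\<omega>. ennreal (?e t \<omega>) \<partial>M)"
      using g_gh_product[of t T] by (simp add: indicator_def)
    then show "indicator {0<..<T} t * (g t * gh (T - t)) = (\<integral>\<^sup>+\<omega>. indicator {0<..<T} t * ennreal (?e t \<omega>) \<partial>M)"
      by (simp add: nn_integral_cmult)
  qed
  also have "\<dots> = (\<integral>\<^sup>+\<omega>. \<integral>\<^sup>+t. indicator {0<..<T} t * ennreal (?e t \<omega>) \<partial>lborel \<partial>M)"
    by (rule Fubini') measurable
  also have "\<dots> = (\<integral>\<^sup>+\<omega>. beta_const a \<partial>M)"
  proof (intro nn_integral_cong)
    fix \<omega> assume \<omega>: "\<omega> \<in> space M"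
    obtain C where C: "0 \<le> C" "\<And>u. u \<le> T \<Longrightarrow> \<bar>path u \<omega>\<bar> \<le> C" by (rule path_bounded[OF \<omega>, of T]) blast
    let ?p = "\<lambda>u. exp (path u \<omega>)"
    have [measurable]: "?p \<in> borel_measurable borel" using path_section[OF \<omega>] by measurable
    have \<Phi>: "(\<integral>u. indicator {0..t} u * ?p u \<partial>lborel) = J 1 0 t \<omega>" for t by (simp add: J_def path_0[OF \<omega>])
    have J0: "J 1 0 0 \<omega> = 0" using J_split[OF \<omega>, of 0 0] by (simp add: path_0[OF \<omega>])
    let ?L = "J 1 0 T \<omega>"
    let ?f = "\<lambda>v. indicator {0<..<?L} v * ennreal (v powr (- a) * (?L - v) powr (a - 1))"
    note push = nn_integral_density_pushforward[of ?p T "exp (- C)" "exp C", unfolded \<Phi>, OF _ T]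
    have bd: "exp (- C) \<le> ?p u" "?p u \<le> exp C" if "u \<le> T" for u using C(2)[OF that] by auto
    have strict: "J 1 0 s \<omega> < J 1 0 t \<omega>" if "0 \<le> s" "s < t" "t \<le> T" for s t
      by (rule push(2)[of "\<lambda>_. 0"]) (use that bd in auto)
    have "(\<integral>\<^sup>+t. indicator {0<..<T} t * ennreal (?e t \<omega>) \<partial>lborel) = (\<integral>\<^sup>+t. indicator {0..T} t * (ennreal (?p t) * ?f (J 1 0 t \<omega>)) \<partial>lborel)"
    proof (intro nn_integral_cong)
      fix t
      consider "t \<notin> {0..T}" | "t = 0" | "t = T" | "0 < t" "t < T" by fastforce
      then show "indicator {0<..<T} t * ennreal (?e t \<omega>) = indicator {0..T} t * (ennreal (?p t) * ?f (J 1 0 t \<omega>))"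
      proof cases
        case 4
        then have "J 1 0 t \<omega> \<in> {0<..<?L}" using strict[of 0 t] strict[of t T] by (simp add: J0)
        then show ?thesis using 4 by (simp add: ennreal_mult[symmetric])
      qed (auto simp: J0)
    qed
    also have "\<dots> = (\<integral>\<^sup>+v. indicator {0..?L} v * ?f v \<partial>lborel)"
      by (rule push(1)) (use bd in auto)
    also have "\<dots> = (\<integral>\<^sup>+v. ?f v \<partial>lborel)" by (intro nn_integral_cong) (auto simp: indicator_def)
    also have "\<dots> = beta_const a" by (rule beta_scale[OF J_pos[OF \<omega> T]])
    finally show "(\<integral>\<^sup>+t. indicator {0<..<T} t * ennreal (?e t \<omega>) \<partial>lborel) = beta_const a" .
  qed
  also have "\<dots> = beta_const a" by (simp add: emeasure_space_1)
  finally show ?thesis .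
qed

end

lemma (in prob_space) nn_integral_pos:
  assumes [measurable]: "f \<in> borel_measurable M" and "\<And>x. x \<in> space M \<Longrightarrow> 0 < f x"
  shows "0 < (\<integral>\<^sup>+x. f x \<partial>M)"
proof (rule ccontr)
  assume "\<not> 0 < (\<integral>\<^sup>+x. f x \<partial>M)"
  then have "(\<integral>\<^sup>+x. f x \<partial>M) = 0" by (simp add: not_less)
  then have "AE x in M. f x = 0" by (subst (asm) nn_integral_0_iff_AE) auto
  then have "AE x in M. False" using AE_space by eventually_elim (use assms(2) in fastforce)
  then show False by simp
qed

lemma ennreal_le_suminf: "f j \<le> suminf f" for f :: "nat \<Rightarrow> ennreal"
  using sum_le_suminf[of f "{j}"] by simp

text \<open>For \<open>y \<le> 1\<close> this rests on
  \<open>(1 + y) powr (a - 1) \<ge> 1 / (1 + y) \<ge> 1 - y\<close>. The cap \<open>min 1 y\<close>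
  keeps the error controllable in expectation when \<open>y\<close> is not integrable.\<close>

lemma powr_growth_bound:
  fixes x y z a :: real
  assumes a: "0 < a" "a < 1" and z: "0 < z" "z \<le> x" and y: "0 \<le> y"
  shows "x powr (a - 1) \<le> (x * (1 + y)) powr (a - 1) + z powr (a - 1) * min 1 y"
proof -
  have x: "0 < x" using z by simp
  have "1 - min 1 y \<le> (1 + y) powr (a - 1)"
  proof (cases "y \<le> 1")
    case True
    have "(1 - y) * (1 + y) \<le> 1" using y by (simp add: algebra_simps)
    then have "1 - y \<le> 1 / (1 + y)" using y by (simp add: pos_le_divide_eq)
    also have "\<dots> = (1 + y) powr (- 1)" using y by (simp add: powr_neg_one)
    also have "\<dots> \<le> (1 + y) powr (a - 1)" using a y by (intro powr_mono) auto
    finally show ?thesis using True by simp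
  qed simp
  then have "x powr (a - 1) * (1 - min 1 y) \<le> x powr (a - 1) * (1 + y) powr (a - 1)"
    by (intro mult_left_mono) auto
  moreover have "(x * (1 + y)) powr (a - 1) = x powr (a - 1) * (1 + y) powr (a - 1)"
    using x y by (simp add: powr_mult)
  ultimately have "x powr (a - 1) \<le> (x * (1 + y)) powr (a - 1) + x powr (a - 1) * min 1 y"
    by (simp add: right_diff_distrib)
  also have "x powr (a - 1) * min 1 y \<le> z powr (a - 1) * min 1 y"
    using a z y by (intro mult_right_mono powr_mono2') auto
  finally show ?thesis by simp
qed

text \<open>Convergence of an infinite product: from some index on \<open>y i < 1\<close>, so the
  cap is inactive and the product is at most the exponential of the sum.\<close>

lemma bounded_of_summable_growth:
  fixes x y :: "nat \<Rightarrow> real"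
  assumes x: "\<And>i. 0 < x i" and y: "\<And>i. 0 \<le> y i" and rec: "\<And>i. x (Suc i) = x i * (1 + y i)"
    and sm: "summable (\<lambda>i. min 1 (y i))"
  obtains B where "0 < B" "\<And>i. x i \<le> B"
proof -
  have "(\<lambda>i. min 1 (y i)) \<longlonglongrightarrow> 0" by (rule summable_LIMSEQ_zero[OF sm])
  then have "\<forall>\<^sub>F i in sequentially. min 1 (y i) < 1" by (intro order_tendstoD) auto
  then obtain N where N: "\<And>i. N \<le> i \<Longrightarrow> min 1 (y i) < 1" by (auto simp: eventually_sequentially)
  define S where "S = (\<Sum>i. min 1 (y i))"
  have mono: "x i \<le> x (Suc i)" for i
    using x[of i] y[of i] by (simp add: rec)
  have bd: "x (N + k) \<le> x N * exp (\<Sum>i<k. min 1 (y (N + i)))" for k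
  proof (induction k)
    case (Suc k)
    have yk: "y (N + k) = min 1 (y (N + k))" using N[of "N + k"] by (simp add: min_def split: if_splits)
    have "x (N + Suc k) = x (N + k) * (1 + y (N + k))" by (simp add: rec)
    also have "\<dots> \<le> (x N * exp (\<Sum>i<k. min 1 (y (N + i)))) * exp (min 1 (y (N + k)))"
    proof (rule mult_mono[OF Suc])
      show "1 + y (N + k) \<le> exp (min 1 (y (N + k)))" using exp_ge_add_one_self[of "y (N + k)"] yk by simp
    qed (use x[of N] y[of "N + k"] in auto)
    finally show ?case by (simp add: exp_add mult.assoc)
  qed simp
  have sum_le: "(\<Sum>i<k. min 1 (y (N + i))) \<le> S" for k
  proof -
    have "(\<Sum>i<k. min 1 (y (N + i))) = (\<Sum>i\<in>{N..<N + k}. min 1 (y i))"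
      by (rule sum.reindex_bij_witness[of _ "\<lambda>i. i - N" "\<lambda>i. N + i"]) auto
    also have "\<dots> \<le> S" unfolding S_def by (rule sum_le_suminf[OF sm]) (auto simp: y)
    finally show ?thesis .
  qed
  have "x i \<le> x N * exp S" for i
  proof -
    have "x i \<le> x (N + i)" by (rule lift_Suc_mono_le[of x]) (auto intro: mono)
    also have "\<dots> \<le> x N * exp S"
      using bd[of i] sum_le[of i] x[of N] by (meson exp_le_cancel_iff mult_left_mono less_imp_le order_trans)
    finally show ?thesis .
  qed
  then show ?thesis using x[of N] by (intro that[of "x N * exp S"]) auto
qed

section \<open>Convergence of \<open>gh\<close> to a positive limit\<close>

context levy_exponent
begin

lemma g_pos: "0 < t \<Longrightarrow> 0 < g t"
proof -
  assume t: "0 < t"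
  have "0 < ennreal (I t \<omega> powr (- a))" if "\<omega> \<in> space M" for \<omega>
    using I_pos[OF that t] by simp
  then show ?thesis unfolding g_def by (intro nn_integral_pos) measurable
qed

text \<open>The convolution identity at \<open>T = 1\<close> gives this, as \<open>g\<close> is
  bounded below by \<open>g 1 > 0\<close> on \<open>(0, 1)\<close>. It settles the behaviour of
  \<open>gh\<close> at 0 without any estimate of \<open>J\<close> for small times.\<close>

lemma gh_integral_finite: "(\<integral>\<^sup>+s. indicator {0<..<1} s * gh s \<partial>lborel) < \<infinity>"
proof -
  have "g 1 * (\<integral>\<^sup>+s. indicator {0<..<1} s * gh s \<partial>lborel)
    = g 1 * (ennreal \<bar>- 1\<bar> * (\<integral>\<^sup>+t. indicator {0<..<1} (1 + (- 1) * t) * gh (1 + (- 1) * t) \<partial>lborel))"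
    by (subst nn_integral_real_affine[of _ "- 1" 1]) auto
  also have "\<dots> = (\<integral>\<^sup>+t. g 1 * (indicator {0<..<1} t * gh (1 - t)) \<partial>lborel)"
    by (subst nn_integral_cmult) (auto simp: indicator_def conj_commute)
  also have "\<dots> \<le> (\<integral>\<^sup>+t. indicator {0<..<1} t * (g t * gh (1 - t)) \<partial>lborel)"
    by (intro nn_integral_mono) (auto simp: indicator_def intro!: mult_right_mono g_antimono)
  also have "\<dots> = beta_const a" by (rule convolution_identity) simp
  also have "\<dots> < \<infinity>" by (rule beta_const_finite[OF a_pos a_less])
  finally show ?thesis using g_pos[of 1] by (auto simp: ennreal_mult_less_top)
qed

lemma gh_1_finite: "gh 1 < \<infinity>"
proof -
  have "gh 1 = (\<integral>\<^sup>+s. indicator {0<..<1::real} s * gh 1 \<partial>lborel)" by (subst nn_integral_multc) auto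
  also have "\<dots> \<le> (\<integral>\<^sup>+s. indicator {0<..<1} s * gh s \<partial>lborel)"
    by (intro nn_integral_mono) (auto simp: indicator_def intro!: gh_antimono)
  finally show ?thesis using gh_integral_finite by (rule le_less_trans)
qed

text \<open>The index is shifted by one: the block \<open>[0, 1]\<close> is set aside so that
  \<open>J 1 0 1 powr (a - 1)\<close> is independent of the blocks that govern survival.\<close>

definition growth :: "nat \<Rightarrow> 'a \<Rightarrow> real" where
  "growth i \<omega> = (J 1 0 (real (Suc (Suc i))) \<omega> - J 1 0 (real (Suc i)) \<omega>) / J 1 0 (real (Suc i)) \<omega>"

lemma growth_measurable [measurable]: "growth i \<in> borel_measurable M"
  unfolding growth_def by measurable

lemma fst_blk: "fst (blk i \<omega>) = J 1 (real i) (real (Suc i)) \<omega>"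
  by (simp add: blk_def V_def)

lemma growth_pos:
  assumes \<omega>: "\<omega> \<in> space M"
  shows "0 < growth i \<omega>" and "J 1 0 (real (Suc (Suc i))) \<omega> = J 1 0 (real (Suc i)) \<omega> * (1 + growth i \<omega>)"
    and "growth i \<omega> = exp (path (real (Suc i)) \<omega>) * fst (blk (Suc i) \<omega>) / J 1 0 (real (Suc i)) \<omega>"
proof -
  have J: "0 < J 1 0 (real (Suc i)) \<omega>" by (rule J_pos[OF \<omega>]) simp
  have B: "0 < fst (blk (Suc i) \<omega>)" unfolding fst_blk by (rule J_pos[OF \<omega>]) simp
  have "J 1 0 (real (Suc (Suc i))) \<omega> = J 1 0 (real (Suc i)) \<omega> + exp (path (real (Suc i)) \<omega>) * fst (blk (Suc i) \<omega>)"
    unfolding fst_blk by (rule J_split[OF \<omega>]) auto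
  then show *: "growth i \<omega> = exp (path (real (Suc i)) \<omega>) * fst (blk (Suc i) \<omega>) / J 1 0 (real (Suc i)) \<omega>"
    unfolding growth_def by simp
  show "0 < growth i \<omega>" unfolding * using J B by simp
  show "J 1 0 (real (Suc (Suc i))) \<omega> = J 1 0 (real (Suc i)) \<omega> * (1 + growth i \<omega>)"
    using J by (simp add: growth_def field_simps)
qed

text \<open>The block has length 1, and on it the path is at least its final value minus the height,
  by definition of \<open>H\<close>.\<close>

lemma J_ge_block:
  assumes \<omega>: "\<omega> \<in> space M" and ij: "i < j"
  shows "exp (path (real (Suc i)) \<omega> - H (real i) (real (Suc i)) \<omega>) \<le> J 1 0 (real j) \<omega>"
proof -
  let ?m = "exp (path (real (Suc i)) \<omega> - H (real i) (real (Suc i)) \<omega>)"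
  have "?m = (\<integral>u. indicator {real i..real (Suc i)} u * ?m \<partial>lborel)" by simp
  also have "\<dots> \<le> (\<integral>u. indicator {0..real j} u * exp (1 * path u \<omega>) \<partial>lborel)"
  proof (intro integral_mono exp_path_integrable[OF \<omega>])
    fix u
    have "real (Suc i) \<le> real j" using ij by simp
    moreover have "path (real (Suc i)) \<omega> - H (real i) (real (Suc i)) \<omega> \<le> path u \<omega>" if "real i \<le> u" "u \<le> real (Suc i)"
      using H_upper[OF \<omega> that] by simp
    ultimately show "indicator {real i..real (Suc i)} u * ?m \<le> indicator {0..real j} u * exp (1 * path u \<omega>)"
      by (auto simp: indicator_def simp del: of_nat_Suc)
  qed simp
  also have "\<dots> = J 1 0 (real j) \<omega>" by (simp add: J_def path_0[OF \<omega>])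
  finally show ?thesis .
qed

text \<open>With \<open>min 1 (growth i \<omega>) = exp (- x)\<close>, the sum of
  \<open>path (Suc i)\<close>, the logarithm of the next block integral and \<open>x\<close> is at
  least \<open>ln J\<close>, hence at least the infimum over each earlier block. This is survival of
  the backward walk started at that logarithm plus any level above \<open>x\<close>. The level is
  rounded up to \<open>Suc l\<close>, and \<open>exp (- x)\<close> is at most
  \<open>exp (- l)\<close>.\<close>

lemma min_growth_le:
  assumes \<omega>: "\<omega> \<in> space M"
  shows "ennreal (min 1 (growth i \<omega>)) \<le> (\<Sum>l. ennreal (exp (- real l)) *
    (if alive 1 i (ln (fst (blk (Suc i) \<omega>)) + real (Suc l)) (\<lambda>i. blk i \<omega>) then 1 else 0))"
proof -
  let ?y = "growth i \<omega>" and ?B = "fst (blk (Suc i) \<omega>)" and ?J = "J 1 0 (real (Suc i)) \<omega>"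
  have y: "0 < ?y" by (rule growth_pos[OF \<omega>])
  have B: "0 < ?B" unfolding fst_blk by (rule J_pos[OF \<omega>]) simp
  have J: "0 < ?J" by (rule J_pos[OF \<omega>]) simp
  define x where "x = - ln (min 1 ?y)"
  have x: "0 \<le> x" "exp (- x) = min 1 ?y" "- x \<le> ln ?y" using y by (auto simp: x_def min_def)
  define l where "l = nat \<lfloor>x\<rfloor>"
  have l: "real l \<le> x" "x < real (Suc l)" using x(1) by (auto simp: l_def; linarith)+
  have "alive 1 i (ln ?B + real (Suc l)) (\<lambda>i. blk i \<omega>)"
    unfolding alive_iff
  proof (intro allI impI)
    fix k assume k: "k < i"
    have tele: "(\<Sum>j\<in>{Suc k..<i}. block_incr (blk (1 + j) \<omega>)) = path (real (Suc i)) \<omega> - path (real (Suc (Suc k))) \<omega>"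
    proof -
      have "(\<Sum>j\<in>{Suc k..<i}. path (real (Suc (Suc j))) \<omega> - path (real (Suc j)) \<omega>) = path (real (Suc i)) \<omega> - path (real (Suc (Suc k))) \<omega>"
        by (rule sum_Suc_diff'[of "Suc k" i "\<lambda>j. path (real (Suc j)) \<omega>"]) (use k in simp)
      then show ?thesis unfolding block_incr_blk by simp
    qed
    have "path (real (Suc (Suc k))) \<omega> - H (real (Suc k)) (real (Suc (Suc k))) \<omega> \<le> ln ?J"
      using J_ge_block[OF \<omega>, of "Suc k" "Suc i"] k J by (subst ln_ge_iff) auto
    moreover have "ln ?y = path (real (Suc i)) \<omega> + ln ?B - ln ?J"
      unfolding growth_pos(3)[OF \<omega>] using B J by (simp add: ln_mult ln_div)
    ultimately have "- x \<le> path (real (Suc i)) \<omega> + ln ?B - path (real (Suc (Suc k))) \<omega> + H (real (Suc k)) (real (Suc (Suc k))) \<omega>"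
      using x(3) by linarith
    then show "0 < ln ?B + real (Suc l) + (\<Sum>j\<in>{Suc k..<i}. block_incr (blk (1 + j) \<omega>)) + block_height (blk (1 + k) \<omega>)"
      unfolding tele block_height_blk using l(2) by simp
  qed
  then have "ennreal (min 1 ?y) \<le> (\<lambda>l. ennreal (exp (- real l)) * (if alive 1 i (ln ?B + real (Suc l)) (\<lambda>i. blk i \<omega>) then 1 else 0)) l"
    using l(1) unfolding x(2)[symmetric] by (simp add: ennreal_leI)
  also have "\<dots> \<le> (\<Sum>l. ennreal (exp (- real l)) * (if alive 1 i (ln ?B + real (Suc l)) (\<lambda>i. blk i \<omega>) then 1 else 0))"
    by (rule ennreal_le_suminf)
  finally show ?thesis .
qed

lemma q_mono: "mono (q m)"
  by (rule kstep_pow_mono) (simp add: mono_def)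

text \<open>Time reversal gives the block integral the law of the integral of
  \<open>exp (path 1 - path u)\<close>, whose integrand is at most \<open>exp (H 0 1)\<close>.
  Unreversed, the integral is governed by the supremum of the path instead of
  \<open>H\<close>.\<close>

lemma q_log_block_le: "(\<integral>\<^sup>+\<omega>. q m (ln (fst (blk 0 \<omega>)) + b) \<partial>M) \<le> (\<integral>\<^sup>+\<omega>. q m (H 0 1 \<omega> + b) \<partial>M)"
proof -
  let ?f = "\<lambda>\<omega>. \<integral>u. indicator {0..1} u * exp (1 * path u \<omega>) \<partial>lborel"
  let ?r = "\<lambda>\<omega>. \<integral>u. indicator {0..1} u * exp (1 * (path 1 \<omega> - path u \<omega>)) \<partial>lborel"
  have [measurable]: "?f \<in> borel_measurable M" "?r \<in> borel_measurable M" by measurable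
  have "(\<integral>\<^sup>+\<omega>. q m (ln (fst (blk 0 \<omega>)) + b) \<partial>M) = (\<integral>\<^sup>+\<omega>. q m (ln (?f \<omega>) + b) \<partial>M)"
    by (intro nn_integral_cong) (simp add: fst_blk J_def path_0)
  also have "\<dots> = (\<integral>\<^sup>+x. q m (ln x + b) \<partial>distr M borel ?f)" by (subst nn_integral_distr) auto
  also have "\<dots> = (\<integral>\<^sup>+\<omega>. q m (ln (?r \<omega>) + b) \<partial>M)"
    unfolding J_reversal[OF zero_less_one] by (rule nn_integral_distr) measurable
  also have "\<dots> \<le> (\<integral>\<^sup>+\<omega>. q m (H 0 1 \<omega> + b) \<partial>M)"
  proof (intro nn_integral_mono monoD[OF q_mono] add_right_mono)
    fix \<omega> assume \<omega>: "\<omega> \<in> space M"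
    have eq: "indicator {0..1} u * exp (1 * (path 1 \<omega> - path u \<omega>)) = exp (path 1 \<omega>) * (indicator {0..1} u * exp (- 1 * path u \<omega>))" for u :: real
      by (simp add: exp_diff exp_minus field_simps)
    have r: "?r \<omega> = exp (path 1 \<omega>) * (\<integral>u. indicator {0..1} u * exp (- 1 * path u \<omega>) \<partial>lborel)"
      unfolding eq by simp
    have pos: "0 < ?r \<omega>" unfolding r using exp_path_integral_pos[OF \<omega>, of 0 1 "- 1"] by simp
    have "?r \<omega> \<le> (\<integral>u. indicator {0..1::real} u * exp (H 0 1 \<omega>) \<partial>lborel)"
    proof (rule integral_mono)
      show "integrable lborel (\<lambda>u. indicator {0..1} u * exp (1 * (path 1 \<omega> - path u \<omega>)))"
        unfolding eq using exp_path_integrable[OF \<omega>, of 0 1 "- 1"] by simp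
      show "indicator {0..1} u * exp (1 * (path 1 \<omega> - path u \<omega>)) \<le> indicator {0..1} u * exp (H 0 1 \<omega>)" for u
        using H_upper[OF \<omega>, of 0 u 1] by (auto simp: indicator_def)
    qed simp
    then have "?r \<omega> \<le> exp (H 0 1 \<omega>)" by simp
    then show "ln (?r \<omega>) \<le> H 0 1 \<omega>" using pos by (metis ln_exp ln_mono exp_gt_zero)
  qed
  finally show ?thesis .
qed

text \<open>Three independent groups of blocks are involved: block 0 yields \<open>gh 1\<close>,
  block \<open>Suc i\<close> the starting point of the walk, and the blocks between them its
  survival.\<close>

lemma growth_expectation:
  "(\<integral>\<^sup>+\<omega>. ennreal (J 1 0 1 \<omega> powr (a - 1)) * ennreal (min 1 (growth i \<omega>)) \<partial>M) \<le> gh 1 * \<tau> i"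
proof -
  let ?al = "\<lambda>l w. if alive 1 i (ln (fst (w (Suc i) :: real \<times> real \<times> real)) + real (Suc l)) w then 1 else 0 :: ennreal"
  have al_m: "(\<lambda>w. ?al l w) \<in> borel_measurable (PiM {1..Suc i} (\<lambda>_. borel))" for l
  proof -
    have [measurable]: "(\<lambda>w. w (Suc i)) \<in> borel_measurable (PiM {1..Suc i} (\<lambda>_. borel :: (real \<times> real \<times> real) measure))"
      by (rule measurable_component_singleton) simp
    have "(\<lambda>w. ln (fst (w (Suc i))) + real (Suc l)) \<in> borel_measurable (PiM {1..Suc i} (\<lambda>_. borel :: (real \<times> real \<times> real) measure))"
      by measurable
    then have "Measurable.pred (PiM {1..Suc i} (\<lambda>_. borel)) (\<lambda>w. alive 1 i (ln (fst (w (Suc i))) + real (Suc l)) (id w))"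
      by (rule alive_measurable[OF _ measurable_ident]) auto
    then have [measurable]: "Measurable.pred (PiM {1..Suc i} (\<lambda>_. borel)) (\<lambda>w. alive 1 i (ln (fst (w (Suc i))) + real (Suc l)) w)"
      by (simp only: id_apply)
    show ?thesis by measurable
  qed
  have bvec: "?al l (bvec {1..Suc i} \<omega>) = ?al l (\<lambda>i. blk i \<omega>)" for l \<omega>
  proof -
    have "alive 1 i y (bvec {1..Suc i} \<omega>) = alive 1 i y (\<lambda>i. blk i \<omega>)" for y
      by (rule alive_cong) auto
    then show ?thesis by simp
  qed
  have bvec_m: "bvec A \<in> measurable M (PiM A (\<lambda>_. borel))" for A
    by (intro measurable_restrict) simp
  have al_m' [measurable]: "(\<lambda>\<omega>. ?al l (\<lambda>i. blk i \<omega>)) \<in> borel_measurable M" for l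
    using measurable_compose[OF bvec_m al_m[of l]] unfolding bvec .
  have alive_le: "(\<integral>\<^sup>+\<omega>. ?al l (\<lambda>i. blk i \<omega>) \<partial>M) \<le> (\<integral>\<^sup>+\<omega>. q i (H 0 1 \<omega> + real (Suc l)) \<partial>M)" for l
  proof -
    let ?A = "{Suc i}" and ?B = "{1..<1 + i}"
    define f where "f = (\<lambda>(u, w). if alive 1 i (ln (fst (u (Suc i) :: real \<times> real \<times> real)) + real (Suc l)) w then 1 else 0 :: ennreal)"
    have f: "f \<in> borel_measurable (PiM ?A (\<lambda>_. borel) \<Otimes>\<^sub>M PiM ?B (\<lambda>_. borel))"
    proof -
      have [measurable]: "(\<lambda>z. fst z (Suc i)) \<in> borel_measurable (PiM ?A (\<lambda>_. borel :: (real \<times> real \<times> real) measure) \<Otimes>\<^sub>M PiM ?B (\<lambda>_. borel :: (real \<times> real \<times> real) measure))"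
        by (rule measurable_compose[OF measurable_fst measurable_component_singleton]) simp
      have [measurable]: "Measurable.pred (PiM ?A (\<lambda>_. borel :: (real \<times> real \<times> real) measure) \<Otimes>\<^sub>M PiM ?B (\<lambda>_. borel))
        (\<lambda>z. alive 1 i (ln (fst (fst z (Suc i))) + real (Suc l)) (snd z))"
        by (rule alive_measurable[OF _ measurable_snd]) auto
      show ?thesis unfolding f_def case_prod_beta' by measurable
    qed
    have bv: "alive 1 i y (bvec ?B \<omega>) = alive 1 i y (\<lambda>i. blk i \<omega>)" for y \<omega>
      by (rule alive_cong) auto
    have "(\<integral>\<^sup>+\<omega>. ?al l (\<lambda>i. blk i \<omega>) \<partial>M) = (\<integral>\<^sup>+\<omega>. f (bvec ?A \<omega>, bvec ?B \<omega>) \<partial>M)"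
      unfolding f_def prod.case bv by simp
    also have "\<dots> = (\<integral>\<^sup>+\<omega>. \<integral>\<^sup>+\<omega>'. f (bvec ?A \<omega>, bvec ?B \<omega>') \<partial>M \<partial>M)"
      by (rule nn_integral_blk_split[OF _ f]) auto
    also have "\<dots> = (\<integral>\<^sup>+\<omega>. (\<lambda>z. q i (ln (fst z) + real (Suc l))) (blk (Suc i) \<omega>) \<partial>M)"
      unfolding f_def prod.case bv prob_alive by simp
    also have "\<dots> = (\<integral>\<^sup>+\<omega>. (\<lambda>z. q i (ln (fst z) + real (Suc l))) (blk 0 \<omega>) \<partial>M)"
      by (rule nn_integral_blk) measurable
    also have "\<dots> \<le> (\<integral>\<^sup>+\<omega>. q i (H 0 1 \<omega> + real (Suc l)) \<partial>M)" by (rule q_log_block_le)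
    finally show ?thesis .
  qed
  have prod: "(\<integral>\<^sup>+\<omega>. ennreal (J 1 0 1 \<omega> powr (a - 1)) * ?al l (\<lambda>i. blk i \<omega>) \<partial>M) = gh 1 * (\<integral>\<^sup>+\<omega>. ?al l (\<lambda>i. blk i \<omega>) \<partial>M)" for l
  proof -
    let ?A = "{0}" and ?B = "{1..Suc i}"
    define f where "f = (\<lambda>(u, w). ennreal (fst (u (0::nat) :: real \<times> real \<times> real) powr (a - 1)) * ?al l w)"
    have f: "f \<in> borel_measurable (PiM ?A (\<lambda>_. borel) \<Otimes>\<^sub>M PiM ?B (\<lambda>_. borel))"
    proof -
      have [measurable]: "(\<lambda>z. fst z 0) \<in> borel_measurable (PiM ?A (\<lambda>_. borel :: (real \<times> real \<times> real) measure) \<Otimes>\<^sub>M PiM ?B (\<lambda>_. borel :: (real \<times> real \<times> real) measure))"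
        by (rule measurable_compose[OF measurable_fst measurable_component_singleton]) simp
      have [measurable]: "(\<lambda>z. ?al l (snd z)) \<in> borel_measurable (PiM ?A (\<lambda>_. borel :: (real \<times> real \<times> real) measure) \<Otimes>\<^sub>M PiM ?B (\<lambda>_. borel))"
        by (rule measurable_compose[OF measurable_snd al_m])
      show ?thesis unfolding f_def case_prod_beta' by measurable
    qed
    have b0: "fst (bvec ?A \<omega> 0) = J 1 0 1 \<omega>" for \<omega> by (simp add: fst_blk)
    have "(\<integral>\<^sup>+\<omega>. ennreal (J 1 0 1 \<omega> powr (a - 1)) * ?al l (\<lambda>i. blk i \<omega>) \<partial>M) = (\<integral>\<^sup>+\<omega>. f (bvec ?A \<omega>, bvec ?B \<omega>) \<partial>M)"
      unfolding f_def prod.case bvec b0 ..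
    also have "\<dots> = (\<integral>\<^sup>+\<omega>. \<integral>\<^sup>+\<omega>'. f (bvec ?A \<omega>, bvec ?B \<omega>') \<partial>M \<partial>M)"
      by (rule nn_integral_blk_split[OF _ f]) auto
    also have "\<dots> = gh 1 * (\<integral>\<^sup>+\<omega>. ?al l (\<lambda>i. blk i \<omega>) \<partial>M)"
      unfolding f_def prod.case bvec b0 gh_def
      by (simp only: nn_integral_cmult[OF al_m']) (rule nn_integral_multc, measurable)
    finally show ?thesis .
  qed
  have "(\<integral>\<^sup>+\<omega>. ennreal (J 1 0 1 \<omega> powr (a - 1)) * ennreal (min 1 (growth i \<omega>)) \<partial>M)
    \<le> (\<integral>\<^sup>+\<omega>. ennreal (J 1 0 1 \<omega> powr (a - 1)) * (\<Sum>l. ennreal (exp (- real l)) * ?al l (\<lambda>i. blk i \<omega>)) \<partial>M)"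
    by (intro nn_integral_mono mult_left_mono min_growth_le) auto
  also have "\<dots> = (\<integral>\<^sup>+\<omega>. (\<Sum>l. ennreal (exp (- real l)) * (ennreal (J 1 0 1 \<omega> powr (a - 1)) * ?al l (\<lambda>i. blk i \<omega>))) \<partial>M)"
    by (simp only: ennreal_suminf_cmult[symmetric] mult.left_commute)
  also have "\<dots> = (\<Sum>l. \<integral>\<^sup>+\<omega>. ennreal (exp (- real l)) * (ennreal (J 1 0 1 \<omega> powr (a - 1)) * ?al l (\<lambda>i. blk i \<omega>)) \<partial>M)"
    by (rule nn_integral_suminf) measurable
  also have "\<dots> = (\<Sum>l. ennreal (exp (- real l)) * (gh 1 * (\<integral>\<^sup>+\<omega>. ?al l (\<lambda>i. blk i \<omega>) \<partial>M)))"
    unfolding prod[symmetric] by (intro suminf_cong nn_integral_cmult) measurable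
  also have "\<dots> \<le> (\<Sum>l. ennreal (exp (- real l)) * (gh 1 * (\<integral>\<^sup>+\<omega>. q i (H 0 1 \<omega> + real (Suc l)) \<partial>M)))"
    by (intro suminf_le summableI mult_left_mono alive_le) auto
  also have "\<dots> = gh 1 * \<tau> i"
    unfolding \<tau>_def by (simp only: ennreal_suminf_cmult[symmetric] mult.left_commute)
  finally show ?thesis .
qed

lemma gh_step: "gh (real (Suc i)) \<le> gh (real (Suc (Suc i))) + gh 1 * \<tau> i"
proof -
  have "gh (real (Suc i)) \<le> (\<integral>\<^sup>+\<omega>. ennreal (J 1 0 (real (Suc (Suc i))) \<omega> powr (a - 1)) + ennreal (J 1 0 1 \<omega> powr (a - 1)) * ennreal (min 1 (growth i \<omega>)) \<partial>M)"
    unfolding gh_def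
  proof (intro nn_integral_mono)
    fix \<omega> assume \<omega>: "\<omega> \<in> space M"
    have "J 1 0 (real (Suc i)) \<omega> powr (a - 1) \<le> J 1 0 (real (Suc (Suc i))) \<omega> powr (a - 1) + J 1 0 1 \<omega> powr (a - 1) * min 1 (growth i \<omega>)"
      unfolding growth_pos(2)[OF \<omega>]
      using growth_pos(1)[OF \<omega>, of i] J_mono[OF \<omega>, of 1 "real (Suc i)"] J_pos[OF \<omega>, of 0 1] a_pos a_less
      by (intro powr_growth_bound) auto
    moreover have "0 \<le> min 1 (growth i \<omega>)" using growth_pos(1)[OF \<omega>, of i] by simp
    ultimately show "ennreal (J 1 0 (real (Suc i)) \<omega> powr (a - 1)) \<le> ennreal (J 1 0 (real (Suc (Suc i))) \<omega> powr (a - 1)) + ennreal (J 1 0 1 \<omega> powr (a - 1)) * ennreal (min 1 (growth i \<omega>))"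
      by (subst ennreal_mult[symmetric]) (auto simp: ennreal_plus[symmetric] intro!: ennreal_leI simp del: ennreal_plus)
  qed
  also have "\<dots> = gh (real (Suc (Suc i))) + (\<integral>\<^sup>+\<omega>. ennreal (J 1 0 1 \<omega> powr (a - 1)) * ennreal (min 1 (growth i \<omega>)) \<partial>M)"
    unfolding gh_def by (rule nn_integral_add) measurable
  also have "\<dots> \<le> gh (real (Suc (Suc i))) + gh 1 * \<tau> i"
    by (intro add_left_mono growth_expectation)
  finally show ?thesis .
qed

definition c :: ennreal where "c = (INF j. gh (real (Suc j)))"

lemma c_le: "0 < s \<Longrightarrow> c \<le> gh s"
proof -
  assume s: "0 < s"
  obtain j :: nat where "s \<le> real j" using real_arch_simple by blast
  then have "s \<le> real (Suc j)" by simp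
  then have "gh (real (Suc j)) \<le> gh s" using s by (intro gh_antimono) auto
  moreover have "c \<le> gh (real (Suc j))" unfolding c_def by (rule INF_lower) simp
  ultimately show ?thesis by (rule order_trans[rotated])
qed

lemma c_finite: "c < \<infinity>"
  using c_le[of 1] gh_1_finite by (auto elim: le_less_trans)

text \<open>Summability of \<open>\<tau>\<close> makes the capped growth ratios summable almost
  surely, hence \<open>J\<close> bounded along the integers and the infimum of its powers positive.
  The expectation of this infimum bounds \<open>c\<close> from below.\<close>

lemma c_pos: "0 < c"
proof -
  let ?Z = "\<lambda>\<omega>. \<Sum>i. ennreal (J 1 0 1 \<omega> powr (a - 1)) * ennreal (min 1 (growth i \<omega>))"
  let ?Y = "\<lambda>\<omega>. INF j. ennreal (J 1 0 (real (Suc j)) \<omega> powr (a - 1))"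
  have "(\<integral>\<^sup>+\<omega>. ?Z \<omega> \<partial>M) = (\<Sum>i. \<integral>\<^sup>+\<omega>. ennreal (J 1 0 1 \<omega> powr (a - 1)) * ennreal (min 1 (growth i \<omega>)) \<partial>M)"
    by (rule nn_integral_suminf) measurable
  also have "\<dots> \<le> (\<Sum>i. gh 1 * \<tau> i)" by (intro suminf_le summableI growth_expectation)
  also have "\<dots> < \<infinity>" using gh_1_finite sum_\<tau>_finite by (simp add: ennreal_mult_less_top)
  finally have "AE \<omega> in M. ?Z \<omega> \<noteq> \<infinity>" by (intro nn_integral_PInf_AE) auto
  then have "AE \<omega> in M. ?Y \<omega> \<noteq> 0"
    using AE_space
  proof eventually_elim
    case (elim \<omega>)
    have J: "0 < J 1 0 (real (Suc i)) \<omega>" for i by (rule J_pos[OF elim(2)]) simp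
    have "(\<Sum>i. ennreal (min 1 (growth i \<omega>))) \<noteq> top"
      using elim(1) J[of 0] by (auto simp: ennreal_mult_eq_top_iff)
    then have sm: "summable (\<lambda>i. min 1 (growth i \<omega>))"
    proof (rule summable_suminf_not_top[rotated])
      show "0 \<le> min 1 (growth i \<omega>)" for i using growth_pos(1)[OF elim(2), of i] by simp
    qed
    obtain B where B: "0 < B" "\<And>i. J 1 0 (real (Suc i)) \<omega> \<le> B"
      by (rule bounded_of_summable_growth[where x = "\<lambda>i. J 1 0 (real (Suc i)) \<omega>" and y = "\<lambda>i. growth i \<omega>"])
         (use J growth_pos[OF elim(2)] sm in \<open>auto simp: less_imp_le\<close>)
    have "ennreal (B powr (a - 1)) \<le> ?Y \<omega>"
      using B J a_less by (intro INF_greatest ennreal_leI powr_mono2') auto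
    then show ?case using B(1) by auto
  qed
  then have "(\<integral>\<^sup>+\<omega>. ?Y \<omega> \<partial>M) \<noteq> 0"
  proof (rule contrapos_pn)
    assume "(\<integral>\<^sup>+\<omega>. ?Y \<omega> \<partial>M) = 0"
    then have Y0: "AE \<omega> in M. ?Y \<omega> = 0" by (subst (asm) nn_integral_0_iff_AE) measurable
    show "\<not> (AE \<omega> in M. ?Y \<omega> \<noteq> 0)"
    proof
      assume "AE \<omega> in M. ?Y \<omega> \<noteq> 0"
      with Y0 have "AE \<omega> in M. False" by eventually_elim (erule notE, assumption)
      then show False by simp
    qed
  qed
  moreover have "(\<integral>\<^sup>+\<omega>. ?Y \<omega> \<partial>M) \<le> c"
    unfolding c_def gh_def by (intro INF_greatest nn_integral_mono INF_lower) auto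
  ultimately show ?thesis by (metis le_zero_eq not_gr_zero)
qed

text \<open>Telescoping \<open>gh_step\<close> up to \<open>j + k\<close> and taking the infimum
  over \<open>k\<close> replaces the last value of \<open>gh\<close> by \<open>c\<close>.\<close>

lemma gh_tail: "gh (real (Suc j)) \<le> c + gh 1 * (\<Sum>i. if j \<le> i then \<tau> i else 0)"
proof -
  let ?R = "gh 1 * (\<Sum>i. if j \<le> i then \<tau> i else 0)"
  have it: "gh (real (Suc j)) \<le> gh (real (Suc (j + k))) + gh 1 * (\<Sum>i\<in>{j..<j + k}. \<tau> i)" for k
  proof (induction k)
    case (Suc k)
    have "gh (real (Suc j)) \<le> (gh (real (Suc (Suc (j + k)))) + gh 1 * \<tau> (j + k)) + gh 1 * (\<Sum>i\<in>{j..<j + k}. \<tau> i)"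
      by (rule order_trans[OF Suc add_right_mono[OF gh_step]])
    also have "\<dots> = gh (real (Suc (j + Suc k))) + gh 1 * (\<Sum>i\<in>{j..<j + Suc k}. \<tau> i)"
      by (simp add: distrib_left ac_simps del: of_nat_Suc)
    finally show ?case .
  qed simp
  have le: "gh (real (Suc j)) \<le> ?R + gh (real (Suc (j + k)))" for k
  proof -
    have "(\<Sum>i\<in>{j..<j + k}. \<tau> i) = (\<Sum>i\<in>{j..<j + k}. if j \<le> i then \<tau> i else 0)" by (intro sum.cong) auto
    also have "\<dots> \<le> (\<Sum>i. if j \<le> i then \<tau> i else 0)" by (rule sum_le_suminf) auto
    finally show ?thesis unfolding add.commute[of ?R] by (intro order_trans[OF it[of k]] add_left_mono mult_left_mono) auto
  qed
  have fin: "gh (real (Suc j)) < \<infinity>"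
    by (rule le_less_trans[OF gh_antimono[of 1] gh_1_finite]) auto
  have le': "gh (real (Suc j)) - ?R \<le> gh (real (Suc (j + k)))" for k
    unfolding ennreal_minus_le_iff using le[of k] fin by auto
  have "gh (real (Suc j)) - ?R \<le> gh (real (Suc k))" for k
    by (rule order_trans[OF le'[of k] gh_antimono]) auto
  then have "gh (real (Suc j)) - ?R \<le> c" unfolding c_def by (rule INF_greatest)
  then show ?thesis by (simp add: ennreal_minus_le_iff add.commute)
qed

text \<open>On \<open>[j + 1, j + 2)\<close> the excess is at most \<open>gh 1\<close> times the
  tail sum of \<open>\<tau>\<close> from \<open>j\<close>. Exchanging the sums counts each
  \<open>\<tau> i\<close> for \<open>i + 1\<close> values of \<open>j\<close>, with weight at most
  \<open>(2 * (i + 1)) ^ m\<close>; hence the exponent \<open>Suc m\<close>. Near 0 integrability of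
  \<open>gh\<close> is used.\<close>

lemma excess_moment:
  assumes fin: "(\<Sum>i. of_nat ((i + 1) ^ Suc m) * \<tau> i) < \<infinity>"
  shows "(\<integral>\<^sup>+s. indicator {0<..} s * (ennreal (s ^ m) * (gh s - c)) \<partial>lborel) < \<infinity>"
proof -
  define T where "T j = (\<Sum>i. if j \<le> i then \<tau> i else 0)" for j
  let ?S = "\<lambda>j s. indicator {real (Suc j)..<real (Suc (Suc j))} s * (of_nat ((j + 2) ^ m) * (gh 1 * T j)) :: ennreal"
  have "(\<integral>\<^sup>+s. indicator {0<..} s * (ennreal (s ^ m) * (gh s - c)) \<partial>lborel) \<le> (\<integral>\<^sup>+s. indicator {0<..<1} s * gh s + (\<Sum>j. ?S j s) \<partial>lborel)"
  proof (intro nn_integral_mono)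
    fix s :: real
    consider "s \<le> 0" | "0 < s" "s < 1" | "1 \<le> s" by linarith
    then show "indicator {0<..} s * (ennreal (s ^ m) * (gh s - c)) \<le> indicator {0<..<1} s * gh s + (\<Sum>j. ?S j s)"
    proof cases
      case 2
      have "ennreal (s ^ m) * (gh s - c) \<le> 1 * gh s"
        using 2 by (intro mult_mono diff_le_self_ennreal) (auto intro: power_le_one)
      then show ?thesis using 2 by (auto intro: order_trans)
    next
      case 3
      define j where "j = nat \<lfloor>s\<rfloor> - 1"
      have j: "real (Suc j) \<le> s" "s < real (Suc (Suc j))" using 3 unfolding j_def by linarith+
      have "s ^ m \<le> real ((j + 2) ^ m)" using 3 j(2) by (auto intro!: power_mono)
      then have "ennreal (s ^ m) \<le> of_nat ((j + 2) ^ m)"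
        by (metis ennreal_leI ennreal_of_nat_eq_real_of_nat)
      moreover have "gh s - c \<le> gh 1 * T j"
      proof -
        have "gh s \<le> gh (real (Suc j))" using j by (intro gh_antimono) auto
        also have "\<dots> \<le> c + gh 1 * T j" unfolding T_def by (rule gh_tail)
        finally show ?thesis using c_finite by (auto simp: ennreal_minus_le_iff)
      qed
      ultimately have "ennreal (s ^ m) * (gh s - c) \<le> ?S j s" using j by (auto intro!: mult_mono)
      also have "\<dots> \<le> (\<Sum>j. ?S j s)" by (rule ennreal_le_suminf)
      finally show ?thesis using 3 by simp
    qed simp
  qed
  also have "\<dots> = (\<integral>\<^sup>+s. indicator {0<..<1} s * gh s \<partial>lborel) + (\<Sum>j. \<integral>\<^sup>+s. ?S j s \<partial>lborel)"
    by (subst nn_integral_add) (auto simp: nn_integral_suminf)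
  also have "(\<Sum>j. \<integral>\<^sup>+s. ?S j s \<partial>lborel) = (\<Sum>j. of_nat ((j + 2) ^ m) * (gh 1 * T j))"
    by (intro suminf_cong, subst nn_integral_multc) auto
  also have "\<dots> = gh 1 * (\<Sum>j. \<Sum>i. (if j \<le> i then of_nat ((j + 2) ^ m) * \<tau> i else 0))"
  proof -
    have "of_nat ((j + 2) ^ m) * (gh 1 * T j) = gh 1 * (\<Sum>i. (if j \<le> i then of_nat ((j + 2) ^ m) * \<tau> i else 0))" for j
    proof -
      have "of_nat ((j + 2) ^ m) * T j = (\<Sum>i. of_nat ((j + 2) ^ m) * (if j \<le> i then \<tau> i else 0))"
        unfolding T_def by (rule ennreal_suminf_cmult[symmetric])
      also have "\<dots> = (\<Sum>i. (if j \<le> i then of_nat ((j + 2) ^ m) * \<tau> i else 0))"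
        by (intro suminf_cong) auto
      finally show ?thesis by (simp only: mult.left_commute)
    qed
    then show ?thesis by (simp only: ennreal_suminf_cmult)
  qed
  also have "(\<Sum>j. \<Sum>i. (if j \<le> i then of_nat ((j + 2) ^ m) * \<tau> i else 0)) = (\<Sum>i. \<Sum>j. (if j \<le> i then of_nat ((j + 2) ^ m) * \<tau> i else 0))"
    by (rule ennreal_suminf_swap)
  also have "\<dots> \<le> (\<Sum>i. of_nat (2 ^ m) * (of_nat ((i + 1) ^ Suc m) * \<tau> i))"
  proof (intro suminf_le summableI)
    fix i
    have "(\<Sum>j. (if j \<le> i then of_nat ((j + 2) ^ m) * \<tau> i else 0)) = (\<Sum>j\<le>i. of_nat ((j + 2) ^ m) * \<tau> i)"
      by (subst suminf_finite[of "{..i}"]) auto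
    also have "\<dots> = of_nat (\<Sum>j\<le>i. (j + 2) ^ m) * \<tau> i" by (simp add: sum_distrib_right)
    also have "\<dots> \<le> of_nat (2 ^ m * (i + 1) ^ Suc m) * \<tau> i"
    proof (intro mult_right_mono of_nat_mono)
      have "(\<Sum>j\<le>i. (j + 2) ^ m) \<le> (\<Sum>j\<le>i. (2 * (i + 1)) ^ m)" by (intro sum_mono power_mono) auto
      also have "\<dots> = 2 ^ m * (i + 1) ^ Suc m" by (simp only: sum_constant card_atMost power_mult_distrib Suc_eq_plus1[symmetric] power_Suc of_nat_id ac_simps) (simp only: Suc_eq_plus1 ac_simps)
      finally show "(\<Sum>j\<le>i. (j + 2) ^ m) \<le> 2 ^ m * (i + 1) ^ Suc m" .
    qed simp
    finally show "(\<Sum>j. (if j \<le> i then of_nat ((j + 2) ^ m) * \<tau> i else 0)) \<le> of_nat (2 ^ m) * (of_nat ((i + 1) ^ Suc m) * \<tau> i)"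
      by (simp only: of_nat_mult mult.assoc)
  qed
  also have "\<dots> = of_nat (2 ^ m) * (\<Sum>i. of_nat ((i + 1) ^ Suc m) * \<tau> i)" by (rule ennreal_suminf_cmult)
  also have "(\<integral>\<^sup>+s. indicator {0<..<1} s * gh s \<partial>lborel) + gh 1 * \<dots> < \<infinity>"
    using gh_integral_finite gh_1_finite fin of_nat_less_top[of "2 ^ m"] by (simp add: ennreal_mult_less_top del: power_Suc)
  finally show ?thesis by (simp add: add_left_mono mult_left_mono)
qed

end

section \<open>Moments of the expected negative power\<close>

lemma nn_integral_linear_combination:
  assumes [measurable]: "f \<in> borel_measurable N" "h \<in> borel_measurable N"
  shows "(\<integral>\<^sup>+s. C * (A * f s + B * h s) \<partial>N) = C * (A * (\<integral>\<^sup>+s. f s \<partial>N) + B * (\<integral>\<^sup>+s. h s \<partial>N))"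
    and "(\<integral>\<^sup>+s. C * (f s * A + h s * B) \<partial>N) = C * ((\<integral>\<^sup>+s. f s \<partial>N) * A + (\<integral>\<^sup>+s. h s \<partial>N) * B)"
  by (simp_all add: nn_integral_cmult nn_integral_multc nn_integral_add)

context levy_exponent
begin

definition moment :: "nat \<Rightarrow> ennreal" where
  "moment m = (\<integral>\<^sup>+t. indicator {0<..} t * (ennreal (t ^ m) * g t) \<partial>lborel)"

definition excess :: "nat \<Rightarrow> ennreal" where
  "excess m = (\<integral>\<^sup>+s. indicator {0<..} s * (ennreal (s ^ m) * (gh s - c)) \<partial>lborel)"

text \<open>Replacing \<open>gh\<close> by its positive lower bound \<open>c\<close> in the
  convolution identity bounds the mass of \<open>g\<close> uniformly in the horizon.\<close>

lemma moment_0_finite: "moment 0 < \<infinity>"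
proof -
  have le: "(\<integral>\<^sup>+t. indicator {0<..<real (Suc N)} t * g t \<partial>lborel) \<le> beta_const a / c" for N
  proof -
    have "(\<integral>\<^sup>+t. indicator {0<..<real (Suc N)} t * g t \<partial>lborel) * c = (\<integral>\<^sup>+t. indicator {0<..<real (Suc N)} t * g t * c \<partial>lborel)"
      by (rule nn_integral_multc[symmetric]) measurable
    also have "\<dots> \<le> (\<integral>\<^sup>+t. indicator {0<..<real (Suc N)} t * (g t * gh (real (Suc N) - t)) \<partial>lborel)"
      by (intro nn_integral_mono) (auto simp: indicator_def simp del: of_nat_Suc intro!: mult_left_mono c_le)
    also have "\<dots> = beta_const a" by (rule convolution_identity) simp
    finally have "(\<integral>\<^sup>+t. indicator {0<..<real (Suc N)} t * g t \<partial>lborel) * c / c \<le> beta_const a / c"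
      by (rule divide_right_mono_ennreal)
    then show ?thesis using c_pos c_finite by (simp add: ennreal_mult_divide_eq)
  qed
  have "moment 0 = (\<integral>\<^sup>+t. (SUP N. indicator {0<..<real (Suc N)} t * g t) \<partial>lborel)"
    unfolding moment_def
  proof (intro nn_integral_cong antisym)
    fix t
    obtain N :: nat where "t < real N" using reals_Archimedean2 by blast
    then have "t < real (Suc N)" by simp
    then have "indicator {0<..} t * (ennreal (t ^ 0) * g t) \<le> indicator {0<..<real (Suc N)} t * g t"
      by (auto simp: indicator_def)
    also have "\<dots> \<le> (SUP N. indicator {0<..<real (Suc N)} t * g t)" by (rule SUP_upper) simp
    finally show "indicator {0<..} t * (ennreal (t ^ 0) * g t) \<le> (SUP N. indicator {0<..<real (Suc N)} t * g t)" .
    show "(SUP N. indicator {0<..<real (Suc N)} t * g t) \<le> indicator {0<..} t * (ennreal (t ^ 0) * g t)"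
      by (rule SUP_least) (auto simp: indicator_def)
  qed
  also have "\<dots> = (SUP N. \<integral>\<^sup>+t. indicator {0<..<real (Suc N)} t * g t \<partial>lborel)"
    by (rule nn_integral_monotone_convergence_SUP)
       (auto simp: incseq_def le_fun_def indicator_def)
  also have "\<dots> \<le> beta_const a / c" by (rule SUP_least) (rule le)
  also have "\<dots> < \<infinity>"
    using c_pos beta_const_finite[OF a_pos a_less] by (auto simp: ennreal_divide_eq_top_iff less_top[symmetric])
  finally show ?thesis .
qed

text \<open>The convolution identity holds with the same constant for every horizon, and \<open>c\<close> times the
  total mass of \<open>g\<close> is at most that constant; subtract.\<close>
lemma tail_le_excess:
  assumes T: "0 < T"
  shows "c * (\<integral>\<^sup>+t. indicator {T..} t * g t \<partial>lborel) \<le> (\<integral>\<^sup>+t. indicator {0<..<T} t * (g t * (gh (T - t) - c)) \<partial>lborel)"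
proof -
  let ?L = "\<integral>\<^sup>+t. indicator {0<..<T} t * (g t * c) \<partial>lborel"
  have "?L + c * (\<integral>\<^sup>+t. indicator {T..} t * g t \<partial>lborel) = c * moment 0"
  proof -
    have "?L = (\<integral>\<^sup>+t. c * (indicator {0<..<T} t * g t) \<partial>lborel)" by (simp only: mult.commute mult.left_commute)
    also have "\<dots> = c * (\<integral>\<^sup>+t. indicator {0<..<T} t * g t \<partial>lborel)" by (rule nn_integral_cmult) measurable
    finally have "?L + c * (\<integral>\<^sup>+t. indicator {T..} t * g t \<partial>lborel)
      = c * ((\<integral>\<^sup>+t. indicator {0<..<T} t * g t \<partial>lborel) + (\<integral>\<^sup>+t. indicator {T..} t * g t \<partial>lborel))"
      by (simp only: distrib_left)
    also have "(\<integral>\<^sup>+t. indicator {0<..<T} t * g t \<partial>lborel) + (\<integral>\<^sup>+t. indicator {T..} t * g t \<partial>lborel)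
      = (\<integral>\<^sup>+t. indicator {0<..<T} t * g t + indicator {T..} t * g t \<partial>lborel)"
      by (rule nn_integral_add[symmetric]) measurable
    also have "\<dots> = moment 0"
      unfolding moment_def using T by (intro nn_integral_cong) (auto simp: indicator_def)
    finally show ?thesis .
  qed
  also have "c * moment 0 \<le> beta_const a"
  proof -
    have "(SUP N. \<integral>\<^sup>+t. indicator {0<..<real (Suc N)} t * (c * g t) \<partial>lborel) \<le> beta_const a"
    proof (rule SUP_least)
      fix N
      have "(\<integral>\<^sup>+t. indicator {0<..<real (Suc N)} t * (c * g t) \<partial>lborel) \<le> (\<integral>\<^sup>+t. indicator {0<..<real (Suc N)} t * (g t * gh (real (Suc N) - t)) \<partial>lborel)"
        by (intro nn_integral_mono) (auto simp: indicator_def mult.commute[of c] simp del: of_nat_Suc intro!: mult_left_mono c_le)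
      also have "\<dots> = beta_const a" by (rule convolution_identity) simp
      finally show "(\<integral>\<^sup>+t. indicator {0<..<real (Suc N)} t * (c * g t) \<partial>lborel) \<le> beta_const a" .
    qed
    also have "(SUP N. \<integral>\<^sup>+t. indicator {0<..<real (Suc N)} t * (c * g t) \<partial>lborel) = (\<integral>\<^sup>+t. (SUP N. indicator {0<..<real (Suc N)} t * (c * g t)) \<partial>lborel)"
      by (rule nn_integral_monotone_convergence_SUP[symmetric]) (auto simp: incseq_def le_fun_def indicator_def)
    finally have *: "(\<integral>\<^sup>+t. (SUP N. indicator {0<..<real (Suc N)} t * (c * g t)) \<partial>lborel) \<le> beta_const a" .
    have "c * moment 0 = (\<integral>\<^sup>+t. c * (indicator {0<..} t * (ennreal (t ^ 0) * g t)) \<partial>lborel)"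
      unfolding moment_def by (rule nn_integral_cmult[symmetric]) measurable
    also have "\<dots> \<le> (\<integral>\<^sup>+t. (SUP N. indicator {0<..<real (Suc N)} t * (c * g t)) \<partial>lborel)"
    proof (intro nn_integral_mono)
      fix t
      obtain N :: nat where "t < real N" using reals_Archimedean2 by blast
      then have "t < real (Suc N)" by simp
      then have "c * (indicator {0<..} t * (ennreal (t ^ 0) * g t)) \<le> indicator {0<..<real (Suc N)} t * (c * g t)"
        by (auto simp: indicator_def)
      also have "\<dots> \<le> (SUP N. indicator {0<..<real (Suc N)} t * (c * g t))" by (rule SUP_upper) simp
      finally show "c * (indicator {0<..} t * (ennreal (t ^ 0) * g t)) \<le> (SUP N. indicator {0<..<real (Suc N)} t * (c * g t))" .
    qed
    also note *
    finally show ?thesis .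
  qed
  also have "beta_const a = (\<integral>\<^sup>+t. indicator {0<..<T} t * (g t * c) + indicator {0<..<T} t * (g t * (gh (T - t) - c)) \<partial>lborel)"
    unfolding convolution_identity[OF T, symmetric]
  proof (intro nn_integral_cong)
    fix t
    have "gh (T - t) = c + (gh (T - t) - c)" if "t < T"
      using c_le[of "T - t"] that by (subst add.commute) (simp add: diff_add_cancel_ennreal)
    then show "indicator {0<..<T} t * (g t * gh (T - t)) = indicator {0<..<T} t * (g t * c) + indicator {0<..<T} t * (g t * (gh (T - t) - c))"
      by (auto simp: indicator_def distrib_left[symmetric])
  qed
  also have "\<dots> = ?L + (\<integral>\<^sup>+t. indicator {0<..<T} t * (g t * (gh (T - t) - c)) \<partial>lborel)"
    by (rule nn_integral_add) measurable
  finally have *: "?L + c * (\<integral>\<^sup>+t. indicator {T..} t * g t \<partial>lborel) \<le> ?L + (\<integral>\<^sup>+t. indicator {0<..<T} t * (g t * (gh (T - t) - c)) \<partial>lborel)" .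
  have "?L \<le> beta_const a"
    unfolding convolution_identity[OF T, symmetric]
    by (intro nn_integral_mono) (auto simp: indicator_def intro!: mult_left_mono c_le)
  then have "?L \<noteq> \<infinity>" using beta_const_finite[OF a_pos a_less] by (auto simp: top_unique)
  with * show ?thesis by (simp add: ennreal_add_left_cancel_le)
qed

lemma power_add_le: "0 \<le> s \<Longrightarrow> 0 \<le> t \<Longrightarrow> (s + t) ^ k \<le> 2 ^ k * (s ^ k + t ^ k)" for s t :: real
proof -
  assume st: "0 \<le> s" "0 \<le> t"
  have "(s + t) ^ k \<le> (2 * max s t) ^ k" using st by (intro power_mono) auto
  also have "\<dots> = 2 ^ k * max s t ^ k" by (simp add: power_mult_distrib)
  also have "\<dots> \<le> 2 ^ k * (s ^ k + t ^ k)" using st by (intro mult_left_mono) (auto simp: max_def)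
  finally show ?thesis .
qed

text \<open>The tail inequality is integrated against \<open>(k + 1) * T ^ k\<close>. On the left
  Fubini rebuilds \<open>t ^ (k + 1)\<close>. On the right \<open>T = t + s\<close>, and
  \<open>(t + s) ^ k \<le> 2 ^ k * (s ^ k + t ^ k)\<close> separates the convolution into products
  of moments.\<close>

lemma moment_Suc_le:
  "c * moment (Suc k) \<le> ennreal (real (Suc k) * 2 ^ k) * (moment 0 * excess k + moment k * excess 0)"
proof -
  let ?w = "\<lambda>T::real. ennreal (real (Suc k) * T ^ k)"
  have pw: "indicator {0<..} t * (ennreal (t ^ Suc k) * g t) = (\<integral>\<^sup>+T. indicator {0<..} T * ?w T * (indicator {T..} t * g t) \<partial>lborel)" for t
  proof (cases "0 < t")
    case True
    have "(\<integral>\<^sup>+T. ?w T * indicator {0..t} T \<partial>lborel) = ennreal (t ^ Suc k - 0 ^ Suc k)"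
      by (rule nn_integral_FTC_Icc) (use True in \<open>auto intro!: derivative_eq_intros simp del: of_nat_Suc power_Suc\<close>)
    moreover have "(\<integral>\<^sup>+T. indicator {0<..} T * ?w T * indicator {T..} t \<partial>lborel) = (\<integral>\<^sup>+T. ?w T * indicator {0..t} T \<partial>lborel)"
      by (rule nn_integral_cong_AE) (use AE_lborel_singleton[of 0] in \<open>eventually_elim, auto simp: indicator_def\<close>)
    ultimately have "ennreal (t ^ Suc k) = (\<integral>\<^sup>+T. indicator {0<..} T * ?w T * indicator {T..} t \<partial>lborel)"
      by simp
    then have "ennreal (t ^ Suc k) * g t = (\<integral>\<^sup>+T. indicator {0<..} T * ?w T * indicator {T..} t * g t \<partial>lborel)"
      by (subst nn_integral_multc) (auto simp: indicator_def of_bool_def)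
    then show ?thesis using True by (simp add: mult.assoc del: power_Suc)
  next
    case False
    then have "indicator {0<..} T * ?w T * (indicator {T..} t * g t) = 0" for T by (auto simp: indicator_def)
    then have "(\<integral>\<^sup>+T. indicator {0<..} T * ?w T * (indicator {T..} t * g t) \<partial>lborel) = 0" by (simp only:) simp
    then show ?thesis using False by simp
  qed
  have "c * moment (Suc k) = c * (\<integral>\<^sup>+t. \<integral>\<^sup>+T. indicator {0<..} T * ?w T * (indicator {T..} t * g t) \<partial>lborel \<partial>lborel)"
    unfolding moment_def pw ..
  also have "\<dots> = c * (\<integral>\<^sup>+T. \<integral>\<^sup>+t. indicator {0<..} T * ?w T * (indicator {T..} t * g t) \<partial>lborel \<partial>lborel)"
  proof -
    have "(\<lambda>(T, t). indicator {0<..} T * ?w T * (indicator {T..} t * g t)) \<in> borel_measurable (lborel \<Otimes>\<^sub>M lborel)"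
      unfolding indicator_def of_bool_def atLeast_iff by measurable
    from lborel_pair.Fubini'[OF this] show ?thesis by simp
  qed
  also have "\<dots> = (\<integral>\<^sup>+T. indicator {0<..} T * ?w T * (c * (\<integral>\<^sup>+t. indicator {T..} t * g t \<partial>lborel)) \<partial>lborel)"
  proof -
    define A where "A T = (\<integral>\<^sup>+t. indicator {T..} t * g t \<partial>lborel)" for T :: real
    have [measurable]: "A \<in> borel_measurable borel"
      unfolding A_def indicator_def of_bool_def atLeast_iff by measurable
    have "(\<integral>\<^sup>+t. indicator {0<..} T * ?w T * (indicator {T..} t * g t) \<partial>lborel) = indicator {0<..} T * ?w T * A T" for T :: real
      unfolding A_def by (rule nn_integral_cmult) measurable
    then have "c * (\<integral>\<^sup>+T. \<integral>\<^sup>+t. indicator {0<..} T * ?w T * (indicator {T..} t * g t) \<partial>lborel \<partial>lborel) = c * (\<integral>\<^sup>+T. indicator {0<..} T * ?w T * A T \<partial>lborel)"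
      by (simp only:)
    also have "\<dots> = (\<integral>\<^sup>+T. c * (indicator {0<..} T * ?w T * A T) \<partial>lborel)" by (rule nn_integral_cmult[symmetric]) measurable
    also have "\<dots> = (\<integral>\<^sup>+T. indicator {0<..} T * ?w T * (c * A T) \<partial>lborel)" by (simp only: mult.left_commute)
    finally show ?thesis unfolding A_def .
  qed
  also have "\<dots> \<le> (\<integral>\<^sup>+T. indicator {0<..} T * ?w T * (\<integral>\<^sup>+t. indicator {0<..<T} t * (g t * (gh (T - t) - c)) \<partial>lborel) \<partial>lborel)"
  proof (intro nn_integral_mono)
    fix T :: real
    show "indicator {0<..} T * ?w T * (c * (\<integral>\<^sup>+t. indicator {T..} t * g t \<partial>lborel)) \<le> indicator {0<..} T * ?w T * (\<integral>\<^sup>+t. indicator {0<..<T} t * (g t * (gh (T - t) - c)) \<partial>lborel)"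
    proof (cases "0 < T")
      case True
      then show ?thesis using tail_le_excess[OF True] by (intro mult_left_mono) auto
    qed simp
  qed
  also have "\<dots> = (\<integral>\<^sup>+T. \<integral>\<^sup>+t. ?w T * (indicator {0<..<T} t * (g t * (gh (T - t) - c))) \<partial>lborel \<partial>lborel)"
  proof (intro nn_integral_cong)
    fix T :: real
    have "indicator {0<..} T * ?w T * (\<integral>\<^sup>+t. indicator {0<..<T} t * (g t * (gh (T - t) - c)) \<partial>lborel)
      = (\<integral>\<^sup>+t. indicator {0<..} T * ?w T * (indicator {0<..<T} t * (g t * (gh (T - t) - c))) \<partial>lborel)"
      by (rule nn_integral_cmult[symmetric]) measurable
    also have "\<dots> = (\<integral>\<^sup>+t. ?w T * (indicator {0<..<T} t * (g t * (gh (T - t) - c))) \<partial>lborel)"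
      by (intro nn_integral_cong) (auto simp: indicator_def)
    finally show "indicator {0<..} T * ?w T * (\<integral>\<^sup>+t. indicator {0<..<T} t * (g t * (gh (T - t) - c)) \<partial>lborel)
      = (\<integral>\<^sup>+t. ?w T * (indicator {0<..<T} t * (g t * (gh (T - t) - c))) \<partial>lborel)" .
  qed
  also have "\<dots> = (\<integral>\<^sup>+t. \<integral>\<^sup>+T. ?w T * (indicator {0<..<T} t * (g t * (gh (T - t) - c))) \<partial>lborel \<partial>lborel)"
    by (rule lborel_pair.Fubini') (unfold indicator_def of_bool_def greaterThanLessThan_iff, measurable)
  also have "\<dots> \<le> (\<integral>\<^sup>+t. \<integral>\<^sup>+s. ennreal (real (Suc k) * 2 ^ k) * (indicator {0<..} t * g t * (indicator {0<..} s * (ennreal (s ^ k) * (gh s - c)))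
       + indicator {0<..} t * (ennreal (t ^ k) * g t) * (indicator {0<..} s * (ennreal (s ^ 0) * (gh s - c)))) \<partial>lborel \<partial>lborel)"
  proof (rule nn_integral_mono)
    fix t :: real
    have "(\<integral>\<^sup>+T. ?w T * (indicator {0<..<T} t * (g t * (gh (T - t) - c))) \<partial>lborel)
      = ennreal \<bar>1\<bar> * (\<integral>\<^sup>+s. ?w (t + 1 * s) * (indicator {0<..<t + 1 * s} t * (g t * (gh (t + 1 * s - t) - c))) \<partial>lborel)"
    proof (rule nn_integral_real_affine)
      have [measurable]: "(\<lambda>T. indicator {0<..<T} t :: ennreal) \<in> borel_measurable borel"
        unfolding indicator_def of_bool_def greaterThanLessThan_iff by measurable
      show "(\<lambda>T. ?w T * (indicator {0<..<T} t * (g t * (gh (T - t) - c)))) \<in> borel_measurable borel"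
        by measurable
    qed simp
    also have "\<dots> = (\<integral>\<^sup>+s. ?w (t + s) * (indicator {0<..<t + s} t * (g t * (gh s - c))) \<partial>lborel)" by simp
    also have "\<dots> \<le> (\<integral>\<^sup>+s. ennreal (real (Suc k) * 2 ^ k) * (indicator {0<..} t * g t * (indicator {0<..} s * (ennreal (s ^ k) * (gh s - c)))
       + indicator {0<..} t * (ennreal (t ^ k) * g t) * (indicator {0<..} s * (ennreal (s ^ 0) * (gh s - c)))) \<partial>lborel)"
    proof (intro nn_integral_mono)
      fix s :: real
      show "?w (t + s) * (indicator {0<..<t + s} t * (g t * (gh s - c))) \<le> ennreal (real (Suc k) * 2 ^ k) * (indicator {0<..} t * g t * (indicator {0<..} s * (ennreal (s ^ k) * (gh s - c)))
       + indicator {0<..} t * (ennreal (t ^ k) * g t) * (indicator {0<..} s * (ennreal (s ^ 0) * (gh s - c))))"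
      proof (cases "0 < t \<and> 0 < s")
        case True
        have "real (Suc k) * (t + s) ^ k \<le> (real (Suc k) * 2 ^ k) * (s ^ k + t ^ k)"
          using power_add_le[of t s k] True by (simp add: mult.assoc add.commute del: of_nat_Suc)
        then have "?w (t + s) \<le> ennreal ((real (Suc k) * 2 ^ k) * (s ^ k + t ^ k))" by (rule ennreal_leI)
        also have "\<dots> = ennreal (real (Suc k) * 2 ^ k) * (ennreal (s ^ k) + ennreal (t ^ k))"
          using True by (subst ennreal_mult) auto
        finally have "?w (t + s) * (g t * (gh s - c)) \<le> ennreal (real (Suc k) * 2 ^ k) * (ennreal (s ^ k) + ennreal (t ^ k)) * (g t * (gh s - c))"
          by (rule mult_right_mono) simp
        also have "\<dots> = ennreal (real (Suc k) * 2 ^ k) * (g t * (ennreal (s ^ k) * (gh s - c)) + ennreal (t ^ k) * g t * (gh s - c))"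
          by (simp only: distrib_left distrib_right ac_simps)
        finally show ?thesis using True by simp
      next
        case False
        then have "t \<notin> {0<..<t + s}" by auto
        then show ?thesis by simp
      qed
    qed
    finally show "(\<integral>\<^sup>+T. ?w T * (indicator {0<..<T} t * (g t * (gh (T - t) - c))) \<partial>lborel)
      \<le> (\<integral>\<^sup>+s. ennreal (real (Suc k) * 2 ^ k) * (indicator {0<..} t * g t * (indicator {0<..} s * (ennreal (s ^ k) * (gh s - c)))
       + indicator {0<..} t * (ennreal (t ^ k) * g t) * (indicator {0<..} s * (ennreal (s ^ 0) * (gh s - c)))) \<partial>lborel)" .
  qed
  also have "\<dots> = ennreal (real (Suc k) * 2 ^ k) * (moment 0 * excess k + moment k * excess 0)"
  proof -
    have "(\<integral>\<^sup>+s. ennreal (real (Suc k) * 2 ^ k) * (indicator {0<..} t * g t * (indicator {0<..} s * (ennreal (s ^ k) * (gh s - c)))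
       + indicator {0<..} t * (ennreal (t ^ k) * g t) * (indicator {0<..} s * (ennreal (s ^ 0) * (gh s - c)))) \<partial>lborel)
      = ennreal (real (Suc k) * 2 ^ k) * (indicator {0<..} t * (ennreal (t ^ 0) * g t) * excess k + indicator {0<..} t * (ennreal (t ^ k) * g t) * excess 0)" for t
    proof -
      have e: "(\<lambda>s. indicator {0<..} s * (ennreal (s ^ m) * (gh s - c))) \<in> borel_measurable lborel" for m
        by measurable
      show ?thesis
        unfolding excess_def nn_integral_linear_combination(1)[OF e e] by simp
    qed
    then have "(\<integral>\<^sup>+t. \<integral>\<^sup>+s. ennreal (real (Suc k) * 2 ^ k) * (indicator {0<..} t * g t * (indicator {0<..} s * (ennreal (s ^ k) * (gh s - c)))
       + indicator {0<..} t * (ennreal (t ^ k) * g t) * (indicator {0<..} s * (ennreal (s ^ 0) * (gh s - c)))) \<partial>lborel \<partial>lborel)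
      = (\<integral>\<^sup>+t. ennreal (real (Suc k) * 2 ^ k) * (indicator {0<..} t * (ennreal (t ^ 0) * g t) * excess k + indicator {0<..} t * (ennreal (t ^ k) * g t) * excess 0) \<partial>lborel)"
      by (simp only:)
    also have "\<dots> = ennreal (real (Suc k) * 2 ^ k) * (moment 0 * excess k + moment k * excess 0)"
      unfolding moment_def by (rule nn_integral_linear_combination(2)) measurable
    finally show ?thesis .
  qed
  finally show ?thesis .
qed

lemma moment_finite:
  assumes "\<And>m. m < n \<Longrightarrow> excess m < \<infinity>"
  shows "m \<le> n \<Longrightarrow> moment m < \<infinity>"
proof (induction m)
  case 0
  show ?case by (rule moment_0_finite)
next
  case (Suc k)
  have "c * moment (Suc k) \<le> ennreal (real (Suc k) * 2 ^ k) * (moment 0 * excess k + moment k * excess 0)"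
    by (rule moment_Suc_le)
  also have "\<dots> < \<infinity>"
    using assms[of k] assms[of 0] Suc moment_0_finite by (simp add: ennreal_mult_less_top)
  finally show ?case using c_pos by (auto simp: ennreal_mult_less_top)
qed

text \<open>Order \<open>n\<close> of \<open>g\<close> asks for the excess up to order
  \<open>n - 1\<close>, hence for weights up to \<open>(i + 1) ^ n\<close>.\<close>

lemma moment_of_criterion:
  assumes "has_levy_triplet M X \<gamma> \<sigma>2 Lm" and "1 < x0" and "\<And>x. x0 \<le> x \<Longrightarrow> levy_A \<gamma> Lm x \<noteq> 0"
    and "(\<integral>\<^sup>+ x\<in>{x0<..}. ennreal ((x / \<bar>levy_A \<gamma> Lm x\<bar>) ^ (n + 1)) \<partial>Lm) < \<infinity>"
  shows "moment n < \<infinity>"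
proof (rule moment_finite[OF _ order_refl])
  fix m assume m: "m < n"
  show "excess m < \<infinity>"
    unfolding excess_def
  proof (rule excess_moment)
    have "(\<Sum>i. of_nat ((i + 1) ^ Suc m) * \<tau> i) \<le> (\<Sum>i. of_nat ((i + 1) ^ n) * \<tau> i)"
      using m by (intro suminf_le summableI mult_right_mono of_nat_mono power_increasing) auto
    also have "\<dots> < \<infinity>" by (rule sum_pow_\<tau>_finite[OF assms])
    finally show "(\<Sum>i. of_nat ((i + 1) ^ Suc m) * \<tau> i) < \<infinity>" .
  qed
qed

text \<open>\<open>g\<close> is nonincreasing, so its mass on \<open>[t / 2, t]\<close> is at least
  \<open>g t * t / 2\<close>. The surplus factor \<open>1 / t\<close> yields the little-o.\<close>

lemma g_le_moment:
  assumes t: "0 < t"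
  shows "ennreal (t ^ n) * g t \<le> ennreal (2 ^ Suc n / t) * moment n"
proof -
  have "ennreal ((t / 2) ^ Suc n) * g t = ennreal ((t / 2) ^ n) * g t * ennreal (t / 2)"
    using t by (simp add: ennreal_mult[symmetric] mult.commute mult.left_commute)
  also have "\<dots> = (\<integral>\<^sup>+s. indicator {t / 2..t} s * (ennreal ((t / 2) ^ n) * g t) \<partial>lborel)"
    using t by (subst nn_integral_multc) (auto simp: mult.commute)
  also have "\<dots> \<le> moment n"
    unfolding moment_def
    using t by (intro nn_integral_mono) (auto simp: indicator_def intro!: mult_mono ennreal_leI power_mono g_antimono)
  finally have "ennreal (2 ^ Suc n / t) * (ennreal ((t / 2) ^ Suc n) * g t) \<le> ennreal (2 ^ Suc n / t) * moment n"
    by (rule mult_left_mono) simp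
  moreover have "ennreal (2 ^ Suc n / t) * ennreal ((t / 2) ^ Suc n) = ennreal (t ^ n)"
    using t by (subst ennreal_mult[symmetric]) (auto simp: power_divide)
  ultimately show ?thesis by (simp only: mult.assoc[symmetric])
qed

section \<open>Consequences for functions of the exponential functional\<close>

lemma exp_functional_eq:
  assumes "0 < t"
  shows "exp_functional X t \<omega> = I t \<omega>"
  unfolding exp_functional_def I_def set_lebesgue_integral_def
  by (intro Bochner_Integration.integral_cong) (auto simp: indicator_def path_eq)

lemma expectation_le_g:
  assumes bd: "bounded ((\<lambda>x. x powr a * F x) ` {0<..})"
  obtains C where "0 \<le> C" "\<And>t. 0 < t \<Longrightarrow> (\<integral>\<^sup>+\<omega>. ennreal \<bar>F (exp_functional X t \<omega>)\<bar> \<partial>M) \<le> ennreal C * g t"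
proof -
  obtain C where C: "\<And>x. 0 < x \<Longrightarrow> \<bar>x powr a * F x\<bar> \<le> C" using bd by (auto simp: bounded_iff)
  have C0: "0 \<le> C" using C[of 1] by (auto intro: order_trans[OF abs_ge_zero])
  show ?thesis
  proof (rule that[OF C0])
    fix t :: real assume t: "0 < t"
    have "(\<integral>\<^sup>+\<omega>. ennreal \<bar>F (exp_functional X t \<omega>)\<bar> \<partial>M) \<le> (\<integral>\<^sup>+\<omega>. ennreal C * ennreal (I t \<omega> powr (- a)) \<partial>M)"
    proof (intro nn_integral_mono)
      fix \<omega> assume \<omega>: "\<omega> \<in> space M"
      let ?x = "I t \<omega>"
      have x: "0 < ?x" by (rule I_pos[OF \<omega> t])
      have "\<bar>F ?x\<bar> = \<bar>?x powr a * F ?x\<bar> * ?x powr (- a)"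
        using x by (simp add: abs_mult powr_minus)
      also have "\<dots> \<le> C * ?x powr (- a)" by (intro mult_right_mono C x) auto
      finally show "ennreal \<bar>F (exp_functional X t \<omega>)\<bar> \<le> ennreal C * ennreal (?x powr (- a))"
        unfolding exp_functional_eq[OF t] using C0 by (simp add: ennreal_mult[symmetric] ennreal_leI)
    qed
    also have "\<dots> = ennreal C * g t" unfolding g_def by (rule nn_integral_cmult) measurable
    finally show "(\<integral>\<^sup>+\<omega>. ennreal \<bar>F (exp_functional X t \<omega>)\<bar> \<partial>M) \<le> ennreal C * g t" .
  qed
qed

lemma expectation_moment_finite:
  assumes bd: "bounded ((\<lambda>x. x powr a * F x) ` {0<..})" and m: "moment n < \<infinity>"
  shows "(\<integral>\<^sup>+ t\<in>{0<..}. ennreal (t ^ n) * (\<integral>\<^sup>+ \<omega>. ennreal \<bar>F (exp_functional X t \<omega>)\<bar> \<partial>M) \<partial>lborel) < \<infinity>"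
proof -
  obtain C where C: "0 \<le> C" "\<And>t. 0 < t \<Longrightarrow> (\<integral>\<^sup>+\<omega>. ennreal \<bar>F (exp_functional X t \<omega>)\<bar> \<partial>M) \<le> ennreal C * g t"
    by (rule expectation_le_g[OF bd]) blast
  have "(\<integral>\<^sup>+ t\<in>{0<..}. ennreal (t ^ n) * (\<integral>\<^sup>+ \<omega>. ennreal \<bar>F (exp_functional X t \<omega>)\<bar> \<partial>M) \<partial>lborel)
    \<le> (\<integral>\<^sup>+t. ennreal C * (indicator {0<..} t * (ennreal (t ^ n) * g t)) \<partial>lborel)"
  proof (intro nn_integral_mono)
    fix t :: real
    show "ennreal (t ^ n) * (\<integral>\<^sup>+ \<omega>. ennreal \<bar>F (exp_functional X t \<omega>)\<bar> \<partial>M) * indicator {0<..} t \<le> ennreal C * (indicator {0<..} t * (ennreal (t ^ n) * g t))"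
    proof (cases "0 < t")
      case True
      then have "ennreal (t ^ n) * (\<integral>\<^sup>+ \<omega>. ennreal \<bar>F (exp_functional X t \<omega>)\<bar> \<partial>M) \<le> ennreal (t ^ n) * (ennreal C * g t)"
        by (intro mult_left_mono C) auto
      then show ?thesis using True by (simp add: mult.left_commute)
    qed simp
  qed
  also have "\<dots> = ennreal C * moment n" unfolding moment_def by (rule nn_integral_cmult) measurable
  also have "\<dots> < \<infinity>" using m by (simp add: ennreal_mult_less_top)
  finally show ?thesis .
qed

lemma expectation_tendsto_0:
  assumes bd: "bounded ((\<lambda>x. x powr a * F x) ` {0<..})" and m: "moment n < \<infinity>"
  shows "((\<lambda>t. ennreal (t ^ n) * (\<integral>\<^sup>+ \<omega>. ennreal \<bar>F (exp_functional X t \<omega>)\<bar> \<partial>M)) \<longlongrightarrow> 0) at_top"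
proof -
  obtain C where C: "0 \<le> C" "\<And>t. 0 < t \<Longrightarrow> (\<integral>\<^sup>+\<omega>. ennreal \<bar>F (exp_functional X t \<omega>)\<bar> \<partial>M) \<le> ennreal C * g t"
    by (rule expectation_le_g[OF bd]) blast
  obtain K where K: "0 \<le> K" "moment n = ennreal K" using m by (cases "moment n") auto
  have "((\<lambda>t::real. C * (2 ^ Suc n / t * K)) \<longlongrightarrow> 0) at_top" by real_asymp
  then have "((\<lambda>t::real. ennreal (C * (2 ^ Suc n / t * K))) \<longlongrightarrow> ennreal 0) at_top" by (rule tendsto_ennrealI)
  then have lim: "((\<lambda>t::real. ennreal (C * (2 ^ Suc n / t * K))) \<longlongrightarrow> 0) at_top" by simp
  show ?thesis
  proof (rule tendsto_sandwich[OF _ _ tendsto_const lim])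
    show "\<forall>\<^sub>F t in at_top. ennreal (t ^ n) * (\<integral>\<^sup>+ \<omega>. ennreal \<bar>F (exp_functional X t \<omega>)\<bar> \<partial>M) \<le> ennreal (C * (2 ^ Suc n / t * K))"
      using eventually_gt_at_top[of 0]
    proof eventually_elim
      case (elim t)
      have "ennreal (t ^ n) * (\<integral>\<^sup>+ \<omega>. ennreal \<bar>F (exp_functional X t \<omega>)\<bar> \<partial>M) \<le> ennreal (t ^ n) * (ennreal C * g t)"
        by (intro mult_left_mono C elim) auto
      also have "\<dots> = ennreal C * (ennreal (t ^ n) * g t)" by (rule mult.left_commute)
      also have "\<dots> \<le> ennreal C * (ennreal (2 ^ Suc n / t) * moment n)"
        by (intro mult_left_mono g_le_moment elim) auto
      also have "\<dots> = ennreal (C * (2 ^ Suc n / t * K))"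
        unfolding K(2) using C(1) K(1) elim by (simp add: ennreal_mult[symmetric])
      finally show ?case .
    qed
  qed simp
qed

end

theorem theorem3p6:
  fixes M :: "'a measure" and X :: "real \<Rightarrow> 'a \<Rightarrow> real"
    and \<gamma> \<sigma>2 :: real and Lm :: "real measure"
  assumes "levy_process M X"
    and "has_levy_triplet M X \<gamma> \<sigma>2 Lm"
    and "AE \<omega> in M. filterlim (\<lambda>t. X t \<omega>) at_bot at_top"
  shows "(\<forall>n::nat. n \<ge> 1 \<longrightarrow>
            (\<exists>x0>1. (\<forall>x\<ge>x0. levy_A \<gamma> Lm x \<noteq> 0) \<and>
               (\<integral>\<^sup>+ x\<in>{x0<..}. ennreal ((x / \<bar>levy_A \<gamma> Lm x\<bar>) ^ (n + 1)) \<partial>Lm) < \<infinity>) \<longrightarrow>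
            (\<forall>F :: real \<Rightarrow> real. F \<in> borel_measurable borel \<and>
               (\<exists>a\<in>{0<..<1}. bounded ((\<lambda>x. x powr a * F x) ` {0<..})) \<longrightarrow>
               ((\<lambda>t. ennreal (t ^ n) * (\<integral>\<^sup>+ \<omega>. ennreal \<bar>F (exp_functional X t \<omega>)\<bar> \<partial>M))
                  \<longlongrightarrow> 0) at_top \<and>
               (\<integral>\<^sup>+ t\<in>{0<..}. ennreal (t ^ n) *
                  (\<integral>\<^sup>+ \<omega>. ennreal \<bar>F (exp_functional X t \<omega>)\<bar> \<partial>M) \<partial>lborel) < \<infinity>))
       \<and> (\<forall>F :: real \<Rightarrow> real. F \<in> borel_measurable borel \<and>
             (\<exists>a\<in>{0<..<1}. bounded ((\<lambda>x. x powr a * F x) ` {0<..})) \<longrightarrow>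
             (\<integral>\<^sup>+ t\<in>{0<..}. (\<integral>\<^sup>+ \<omega>. ennreal \<bar>F (exp_functional X t \<omega>)\<bar> \<partial>M) \<partial>lborel) < \<infinity>)"
proof -
  interpret prob_space M using assms(1) by (simp add: levy_process_def)
  interpret levy_drift M X by unfold_locales (use assms in auto)
  \<comment> \<open>The exponent \<open>a\<close> comes with \<open>F\<close>, so the estimates are
    instantiated anew for each \<open>F\<close>.\<close>
  have loc: "levy_exponent M X a" if "a \<in> {0<..<1}" for a
    by unfold_locales (use that in auto)
  show ?thesis
  proof (intro conjI allI impI, goal_cases)
    case (1 n F)
    then obtain x0 where x0: "1 < x0" "\<And>x. x0 \<le> x \<Longrightarrow> levy_A \<gamma> Lm x \<noteq> 0"
      "(\<integral>\<^sup>+ x\<in>{x0<..}. ennreal ((x / \<bar>levy_A \<gamma> Lm x\<bar>) ^ (n + 1)) \<partial>Lm) < \<infinity>" by blast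
    from 1 obtain a where a: "a \<in> {0<..<1}" "bounded ((\<lambda>x. x powr a * F x) ` {0<..})" by blast
    interpret E: levy_exponent M X a by (rule loc[OF a(1)])
    have "E.moment n < \<infinity>"
      by (rule E.moment_of_criterion[OF assms(2) x0])
    then show ?case by (rule E.expectation_tendsto_0[OF a(2)])
  next
    case (2 n F)
    then obtain x0 where x0: "1 < x0" "\<And>x. x0 \<le> x \<Longrightarrow> levy_A \<gamma> Lm x \<noteq> 0"
      "(\<integral>\<^sup>+ x\<in>{x0<..}. ennreal ((x / \<bar>levy_A \<gamma> Lm x\<bar>) ^ (n + 1)) \<partial>Lm) < \<infinity>" by blast
    from 2 obtain a where a: "a \<in> {0<..<1}" "bounded ((\<lambda>x. x powr a * F x) ` {0<..})" by blast
    interpret E: levy_exponent M X a by (rule loc[OF a(1)])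
    have "E.moment n < \<infinity>"
      by (rule E.moment_of_criterion[OF assms(2) x0])
    then show ?case by (rule E.expectation_moment_finite[OF a(2)])
  next
    case (3 F)
    then obtain a where a: "a \<in> {0<..<1}" "bounded ((\<lambda>x. x powr a * F x) ` {0<..})" by blast
    interpret E: levy_exponent M X a by (rule loc[OF a(1)])
    \<comment> \<open>Order 0 rests on \<open>c > 0\<close> alone, which follows from the drift, so
      the integral criterion does not enter.\<close>
    show ?case using E.expectation_moment_finite[OF a(2) E.moment_0_finite] by simp
  qed
qed

end
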